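(* Let ${\bf b}=({\bf b}^1,0,1,{\bf b}^2)$ and ${\bf b}'=({\bf b}^1,1,0,{\bf b}^2)$ be adjacent $0^m1^n$-sequences. Then: (1) the restriction of $\mathcal R:\widetilde{\mathbb T}_{\mathbb L}\to\widetilde{\mathbb T}_{\mathbb L}'$ gives a $\mathbb Q(q)$-linear isomorphism $\mathcal R:\ddot{\mathbb T}_{\mathbb L}\to\ddot{\mathbb T}_{\mathbb L}'$; (2) $\ddot{\mathbb T}_{\mathbb L}$ and $\ddot{\mathbb T}_{\mathbb L}'$ are bar-invariant subspaces of $\widehat{\mathbb T}_{\mathbb L}$ and $\widehat{\mathbb T}_{\mathbb L}'$, respectively; moreover, the dual canonical bases of $\widehat{\mathbb T}_{\mathbb L}$ and $\widehat{\mathbb T}_{\mathbb L}'$ lie in $\ddot{\mathbb T}_{\mathbb L}$ and $\ddot{\mathbb T}_{\mathbb L}'$, respectively; (3) $\mathcal R(N_f)=N'_{f^{\mathbb L}}$, $\mathcal R(\mathtt L_f)=\mathtt L'_{f^{\mathbb L}}$, and $\mathcal R(L^{\bf b}_f)=L^{{\bf b}'}_{f^{\mathbb L}}$ for all $f\in\mathbb Z^{m+n}$.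
   Context: **Quantum group.** Let $q$ be an indeterminate; $\overline{\phantom{x}}$ is the automorphism of $\mathbb{Q}(q)$ with $\overline{q}=q^{-1}$. $U_q(\mathfrak{gl}_\infty)$ is the $\mathbb{Q}(q)$-algebra generated by $E_a,F_a,K_a^{\pm1}$ ($a\in\mathbb{Z}$) with relations: the $K_a$ commute; $K_aE_bK_a^{-1}=q^{\delta_{a,b}-\delta_{a,b+1}}E_b$; $K_aF_bK_a^{-1}=q^{\delta_{a,b+1}-\delta_{a,b}}F_b$; $E_aF_b-F_bE_a=\delta_{a,b}(K_{a,a+1}-K_{a+1,a})/(q-q^{-1})$, where $K_{a,b}=K_aK_b^{-1}$; $E_a^2E_b+E_bE_a^2=(q+q^{-1})E_aE_bE_a$ if $|a-b|=1$, $E_aE_b=E_bE_a$ if $|a-b|>1$, and the same for the $F$'s. Its bar involution is the anti-linear ring automorphism fixing $E_a,F_a$ and sending $K_a\mapsto K_a^{-1}$. Comultiplication: $\Delta(E_a)=1\otimes E_a+E_a\otimes K_{a+1,a}$, $\Delta(F_a)=F_a\otimes1+K_{a,a+1}\otimes F_a$, $\Delta(K_a)=K_a\otimes K_a$. $\mathbb V$ has basis $\{v_a\}_{a\in\mathbb Z}$ with $K_av_b=q^{\delta_{ab}}v_b$, $E_av_b=\delta_{a+1,b}v_a$, $F_av_b=\delta_{a,b}v_{a+1}$; $\mathbb W$ has basis $\{w_a\}_{a\in\mathbb Z}$ with $K_aw_b=q^{-\delta_{ab}}w_b$, $E_aw_b=\delta_{a,b}w_{a+1}$, $F_aw_b=\delta_{a+1,b}w_a$.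 **Fock space.** A $0^m1^n$-sequence is ${\bf b}=(b_1,\dots,b_{m+n})$ with $m$ entries $0$ and $n$ entries $1$. $\mathbb T^{\bf b}=\mathbb V^{b_1}\otimes\cdots\otimes\mathbb V^{b_{m+n}}$ with $\mathbb V^0=\mathbb V$, $\mathbb V^1=\mathbb W$. For $f\in\mathbb Z^{m+n}$ (functions $[m+n]=\{1,\dots,m+n\}\to\mathbb Z$) let $M^{\bf b}_f$ be the tensor of basis vectors whose $i$-th factor is $v_{f(i)}$ if $b_i=0$, $w_{f(i)}$ if $b_i=1$. Put $\sharp_{\bf b}(f,a,j)=\sum_{i\ge j,\,f(i)\le a}(-1)^{b_i}$. Bruhat order: $g\preceq_{\bf b}f$ iff $\sharp_{\bf b}(g,a,j)\le\sharp_{\bf b}(f,a,j)$ for all $a\in\mathbb Z$, $j\in[m+n]$, with equality for $j=1$. The $A$-completion $\widetilde{\mathbb T}^{\bf b}$ consists of all formal, possibly infinite, linear combinations of the $M^{\bf b}_f$; the $B$-completion $\widehat{\mathbb T}^{\bf b}\subseteq\widetilde{\mathbb T}^{\bf b}$ is the span of elements $M^{\bf b}_f+\sum_{g\prec_{\bf b}f}r_gM^{\bf b}_g$ (possibly infinite sums). **Bar map.** For $k\ge1$ let $U_k$ be the subalgebra generated by $E_a,F_a,K_a^{\pm1},K_{a+1}^{\pm1}$, $-k\le a\le k-1$, with positive and negative parts $U_k^\pm$, and let $\Theta^{(k)}=\sum_\mu\Theta^{(k)}_\mu$, $\Theta^{(k)}_\mu\in U^+_{k,\mu}\otimes U^-_{k,-\mu}$,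 be its quasi-$\mathcal R$-matrix: the unique such formal sum with $\Theta^{(k)}_0=1\otimes1$ and $\Delta(u)\Theta^{(k)}=\Theta^{(k)}\,\overline{\Delta(\overline u)}$ for all $u\in U_k$. On the span of the $M_f^{\bf b}$ with all $|f(i)|\le k$ define an anti-linear map $\psi^{(k)}$ inductively: it fixes basis vectors of a single tensor factor, and $\psi^{(k)}(x\otimes y)=\Theta^{(k)}(\psi^{(k)}(x)\otimes y)$ for $y$ a basis vector of the last factor. For each $f$ the coefficients of $\psi^{(\ell)}(M_f^{\bf b})$ stabilize as $\ell\to\infty$; the limit is $\overline{M^{\bf b}_f}=M^{\bf b}_f+\sum_{g\prec_{\bf b}f}r_{gf}(q)M_g^{\bf b}$, $r_{gf}\in\mathbb Z[q,q^{-1}]$. It extends to an anti-linear involution of $\widehat{\mathbb T}^{\bf b}$ (intervals of $\preceq_{\bf b}$ are finite). **Dual canonical basis.** $L^{\bf b}_f=M^{\bf b}_f+\sum_{g\prec_{\bf b}f}\ell^{\bf b}_{gf}(q)M^{\bf b}_g$ is the unique bar-invariant element of $\widehat{\mathbb T}^{\bf b}$ of this form with all $\ell^{\bf b}_{gf}\in q^{-1}\mathbb Z[q^{-1}]$. **Adjacent sequences.** In ${\bf b}=({\bf b}^1,0,1,{\bf b}^2)$, ${\bf b}'=({\bf b}^1,1,0,{\bf b}^2)$ the exchanged entries are in positions $\kappa,\kappa+1$. For $f\in\mathbb Z^{m+n}$, $f\cdot\tau$ is $f$ with the values at $\kappa$ and $\kappa+1$ interchanged; if $f(\kappa)=f(\kappa+1)$,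 then $f^{\uparrow}$ (resp. $f^{\downarrow}$) is $f$ with both values at $\kappa,\kappa+1$ increased (resp. decreased) by $1$, and $f^{\uparrow k},f^{\downarrow k}$ are the $k$-fold iterates. Set $f^{\mathbb L}=f\cdot\tau$, $f^{\mathbb U}=f\cdot\tau$ if $f(\kappa)\ne f(\kappa+1)$, and $f^{\mathbb L}=f^\uparrow$, $f^{\mathbb U}=f^\downarrow$ if $f(\kappa)=f(\kappa+1)$. **The spaces.** Let $N_f=M^{\bf b}_f+\sum_{k\ge1}(-q)^{-k}M^{\bf b}_{f^{\downarrow k}}$ if $f(\kappa)=f(\kappa+1)$ and $N_f=M^{\bf b}_f$ otherwise; let $N'_f=M^{{\bf b}'}_f+\sum_{k\ge1}(-q)^{-k}M^{{\bf b}'}_{f^{\uparrow k}}$ if $f(\kappa)=f(\kappa+1)$ and $N'_f=M^{{\bf b}'}_f$ otherwise. (That is, in positions $\kappa,\kappa+1$ one uses the dual canonical basis of $\mathbb V\widehat\otimes\mathbb W$, resp. $\mathbb W\widehat\otimes\mathbb V$, spanning $U_q(\mathfrak{gl}_\infty)$-modules $\mathbb L$, resp. $\mathbb L'$.) $\mathbb T_{\mathbb L}$ and $\mathbb T_{\mathbb L}'$ are the $\mathbb Q(q)$-spans of $\{N_f\}$ and $\{N'_f\}$. Their $A$-completions $\widetilde{\mathbb T}_{\mathbb L},\widetilde{\mathbb T}'_{\mathbb L}$ are the spaces of all formal, possibly infinite, combinations of the $N_f$, resp. $N'_f$. The $B$-completion $\widehat{\mathbb T}_{\mathbb L}$ is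 spanned by elements $N_f+\sum_{g\prec_{\bf b}f}d_gN_g$, and $\widehat{\mathbb T}'_{\mathbb L}$ by elements $N'_f+\sum_{g\prec_{{\bf b}'}f}d_gN'_g$ (possibly infinite sums). Via the expansions of $N_f,N'_f$ one has $\widehat{\mathbb T}_{\mathbb L}\subseteq\widehat{\mathbb T}^{\bf b}$, $\widehat{\mathbb T}'_{\mathbb L}\subseteq\widehat{\mathbb T}^{{\bf b}'}$, stable under the bar involutions. The dual canonical basis of $\widehat{\mathbb T}_{\mathbb L}$ consists of the unique bar-invariant elements $\mathtt L_f=N_f+\sum_{g\prec_{\bf b}f}\check\ell_{gf}(q)N_g$ with $\check\ell_{gf}\in q^{-1}\mathbb Z[q^{-1}]$; the dual canonical basis $\{\mathtt L'_f\}$ of $\widehat{\mathbb T}_{\mathbb L}'$ is defined in the same way with $N'$ and $\prec_{{\bf b}'}$. **Refined orders and $C$-completions.** $g\preceq_{{\bf b},{\bf b}'}f$ iff $g\preceq_{\bf b}f$ and $g^{\mathbb L}\preceq_{{\bf b}'}f^{\mathbb L}$; $g\preceq^*_{{\bf b},{\bf b}'}f$ iff $g\preceq_{{\bf b}'}f$ and $g^{\mathbb U}\preceq_{\bf b}f^{\mathbb U}$. $\ddot{\mathbb T}_{\mathbb L}\subseteq\widetilde{\mathbb T}_{\mathbb L}$ is spanned by elements $N_f+\sum_{g\prec_{{\bf b},{\bf b}'}f}r_gN_g$, and $\ddot{\mathbb T}'_{\mathbb L}\subseteq\widetilde{\mathbb T}'_{\mathbb L}$ by elements $N'_f+\sum_{g\prec^*_{{\bf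 b},{\bf b}'}f}r_gN'_g$ ($r_g\in\mathbb Q(q)$, possibly infinite sums). **The map $\mathcal R$.** $\mathcal R:\mathbb T_{\mathbb L}\to\mathbb T'_{\mathbb L}$ is the $\mathbb Q(q)$-linear map $N_f\mapsto N'_{f^{\mathbb L}}$ (an isomorphism of $U_q(\mathfrak{gl}_\infty)$-modules), extended continuously to $\widetilde{\mathbb T}_{\mathbb L}\to\widetilde{\mathbb T}'_{\mathbb L}$. *)

theory Defs
  imports
    "HOL-Computational_Algebra.Polynomial_Factorial"
    "HOL-Computational_Algebra.Field_as_Ring"
    "HOL-Library.Poly_Mapping"
    "HOL-Library.Product_Plus"
    "HOL-Library.Function_Algebras"
begin

section \<open>The field of rational functions and its bar automorphism\<close>

type_synonym qf = "rat poly fract"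

definition qq :: qf where
  "qq = to_fract [:0, 1:]"

definition eval_qinv :: "rat poly \<Rightarrow> qf" where
  "eval_qinv p = poly (map_poly (\<lambda>c. to_fract [:c:]) p) (inverse qq)"

text \<open>The automorphism of the field \<open>\<rat>(q)\<close> sending \<open>p(q)/r(q)\<close> to \<open>p(q\<inverse>)/r(q\<inverse>)\<close>.\<close>

definition barq :: "qf \<Rightarrow> qf" where
  "barq x = eval_qinv (fst (quot_of_fract x)) / eval_qinv (snd (quot_of_fract x))"

definition qinv_Z_qinv :: "qf set" where
  "qinv_Z_qinv = {poly (map_poly of_int p) (inverse qq) |p::int poly. coeff p 0 = 0}"

text \<open>The functions \<open>'a \<Rightarrow>\<^sub>0 qf\<close> are the vector space with basis \<open>'a\<close>;
  \<open>lin \<phi>\<close> is the linear map that is \<open>\<phi>\<close> on the basis.\<close>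

definition lin :: "('a \<Rightarrow> 'b \<Rightarrow>\<^sub>0 qf) \<Rightarrow> ('a \<Rightarrow>\<^sub>0 qf) \<Rightarrow> ('b \<Rightarrow>\<^sub>0 qf)" where
  "lin \<phi> x = (\<Sum>a\<in>Poly_Mapping.keys x.
     Poly_Mapping.map ((*) (Poly_Mapping.lookup x a)) (\<phi> a))"

section \<open>The quantum group\<close>

text \<open>The free algebra on the generators is the monoid algebra of words. Elements of the
  quantum group \<open>U\<close> and of \<open>U \<otimes> U\<close> are represented by elements of \<open>falg\<close> and
  \<open>falg2\<close> (the tensor square of \<open>falg\<close>); equality in \<open>U\<close> and \<open>U \<otimes> U\<close> is congruence modulo the
  two-sided ideals \<open>uq_ideal\<close> and \<open>uq2_ideal\<close>.\<close>

datatype gen = gE int | gF int | gK int | gKi int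

datatype word = Word (letters: "gen list")

instantiation word :: monoid_add
begin

definition zero_word :: word where
  "0 = Word []"

definition plus_word :: "word \<Rightarrow> word \<Rightarrow> word" where
  "v + w = Word (letters v @ letters w)"

instance
  by standard (simp_all add: zero_word_def plus_word_def)

end

type_synonym falg = "word \<Rightarrow>\<^sub>0 qf"
type_synonym falg2 = "word \<times> word \<Rightarrow>\<^sub>0 qf"

definition mon :: "gen list \<Rightarrow> falg" where
  "mon w = Poly_Mapping.single (Word w) 1"

definition sc :: "qf \<Rightarrow> falg" where
  "sc c = Poly_Mapping.single 0 c"

definition otimes :: "falg \<Rightarrow> falg \<Rightarrow> falg2" where
  "otimes x y = lin (\<lambda>v. lin (\<lambda>w. Poly_Mapping.single (v, w) 1) y) x"

text \<open>Each relation is given as an element that vanishes in \<open>U\<close>; \<open>gKi a\<close> stands for the inverse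
  of \<open>K\<^sub>a\<close>.\<close>

inductive_set uq_rels :: "falg set" where
  "mon [gK a, gKi a] - 1 \<in> uq_rels"
| "mon [gKi a, gK a] - 1 \<in> uq_rels"
| "mon [gK a, gK b] - mon [gK b, gK a] \<in> uq_rels"
| "mon [gK a, gE b, gKi a] - sc (qq powi (of_bool (a = b) - of_bool (a = b + 1))) * mon [gE b]
     \<in> uq_rels"
| "mon [gK a, gF b, gKi a] - sc (qq powi (of_bool (a = b + 1) - of_bool (a = b))) * mon [gF b]
     \<in> uq_rels"
| "mon [gE a, gF b] - mon [gF b, gE a]
     - (if a = b
        then sc (1 / (qq - inverse qq)) * (mon [gK a, gKi (a + 1)] - mon [gK (a + 1), gKi a])
        else 0) \<in> uq_rels"
| "\<bar>a - b\<bar> = 1 \<Longrightarrow>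
     mon [gE a, gE a, gE b] + mon [gE b, gE a, gE a]
     - sc (qq + inverse qq) * mon [gE a, gE b, gE a] \<in> uq_rels"
| "\<bar>a - b\<bar> > 1 \<Longrightarrow> mon [gE a, gE b] - mon [gE b, gE a] \<in> uq_rels"
| "\<bar>a - b\<bar> = 1 \<Longrightarrow>
     mon [gF a, gF a, gF b] + mon [gF b, gF a, gF a]
     - sc (qq + inverse qq) * mon [gF a, gF b, gF a] \<in> uq_rels"
| "\<bar>a - b\<bar> > 1 \<Longrightarrow> mon [gF a, gF b] - mon [gF b, gF a] \<in> uq_rels"

inductive_set two_sided_ideal :: "'a::ring_1 set \<Rightarrow> 'a set" for R :: "'a set" where
  zero: "0 \<in> two_sided_ideal R"
| gen: "r \<in> R \<Longrightarrow> x * r * y \<in> two_sided_ideal R"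
| add: "x \<in> two_sided_ideal R \<Longrightarrow> y \<in> two_sided_ideal R \<Longrightarrow> x + y \<in> two_sided_ideal R"

definition uq_ideal :: "falg set" where
  "uq_ideal = two_sided_ideal uq_rels"

definition uq2_ideal :: "falg2 set" where
  "uq2_ideal = two_sided_ideal ((\<lambda>r. otimes r 1) ` uq_rels \<union> (\<lambda>r. otimes 1 r) ` uq_rels)"

fun coprod_gen :: "gen \<Rightarrow> falg2" where
  "coprod_gen (gE a) = otimes 1 (mon [gE a]) + otimes (mon [gE a]) (mon [gK (a + 1), gKi a])"
| "coprod_gen (gF a) = otimes (mon [gF a]) 1 + otimes (mon [gK a, gKi (a + 1)]) (mon [gF a])"
| "coprod_gen (gK a) = otimes (mon [gK a]) (mon [gK a])"
| "coprod_gen (gKi a) = otimes (mon [gKi a]) (mon [gKi a])"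

definition coprod :: "falg \<Rightarrow> falg2" where
  "coprod = lin (\<lambda>w. prod_list (map coprod_gen (letters w)))"

fun bar_gen :: "gen \<Rightarrow> gen" where
  "bar_gen (gE a) = gE a"
| "bar_gen (gF a) = gF a"
| "bar_gen (gK a) = gKi a"
| "bar_gen (gKi a) = gK a"

definition bar_word :: "word \<Rightarrow> word" where
  "bar_word w = Word (map bar_gen (letters w))"

definition bar_uq :: "falg \<Rightarrow> falg" where
  "bar_uq x = (\<Sum>w\<in>Poly_Mapping.keys x.
     Poly_Mapping.single (bar_word w) (barq (Poly_Mapping.lookup x w)))"

definition bar_uq2 :: "falg2 \<Rightarrow> falg2" where
  "bar_uq2 x = (\<Sum>(v, w)\<in>Poly_Mapping.keys x.
     Poly_Mapping.single (bar_word v, bar_word w) (barq (Poly_Mapping.lookup x (v, w))))"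

section \<open>The quasi-R-matrix\<close>

text \<open>Weights are elements \<open>\<mu>\<close> of the free abelian group on \<open>\<epsilon>\<^sub>a\<close>, \<open>a \<in> \<int>\<close>;
  \<open>E\<^sub>a\<close> has weight \<open>\<epsilon>\<^sub>a - \<epsilon>\<^bsub>a+1\<^esub>\<close>.\<close>

type_synonym weight = "int \<Rightarrow>\<^sub>0 int"

fun wt_gen :: "gen \<Rightarrow> weight" where
  "wt_gen (gE a) = Poly_Mapping.single a 1 - Poly_Mapping.single (a + 1) 1"
| "wt_gen (gF a) = Poly_Mapping.single (a + 1) 1 - Poly_Mapping.single a 1"
| "wt_gen (gK a) = 0"
| "wt_gen (gKi a) = 0"

definition wt :: "word \<Rightarrow> weight" where
  "wt w = sum_list (map wt_gen (letters w))"

text \<open>The homogeneous component of bidegree \<open>(\<mu>, \<nu>)\<close>. The defining relations are homogeneous,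
  so this descends to \<open>U \<otimes> U\<close>.\<close>

definition component :: "weight \<Rightarrow> weight \<Rightarrow> falg2 \<Rightarrow> falg2" where
  "component \<mu> \<nu> x = (\<Sum>(v, w) | (v, w) \<in> Poly_Mapping.keys x \<and> wt v = \<mu> \<and> wt w = \<nu>.
     Poly_Mapping.single (v, w) (Poly_Mapping.lookup x (v, w)))"

definition gens_pos :: "nat \<Rightarrow> gen set" where
  "gens_pos k = gE ` {- int k..int k - 1}"

definition gens_neg :: "nat \<Rightarrow> gen set" where
  "gens_neg k = gF ` {- int k..int k - 1}"

definition gens_U :: "nat \<Rightarrow> gen set" where
  "gens_U k = (\<Union>a\<in>{- int k..int k - 1}. {gE a, gF a, gK a, gKi a, gK (a + 1), gKi (a + 1)})"

text \<open>The subalgebra of the free algebra generated by a set of generators; its image in \<open>U\<close> is the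
  subalgebra of \<open>U\<close> generated by that set.\<close>

definition subalg :: "gen set \<Rightarrow> falg set" where
  "subalg G = {u. \<forall>w\<in>Poly_Mapping.keys u. set (letters w) \<subseteq> G}"

text \<open>The formal sum of the \<open>\<Theta> \<mu>\<close> is the quasi-R-matrix of \<open>U\<^sub>k\<close>. Since \<open>\<Theta> \<mu>\<close> has
  bidegree \<open>(\<mu>, -\<mu>)\<close>, the identity of formal sums
  \<open>\<Delta>(u) \<Theta> = \<Theta> bar(\<Delta>(bar u))\<close> is expressed by comparing the components of every
  bidegree \<open>(\<alpha>, \<beta>)\<close>; the sums over \<open>\<mu>\<close> have finite support.\<close>

definition quasi_R_matrix :: "nat \<Rightarrow> (weight \<Rightarrow> falg2) \<Rightarrow> bool" where
  "quasi_R_matrix k \<Theta> \<longleftrightarrow>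
     (\<forall>\<mu>. \<forall>(v, w)\<in>Poly_Mapping.keys (\<Theta> \<mu>).
        set (letters v) \<subseteq> gens_pos k \<and> wt v = \<mu> \<and>
        set (letters w) \<subseteq> gens_neg k \<and> wt w = - \<mu>) \<and>
     \<Theta> 0 - otimes 1 1 \<in> uq2_ideal \<and>
     (\<forall>u\<in>subalg (gens_U k). \<forall>\<alpha> \<beta>.
        Sum_any (\<lambda>\<mu>. component (\<alpha> - \<mu>) (\<beta> + \<mu>) (coprod u) * \<Theta> \<mu>)
        - Sum_any (\<lambda>\<mu>. \<Theta> \<mu> * component (\<alpha> - \<mu>) (\<beta> + \<mu>) (bar_uq2 (coprod (bar_uq u))))
        \<in> uq2_ideal)"

section \<open>Tensor modules\<close>

text \<open>A sequence \<open>b\<close> of zeros and ones is a list of natural numbers, and \<open>f \<in> \<int>\<^bsup>m+n\<^esup>\<close> is an integer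
  list of the same length; list positions start at \<open>0\<close>, so the entry in position \<open>i\<close> of the
  mathematical sequence is at list index \<open>i - 1\<close>.\<close>

definition zero_one_seq :: "nat \<Rightarrow> nat \<Rightarrow> nat list \<Rightarrow> bool" where
  "zero_one_seq m n b \<longleftrightarrow> set b \<subseteq> {0, 1} \<and> count_list b 0 = m \<and> count_list b 1 = n"

type_synonym tens = "int list \<Rightarrow>\<^sub>0 qf"

definition tensor :: "tens \<Rightarrow> tens \<Rightarrow> tens" where
  "tensor x y = lin (\<lambda>f. lin (\<lambda>g. Poly_Mapping.single (f @ g) 1) y) x"

definition bas :: "int \<Rightarrow> tens" where
  "bas c = Poly_Mapping.single [c] 1"

fun V_act :: "gen \<Rightarrow> int \<Rightarrow> tens" where
  "V_act (gE a) c = (if c = a + 1 then bas a else 0)"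
| "V_act (gF a) c = (if c = a then bas (a + 1) else 0)"
| "V_act (gK a) c = Poly_Mapping.single [c] (if c = a then qq else 1)"
| "V_act (gKi a) c = Poly_Mapping.single [c] (if c = a then inverse qq else 1)"

fun W_act :: "gen \<Rightarrow> int \<Rightarrow> tens" where
  "W_act (gE a) c = (if c = a then bas (a + 1) else 0)"
| "W_act (gF a) c = (if c = a + 1 then bas a else 0)"
| "W_act (gK a) c = Poly_Mapping.single [c] (if c = a then inverse qq else 1)"
| "W_act (gKi a) c = Poly_Mapping.single [c] (if c = a then qq else 1)"

definition factor_act :: "nat \<Rightarrow> gen \<Rightarrow> int list \<Rightarrow> tens" where
  "factor_act e g f = (if e = 0 then V_act g (hd f) else W_act g (hd f))"

text \<open>The action of a word, given the action \<open>\<rho>\<close> of the generators on a basis.\<close>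

primrec word_act :: "(gen \<Rightarrow> int list \<Rightarrow> tens) \<Rightarrow> gen list \<Rightarrow> int list \<Rightarrow> tens" where
  "word_act \<rho> [] f = Poly_Mapping.single f 1"
| "word_act \<rho> (g # w) f = lin (\<rho> g) (word_act \<rho> w f)"

text \<open>The action of an element of \<open>U \<otimes> U\<close> on the tensor product of two basis vectors.\<close>

definition act2 ::
  "(gen \<Rightarrow> int list \<Rightarrow> tens) \<Rightarrow> (gen \<Rightarrow> int list \<Rightarrow> tens) \<Rightarrow> falg2 \<Rightarrow> int list \<Rightarrow> int list \<Rightarrow> tens"
where
  "act2 \<rho> \<sigma> z f g =
     lin (\<lambda>(v, w). tensor (word_act \<rho> (letters v) f) (word_act \<sigma> (letters w) g)) z"

text \<open>The action of a generator on a basis vector \<open>f\<close> of the tensor product of the first \<open>n\<close> factors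
  of the tensor space of \<open>b\<close>. The value for \<open>n = 0\<close> is irrelevant.\<close>

fun tensor_act :: "nat list \<Rightarrow> nat \<Rightarrow> gen \<Rightarrow> int list \<Rightarrow> tens" where
  "tensor_act b 0 g f = 0"
| "tensor_act b (Suc 0) g f = factor_act (b ! 0) g f"
| "tensor_act b (Suc (Suc n)) g f =
     act2 (tensor_act b (Suc n)) (factor_act (b ! Suc n)) (coprod_gen g)
       (take (Suc n) f) [f ! Suc n]"

section \<open>The bar involution\<close>

text \<open>\<open>psi \<Theta> b n f\<close> is the value of \<open>\<psi>\<^bsup>(k)\<^esup>\<close> at the basis vector of the tensor product
  of the first \<open>n\<close> factors given by the first \<open>n\<close> entries of \<open>f\<close>, where \<open>\<Theta>\<close> is the quasi-R-matrix of \<open>U\<^sub>k\<close>.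
  Only finitely many \<open>\<Theta> \<mu>\<close> act by a nonzero vector in the sum.\<close>

fun psi :: "(weight \<Rightarrow> falg2) \<Rightarrow> nat list \<Rightarrow> nat \<Rightarrow> int list \<Rightarrow> tens" where
  "psi \<Theta> b 0 f = 0"
| "psi \<Theta> b (Suc 0) f = bas (f ! 0)"
| "psi \<Theta> b (Suc (Suc n)) f =
     Sum_any (\<lambda>\<mu>.
       lin (\<lambda>g. act2 (tensor_act b (Suc n)) (factor_act (b ! Suc n)) (\<Theta> \<mu>) g [f ! Suc n])
           (psi \<Theta> b (Suc n) f))"

text \<open>From here on \<open>\<Theta> k\<close> is the quasi-R-matrix of \<open>U\<^sub>k\<close>, and \<open>bar_coeff \<Theta> b g f\<close> is the eventual
  value of the coefficient of \<open>M\<^sub>g\<close> in \<open>\<psi>\<^bsup>(l)\<^esup>(M\<^sub>f)\<close>.\<close>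

definition bar_coeff :: "(nat \<Rightarrow> weight \<Rightarrow> falg2) \<Rightarrow> nat list \<Rightarrow> int list \<Rightarrow> int list \<Rightarrow> qf" where
  "bar_coeff \<Theta> b g f =
     (THE r. \<forall>\<^sub>F l in sequentially. Poly_Mapping.lookup (psi (\<Theta> l) b (length b) f) g = r)"

text \<open>Formal, possibly infinite, combinations of symbols indexed by integer lists are functions
  \<open>int list \<Rightarrow> qf\<close> that vanish outside the lists of the relevant length.\<close>

type_synonym formal = "int list \<Rightarrow> qf"

definition fscale :: "qf \<Rightarrow> formal \<Rightarrow> formal" where
  "fscale c x = (\<lambda>f. c * x f)"

interpretation fs: vector_space fscale
  by standard (simp_all add: fscale_def fun_eq_iff algebra_simps)

text \<open>The sum is finite on the B-completion, because intervals of the Bruhat order are finite.\<close>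

definition bar :: "(nat \<Rightarrow> weight \<Rightarrow> falg2) \<Rightarrow> nat list \<Rightarrow> formal \<Rightarrow> formal" where
  "bar \<Theta> b x = (\<lambda>g. Sum_any (\<lambda>f. barq (x f) * bar_coeff \<Theta> b g f))"

section \<open>Bruhat order and completions\<close>

definition sharp :: "nat list \<Rightarrow> int list \<Rightarrow> int \<Rightarrow> nat \<Rightarrow> int" where
  "sharp b f a j = (\<Sum>i | j \<le> i \<and> i < length b \<and> f ! i \<le> a. (- 1) ^ (b ! i))"

definition bruhat :: "nat list \<Rightarrow> int list \<Rightarrow> int list \<Rightarrow> bool" where
  "bruhat b g f \<longleftrightarrow> length g = length b \<and> length f = length b \<and>
     (\<forall>a. \<forall>j<length b. sharp b g a j \<le> sharp b f a j) \<and>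
     (\<forall>a. sharp b g a 0 = sharp b f a 0)"

text \<open>The formal combination consists of the symbol \<open>f\<close> with coefficient \<open>1\<close> and of symbols strictly
  below \<open>f\<close>.\<close>

definition lower_form :: "(int list \<Rightarrow> int list \<Rightarrow> bool) \<Rightarrow> int list \<Rightarrow> formal \<Rightarrow> bool" where
  "lower_form le f x \<longleftrightarrow> x f = 1 \<and> (\<forall>g. x g \<noteq> 0 \<longrightarrow> le g f)"

definition completion :: "(int list \<Rightarrow> int list \<Rightarrow> bool) \<Rightarrow> formal set" where
  "completion le = fs.span {x. \<exists>f. lower_form le f x}"

text \<open>The B-completion of the tensor space (in coordinates with respect to the \<open>M\<^sub>f\<close>). With
  coordinates taken with respect to the \<open>N\<^sub>f\<close> or \<open>N'\<^sub>f\<close> introduced below, the same set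
  is the B-completion of \<open>T\<^sub>L\<close> or \<open>T'\<^sub>L\<close>.\<close>

definition T_hat :: "nat list \<Rightarrow> formal set" where
  "T_hat b = completion (bruhat b)"

definition dual_canonical ::
  "(nat \<Rightarrow> weight \<Rightarrow> falg2) \<Rightarrow> nat list \<Rightarrow> int list \<Rightarrow> formal" where
  "dual_canonical \<Theta> b f = (THE x.
     x \<in> T_hat b \<and> lower_form (bruhat b) f x \<and>
     (\<forall>g. g \<noteq> f \<longrightarrow> x g \<in> qinv_Z_qinv) \<and> bar \<Theta> b x = x)"

section \<open>Adjacent sequences\<close>

text \<open>The exchanged entries are at list indices \<open>\<kappa>\<close> and \<open>Suc \<kappa>\<close>.\<close>

definition swap :: "nat \<Rightarrow> int list \<Rightarrow> int list" where
  "swap \<kappa> f = f[\<kappa> := f ! Suc \<kappa>, Suc \<kappa> := f ! \<kappa>]"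

definition up :: "nat \<Rightarrow> int list \<Rightarrow> int list" where
  "up \<kappa> f = f[\<kappa> := f ! \<kappa> + 1, Suc \<kappa> := f ! Suc \<kappa> + 1]"

definition down :: "nat \<Rightarrow> int list \<Rightarrow> int list" where
  "down \<kappa> f = f[\<kappa> := f ! \<kappa> - 1, Suc \<kappa> := f ! Suc \<kappa> - 1]"

definition fL :: "nat \<Rightarrow> int list \<Rightarrow> int list" where
  "fL \<kappa> f = (if f ! \<kappa> = f ! Suc \<kappa> then up \<kappa> f else swap \<kappa> f)"

definition fU :: "nat \<Rightarrow> int list \<Rightarrow> int list" where
  "fU \<kappa> f = (if f ! \<kappa> = f ! Suc \<kappa> then down \<kappa> f else swap \<kappa> f)"

text \<open>The vector \<open>N\<^sub>f\<close> for \<open>step = down \<kappa>\<close>, and \<open>N'\<^sub>f\<close> for \<open>step = up \<kappa>\<close>, in coordinates with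
  respect to the \<open>M\<^sub>h\<close>.\<close>

definition Nvec :: "nat \<Rightarrow> (int list \<Rightarrow> int list) \<Rightarrow> int list \<Rightarrow> formal" where
  "Nvec \<kappa> step f = (\<lambda>h. (1 when h = f) +
     (if f ! \<kappa> = f ! Suc \<kappa>
      then Sum_any (\<lambda>k. (- qq) powi (- int k) when k \<ge> 1 \<and> h = (step ^^ k) f)
      else 0))"

text \<open>An element of the A-completion of \<open>T\<^sub>L\<close> is a formal combination of the \<open>N\<^sub>f\<close> and is given
  by its coordinates with respect to the \<open>N\<^sub>f\<close>; \<open>expand\<close> passes to coordinates with respect to
  the \<open>M\<^sub>h\<close>. The sum is finite on the B-completion (but not on the A-completion), so \<open>expand\<close>
  embeds the B-completion of \<open>T\<^sub>L\<close> in that of the tensor space. The same applies to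
  the \<open>N'\<^sub>f\<close>.\<close>

definition expand :: "nat \<Rightarrow> (int list \<Rightarrow> int list) \<Rightarrow> formal \<Rightarrow> formal" where
  "expand \<kappa> step x = (\<lambda>h. Sum_any (\<lambda>f. x f * Nvec \<kappa> step f h))"

definition basis_vec :: "int list \<Rightarrow> formal" where
  "basis_vec f = (\<lambda>h. 1 when h = f)"

text \<open>The dual canonical basis of the B-completion of \<open>T\<^sub>L\<close>, in coordinates with respect to the
  \<open>N\<^sub>f\<close> or \<open>N'\<^sub>f\<close>.\<close>

definition dual_canonical_L ::
  "(nat \<Rightarrow> weight \<Rightarrow> falg2) \<Rightarrow> nat list \<Rightarrow> nat \<Rightarrow> (int list \<Rightarrow> int list) \<Rightarrow> int list \<Rightarrow> formal" where
  "dual_canonical_L \<Theta> b \<kappa> step f = (THE x.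
     x \<in> T_hat b \<and> lower_form (bruhat b) f x \<and>
     (\<forall>g. g \<noteq> f \<longrightarrow> x g \<in> qinv_Z_qinv) \<and>
     bar \<Theta> b (expand \<kappa> step x) = expand \<kappa> step x)"

definition refined :: "nat list \<Rightarrow> nat list \<Rightarrow> nat \<Rightarrow> int list \<Rightarrow> int list \<Rightarrow> bool" where
  "refined b b' \<kappa> g f \<longleftrightarrow> bruhat b g f \<and> bruhat b' (fL \<kappa> g) (fL \<kappa> f)"

definition refined_star :: "nat list \<Rightarrow> nat list \<Rightarrow> nat \<Rightarrow> int list \<Rightarrow> int list \<Rightarrow> bool" where
  "refined_star b b' \<kappa> g f \<longleftrightarrow> bruhat b' g f \<and> bruhat b (fU \<kappa> g) (fU \<kappa> f)"

text \<open>The C-completions, in coordinates with respect to the \<open>N\<^sub>f\<close> and the \<open>N'\<^sub>f\<close>.\<close>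

definition T_ddot :: "nat list \<Rightarrow> nat list \<Rightarrow> nat \<Rightarrow> formal set" where
  "T_ddot b b' \<kappa> = completion (refined b b' \<kappa>)"

definition T_ddot' :: "nat list \<Rightarrow> nat list \<Rightarrow> nat \<Rightarrow> formal set" where
  "T_ddot' b b' \<kappa> = completion (refined_star b b' \<kappa>)"

text \<open>The continuous linear map \<open>N\<^sub>f \<mapsto> N'\<^bsub>fL\<^esub>\<close> in coordinates with respect to the \<open>N\<^sub>f\<close> and
  the \<open>N'\<^sub>f\<close>, for integer lists of length \<open>r\<close>.\<close>

definition Rmap :: "nat \<Rightarrow> nat \<Rightarrow> formal \<Rightarrow> formal" where
  "Rmap r \<kappa> x = (\<lambda>h. \<Sum>f | length f = r \<and> fL \<kappa> f = h. x f)"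

end

theory Submission
  imports Defs
begin

text \<open>The quasi-R-matrix is used only through its commutation with the \<open>E\<^sub>a\<close>. That determines the
  operator by which it acts on \<open>X \<otimes> V\<close> and \<open>X \<otimes> W\<close>: its components are iterated q-commutators of
  the \<open>E\<^sub>a\<close> acting on \<open>X\<close>.

  The point is that the bar maps have the same matrix with respect to the \<open>N\<^sub>f\<close> and the \<open>N'\<^sub>f\<close> when
  \<open>f\<close> is relabelled as \<open>f\<^sup>L\<close>. If the exchanged factors are the last ones, both matrices commute with the
  matrices of the \<open>E\<^sub>a\<close> on \<open>X \<otimes> \<bbbL>\<close>, which correspond to each other; both are triangular for the height of weights
  of \<open>\<bbbL>\<close> and have the same part of height zero, and an \<open>E\<close>-linear map that lowers the height strictly
  vanishes. Every further factor applies the same q-commutators of the \<open>E\<^sub>a\<close> on both sides.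

  Hence the common matrix is unitriangular for the refined order, so that Lusztig's
  lemma produces the dual canonical bases inside the C-completions, and \<open>R\<close> matches
  them by uniqueness. Finally \<open>L\<^sub>f\<close> is the expansion of the dual canonical basis
  element of \<open>T\<^sub>L\<close>, because \<open>N\<^sub>f - M\<^sub>f\<close> has coefficients in \<open>q\<inverse>\<int>[q\<inverse>]\<close>.\<close>

text \<open>In the bases M the bar map sends equal pairs downwards for \<open>b\<close> and upwards
  for \<open>b'\<close>; only the N_f and N'_f carry the raising operators by identical formulas,
  which is the isomorphism of the two pair modules in coordinates. The price is that N_f is an
  infinite sum. Identities are therefore compared one coefficient at a time: operators act on
  arbitrary coefficient functions, each output coefficient depends on finitely many inputs, and
  along a chain of equal pairs the matrix entries vanish eventually because Bruhat intervals are
  finite. Since the bar map is antilinear, commutation with E_a says that E_a on the row index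
  equals the transposed E_a, with q inverted, on the column index; both sides are finite. The height
  \<open>d - c\<close> of a pair (v_c, w_d) is the sum over all thresholds of its contribution to
  the Bruhat order, whence the triangularity. All equal pairs have the same weight, so the height
  says nothing about the entries between them; these are determined by E_x, which sends N_xx to
  N_{x,x+1} and kills the other N_cc.\<close>

abbreviation "lookup \<equiv> Poly_Mapping.lookup"

section \<open>Bar automorphism and Laurent polynomials\<close>

lemma poly_mapping_induct [case_names zero single add]:
  fixes x :: "'a \<Rightarrow>\<^sub>0 'b::comm_monoid_add"
  assumes "P 0" "\<And>a c. P (Poly_Mapping.single a c)" "\<And>x y. P x \<Longrightarrow> P y \<Longrightarrow> P (x + y)"
  shows "P x"
proof (induction x rule: update_induct)
  case const
  then show ?case by (rule assms(1))
next
  case (update f a b)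
  have "Poly_Mapping.update a b f = Poly_Mapping.single a b + f"
    using update(1)
    by (intro poly_mapping_eqI) (auto simp: lookup_update lookup_add lookup_single when_def in_keys_iff)
  then show ?case
    using update assms by simp
qed

lemma sum_keys_additive:
  fixes h :: "'a \<Rightarrow> 'b::comm_monoid_add \<Rightarrow> 'c::comm_monoid_add"
  assumes "\<And>a. h a 0 = 0" "\<And>a c d. h a (c + d) = h a c + h a d"
  shows "(\<Sum>a\<in>Poly_Mapping.keys (x + y). h a (lookup (x + y) a))
    = (\<Sum>a\<in>Poly_Mapping.keys x. h a (lookup x a)) + (\<Sum>a\<in>Poly_Mapping.keys y. h a (lookup y a))"
  using assms by (intro setsum_keys_plus_distrib) auto

lemma sum_keys_single:
  assumes "h a 0 = 0"
  shows "(\<Sum>b\<in>Poly_Mapping.keys (Poly_Mapping.single a c). h b (lookup (Poly_Mapping.single a c) b)) = h a c"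
  using assms by (cases "c = 0") auto

lemma qq_nonzero [simp]: "qq \<noteq> 0"
  by (simp add: qq_def)

lemma to_fract_pCons: "to_fract (pCons a p) = to_fract [:a:] + qq * to_fract p"
proof -
  have "pCons a p = [:a:] + [:0, 1:] * p"
    by simp
  then show ?thesis
    by (simp only: qq_def to_fract_add to_fract_mult)
qed

lemma to_fract_monom: "to_fract (monom c k) = to_fract [:c:] * qq ^ k"
  by (induction k) (simp_all add: monom_0 monom_Suc to_fract_pCons[of 0 "monom c k" for k])

lemma of_int_to_fract: "(of_int c :: qf) = to_fract [:of_int c:]"
proof -
  have *: "(of_nat k :: qf) = to_fract [:of_nat k:]" for k
    by (induction k) (simp_all, metis add_pCons add.right_neutral one_pCons to_fract_1 to_fract_add)
  show ?thesis
  proof (cases c)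
    case (neg n)
    then have "(of_int c :: qf) = - of_nat (Suc n)"
      by simp
    also have "\<dots> = to_fract (- [:of_nat (Suc n):])"
      by (simp only: * to_fract_uminus)
    finally show ?thesis
      using neg by (simp del: to_fract_uminus)
  qed (use * in simp)
qed

lemma eval_qinv_pCons: "eval_qinv (pCons c p) = to_fract [:c:] + inverse qq * eval_qinv p"
  by (simp add: eval_qinv_def map_poly_pCons)

lemma eval_qinv_0 [simp]: "eval_qinv 0 = 0"
  by (simp add: eval_qinv_def)

lemma eval_qinv_add: "eval_qinv (p + r) = eval_qinv p + eval_qinv r"
proof (induction p r rule: poly_induct2)
  case (pCons a p b q)
  have "to_fract [:a + b:] = to_fract [:a:] + to_fract [:b:]"
    by (metis add_pCons to_fract_add add.right_neutral)
  with pCons show ?case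
    by (simp add: eval_qinv_pCons algebra_simps)
qed auto

lemma eval_qinv_smult: "eval_qinv (smult a p) = to_fract [:a:] * eval_qinv p"
proof (induction p)
  case (pCons b p)
  have "to_fract [:a * b:] = to_fract [:a:] * to_fract [:b:]"
    by (simp flip: to_fract_mult)
  with pCons show ?case
    by (simp add: eval_qinv_pCons algebra_simps)
qed auto

lemma eval_qinv_mult: "eval_qinv (p * r) = eval_qinv p * eval_qinv r"
proof (induction p)
  case (pCons a p)
  then show ?case
    by (simp add: eval_qinv_pCons eval_qinv_add eval_qinv_smult algebra_simps)
qed auto

lemma eval_qinv_const [simp]: "eval_qinv [:c:] = to_fract [:c:]"
  by (simp add: eval_qinv_pCons)

lemma eval_qinv_1 [simp]: "eval_qinv 1 = 1"
  unfolding one_pCons eval_qinv_const by (simp flip: one_pCons)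

text \<open>Multiplying the value at the inverse of \<open>qq\<close> by \<open>qq ^ d\<close> gives
  the polynomial with reversed coefficients, whose constant term is the leading coefficient of
  \<open>p\<close>. This keeps the denominators in \<open>barq\<close> nonzero.\<close>

lemma eval_qinv_eq_0_iff [simp]: "eval_qinv p = 0 \<longleftrightarrow> p = 0"
proof
  assume *: "eval_qinv p = 0"
  show "p = 0"
  proof (rule ccontr)
    assume "p \<noteq> 0"
    define d where "d = degree p"
    define r where "r = (\<Sum>i\<le>d. monom (coeff p i) (d - i))"
    have c: "degree (map_poly (\<lambda>c. to_fract [:c:]) p) = d"
      by (simp add: d_def degree_map_poly)
    have "qq ^ d * eval_qinv p = (\<Sum>i\<le>d. to_fract [:coeff p i:] * (qq ^ d * inverse qq ^ i))"
      unfolding eval_qinv_def poly_altdef c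
      by (simp add: sum_distrib_left coeff_map_poly mult_ac)
    also have "\<dots> = (\<Sum>i\<le>d. to_fract [:coeff p i:] * qq ^ (d - i))"
      by (intro sum.cong refl) (simp add: power_diff field_simps)
    also have "\<dots> = to_fract r"
      unfolding r_def by (simp add: to_fract_monom)
    finally have "r = 0"
      using * by simp
    then have "coeff r 0 = 0"
      by simp
    moreover have "coeff r 0 = (\<Sum>i\<in>{d}. coeff p i)"
      unfolding r_def coeff_sum coeff_monom
      by (rule sum.mono_neutral_cong_right) auto
    ultimately show False
      using \<open>p \<noteq> 0\<close> by (simp add: d_def)
  qed
qed simp

text \<open>The definition of \<open>barq\<close> uses the normalized fraction. Cross multiplication
  and multiplicativity of \<open>eval_qinv\<close> make every representation as a quotient
  admissible.\<close>

lemma barq_divide: "r \<noteq> 0 \<Longrightarrow> barq (to_fract p / to_fract r) = eval_qinv p / eval_qinv r"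
proof -
  assume "r \<noteq> 0"
  obtain a b where ab: "quot_of_fract (to_fract p / to_fract r) = (a, b)"
    by force
  have "b \<noteq> 0"
    using snd_quot_of_fract_nonzero[of "to_fract p / to_fract r"] by (simp add: ab)
  have "Fract a b = to_fract p / to_fract r"
    using Fract_quot_of_fract[of "to_fract p / to_fract r"] by (simp add: ab)
  then have "to_fract (a * r) = to_fract (p * b)"
    using \<open>r \<noteq> 0\<close> \<open>b \<noteq> 0\<close> by (simp add: Fract_conv_to_fract field_simps)
  then have "a * r = p * b"
    by (simp del: to_fract_mult)
  then have "eval_qinv a * eval_qinv r = eval_qinv p * eval_qinv b"
    by (metis eval_qinv_mult)
  then show ?thesis
    using \<open>r \<noteq> 0\<close> \<open>b \<noteq> 0\<close> by (simp add: barq_def ab field_simps)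
qed

lemma barq_to_fract: "barq (to_fract p) = eval_qinv p"
  using barq_divide[of 1 p] by simp

lemma qf_cases:
  obtains p r where "(x::qf) = to_fract p / to_fract r" "r \<noteq> 0"
  by (metis snd_quot_of_fract_nonzero Fract_quot_of_fract Fract_conv_to_fract)

lemma barq_add: "barq (x + y) = barq x + barq y"
proof -
  obtain p r where x: "x = to_fract p / to_fract r" and r: "r \<noteq> 0" by (rule qf_cases)
  obtain s t where y: "y = to_fract s / to_fract t" and t: "t \<noteq> 0" by (rule qf_cases)
  have "x + y = to_fract (p * t + s * r) / to_fract (r * t)"
    using r t by (simp add: x y field_simps)
  then have "barq (x + y) = eval_qinv (p * t + s * r) / eval_qinv (r * t)"
    using barq_divide[of "r * t" "p * t + s * r"] r t by simp
  then show ?thesis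
    using r t by (simp add: x y barq_divide eval_qinv_add eval_qinv_mult field_simps)
qed

lemma barq_mult: "barq (x * y) = barq x * barq y"
proof -
  obtain p r where x: "x = to_fract p / to_fract r" and r: "r \<noteq> 0" by (rule qf_cases)
  obtain s t where y: "y = to_fract s / to_fract t" and t: "t \<noteq> 0" by (rule qf_cases)
  have "x * y = to_fract (p * s) / to_fract (r * t)"
    using r t by (simp add: x y field_simps)
  then have "barq (x * y) = eval_qinv (p * s) / eval_qinv (r * t)"
    using barq_divide[of "r * t" "p * s"] r t by simp
  then show ?thesis
    using r t by (simp add: x y barq_divide eval_qinv_mult field_simps)
qed

lemma barq_0 [simp]: "barq 0 = 0"
  using barq_to_fract[of 0] by simp

lemma barq_1 [simp]: "barq 1 = 1"
  using barq_to_fract[of 1] by simp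

lemma barq_uminus: "barq (- x) = - barq x"
  by (metis add.right_inverse barq_0 barq_add add_eq_0_iff)

lemma barq_diff: "barq (x - y) = barq x - barq y"
  by (metis barq_add barq_uminus diff_conv_add_uminus)

lemma barq_qq [simp]: "barq qq = inverse qq"
  unfolding qq_def barq_to_fract by (simp add: eval_qinv_pCons flip: one_pCons) (simp add: qq_def)

lemma barq_sum: "barq (sum f A) = (\<Sum>a\<in>A. barq (f a))"
  by (induction A rule: infinite_finite_induct) (simp_all add: barq_add)

lemma barq_inverse: "barq (inverse x) = inverse (barq x)"
proof (cases "x = 0")
  case False
  then have "barq x * barq (inverse x) = 1"
    by (simp flip: barq_mult)
  then show ?thesis
    by (simp add: inverse_unique)
qed simp

lemma barq_barq [simp]: "barq (barq x) = x"
proof -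
  have *: "barq (eval_qinv p) = to_fract p" for p
  proof (induction p)
    case (pCons a p)
    have "barq (to_fract [:a:]) = to_fract [:a:]"
      by (simp add: barq_to_fract)
    then show ?case
      using pCons by (simp add: eval_qinv_pCons barq_add barq_mult barq_inverse to_fract_pCons[of a p])
  qed simp
  obtain p r where x: "x = to_fract p / to_fract r" and r: "r \<noteq> 0" by (rule qf_cases)
  show ?thesis
    using r by (simp add: x barq_divide)(simp add: divide_inverse barq_mult barq_inverse *)
qed

lemma barq_eq_0_iff [simp]: "barq x = 0 \<longleftrightarrow> x = 0"
  by (metis barq_0 barq_barq)

lemma barq_power: "barq (x ^ n) = barq x ^ n"
  by (induction n) (simp_all add: barq_mult)

lemma barq_power_int: "barq (x powi n) = barq x powi n"
  by (simp add: power_int_def barq_power barq_inverse)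

lemma barq_of_nat [simp]: "barq (of_nat n) = of_nat n"
  by (induction n) (simp_all add: barq_add)

lemma barq_of_int [simp]: "barq (of_int n) = of_int n"
  by (cases n) (simp_all add: barq_uminus barq_add barq_diff)

text \<open>Integral Laurent polynomials in q, encoded by their coefficients as a function of the
  exponent. As \<open>lau\<close> is injective, conditions on exponents can be read off from
  elements of the field.\<close>

definition lau :: "(int \<Rightarrow>\<^sub>0 int) \<Rightarrow> qf" where
  "lau a = (\<Sum>i\<in>Poly_Mapping.keys a. of_int (lookup a i) * qq powi i)"

lemma lau_add: "lau (a + b) = lau a + lau b"
  unfolding lau_def by (rule sum_keys_additive) (simp_all add: algebra_simps)

lemma lau_0 [simp]: "lau 0 = 0"
  by (simp add: lau_def)

lemma lau_single: "lau (Poly_Mapping.single i c) = of_int c * qq powi i"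
  unfolding lau_def by (rule sum_keys_single) simp

lemma lau_uminus: "lau (- a) = - lau a"
  by (metis add.right_inverse add_eq_0_iff lau_0 lau_add)

lemma lau_diff: "lau (a - b) = lau a - lau b"
  by (metis lau_add lau_uminus diff_conv_add_uminus)

lemma lau_mult: "lau (a * b) = lau a * lau b"
proof (induction a rule: poly_mapping_induct)
  case (single i c)
  show ?case
    by (induction b rule: poly_mapping_induct)
      (simp_all add: lau_single mult_single power_int_add lau_add algebra_simps)
qed (simp_all add: lau_add algebra_simps)

lemma lau_eq_0_iff [simp]: "lau a = 0 \<longleftrightarrow> a = 0"
proof
  assume *: "lau a = 0"
  show "a = 0"
  proof (rule ccontr)
    assume "a \<noteq> 0"
    define m where "m = Min (Poly_Mapping.keys a)"
    have ne: "Poly_Mapping.keys a \<noteq> {}"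
      using \<open>a \<noteq> 0\<close> by simp
    have m: "m \<in> Poly_Mapping.keys a" "\<And>i. i \<in> Poly_Mapping.keys a \<Longrightarrow> m \<le> i"
      using ne by (simp_all add: m_def)
    \<comment> \<open>Dividing by the lowest power of q leaves a polynomial whose constant term is
      the coefficient at the lowest exponent \<open>m\<close>.\<close>
    define r where "r = (\<Sum>i\<in>Poly_Mapping.keys a. monom (of_int (lookup a i) :: rat) (nat (i - m)))"
    have "qq powi (- m) * lau a = (\<Sum>i\<in>Poly_Mapping.keys a. of_int (lookup a i) * (qq powi i * qq powi (- m)))"
      by (simp add: lau_def sum_distrib_left sum_distrib_right mult_ac)
    also have "\<dots> = (\<Sum>i\<in>Poly_Mapping.keys a. of_int (lookup a i) * qq ^ nat (i - m))"
    proof (intro sum.cong refl)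
      fix i assume "i \<in> Poly_Mapping.keys a"
      then have "qq powi (i + - m) = qq ^ nat (i - m)"
        using m(2) by (simp add: power_int_def)
      moreover have "qq powi i * qq powi (- m) = qq powi (i + - m)"
        by (rule power_int_add[symmetric]) simp
      ultimately show "of_int (lookup a i) * (qq powi i * qq powi (- m)) = of_int (lookup a i) * qq ^ nat (i - m)"
        by (simp only:)
    qed
    also have "\<dots> = to_fract r"
      unfolding r_def by (simp add: to_fract_monom of_int_to_fract)
    finally have "coeff r 0 = 0"
      using * by simp
    moreover have "nat (i - m) = 0 \<longleftrightarrow> i = m" if "i \<in> Poly_Mapping.keys a" for i
      using m(2)[OF that] by auto
    then have "coeff r 0 = (\<Sum>i\<in>{m}. of_int (lookup a i))"
      unfolding r_def coeff_sum coeff_monom using m(1)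
      by (intro sum.mono_neutral_cong_right) auto
    ultimately show False
      using m(1) by (simp add: in_keys_iff)
  qed
qed simp

lemma lau_inject: "lau a = lau b \<longleftrightarrow> a = b"
  by (metis lau_diff lau_eq_0_iff right_minus_eq)

definition reflect_lau :: "(int \<Rightarrow>\<^sub>0 int) \<Rightarrow> (int \<Rightarrow>\<^sub>0 int)" where
  "reflect_lau = Poly_Mapping.map_key uminus"

lemma lookup_reflect_lau [simp]: "lookup (reflect_lau a) i = lookup a (- i)"
  by (simp add: reflect_lau_def map_key.rep_eq)

lemma reflect_lau_add: "reflect_lau (a + b) = reflect_lau a + reflect_lau b"
  by (rule poly_mapping_eqI) (simp add: lookup_add)

lemma reflect_lau_single: "reflect_lau (Poly_Mapping.single i c) = Poly_Mapping.single (- i) c"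
  by (rule poly_mapping_eqI) (auto simp: lookup_single when_def)

lemma reflect_lau_0 [simp]: "reflect_lau 0 = 0"
  by (rule poly_mapping_eqI) simp

lemma barq_lau: "barq (lau a) = lau (reflect_lau a)"
proof (induction a rule: poly_mapping_induct)
  case (single i c)
  then show ?case
    by (simp add: lau_single reflect_lau_single barq_mult barq_power_int power_int_inverse power_int_minus)
qed (simp_all add: reflect_lau_add lau_add barq_add)

definition Laurent :: "qf set" where
  "Laurent = range lau"

lemma Laurent_0 [simp, intro]: "0 \<in> Laurent"
  unfolding Laurent_def by (metis lau_0 rangeI)

lemma Laurent_powi [simp, intro]: "qq powi i \<in> Laurent"
  unfolding Laurent_def using lau_single[of i 1] by (metis lambda_one of_int_1 rangeI)

lemma Laurent_qq [simp, intro]: "qq \<in> Laurent" "inverse qq \<in> Laurent" "1 \<in> Laurent"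
  using Laurent_powi[of 1] Laurent_powi[of "-1"] Laurent_powi[of 0] by (simp_all add: power_int_minus)

lemma Laurent_add [intro]: "x \<in> Laurent \<Longrightarrow> y \<in> Laurent \<Longrightarrow> x + y \<in> Laurent"
  unfolding Laurent_def by (auto simp flip: lau_add)

lemma Laurent_uminus [intro]: "x \<in> Laurent \<Longrightarrow> - x \<in> Laurent"
  unfolding Laurent_def by (auto simp flip: lau_uminus)

lemma Laurent_diff [intro]: "x \<in> Laurent \<Longrightarrow> y \<in> Laurent \<Longrightarrow> x - y \<in> Laurent"
  unfolding Laurent_def by (auto simp flip: lau_diff)

lemma Laurent_mult [intro]: "x \<in> Laurent \<Longrightarrow> y \<in> Laurent \<Longrightarrow> x * y \<in> Laurent"
  unfolding Laurent_def by (auto simp flip: lau_mult)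

lemma Laurent_sum [intro]:
  fixes A :: "'a set"
  shows "(\<And>a. a \<in> A \<Longrightarrow> f a \<in> Laurent) \<Longrightarrow> sum f A \<in> Laurent"
  by (induction A rule: infinite_finite_induct) auto

lemma Laurent_power [intro]: "x \<in> Laurent \<Longrightarrow> x ^ n \<in> Laurent"
  by (induction n) auto

lemma Laurent_barq [intro]: "x \<in> Laurent \<Longrightarrow> barq x \<in> Laurent"
  unfolding Laurent_def by (auto simp: barq_lau)

lemma poly_inverse_qq_lau:
  "\<exists>a. poly (map_poly of_int p) (inverse qq) = lau a
     \<and> (\<forall>i>0. lookup a i = 0) \<and> lookup a 0 = coeff p 0"
proof (induction p)
  case 0
  then show ?case by (intro exI[of _ 0]) simp
next
  case (pCons c p)
  then obtain a where a: "poly (map_poly of_int p) (inverse qq) = lau a" "\<forall>i>0. lookup a i = 0"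
    by blast
  define d where "d = Poly_Mapping.single 0 c + Poly_Mapping.single (-1) 1 * a"
  have shift: "lookup (Poly_Mapping.single (-1) 1 * a) i = lookup a (i + 1)" for i
    by (induction a rule: poly_mapping_induct)
      (auto simp: mult_single lookup_single lookup_add when_def algebra_simps)
  have "poly (map_poly of_int (pCons c p)) (inverse qq) = lau d"
    using a(1) by (simp add: d_def map_poly_pCons lau_add lau_mult lau_single power_int_minus)
  moreover have "\<forall>i>0. lookup d i = 0" "lookup d 0 = c"
    using a(2) by (auto simp: d_def lookup_add shift lookup_single when_def)
  ultimately show ?case
    by (intro exI[of _ d]) simp
qed

lemma qinv_Z_qinv_iff: "x \<in> qinv_Z_qinv \<longleftrightarrow> (\<exists>a. x = lau a \<and> (\<forall>i\<ge>0. lookup a i = 0))"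
proof
  assume "x \<in> qinv_Z_qinv"
  then obtain p where p: "x = poly (map_poly of_int p) (inverse qq)" "coeff p 0 = 0"
    by (auto simp: qinv_Z_qinv_def)
  then show "\<exists>a. x = lau a \<and> (\<forall>i\<ge>0. lookup a i = 0)"
    using poly_inverse_qq_lau[of p] by (metis order_le_less)
next
  assume "\<exists>a. x = lau a \<and> (\<forall>i\<ge>0. lookup a i = 0)"
  then obtain a where a: "x = lau a" "\<forall>i\<ge>0. lookup a i = 0" by blast
  define p :: "int poly" where "p = (\<Sum>i\<in>Poly_Mapping.keys a. monom (lookup a i) (nat (- i)))"
  have add: "poly (map_poly of_int (p + r)) (z::qf) = poly (map_poly of_int p) z + poly (map_poly of_int r) z" for p r z
    by (induction p r rule: poly_induct2) (simp_all add: map_poly_pCons algebra_simps)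
  have sum: "poly (map_poly of_int (sum f A)) (z::qf) = (\<Sum>i\<in>A. poly (map_poly of_int (f i)) z)"
    if "finite A" for f A z
    using that by (induction A rule: finite_induct) (simp_all add: add)
  have mon: "poly (map_poly of_int (monom c k)) (z::qf) = of_int c * z ^ k" for c k z
    by (induction k) (simp_all add: monom_0 monom_Suc map_poly_pCons)
  have "poly (map_poly of_int p) (inverse qq) = lau a"
    unfolding p_def sum[OF finite_keys] mon lau_def
    using a(2) by (intro sum.cong refl) (auto simp: power_int_def in_keys_iff)
  moreover have "coeff p 0 = 0"
    unfolding p_def coeff_sum coeff_monom
    using a(2) by (intro sum.neutral) (auto simp: in_keys_iff)
  ultimately show "x \<in> qinv_Z_qinv"
    unfolding qinv_Z_qinv_def a(1) by (metis (mono_tags, lifting) mem_Collect_eq)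
qed

lemma qinv_0 [simp, intro]: "0 \<in> qinv_Z_qinv"
  unfolding qinv_Z_qinv_iff by (intro exI[of _ 0]) simp

lemma qinv_add [intro]: "x \<in> qinv_Z_qinv \<Longrightarrow> y \<in> qinv_Z_qinv \<Longrightarrow> x + y \<in> qinv_Z_qinv"
  unfolding qinv_Z_qinv_iff by (metis add.right_neutral lau_add lookup_add)

lemma qinv_diff [intro]: "x \<in> qinv_Z_qinv \<Longrightarrow> y \<in> qinv_Z_qinv \<Longrightarrow> x - y \<in> qinv_Z_qinv"
  unfolding qinv_Z_qinv_iff by (metis diff_zero lau_diff lookup_minus)

lemma qinv_sum [intro]:
  fixes A :: "'a set"
  shows "(\<And>a. a \<in> A \<Longrightarrow> f a \<in> qinv_Z_qinv) \<Longrightarrow> sum f A \<in> qinv_Z_qinv"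
  by (induction A rule: infinite_finite_induct) auto

lemma qinv_mult_minus_qinv [intro]: "x \<in> qinv_Z_qinv \<Longrightarrow> - inverse qq * x \<in> qinv_Z_qinv"
proof -
  assume "x \<in> qinv_Z_qinv"
  then obtain a where a: "x = lau a" "\<forall>i\<ge>0. lookup a i = 0"
    by (auto simp: qinv_Z_qinv_iff)
  have shift: "lookup (Poly_Mapping.single (-1) (-1) * a) i = - lookup a (i + 1)" for i
    by (induction a rule: poly_mapping_induct)
      (auto simp: mult_single lookup_single lookup_add when_def algebra_simps)
  have "- inverse qq * x = lau (Poly_Mapping.single (-1) (-1) * a)"
    by (simp add: a lau_mult lau_single power_int_minus)
  then show ?thesis
    unfolding qinv_Z_qinv_iff using a(2) shift by (metis add_increasing neg_0_equal_iff_equal zero_le_one)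
qed

lemma qinv_minus_qinv [simp, intro]: "- inverse qq \<in> qinv_Z_qinv"
  unfolding qinv_Z_qinv_iff
  by (intro exI[of _ "Poly_Mapping.single (-1) (-1)"])
    (simp add: lau_single lookup_single power_int_minus)

lemma qinv_Laurent: "x \<in> qinv_Z_qinv \<Longrightarrow> x \<in> Laurent"
  unfolding qinv_Z_qinv_iff Laurent_def by blast

text \<open>\<open>barq\<close> reflects the exponents, so an invariant element with only negative
  exponents has none. This is the uniqueness half of Lusztig's lemma.\<close>

lemma qinv_bar_invariant:
  assumes "x \<in> qinv_Z_qinv" "barq x = x"
  shows "x = 0"
proof -
  obtain a where a: "x = lau a" "\<forall>i\<ge>0. lookup a i = 0"
    using assms(1) by (auto simp: qinv_Z_qinv_iff)
  then have "reflect_lau a = a"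
    using assms(2) by (simp add: barq_lau lau_inject)
  then have "lookup a i = lookup a (- i)" for i
    by (metis lookup_reflect_lau)
  then have "lookup a i = 0" for i
    using a(2) by (cases "i \<ge> 0") (auto, metis neg_0_le_iff_le linear)
  then show ?thesis
    using a(1) by (metis lau_0 poly_mapping_eqI lookup_zero)
qed

text \<open>Antisymmetry under reflection forces the coefficient at exponent 0 to vanish, and the
  part \<open>d\<close> with negative exponents determines the rest up to sign. This is the
  existence half of Lusztig's lemma.\<close>

lemma qinv_split:
  assumes "z \<in> Laurent" "barq z = - z"
  shows "\<exists>y\<in>qinv_Z_qinv. z = y - barq y"
proof -
  obtain a where a: "z = lau a"
    using assms(1) by (auto simp: Laurent_def)
  then have "reflect_lau a = - a"
    using assms(2) by (simp add: barq_lau lau_inject flip: lau_uminus)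
  then have refl: "lookup a (- i) = - lookup a i" for i
    by (metis lookup_reflect_lau lookup_uminus)
  define d where "d = (\<Sum>i\<in>Poly_Mapping.keys a \<inter> {..<0}. Poly_Mapping.single i (lookup a i))"
  have d: "lookup d i = (if i < 0 then lookup a i else 0)" for i
    by (auto simp: d_def lookup_sum lookup_single when_def in_keys_iff)
  have "a = d - reflect_lau d"
  proof (rule poly_mapping_eqI)
    fix i
    show "lookup a i = lookup (d - reflect_lau d) i"
      using refl[of i] by (auto simp: lookup_minus d)
  qed
  then show ?thesis
    using a d by (intro bexI[of _ "lau d"]) (auto simp: barq_lau qinv_Z_qinv_iff simp flip: lau_diff)
qed

section \<open>Formal action of the quantum group\<close>

text \<open>The counit representation. A single factor is then \<open>ext_act\<close> of it, so
  inductions on the number of factors can start from the empty tensor product.\<close>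

fun triv_act :: "gen \<Rightarrow> formal \<Rightarrow> formal" where
  "triv_act (gE a) x f = 0"
| "triv_act (gF a) x f = 0"
| "triv_act (gK a) x f = x f"
| "triv_act (gKi a) x f = x f"

text \<open>The action of a generator on coefficient functions of \<open>X \<otimes> V\<close> (for \<open>e = 0\<close>) or
  \<open>X \<otimes> W\<close>, at the coefficient of \<open>h \<otimes> c\<close>, where \<open>G\<close> is the action on those of \<open>X\<close>.\<close>

fun ext_act :: "nat \<Rightarrow> (gen \<Rightarrow> formal \<Rightarrow> formal) \<Rightarrow> gen \<Rightarrow> formal \<Rightarrow> int list \<Rightarrow> int \<Rightarrow> qf" where
  "ext_act e G (gE a) x h c = (if e = 0
     then (if c = a then x (h @ [a + 1]) else 0)
       + qq powi (of_bool (c = a + 1) - of_bool (c = a)) * G (gE a) (\<lambda>h. x (h @ [c])) h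
     else (if c = a + 1 then x (h @ [a]) else 0)
       + qq powi (of_bool (c = a) - of_bool (c = a + 1)) * G (gE a) (\<lambda>h. x (h @ [c])) h)"
| "ext_act e G (gF a) x h c = G (gF a) (\<lambda>h. x (h @ [c])) h + (if e = 0
     then (if c = a + 1 then G (gK a) (G (gKi (a + 1)) (\<lambda>h. x (h @ [a]))) h else 0)
     else (if c = a then G (gK a) (G (gKi (a + 1)) (\<lambda>h. x (h @ [a + 1]))) h else 0))"
| "ext_act e G (gK a) x h c =
     qq powi (if e = 0 then of_bool (c = a) else - of_bool (c = a)) * G (gK a) (\<lambda>h. x (h @ [c])) h"
| "ext_act e G (gKi a) x h c =
     qq powi (if e = 0 then - of_bool (c = a) else of_bool (c = a)) * G (gKi a) (\<lambda>h. x (h @ [c])) h"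

text \<open>The factors are matched from the right, so that the equations below hold for lists of any
  length.\<close>

primrec gop :: "nat list \<Rightarrow> nat \<Rightarrow> gen \<Rightarrow> formal \<Rightarrow> formal" where
  "gop b 0 = triv_act"
| "gop b (Suc n) = (\<lambda>g x f. if f = [] then triv_act g x f
     else ext_act (b ! n) (gop b n) g x (butlast f) (last f))"

lemma gop_snoc: "gop b (Suc n) g x (h @ [c]) = ext_act (b ! n) (gop b n) g x h c"
  by simp

lemma gop_Nil: "gop b n g x [] = triv_act g x []"
  by (cases n) auto

declare gop.simps(2) [simp del]

lemma qq_square: "qq * qq \<noteq> 1"
proof
  assume "qq * qq = 1"
  then have "lau (Poly_Mapping.single 2 1) = lau (Poly_Mapping.single 0 1)"
    by (simp add: lau_single power2_eq_square del: single_one)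
  then have "lookup (Poly_Mapping.single (2::int) 1) 2 = (lookup (Poly_Mapping.single (0::int) 1) 2 :: int)"
    by (simp only: lau_inject)
  then show False
    by (simp add: lookup_single del: single_one)
qed

text \<open>The defining relations as identities of operators on coefficient functions. That they
  pass from \<open>G\<close> to its extension by one factor V or W is the compatibility of the
  coproduct with the relations; by induction every tensor space is a module.\<close>

locale urep =
  fixes G :: "gen \<Rightarrow> formal \<Rightarrow> formal"
  assumes add: "G g (\<lambda>f. x f + y f) f = G g x f + G g y f"
    and scale: "G g (\<lambda>f. c * x f) f = c * G g x f"
    and K_Ki: "G (gK a) (G (gKi a) x) = x"
    and Ki_K: "G (gKi a) (G (gK a) x) = x"
    and K_K: "G (gK a) (G (gK b) x) = G (gK b) (G (gK a) x)"
    and K_E: "G (gK a) (G (gE b) x) f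
      = qq powi (of_bool (a = b) - of_bool (a = b + 1)) * G (gE b) (G (gK a) x) f"
    and K_F: "G (gK a) (G (gF b) x) f
      = qq powi (of_bool (a = b + 1) - of_bool (a = b)) * G (gF b) (G (gK a) x) f"
    and E_F: "G (gE a) (G (gF b) x) f = G (gF b) (G (gE a) x) f
      + (if a = b then 1 / (qq - inverse qq) *
         (G (gK a) (G (gKi (a + 1)) x) f - G (gK (a + 1)) (G (gKi a) x) f) else 0)"
    and E_serre: "\<bar>a - b\<bar> = 1 \<Longrightarrow> G (gE a) (G (gE a) (G (gE b) x)) f + G (gE b) (G (gE a) (G (gE a) x)) f
      = (qq + inverse qq) * G (gE a) (G (gE b) (G (gE a) x)) f"
    and E_E: "\<bar>a - b\<bar> > 1 \<Longrightarrow> G (gE a) (G (gE b) x) f = G (gE b) (G (gE a) x) f"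
    and F_serre: "\<bar>a - b\<bar> = 1 \<Longrightarrow> G (gF a) (G (gF a) (G (gF b) x)) f + G (gF b) (G (gF a) (G (gF a) x)) f
      = (qq + inverse qq) * G (gF a) (G (gF b) (G (gF a) x)) f"
    and F_F: "\<bar>a - b\<bar> > 1 \<Longrightarrow> G (gF a) (G (gF b) x) f = G (gF b) (G (gF a) x) f"
begin

lemma zero: "G g (\<lambda>f. 0) f = 0"
  using scale[of g 0 "\<lambda>f. 0"] by simp

lemma add_fun: "G g (\<lambda>f. x f + y f) = (\<lambda>f. G g x f + G g y f)"
  and scale_fun: "G g (\<lambda>f. c * x f) = (\<lambda>f. c * G g x f)"
  and zero_fun: "G g (\<lambda>f. 0) = (\<lambda>f. 0)"
  by (auto simp: add scale zero)

lemma K_Ki_commute: "G (gK a) (G (gKi b) x) = G (gKi b) (G (gK a) x)"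
  by (metis K_K K_Ki Ki_K)

lemma Ki_E: "G (gKi a) (G (gE b) x) f
    = qq powi (of_bool (a = b + 1) - of_bool (a = b)) * G (gE b) (G (gKi a) x) f"
proof -
  let ?n = "of_bool (a = b) - of_bool (a = b + 1) :: int"
  have "G (gK a) (G (gE b) (G (gKi a) x)) = (\<lambda>f. qq powi ?n * G (gE b) x f)"
    using K_E[of a b "G (gKi a) x"] by (auto simp: K_Ki)
  then have "G (gE b) (G (gKi a) x) = G (gKi a) (\<lambda>f. qq powi ?n * G (gE b) x f)"
    by (metis Ki_K)
  then have "G (gE b) (G (gKi a) x) f = qq powi ?n * G (gKi a) (G (gE b) x) f"
    by (simp add: scale)
  then have "qq powi (- ?n) * G (gE b) (G (gKi a) x) f = (qq powi (- ?n) * qq powi ?n) * G (gKi a) (G (gE b) x) f"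
    by simp
  also have "qq powi (- ?n) * qq powi ?n = 1"
    by (simp flip: power_int_add)
  finally show ?thesis
    by simp
qed

lemma Ki_F: "G (gKi a) (G (gF b) x) f
    = qq powi (of_bool (a = b) - of_bool (a = b + 1)) * G (gF b) (G (gKi a) x) f"
proof -
  let ?n = "of_bool (a = b + 1) - of_bool (a = b) :: int"
  have "G (gK a) (G (gF b) (G (gKi a) x)) = (\<lambda>f. qq powi ?n * G (gF b) x f)"
    using K_F[of a b "G (gKi a) x"] by (auto simp: K_Ki)
  then have "G (gF b) (G (gKi a) x) = G (gKi a) (\<lambda>f. qq powi ?n * G (gF b) x f)"
    by (metis Ki_K)
  then have "G (gF b) (G (gKi a) x) f = qq powi ?n * G (gKi a) (G (gF b) x) f"
    by (simp add: scale)
  then have "qq powi (- ?n) * G (gF b) (G (gKi a) x) f = (qq powi (- ?n) * qq powi ?n) * G (gKi a) (G (gF b) x) f"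
    by simp
  also have "qq powi (- ?n) * qq powi ?n = 1"
    by (simp flip: power_int_add)
  finally show ?thesis
    by simp
qed

lemmas fun_rules = add_fun scale_fun zero_fun
  K_Ki Ki_K K_Ki_commute K_E[abs_def] K_F[abs_def] Ki_E[abs_def] Ki_F[abs_def]

end

lemma urep_triv: "urep triv_act"
proof
  show "triv_act g (\<lambda>f. x f + y f) f = triv_act g x f + triv_act g y f" for g x y f
    by (cases g) auto
  show "triv_act g (\<lambda>f. c * x f) f = c * triv_act g x f" for g c x f
    by (cases g) auto
  have K: "triv_act (gK a) = (\<lambda>x. x)" "triv_act (gKi a) = (\<lambda>x. x)"
     "triv_act (gE a) = (\<lambda>x f. 0)" "triv_act (gF a) = (\<lambda>x f. 0)" for a
    by (auto simp: fun_eq_iff)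
qed (simp_all add: fun_eq_iff)

context urep begin

definition ext :: "nat \<Rightarrow> gen \<Rightarrow> formal \<Rightarrow> formal" where
  "ext e = (\<lambda>g x f. if f = [] then triv_act g x f else ext_act e G g x (butlast f) (last f))"

lemma ext_snoc: "ext e g x (h @ [c]) = ext_act e G g x h c"
  and ext_Nil: "ext e g x [] = triv_act g x []"
  by (simp_all add: ext_def)

lemma eq_snocI: "F [] = H [] \<Longrightarrow> (\<And>h c. F (h @ [c]) = H (h @ [c])) \<Longrightarrow> F = (H :: formal)"
  by (auto simp: fun_eq_iff) (metis rev_exhaust)

lemma ext_add: "ext e g (\<lambda>f. x f + y f) f = ext e g x f + ext e g y f"
  by (cases f rule: rev_cases; cases g) (auto simp: ext_snoc ext_Nil fun_rules algebra_simps)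

lemma ext_scale: "ext e g (\<lambda>f. c * x f) f = c * ext e g x f"
  by (cases f rule: rev_cases; cases g) (auto simp: ext_snoc ext_Nil fun_rules algebra_simps)

lemma ext_K_Ki: "ext e (gK a) (ext e (gKi a) x) = x"
  by (rule eq_snocI) (auto simp: ext_snoc ext_Nil fun_rules)

lemma ext_Ki_K: "ext e (gKi a) (ext e (gK a) x) = x"
  by (rule eq_snocI) (auto simp: ext_snoc ext_Nil fun_rules)

lemma ext_K_K: "ext e (gK a) (ext e (gK b) x) = ext e (gK b) (ext e (gK a) x)"
  by (rule eq_snocI) (auto simp: ext_snoc ext_Nil fun_rules K_K)

lemma ext_K_E: "ext e (gK a) (ext e (gE b) x) f
      = qq powi (of_bool (a = b) - of_bool (a = b + 1)) * ext e (gE b) (ext e (gK a) x) f"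
  by (cases f rule: rev_cases) (auto simp: ext_snoc ext_Nil fun_rules power_int_minus algebra_simps)

lemma ext_K_F: "ext e (gK a) (ext e (gF b) x) f
      = qq powi (of_bool (a = b + 1) - of_bool (a = b)) * ext e (gF b) (ext e (gK a) x) f"
  by (cases f rule: rev_cases) (auto simp: ext_snoc ext_Nil fun_rules K_K power_int_minus algebra_simps)

lemma ext_E_F: "ext e (gE a) (ext e (gF b) x) f = ext e (gF b) (ext e (gE a) x) f
      + (if a = b then 1 / (qq - inverse qq) *
         (ext e (gK a) (ext e (gKi (a + 1)) x) f - ext e (gK (a + 1)) (ext e (gKi a) x) f) else 0)"
  proof (cases f rule: rev_cases)
  case Nil
  then show ?thesis
    by (simp add: ext_Nil)
next
  case (snoc h c)
  show ?thesis
    using qq_square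
    by (auto simp: snoc ext_snoc fun_rules K_K E_F power_int_minus; simp add: field_simps)
qed

lemma abs_1_cases: "\<bar>a - b\<bar> = (1::int) \<Longrightarrow> b = a + 1 \<or> a = b + 1"
  by auto

lemma ext_E_serre:
  assumes "\<bar>a - b\<bar> = 1"
  shows "ext e (gE a) (ext e (gE a) (ext e (gE b) x)) f + ext e (gE b) (ext e (gE a) (ext e (gE a) x)) f
      = (qq + inverse qq) * ext e (gE a) (ext e (gE b) (ext e (gE a) x)) f"
proof (cases f rule: rev_cases)
  case Nil
  then show ?thesis
    by (simp add: ext_Nil)
next
  case (snoc h c)
  have S: "G (gE a) (G (gE a) (G (gE b) x)) f
      = (qq + inverse qq) * G (gE a) (G (gE b) (G (gE a) x)) f - G (gE b) (G (gE a) (G (gE a) x)) f" for x f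
    using E_serre[OF assms, of x f] by (simp add: algebra_simps)
  from abs_1_cases[OF assms] show ?thesis
  proof
    assume b: "b = a + 1"
    show ?thesis
      unfolding b snoc by (auto simp: ext_snoc fun_rules S[unfolded b] power_int_minus; simp add: field_simps)
  next
    assume a: "a = b + 1"
    show ?thesis
      unfolding a snoc by (auto simp: ext_snoc fun_rules S[unfolded a] power_int_minus; simp add: field_simps)
  qed
qed

lemma ext_E_E: "\<bar>a - b\<bar> > 1 \<Longrightarrow> ext e (gE a) (ext e (gE b) x) f = ext e (gE b) (ext e (gE a) x) f"
proof (cases f rule: rev_cases)
  case Nil
  then show ?thesis
    by (simp add: ext_Nil)
next
  case (snoc h c)
  assume "\<bar>a - b\<bar> > 1"
  then show ?thesis
    by (auto simp: snoc ext_snoc fun_rules E_E power_int_minus; simp add: field_simps)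
qed

lemma ext_F_serre:
  assumes "\<bar>a - b\<bar> = 1"
  shows "ext e (gF a) (ext e (gF a) (ext e (gF b) x)) f + ext e (gF b) (ext e (gF a) (ext e (gF a) x)) f
      = (qq + inverse qq) * ext e (gF a) (ext e (gF b) (ext e (gF a) x)) f"
proof (cases f rule: rev_cases)
  case Nil
  then show ?thesis
    by (simp add: ext_Nil)
next
  case (snoc h c)
  have S: "G (gF a) (G (gF a) (G (gF b) x)) f
      = (qq + inverse qq) * G (gF a) (G (gF b) (G (gF a) x)) f - G (gF b) (G (gF a) (G (gF a) x)) f" for x f
    using F_serre[OF assms, of x f] by (simp add: algebra_simps)
  from abs_1_cases[OF assms] show ?thesis
  proof
    assume b: "b = a + 1"
    show ?thesis
      unfolding b snoc by (auto simp: ext_snoc fun_rules K_K S[unfolded b] power_int_minus; simp add: field_simps)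
  next
    assume a: "a = b + 1"
    show ?thesis
      unfolding a snoc by (auto simp: ext_snoc fun_rules K_K S[unfolded a] power_int_minus; simp add: field_simps)
  qed
qed

lemma ext_F_F: "\<bar>a - b\<bar> > 1 \<Longrightarrow> ext e (gF a) (ext e (gF b) x) f = ext e (gF b) (ext e (gF a) x) f"
proof (cases f rule: rev_cases)
  case Nil
  then show ?thesis
    by (simp add: ext_Nil)
next
  case (snoc h c)
  assume "\<bar>a - b\<bar> > 1"
  then show ?thesis
    by (auto simp: snoc ext_snoc fun_rules F_F K_K power_int_minus; simp add: field_simps)
qed

lemma urep_ext: "urep (ext e)"
  by standard (fact ext_add ext_scale ext_K_Ki ext_Ki_K ext_K_K ext_K_E ext_K_F ext_E_F ext_E_serre
    ext_E_E ext_F_serre ext_F_F)+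

end

lemma urep_gop: "urep (gop b n)"
proof (induction n)
  case (Suc n)
  then have "gop b (Suc n) = urep.ext (gop b n) (b ! n)"
    by (simp add: urep.ext_def gop.simps(2) fun_eq_iff)
  then show ?case
    using urep.urep_ext[OF Suc] by simp
qed (simp add: urep_triv)

section \<open>Linear maps on finite combinations\<close>

definition scl :: "qf \<Rightarrow> ('a \<Rightarrow>\<^sub>0 qf) \<Rightarrow> ('a \<Rightarrow>\<^sub>0 qf)" where
  "scl c x = Poly_Mapping.map ((*) c) x"

lemma lookup_scl [simp]: "lookup (scl c x) a = c * lookup x a"
  by (simp add: scl_def map.rep_eq when_def)

lemma scl_simps [simp]: "scl c (0 :: 'a \<Rightarrow>\<^sub>0 qf) = 0" "scl 0 x = 0" "scl 1 x = x" "scl c (scl d x) = scl (c * d) x"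
  "scl c (Poly_Mapping.single a d) = Poly_Mapping.single a (c * d)"
  and scl_minus_1 [simp]: "scl (- 1) x = - (x :: 'a \<Rightarrow>\<^sub>0 qf)"
  by (auto intro!: poly_mapping_eqI simp: lookup_single when_def)

lemma scl_add: "scl c (x + y) = scl c x + scl c y"
  by (auto intro!: poly_mapping_eqI simp: lookup_add algebra_simps)

lemma scl_sum: "scl c (sum f A) = (\<Sum>a\<in>A. scl c (f a))"
  by (auto intro!: poly_mapping_eqI simp: lookup_sum sum_distrib_left)

lemma keys_scl: "Poly_Mapping.keys (scl c x) \<subseteq> Poly_Mapping.keys x"
  by (auto simp: in_keys_iff)

definition lmap :: "(('a \<Rightarrow>\<^sub>0 qf) \<Rightarrow> ('b \<Rightarrow>\<^sub>0 qf)) \<Rightarrow> bool" where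
  "lmap h \<longleftrightarrow> (\<forall>x y. h (x + y) = h x + h y) \<and> (\<forall>c x. h (scl c x) = scl c (h x))"

lemma lmapI: "(\<And>x y. h (x + y) = h x + h y) \<Longrightarrow> (\<And>c x. h (scl c x) = scl c (h x)) \<Longrightarrow> lmap h"
  by (simp add: lmap_def)

lemma lmap_add: "lmap h \<Longrightarrow> h (x + y) = h x + h y"
  and lmap_scl: "lmap h \<Longrightarrow> h (scl c x) = scl c (h x)"
  by (simp_all add: lmap_def)

lemma lmap_0: "lmap h \<Longrightarrow> h 0 = 0"
  using lmap_scl[of h 0 0] by simp

lemma lmap_uminus: "lmap h \<Longrightarrow> h (- x) = - h x"
  using lmap_scl[of h "- 1" x] by simp

lemma lmap_diff: "lmap h \<Longrightarrow> h (x - y) = h x - h y"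
  using lmap_add[of h x "- y"] lmap_uminus[of h y] by simp

lemma lmap_sum: "lmap h \<Longrightarrow> h (sum f A) = (\<Sum>a\<in>A. h (f a))"
  by (induction A rule: infinite_finite_induct) (simp_all add: lmap_0 lmap_add)

lemma lmap_comp: "lmap h \<Longrightarrow> lmap k \<Longrightarrow> lmap (\<lambda>x. h (k x))"
  by (simp add: lmap_def)

lemma lmap_scl_id: "lmap (scl c)"
  by (simp add: lmap_def scl_add mult.commute)

lemma poly_mapping_expand: "x = (\<Sum>a\<in>Poly_Mapping.keys x. Poly_Mapping.single a (lookup x a))"
  by (rule poly_mapping_eqI) (auto simp: lookup_sum lookup_single when_def in_keys_iff)

lemma lmap_expand: "lmap h \<Longrightarrow> h x = (\<Sum>a\<in>Poly_Mapping.keys x. scl (lookup x a) (h (Poly_Mapping.single a 1)))"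
proof -
  assume h: "lmap h"
  have "h x = h (\<Sum>a\<in>Poly_Mapping.keys x. scl (lookup x a) (Poly_Mapping.single a 1))"
    by (simp flip: poly_mapping_expand)
  then show ?thesis
    by (simp only: lmap_sum[OF h] lmap_scl[OF h])
qed

lemma lmap_eqI:
  assumes "lmap h" "lmap k" "\<And>a. a \<in> Poly_Mapping.keys x \<Longrightarrow> h (Poly_Mapping.single a 1) = k (Poly_Mapping.single a 1)"
  shows "h x = k x"
  using assms by (simp add: lmap_expand[of h x] lmap_expand[of k x])

lemma lin_alt: "lin \<phi> x = (\<Sum>a\<in>Poly_Mapping.keys x. scl (lookup x a) (\<phi> a))"
  by (simp add: lin_def scl_def)

lemma scl_add_left: "scl (c + d) x = scl c x + scl d x"
  by (auto intro!: poly_mapping_eqI simp: lookup_add algebra_simps)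

lemma lmap_lin: "lmap (lin \<phi>)"
proof (rule lmapI)
  show "lin \<phi> (x + y) = lin \<phi> x + lin \<phi> y" for x y
    unfolding lin_alt by (rule sum_keys_additive) (simp_all add: scl_add_left)
  show "lin \<phi> (scl c x) = scl c (lin \<phi> x)" for c x
  proof (cases "c = 0")
    case False
    then have "Poly_Mapping.keys (scl c x) = Poly_Mapping.keys x"
      by (auto simp: in_keys_iff)
    then show ?thesis
      by (simp add: lin_alt scl_sum)
  qed (simp add: lin_alt)
qed

lemmas lin_add = lmap_add[OF lmap_lin]
  and lin_scl = lmap_scl[OF lmap_lin]
  and lin_0 [simp] = lmap_0[OF lmap_lin]
  and lin_diff = lmap_diff[OF lmap_lin]
  and lin_sum = lmap_sum[OF lmap_lin]

lemma lin_single [simp]: "lin \<phi> (Poly_Mapping.single a c) = scl c (\<phi> a)"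
  unfolding lin_alt by (rule sum_keys_single) simp

lemma lmap_lin_commute: "lmap h \<Longrightarrow> h (lin \<phi> x) = lin (\<lambda>a. h (\<phi> a)) x"
  by (simp add: lin_alt lmap_sum lmap_scl)

lemma lin_lin: "lin \<phi> (lin \<psi> x) = lin (\<lambda>a. lin \<phi> (\<psi> a)) x"
  by (rule lmap_lin_commute[OF lmap_lin])

lemma lin_cong: "(\<And>a. a \<in> Poly_Mapping.keys x \<Longrightarrow> \<phi> a = \<psi> a) \<Longrightarrow> lin \<phi> x = lin \<psi> x"
  by (simp add: lin_alt)

lemma lin_id [simp]: "lin (\<lambda>a. Poly_Mapping.single a 1) x = x"
  by (simp add: lin_alt flip: poly_mapping_expand)

lemma lin_fun_add: "lin (\<lambda>a. \<phi> a + \<psi> a) x = lin \<phi> x + lin \<psi> x"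
  by (simp add: lin_alt scl_add sum.distrib)

lemma lin_fun_scl: "lin (\<lambda>a. scl c (\<phi> a)) x = scl c (lin \<phi> x)"
  by (simp add: lin_alt scl_sum mult.commute)

lemma lmap_lin_fun: "(\<And>a. lmap (\<lambda>y. \<phi> y a)) \<Longrightarrow> lmap (\<lambda>y. lin (\<phi> y) x)"
proof (rule lmapI)
  assume *: "\<And>a. lmap (\<lambda>y. \<phi> y a)"
  then have "\<phi> (y + z) = (\<lambda>a. \<phi> y a + \<phi> z a)" "\<phi> (scl c y) = (\<lambda>a. scl c (\<phi> y a))" for y z c
    by (auto simp: fun_eq_iff lmap_def)
  then show "lin (\<phi> (y + z)) x = lin (\<phi> y) x + lin (\<phi> z) x" "lin (\<phi> (scl c y)) x = scl c (lin (\<phi> y) x)" for y z c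
    by (simp_all add: lin_fun_add lin_fun_scl)
qed

lemma lookup_lin: "lookup (lin \<phi> x) b = (\<Sum>a\<in>Poly_Mapping.keys x. lookup x a * lookup (\<phi> a) b)"
  by (simp add: lin_alt lookup_sum)

section \<open>Tensor products and words\<close>

lemma lmap_tensor_left: "lmap (\<lambda>x. tensor x y)"
  unfolding tensor_def by (rule lmap_lin)

lemma lmap_tensor_right: "lmap (tensor x)"
  unfolding tensor_def by (rule lmap_lin_fun) (rule lmap_lin)

lemma tensor_single: "tensor (Poly_Mapping.single f c) (Poly_Mapping.single g d) = Poly_Mapping.single (f @ g) (c * d)"
  by (simp add: tensor_def)

lemma tensor_bas: "tensor x (bas c) = lin (\<lambda>f. Poly_Mapping.single (f @ [c]) 1) x"
  by (simp add: tensor_def bas_def)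

text \<open>Basis vectors of all numbers of factors live in one type. This selects the tensor space
  with \<open>N\<close> factors, the setting in which cutting an index list at a fixed position
  separates the last factor from the others.\<close>

definition hom_len :: "nat \<Rightarrow> tens \<Rightarrow> bool" where
  "hom_len N x \<longleftrightarrow> (\<forall>f\<in>Poly_Mapping.keys x. length f = N)"

lemma hom_lenD: "hom_len N x \<Longrightarrow> lookup x f \<noteq> 0 \<Longrightarrow> length f = N"
  by (auto simp: hom_len_def in_keys_iff)

lemma hom_len_0 [simp]: "hom_len N 0"
  and hom_len_single: "length f = N \<Longrightarrow> hom_len N (Poly_Mapping.single f c)"
  by (auto simp: hom_len_def)

lemma hom_len_add: "hom_len N x \<Longrightarrow> hom_len N y \<Longrightarrow> hom_len N (x + y)"
  using keys_add[of x y] by (auto simp: hom_len_def)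

lemma hom_len_scl: "hom_len N x \<Longrightarrow> hom_len N (scl c x)"
  using keys_scl[of c x] by (auto simp: hom_len_def)

lemma hom_len_sum: "(\<And>a. a \<in> A \<Longrightarrow> hom_len N (f a)) \<Longrightarrow> hom_len N (sum f A)"
  by (induction A rule: infinite_finite_induct) (auto intro: hom_len_add)

lemma hom_len_lin: "(\<And>a. a \<in> Poly_Mapping.keys x \<Longrightarrow> hom_len N (\<phi> a)) \<Longrightarrow> hom_len N (lin \<phi> x)"
  unfolding lin_alt by (intro hom_len_sum hom_len_scl)

lemma hom_len_tensor: "hom_len N x \<Longrightarrow> hom_len N' y \<Longrightarrow> hom_len (N + N') (tensor x y)"
  unfolding tensor_def by (intro hom_len_lin hom_len_single) (auto simp: hom_len_def)

lemma hom_len_bas: "hom_len 1 (bas c)"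
  by (simp add: bas_def hom_len_single)

lemma lookup_tensor_snoc:
  assumes "hom_len 1 y"
  shows "lookup (tensor x y) (h @ [c]) = lookup x h * lookup y [c]"
proof -
  have 1: "lookup (lin (\<lambda>g. Poly_Mapping.single (f @ g) 1) y) (h @ [c]) = (if f = h then lookup y [c] else 0)" for f
  proof -
    have "lookup (lin (\<lambda>g. Poly_Mapping.single (f @ g) 1) y) (h @ [c])
        = (\<Sum>g\<in>Poly_Mapping.keys y. if f = h \<and> g = [c] then lookup y [c] else 0)"
      unfolding lookup_lin
    proof (intro sum.cong refl)
      fix g assume "g \<in> Poly_Mapping.keys y"
      then obtain d where "g = [d]"
        using assms by (auto simp: hom_len_def length_Suc_conv)
      then show "lookup y g * lookup (Poly_Mapping.single (f @ g) 1) (h @ [c]) = (if f = h \<and> g = [c] then lookup y [c] else 0)"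
        by (auto simp: lookup_single when_def)
    qed
    then show ?thesis
      by (auto simp: in_keys_iff)
  qed
  show ?thesis
    unfolding tensor_def lookup_lin[of _ x] 1 by (auto simp: in_keys_iff if_distrib cong: if_cong)
qed

lemma lookup_tensor_bas: "lookup (tensor x (bas c)) (h @ [d]) = (if d = c then lookup x h else 0)"
  using lookup_tensor_snoc[OF hom_len_bas] by (auto simp: bas_def lookup_single when_def)

lemma lookup_tensor_single: "lookup (tensor x (Poly_Mapping.single [c] r)) (h @ [d]) = (if d = c then r * lookup x h else 0)"
  using lookup_tensor_snoc[OF hom_len_single[of "[c]" 1 r]] by (auto simp: lookup_single when_def)

lemma lookup_tensor_bas_Nil: "lookup (tensor x (bas c)) [] = 0"
  by (simp add: tensor_bas lookup_lin lookup_single)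

lemma word_act_append: "word_act \<rho> (v @ w) f = lin (word_act \<rho> v) (word_act \<rho> w f)"
proof (induction v)
  case (Cons g v)
  have "word_act \<rho> (g # v) = (\<lambda>f. lin (\<rho> g) (word_act \<rho> v f))"
    by (auto simp: fun_eq_iff)
  then show ?case
    by (simp add: Cons lin_lin)
qed (simp flip: id_def)

definition act :: "(gen \<Rightarrow> int list \<Rightarrow> tens) \<Rightarrow> falg \<Rightarrow> int list \<Rightarrow> tens" where
  "act \<rho> x f = lin (\<lambda>w. word_act \<rho> (letters w) f) x"

lemma act_mon [simp]: "act \<rho> (mon ws) f = word_act \<rho> ws f"
  by (simp add: act_def mon_def)

lemma one_mon: "(1 :: falg) = mon []"
  unfolding mon_def zero_word_def[symmetric] by (simp only: single_one)

lemma act_1 [simp]: "act \<rho> 1 f = Poly_Mapping.single f 1"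
  by (simp add: one_mon)

lemma sc_mult: "sc c * x = scl c x"
  by (simp add: sc_def scl_def mult_map_scale_conv_mult)

lemma act_scl: "act \<rho> (scl c x) f = scl c (act \<rho> x f)"
  and act_add: "act \<rho> (x + y) f = act \<rho> x f + act \<rho> y f"
  and act_diff: "act \<rho> (x - y) f = act \<rho> x f - act \<rho> y f"
  by (simp_all add: act_def lin_scl lin_add lin_diff)

lemma act2_otimes: "act2 \<rho> \<sigma> (otimes x y) f g = tensor (act \<rho> x f) (act \<sigma> y g)"
proof -
  have "act2 \<rho> \<sigma> (otimes x y) f g
      = lin (\<lambda>v. lin (\<lambda>w. tensor (word_act \<rho> (letters v) f) (word_act \<sigma> (letters w) g)) y) x"
    by (simp add: act2_def otimes_def lin_lin)
  also have "\<dots> = lin (\<lambda>v. tensor (word_act \<rho> (letters v) f) (act \<sigma> y g)) x"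
    by (simp add: act_def lmap_lin_commute[OF lmap_tensor_right])
  also have "\<dots> = tensor (act \<rho> x f) (act \<sigma> y g)"
    by (simp add: act_def lmap_lin_commute[OF lmap_tensor_left])
  finally show ?thesis .
qed

lemma lmap_act2: "lmap (\<lambda>z. act2 \<rho> \<sigma> z f g)"
  unfolding act2_def by (rule lmap_lin)

lemma act2_add: "act2 \<rho> \<sigma> (x + y) f g = act2 \<rho> \<sigma> x f g + act2 \<rho> \<sigma> y f g"
  by (rule lmap_add[OF lmap_act2])

section \<open>Comparison with the formal action\<close>

text \<open>Generators preserve the number of factors, so values at lists of other lengths cannot
  enter.\<close>

lemma gop_cong_length:
  "(\<And>k. length k = length f \<Longrightarrow> x k = y k) \<Longrightarrow> gop b n g x f = gop b n g y f"
proof (induction n arbitrary: g x y f)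
  case 0
  then show ?case by (cases g) auto
next
  case (Suc n)
  show ?case
  proof (cases f rule: rev_cases)
    case Nil
    then show ?thesis
      using Suc.prems by (cases g) (auto simp: gop_Nil)
  next
    case (snoc h c)
    have IH: "gop b n g (\<lambda>h. x (h @ [d])) k = gop b n g (\<lambda>h. y (h @ [d])) k" if "length k = length h" for g d k
      using Suc.prems that snoc by (intro Suc.IH) auto
    have IH2: "gop b n g (gop b n g' (\<lambda>h. x (h @ [d]))) h = gop b n g (gop b n g' (\<lambda>h. y (h @ [d]))) h" for g g' d
      by (intro Suc.IH IH) auto
    show ?thesis
      using Suc.prems IH IH2 unfolding snoc gop_snoc by (cases g) auto
  qed
qed

lemma gop_0_length:
  assumes "\<And>k. length k = length f \<Longrightarrow> x k = 0"
  shows "gop b n g x f = 0"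
  using gop_cong_length[of f x "\<lambda>_. 0" b n g] assms urep.zero[OF urep_gop] by simp

lemma gop_sum: "gop b n g (\<lambda>f. \<Sum>a\<in>A. c a * x a f) f = (\<Sum>a\<in>A. c a * gop b n g (x a) f)"
  by (induction A rule: infinite_finite_induct)
    (simp_all add: urep.zero[OF urep_gop] urep.add[OF urep_gop] urep.scale[OF urep_gop])

lemma lookup_lin_gop:
  assumes "\<And>f k. length f = N \<Longrightarrow> lookup (\<phi> f) k = gop b n g (lookup (Poly_Mapping.single f 1)) k"
    and "hom_len N t"
  shows "lookup (lin \<phi> t) = gop b n g (lookup t)"
proof
  fix k
  have "lookup t = (\<lambda>k. \<Sum>f\<in>Poly_Mapping.keys t. lookup t f * lookup (Poly_Mapping.single f 1) k)"
    by (auto simp: fun_eq_iff lookup_single when_def in_keys_iff if_distrib cong: if_cong)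
  then have "gop b n g (lookup t) k
     = (\<Sum>f\<in>Poly_Mapping.keys t. lookup t f * gop b n g (lookup (Poly_Mapping.single f 1)) k)"
    by (metis (no_types) gop_sum)
  also have "\<dots> = lookup (lin \<phi> t) k"
    unfolding lookup_lin using assms by (intro sum.cong refl) (simp add: hom_len_def)
  finally show "lookup (lin \<phi> t) k = gop b n g (lookup t) k" ..
qed

lemma coprod_gen_act2:
  "act2 \<rho> \<sigma> (coprod_gen (gE a)) f h = tensor (Poly_Mapping.single f 1) (lin (\<sigma> (gE a)) (Poly_Mapping.single h 1))
     + tensor (lin (\<rho> (gE a)) (Poly_Mapping.single f 1)) (word_act \<sigma> [gK (a + 1), gKi a] h)"
  "act2 \<rho> \<sigma> (coprod_gen (gF a)) f h = tensor (lin (\<rho> (gF a)) (Poly_Mapping.single f 1)) (Poly_Mapping.single h 1)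
     + tensor (word_act \<rho> [gK a, gKi (a + 1)] f) (lin (\<sigma> (gF a)) (Poly_Mapping.single h 1))"
  "act2 \<rho> \<sigma> (coprod_gen (gK a)) f h = tensor (lin (\<rho> (gK a)) (Poly_Mapping.single f 1)) (lin (\<sigma> (gK a)) (Poly_Mapping.single h 1))"
  "act2 \<rho> \<sigma> (coprod_gen (gKi a)) f h = tensor (lin (\<rho> (gKi a)) (Poly_Mapping.single f 1)) (lin (\<sigma> (gKi a)) (Poly_Mapping.single h 1))"
  by (simp_all add: act2_add act2_otimes)

lemma hom_len_factor_act: "hom_len 1 (factor_act e g f)"
  by (cases g) (auto simp: factor_act_def bas_def intro!: hom_len_single)

lemma hom_len_word_act:
  assumes "\<And>g f. length f = N \<Longrightarrow> hom_len N (\<rho> g f)" "length f = N"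
  shows "hom_len N (word_act \<rho> ws f)"
proof (induction ws)
  case (Cons g ws)
  then show ?case
    unfolding word_act.simps by (intro hom_len_lin assms(1)) (simp add: hom_len_def)
qed (simp add: assms hom_len_single)

lemma hom_len_act2:
  assumes "\<And>g f. length f = N \<Longrightarrow> hom_len N (\<rho> g f)" "length f = N"
  shows "hom_len (Suc N) (act2 \<rho> (factor_act e) z f [c])"
proof -
  have "hom_len (N + 1) (tensor (word_act \<rho> v f) (word_act (factor_act e) w [c]))" for v w
    using assms by (intro hom_len_tensor hom_len_word_act hom_len_factor_act) auto
  then show ?thesis
    unfolding act2_def by (intro hom_len_lin) auto
qed

lemma hom_len_tensor_act: "length f = Suc n \<Longrightarrow> hom_len (Suc n) (tensor_act b (Suc n) g f)"
proof (induction n arbitrary: g f)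
  case 0
  then show ?case
    using hom_len_factor_act by simp
next
  case (Suc n)
  then show ?case
    by (simp del: tensor_act.simps add: tensor_act.simps(3)) (rule hom_len_act2, auto)
qed

text \<open>The bridge between the action built from the coproduct and the coefficientwise action
  \<open>gop\<close>. It transfers the relations, which were verified for \<open>gop\<close>, to
  \<open>tensor_act\<close>.\<close>

lemma lookup_tensor_act_single:
  "length f = Suc n \<Longrightarrow> lookup (tensor_act b (Suc n) g f) k = gop b (Suc n) g (lookup (Poly_Mapping.single f 1)) k"
proof (induction n arbitrary: g f k)
  case 0
  then obtain c where f: "f = [c]"
    by (auto simp: length_Suc_conv)
  show ?case
  proof (cases "\<exists>d. k = [d]")
    case True
    then obtain d where k: "k = [] @ [d]" by auto
    show ?thesis
      unfolding k gop_snoc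
      by (cases g) (auto simp: f factor_act_def bas_def lookup_single when_def)
  next
    case False
    have "length k = 1 \<longleftrightarrow> (\<exists>d. k = [d])"
      by (auto simp: length_Suc_conv)
    with False have "length k \<noteq> 1"
      by simp
    then have "lookup (factor_act (b ! 0) g f) k = 0"
      using hom_lenD[OF hom_len_factor_act] by blast
    moreover have "gop b (Suc 0) g (lookup (Poly_Mapping.single f 1)) k = 0"
      by (rule gop_0_length) (use \<open>length k \<noteq> 1\<close> in \<open>auto simp: f lookup_single when_def\<close>)
    ultimately show ?thesis
      by (simp add: f)
  qed
next
  case (Suc n)
  show ?case
  proof (cases "length k = Suc (Suc n)")
    case False
    then have "lookup (tensor_act b (Suc (Suc n)) g f) k = 0"
      using hom_lenD[OF hom_len_tensor_act[OF Suc.prems]] by blast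
    moreover have "gop b (Suc (Suc n)) g (lookup (Poly_Mapping.single f 1)) k = 0"
      by (rule gop_0_length) (use False Suc.prems in \<open>auto simp: lookup_single when_def\<close>)
    ultimately show ?thesis
      by simp
  next
    case True
    obtain h c where f: "f = h @ [c]" and h: "length h = Suc n"
      using Suc.prems by (metis append_butlast_last_id length_append_singleton length_greater_0_conv nat.inject zero_less_Suc)
    obtain l d where k: "k = l @ [d]"
      using True by (metis append_butlast_last_id length_greater_0_conv zero_less_Suc)
    have delta: "(\<lambda>k. lookup (Poly_Mapping.single f 1) (k @ [d])) = (if c = d then lookup (Poly_Mapping.single h 1) else (\<lambda>_. 0 :: qf))" for d
      by (auto simp: f lookup_single when_def fun_eq_iff)
    have IH: "gop b (Suc n) g (lookup (Poly_Mapping.single h 1)) = lookup (tensor_act b (Suc n) g h)" for g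
      using Suc.IH[OF h] by (auto simp: fun_eq_iff)
    have "lookup (Poly_Mapping.single h 1) = (\<lambda>k. if h = k then 1 else 0 :: qf)"
      by (auto simp: fun_eq_iff lookup_single when_def)
    with IH have IH': "gop b (Suc n) g (\<lambda>k. if h = k then 1 else 0) = lookup (tensor_act b (Suc n) g h)" for g
      by simp
    have IH2: "gop b (Suc n) g (lookup (tensor_act b (Suc n) g' h)) = lookup (lin (tensor_act b (Suc n) g) (tensor_act b (Suc n) g' h))" for g g'
      using Suc.IH hom_len_tensor_act[OF h] by (intro lookup_lin_gop[symmetric])
    show ?thesis
      unfolding k gop_snoc
      by (cases g)
        (auto simp: h f coprod_gen_act2 nth_append factor_act_def IH' IH2 lookup_add
          urep.zero_fun[OF urep_gop] lookup_tensor_bas lookup_tensor_single lookup_single when_def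
          delta power_int_minus lmap_0[OF lmap_tensor_right]
          simp del: coprod_gen.simps tensor_act.simps(2))
  qed
qed

lemma lookup_lin_tensor_act:
  "hom_len (Suc n) t \<Longrightarrow> lookup (lin (tensor_act b (Suc n) g) t) = gop b (Suc n) g (lookup t)"
  by (rule lookup_lin_gop[OF lookup_tensor_act_single])

lemma lookup_word_act:
  "length f = Suc n \<Longrightarrow> lookup (word_act (tensor_act b (Suc n)) ws f)
    = foldr (gop b (Suc n)) ws (lookup (Poly_Mapping.single f 1))"
proof (induction ws)
  case (Cons g ws)
  have "hom_len (Suc n) (word_act (tensor_act b (Suc n)) ws f)"
    by (rule hom_len_word_act) (use Cons.prems hom_len_tensor_act in auto)
  then show ?case
    unfolding word_act.simps using Cons by (subst lookup_lin_tensor_act) auto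
qed simp

lemma act_uq_rels:
  assumes "r \<in> uq_rels" "length f = Suc n"
  shows "act (tensor_act b (Suc n)) r f = 0"
proof (rule poly_mapping_eqI)
  fix k
  interpret urep "gop b (Suc n)"
    by (rule urep_gop)
  note w = lookup_word_act[OF assms(2), of b]
  note simps = act_diff act_add act_scl sc_mult lookup_minus lookup_add w foldr.simps comp_def id_def
    one_mon act_mon lookup_scl lookup_zero
  show "lookup (act (tensor_act b (Suc n)) r f) k = lookup 0 k"
    using assms(1)
  proof cases
    case (1 a)
    then show ?thesis by (simp only: simps K_Ki diff_self)
  next
    case (2 a)
    then show ?thesis by (simp only: simps Ki_K diff_self)
  next
    case (3 a b')
    then show ?thesis by (simp only: simps K_K[of a b'] diff_self)
  next
    case (4 a b')
    then show ?thesis by (simp only: simps K_E K_Ki diff_self)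
  next
    case (5 a b')
    then show ?thesis by (simp only: simps K_F K_Ki diff_self)
  next
    case (6 a b')
    show ?thesis
    proof (cases "a = b'")
      case True
      with 6 have r: "r = mon [gE a, gF a] - mon [gF a, gE a]
          - scl (1 / (qq - inverse qq)) (mon [gK a, gKi (a + 1)] - mon [gK (a + 1), gKi a])"
        by (simp add: sc_mult)
      show ?thesis
        unfolding r by (simp only: simps E_F) simp
    next
      case False
      with 6 have r: "r = mon [gE a, gF b'] - mon [gF b', gE a]"
        by simp
      show ?thesis
        unfolding r using False by (simp only: simps E_F) simp
    qed
  next
    case (7 a b')
    then show ?thesis by (simp only: simps E_serre diff_self)
  next
    case (8 a b')
    then show ?thesis by (simp only: simps E_E[of a b'] diff_self)
  next
    case (9 a b')
    then show ?thesis by (simp only: simps F_serre diff_self)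
  next
    case (10 a b')
    then show ?thesis by (simp only: simps F_F[of a b'] diff_self)
  qed
qed

text \<open>A single factor is the tensor space of a one-entry sequence, so that
  \<open>act_uq_rels\<close> also covers the second leg of an element of the tensor square.\<close>

lemma factor_act_tensor_act: "factor_act e = tensor_act [e] (Suc 0)"
  by (simp add: fun_eq_iff)

section \<open>The action of the tensor square\<close>

text \<open>\<open>act2\<close> takes its two arguments as separate basis vectors. Cutting an index
  list at position \<open>n\<close> makes the result an endomorphism, which can be composed.\<close>

definition A2 :: "nat list \<Rightarrow> nat \<Rightarrow> falg2 \<Rightarrow> tens \<Rightarrow> tens" where
  "A2 b n z t = lin (\<lambda>f. act2 (tensor_act b n) (factor_act (b ! n)) z (take n f) [f ! n]) t"

lemma lmap_A2: "lmap (A2 b n z)"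
  unfolding A2_def by (rule lmap_lin)

lemma lmap_A2_left: "lmap (\<lambda>z. A2 b n z t)"
  unfolding A2_def by (rule lmap_lin_fun) (rule lmap_act2)

lemma snoc_length: "length f = Suc n \<Longrightarrow> \<exists>h c. f = h @ [c] \<and> length h = n"
  by (cases f rule: rev_cases) auto

lemma lmap_hom_eqI:
  assumes "lmap h" "lmap k" "hom_len N t" "\<And>f. length f = N \<Longrightarrow> h (Poly_Mapping.single f 1) = k (Poly_Mapping.single f 1)"
  shows "h t = k t"
proof (rule lmap_eqI[OF assms(1,2)])
  fix a assume "a \<in> Poly_Mapping.keys t"
  then show "h (Poly_Mapping.single a 1) = k (Poly_Mapping.single a 1)"
    using assms(3,4) by (simp add: hom_len_def)
qed

lemma lmap_tensor_eqI:
  assumes "lmap h" "lmap k" "hom_len (Suc N) t" "\<And>f c. length f = N \<Longrightarrow> h (tensor (Poly_Mapping.single f 1) (bas c)) = k (tensor (Poly_Mapping.single f 1) (bas c))"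
  shows "h t = k t"
proof (rule lmap_hom_eqI[OF assms(1-3)])
  fix f :: "int list" assume "length f = Suc N"
  then obtain g c where "f = g @ [c]" "length g = N"
    using snoc_length by blast
  then show "h (Poly_Mapping.single f 1) = k (Poly_Mapping.single f 1)"
    using assms(4)[of g c] by (simp add: bas_def tensor_single)
qed

lemma A2_single_tensor:
  assumes "hom_len n x" "hom_len 1 y"
  shows "A2 b n (Poly_Mapping.single (v, w) r) (tensor x y)
    = scl r (tensor (lin (word_act (tensor_act b n) (letters v)) x) (lin (word_act (factor_act (b ! n)) (letters w)) y))"
proof (rule lmap_hom_eqI[OF _ _ assms(1)])
  show "lmap (\<lambda>x. A2 b n (Poly_Mapping.single (v, w) r) (tensor x y))"
    by (rule lmap_comp[OF lmap_A2 lmap_tensor_left])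
  show "lmap (\<lambda>x. scl r (tensor (lin (word_act (tensor_act b n) (letters v)) x) (lin (word_act (factor_act (b ! n)) (letters w)) y)))"
    by (intro lmap_comp[OF lmap_scl_id] lmap_comp[OF lmap_tensor_left] lmap_lin)
  fix f :: "int list" assume f: "length f = n"
  show "A2 b n (Poly_Mapping.single (v, w) r) (tensor (Poly_Mapping.single f 1) y)
    = scl r (tensor (lin (word_act (tensor_act b n) (letters v)) (Poly_Mapping.single f 1)) (lin (word_act (factor_act (b ! n)) (letters w)) y))"
  proof (rule lmap_hom_eqI[OF _ _ assms(2)])
    show "lmap (\<lambda>y. A2 b n (Poly_Mapping.single (v, w) r) (tensor (Poly_Mapping.single f 1) y))"
      by (rule lmap_comp[OF lmap_A2 lmap_tensor_right])
    show "lmap (\<lambda>y. scl r (tensor (lin (word_act (tensor_act b n) (letters v)) (Poly_Mapping.single f 1)) (lin (word_act (factor_act (b ! n)) (letters w)) y)))"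
      by (intro lmap_comp[OF lmap_scl_id] lmap_comp[OF lmap_tensor_right] lmap_lin)
    fix g :: "int list" assume "length g = 1"
    then obtain c where g: "g = [c]"
      by (auto simp: length_Suc_conv)
    show "A2 b n (Poly_Mapping.single (v, w) r) (tensor (Poly_Mapping.single f 1) (Poly_Mapping.single g 1))
      = scl r (tensor (lin (word_act (tensor_act b n) (letters v)) (Poly_Mapping.single f 1)) (lin (word_act (factor_act (b ! n)) (letters w)) (Poly_Mapping.single g 1)))"
      using f by (simp add: g tensor_single A2_def act2_def nth_append)
  qed
qed

lemma hom_len_A2: "hom_len (Suc (Suc n)) t \<Longrightarrow> hom_len (Suc (Suc n)) (A2 b (Suc n) z t)"
  unfolding A2_def by (intro hom_len_lin hom_len_act2 hom_len_tensor_act) (auto simp: hom_len_def)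

lemma A2_mult:
  assumes "hom_len (Suc (Suc n)) t"
  shows "A2 b (Suc n) (z1 * z2) t = A2 b (Suc n) z1 (A2 b (Suc n) z2 t)"
proof (rule lmap_tensor_eqI[OF _ _ assms])
  show "lmap (A2 b (Suc n) (z1 * z2))" "lmap (\<lambda>t. A2 b (Suc n) z1 (A2 b (Suc n) z2 t))"
    by (intro lmap_A2 lmap_comp[OF lmap_A2 lmap_A2])+
  fix f :: "int list" and c :: int
  assume f: "length f = Suc n"
  let ?t = "tensor (Poly_Mapping.single f 1) (bas c)"
  note lz = lmap_add[OF lmap_A2_left] lmap_0[OF lmap_A2_left] lmap_add[OF lmap_A2] lmap_0[OF lmap_A2]
  show "A2 b (Suc n) (z1 * z2) ?t = A2 b (Suc n) z1 (A2 b (Suc n) z2 ?t)"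
  proof (induction z1 rule: poly_mapping_induct)
    case (single vw r)
    show ?case
    proof (induction z2 rule: poly_mapping_induct)
      case (single vw' r')
      obtain v w v' w' where vw: "vw = (v, w)" "vw' = (v', w')"
        by force
      have *: "hom_len (Suc n) (lin (word_act (tensor_act b (Suc n)) (letters v')) (Poly_Mapping.single f 1))"
        "hom_len 1 (lin (word_act (factor_act (b ! Suc n)) (letters w')) (bas c))"
        using f by (auto simp: bas_def intro!: hom_len_word_act hom_len_scl hom_len_tensor_act hom_len_factor_act[simplified])
      show ?case
        unfolding vw mult_single add_Pair
        using f by (simp only: A2_single_tensor hom_len_single hom_len_bas plus_word_def word.sel
            lmap_scl[OF lmap_A2] A2_single_tensor[OF *] word_act_append[abs_def] lin_lin scl_simps mult.commute[of r r'])
    qed (simp_all only: lz distrib_left mult_zero_right)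
  qed (simp_all only: lz distrib_right mult_zero_left)
qed

lemma A2_otimes:
  assumes "length f = n"
  shows "A2 b n (otimes x y) (tensor (Poly_Mapping.single f 1) (bas c))
    = tensor (act (tensor_act b n) x f) (act (factor_act (b ! n)) y [c])"
  using assms by (simp add: A2_def bas_def tensor_single act2_otimes nth_append)

text \<open>The quasi-R-matrix is known only modulo the ideal; this turns such congruences into
  identities of operators.\<close>

lemma A2_uq2_ideal:
  assumes "z \<in> uq2_ideal" "hom_len (Suc (Suc n)) t"
  shows "A2 b (Suc n) z t = 0"
  using assms unfolding uq2_ideal_def
proof (induction arbitrary: t rule: two_sided_ideal.induct)
  case zero
  then show ?case by (simp add: lmap_0[OF lmap_A2_left])
next
  case (add x y)
  then show ?case by (simp add: lmap_add[OF lmap_A2_left])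
next
  case (gen r x y)
  have r: "A2 b (Suc n) r t = 0" if "hom_len (Suc (Suc n)) t" for t
  proof (rule lmap_tensor_eqI[OF lmap_A2 _ that])
    show "lmap (\<lambda>_. 0)"
      by (simp add: lmap_def)
    fix f :: "int list" and c :: int
    assume f: "length f = Suc n"
    show "A2 b (Suc n) r (tensor (Poly_Mapping.single f 1) (bas c)) = 0"
      using gen f by (auto simp: A2_otimes act_uq_rels factor_act_tensor_act lmap_0[OF lmap_tensor_left] lmap_0[OF lmap_tensor_right])
  qed
  then show ?case
    using gen by (simp add: A2_mult hom_len_A2 mult.assoc lmap_0[OF lmap_A2])
qed

section \<open>The action of the quasi-R-matrix\<close>

definition wt_fac :: "nat \<Rightarrow> int \<Rightarrow> weight" where
  "wt_fac e c = (if e = 0 then Poly_Mapping.single c 1 else - Poly_Mapping.single c 1)"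

text \<open>The proper changes of the last entry that lowering operators can make: indices of v go
  up, those of w go down. \<open>S\<close> restricts the two end points.\<close>

definition moves :: "(int \<Rightarrow> bool) \<Rightarrow> nat \<Rightarrow> int \<Rightarrow> int \<Rightarrow> bool" where
  "moves S e c d \<longleftrightarrow> (if e = 0 then c < d else d < c) \<and> S c \<and> S d"

abbreviation in_range :: "nat \<Rightarrow> int \<Rightarrow> bool" where
  "in_range k c \<equiv> - int k \<le> c \<and> c \<le> int k"

lemma wt_Nil [simp]: "wt (Word []) = 0"
  and wt_Cons: "wt (Word (g # w)) = wt_gen g + wt (Word w)"
  by (simp_all add: wt_def)

lemma keys_lin: "Poly_Mapping.keys (lin \<phi> x) \<subseteq> (\<Union>a\<in>Poly_Mapping.keys x. Poly_Mapping.keys (\<phi> a))"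
proof
  fix f assume "f \<in> Poly_Mapping.keys (lin \<phi> x)"
  then have "(\<Sum>a\<in>Poly_Mapping.keys x. lookup x a * lookup (\<phi> a) f) \<noteq> 0"
    by (simp add: in_keys_iff lookup_lin)
  then obtain a where "a \<in> Poly_Mapping.keys x" "lookup x a * lookup (\<phi> a) f \<noteq> 0"
    by (rule sum.not_neutral_contains_not_neutral)
  then show "f \<in> (\<Union>a\<in>Poly_Mapping.keys x. Poly_Mapping.keys (\<phi> a))"
    by (auto simp: in_keys_iff)
qed

text \<open>Each F_a moves the index of a single factor by one step or kills the vector. The
  direction never changes, so the start and the end of the path lie in the range whenever the word
  is nonempty.\<close>

lemma keys_word_act_neg:
  assumes "set w \<subseteq> gens_neg k"
  shows "Poly_Mapping.keys (word_act (factor_act e) w [c])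
    \<subseteq> {[d] |d. wt_fac e d = wt_fac e c + wt (Word w) \<and> (w = [] \<and> d = c \<or> w \<noteq> [] \<and> moves (in_range k) e c d)}"
  using assms
proof (induction w)
  case (Cons g w)
  then obtain a where g: "g = gF a" "- int k \<le> a" "a \<le> int k - 1"
    by (auto simp: gens_neg_def)
  show ?case
  proof
    fix f assume "f \<in> Poly_Mapping.keys (word_act (factor_act e) (g # w) [c])"
    then obtain h where h: "h \<in> Poly_Mapping.keys (word_act (factor_act e) w [c])"
      and f: "f \<in> Poly_Mapping.keys (factor_act e g h)"
      unfolding word_act.simps by (blast dest: subsetD[OF keys_lin])
    obtain d where d: "h = [d]" "wt_fac e d = wt_fac e c + wt (Word w)"
      "w = [] \<and> d = c \<or> w \<noteq> [] \<and> moves (in_range k) e c d"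
      using h Cons by auto
    show "f \<in> {[d] |d. wt_fac e d = wt_fac e c + wt (Word (g # w))
        \<and> (g # w = [] \<and> d = c \<or> g # w \<noteq> [] \<and> moves (in_range k) e c d)}"
    proof (cases "e = 0")
      case True
      then have "d = a" "f = [a + 1]"
        using f d g by (auto simp: factor_act_def bas_def split: if_splits)
      then show ?thesis
        using d g True by (auto simp: wt_Cons wt_fac_def moves_def algebra_simps)
    next
      case False
      then have "d = a + 1" "f = [a]"
        using f d g by (auto simp: factor_act_def bas_def split: if_splits)
      then show ?thesis
        using d g False by (auto simp: wt_Cons wt_fac_def moves_def algebra_simps)
    qed
  qed
qed auto

lemma A2_expand: "A2 b n z t = (\<Sum>vw\<in>Poly_Mapping.keys z. scl (lookup z vw) (A2 b n (Poly_Mapping.single vw 1) t))"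
  by (rule lmap_expand[OF lmap_A2_left])

lemma hom_len_tensor_bas: "hom_len n x \<Longrightarrow> hom_len (Suc n) (tensor x (bas c))"
  using hom_len_tensor[OF _ hom_len_bas] by fastforce

lemma lookup_A2_neg:
  assumes z: "\<And>v w. (v, w) \<in> Poly_Mapping.keys z \<Longrightarrow> set (letters w) \<subseteq> gens_neg k \<and> wt w = - \<mu>"
    and x: "hom_len n x"
    and nz: "lookup (A2 b n z (tensor x (bas c))) (h @ [d]) \<noteq> 0"
  shows "wt_fac (b ! n) c = wt_fac (b ! n) d + \<mu> \<and> (d = c \<or> moves (in_range k) (b ! n) c d)"
proof -
  obtain vw where "vw \<in> Poly_Mapping.keys z"
    "lookup (scl (lookup z vw) (A2 b n (Poly_Mapping.single vw 1) (tensor x (bas c)))) (h @ [d]) \<noteq> 0"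
    using nz unfolding A2_expand[of b n z] lookup_sum by (rule sum.not_neutral_contains_not_neutral)
  then obtain v w where vw: "(v, w) \<in> Poly_Mapping.keys z"
    and "lookup (A2 b n (Poly_Mapping.single (v, w) 1) (tensor x (bas c))) (h @ [d]) \<noteq> 0"
    by (cases vw) auto
  moreover have "hom_len 1 (word_act (factor_act (b ! n)) (letters w) [c])"
    by (intro hom_len_word_act hom_len_factor_act) auto
  ultimately have "lookup (word_act (factor_act (b ! n)) (letters w) [c]) [d] \<noteq> 0"
    using x by (auto simp: A2_single_tensor hom_len_bas bas_def lookup_tensor_snoc hom_len_single)
  then show ?thesis
    using keys_word_act_neg[of "letters w" k "b ! n" c] z[OF vw] by (auto simp: in_keys_iff)
qed

section \<open>The operator of the quasi-R-matrix on a tensor product\<close>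

locale quasi_R =
  fixes k :: nat and \<Theta> :: "weight \<Rightarrow> falg2"
  assumes quasi_R: "quasi_R_matrix k \<Theta>"
begin

lemma keys_Theta: "(v, w) \<in> Poly_Mapping.keys (\<Theta> \<mu>) \<Longrightarrow> set (letters w) \<subseteq> gens_neg k \<and> wt w = - \<mu>"
  using quasi_R unfolding quasi_R_matrix_def by fast

lemma A2_Theta_tensor_zero:
  assumes "hom_len (Suc n) x" "\<mu> \<notin> (\<lambda>d. wt_fac (b ! Suc n) c - wt_fac (b ! Suc n) d) ` ({c} \<union> {- int k..int k})"
  shows "A2 b (Suc n) (\<Theta> \<mu>) (tensor x (bas c)) = 0"
proof (rule poly_mapping_eqI)
  fix f
  show "lookup (A2 b (Suc n) (\<Theta> \<mu>) (tensor x (bas c))) f = lookup 0 f"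
  proof (cases "length f = Suc (Suc n)")
    case True
    then obtain h d where f: "f = h @ [d]"
      using snoc_length by blast
    show ?thesis
    proof (rule ccontr)
      assume "lookup (A2 b (Suc n) (\<Theta> \<mu>) (tensor x (bas c))) f \<noteq> lookup 0 f"
      then have "wt_fac (b ! Suc n) c = wt_fac (b ! Suc n) d + \<mu> \<and> (d = c \<or> moves (in_range k) (b ! Suc n) c d)"
        using f keys_Theta assms(1) by (intro lookup_A2_neg[where z = "\<Theta> \<mu>" and x = x and h = h]) auto
      then have "\<mu> = wt_fac (b ! Suc n) c - wt_fac (b ! Suc n) d" "d \<in> {c} \<union> {- int k..int k}"
        by (auto simp: moves_def)
      then show False
        using assms(2) by blast
    qed
  next
    case False
    then show ?thesis
      using hom_lenD[OF hom_len_A2[OF hom_len_tensor_bas[OF assms(1)]]] by force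
  qed
qed

lemma finite_A2_Theta:
  assumes "hom_len (Suc (Suc n)) t"
  shows "finite {\<mu>. A2 b (Suc n) (\<Theta> \<mu>) t \<noteq> 0}"
proof -
  have "{\<mu>. A2 b (Suc n) (\<Theta> \<mu>) t \<noteq> 0}
      \<subseteq> (\<Union>f\<in>Poly_Mapping.keys t. {\<mu>. A2 b (Suc n) (\<Theta> \<mu>) (Poly_Mapping.single f 1) \<noteq> 0})"
  proof
    fix \<mu> assume "\<mu> \<in> {\<mu>. A2 b (Suc n) (\<Theta> \<mu>) t \<noteq> 0}"
    then have "(\<Sum>f\<in>Poly_Mapping.keys t. scl (lookup t f) (A2 b (Suc n) (\<Theta> \<mu>) (Poly_Mapping.single f 1))) \<noteq> 0"
      by (simp flip: lmap_expand[OF lmap_A2])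
    then obtain f where "f \<in> Poly_Mapping.keys t" "scl (lookup t f) (A2 b (Suc n) (\<Theta> \<mu>) (Poly_Mapping.single f 1)) \<noteq> 0"
      by (rule sum.not_neutral_contains_not_neutral)
    moreover from this(2) have "A2 b (Suc n) (\<Theta> \<mu>) (Poly_Mapping.single f 1) \<noteq> 0"
      by (rule contrapos_nn) (simp only: scl_simps)
    ultimately show "\<mu> \<in> (\<Union>f\<in>Poly_Mapping.keys t. {\<mu>. A2 b (Suc n) (\<Theta> \<mu>) (Poly_Mapping.single f 1) \<noteq> 0})"
      by (intro UN_I[of f]) simp_all
  qed
  moreover have "finite {\<mu>. A2 b (Suc n) (\<Theta> \<mu>) (Poly_Mapping.single f 1) \<noteq> 0}" if f: "f \<in> Poly_Mapping.keys t" for f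
  proof -
    have "length f = Suc (Suc n)"
      using f assms by (simp add: hom_len_def)
    then obtain h c where h: "f = h @ [c]" "length h = Suc n"
      using snoc_length by blast
    have "Poly_Mapping.single f 1 = tensor (Poly_Mapping.single h 1) (bas c)"
      by (simp add: h bas_def tensor_single)
    moreover have "hom_len (Suc n) (Poly_Mapping.single h 1)"
      by (simp add: h hom_len_single)
    ultimately have "{\<mu>. A2 b (Suc n) (\<Theta> \<mu>) (Poly_Mapping.single f 1) \<noteq> 0}
      \<subseteq> (\<lambda>d. wt_fac (b ! Suc n) c - wt_fac (b ! Suc n) d) ` ({c} \<union> {- int k..int k})"
      using A2_Theta_tensor_zero[of n "Poly_Mapping.single h 1" _ b c] by auto
    then show ?thesis
      by (rule finite_subset) simp
  qed
  ultimately show ?thesis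
    by (rule finite_subset[OF _ finite_UN_I[OF finite_keys]])
qed

definition Th :: "nat list \<Rightarrow> nat \<Rightarrow> tens \<Rightarrow> tens" where
  "Th b n t = Sum_any (\<lambda>\<mu>. A2 b n (\<Theta> \<mu>) t)"

lemma Th_sum:
  assumes "finite S" "{\<mu>. A2 b n (\<Theta> \<mu>) t \<noteq> 0} \<subseteq> S"
  shows "Th b n t = (\<Sum>\<mu>\<in>S. A2 b n (\<Theta> \<mu>) t)"
  unfolding Th_def by (rule Sum_any.expand_superset[OF assms])

lemma Th_add:
  assumes "hom_len (Suc (Suc n)) t" "hom_len (Suc (Suc n)) u"
  shows "Th b (Suc n) (t + u) = Th b (Suc n) t + Th b (Suc n) u"
  unfolding Th_def lmap_add[OF lmap_A2] using assms by (intro Sum_any.distrib finite_A2_Theta)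

lemma Th_scl:
  assumes "hom_len (Suc (Suc n)) t"
  shows "Th b (Suc n) (scl r t) = scl r (Th b (Suc n) t)"
proof -
  have "{\<mu>. A2 b (Suc n) (\<Theta> \<mu>) (scl r t) \<noteq> 0} \<subseteq> {\<mu>. A2 b (Suc n) (\<Theta> \<mu>) t \<noteq> 0}"
    by (auto simp: lmap_scl[OF lmap_A2])
  then show ?thesis
    using finite_A2_Theta[OF assms] by (simp add: Th_sum[of "{\<mu>. A2 b (Suc n) (\<Theta> \<mu>) t \<noteq> 0}"] lmap_scl[OF lmap_A2] scl_sum)
qed

lemma Th_0: "Th b n 0 = 0"
  by (simp add: Th_def lmap_0[OF lmap_A2])

lemma hom_len_Th: "hom_len (Suc (Suc n)) t \<Longrightarrow> hom_len (Suc (Suc n)) (Th b (Suc n) t)"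
  unfolding Th_sum[OF finite_A2_Theta order.refl] by (intro hom_len_sum hom_len_A2)

text \<open>The weight of the second leg is forced by the entries \<open>c\<close> and
  \<open>d\<close> of the last factor, so a single summand of the formal sum can contribute.\<close>

lemma lookup_Th:
  assumes x: "hom_len (Suc n) x"
  shows "lookup (Th b (Suc n) (tensor x (bas c))) (h @ [d])
    = lookup (A2 b (Suc n) (\<Theta> (wt_fac (b ! Suc n) c - wt_fac (b ! Suc n) d)) (tensor x (bas c))) (h @ [d])"
proof -
  let ?\<mu> = "wt_fac (b ! Suc n) c - wt_fac (b ! Suc n) d"
  let ?S = "insert ?\<mu> {\<mu>. A2 b (Suc n) (\<Theta> \<mu>) (tensor x (bas c)) \<noteq> 0}"
  have S: "finite ?S"
    using finite_A2_Theta[OF hom_len_tensor_bas[OF x]] by simp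
  have *: "lookup (A2 b (Suc n) (\<Theta> \<mu>) (tensor x (bas c))) (h @ [d]) = 0" if "\<mu> \<noteq> ?\<mu>" for \<mu>
  proof (rule ccontr)
    assume "lookup (A2 b (Suc n) (\<Theta> \<mu>) (tensor x (bas c))) (h @ [d]) \<noteq> 0"
    then have "wt_fac (b ! Suc n) c = wt_fac (b ! Suc n) d + \<mu>"
      using lookup_A2_neg[OF keys_Theta x] by auto
    then show False
      using that by simp
  qed
  have "lookup (Th b (Suc n) (tensor x (bas c))) (h @ [d])
     = (\<Sum>\<mu>\<in>?S. lookup (A2 b (Suc n) (\<Theta> \<mu>) (tensor x (bas c))) (h @ [d]))"
    by (subst Th_sum[OF S]) (auto simp: lookup_sum)
  also have "\<dots> = (\<Sum>\<mu>\<in>{?\<mu>}. lookup (A2 b (Suc n) (\<Theta> \<mu>) (tensor x (bas c))) (h @ [d]))"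
    using S * by (intro sum.mono_neutral_right) auto
  finally show ?thesis
    by simp
qed

lemma lookup_Th_diag:
  assumes x: "hom_len (Suc n) x"
  shows "lookup (Th b (Suc n) (tensor x (bas c))) (h @ [c]) = lookup x h"
proof -
  have id: "A2 b (Suc n) (otimes 1 1) t = t" if "hom_len (Suc (Suc n)) t" for t
    by (rule lmap_tensor_eqI[OF lmap_A2 _ that, where k = "\<lambda>t. t"], simp add: lmap_def)
      (simp only: A2_otimes act_1, simp add: bas_def)
  have "\<Theta> 0 - otimes 1 1 \<in> uq2_ideal"
    using quasi_R by (simp add: quasi_R_matrix_def)
  then have "A2 b (Suc n) (\<Theta> 0) (tensor x (bas c)) = tensor x (bas c)"
    using A2_uq2_ideal[OF _ hom_len_tensor_bas[OF x]] id[OF hom_len_tensor_bas[OF x]]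
    by (metis lmap_diff[OF lmap_A2_left] right_minus_eq)
  then show ?thesis
    by (simp add: lookup_Th[OF x] lookup_tensor_bas)
qed

lemma lookup_Th_0:
  assumes x: "hom_len (Suc n) x" "d \<noteq> c" "\<not> moves (in_range k) (b ! Suc n) c d"
  shows "lookup (Th b (Suc n) (tensor x (bas c))) (h @ [d]) = 0"
proof (rule ccontr)
  assume "lookup (Th b (Suc n) (tensor x (bas c))) (h @ [d]) \<noteq> 0"
  then show False
    unfolding lookup_Th[OF x(1)] using x(2,3) by (auto dest!: lookup_A2_neg[OF _ x(1), rotated] dest: keys_Theta)
qed

end

lemma component_add: "component \<mu> \<nu> (x + y) = component \<mu> \<nu> x + component \<mu> \<nu> y"
  and component_single: "component \<mu> \<nu> (Poly_Mapping.single (v, w) r)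
    = (if wt v = \<mu> \<and> wt w = \<nu> then Poly_Mapping.single (v, w) r else 0)"
proof -
  have alt: "component \<mu> \<nu> x = (\<Sum>p\<in>Poly_Mapping.keys x.
      (\<lambda>p r. if wt (fst p) = \<mu> \<and> wt (snd p) = \<nu> then Poly_Mapping.single p r else 0) p (lookup x p))" for x
    unfolding component_def
    by (rule sum.mono_neutral_cong_left) (auto split: prod.splits)
  show "component \<mu> \<nu> (x + y) = component \<mu> \<nu> x + component \<mu> \<nu> y"
    unfolding alt by (rule sum_keys_additive) (auto simp: single_add)
  show "component \<mu> \<nu> (Poly_Mapping.single (v, w) r)
    = (if wt v = \<mu> \<and> wt w = \<nu> then Poly_Mapping.single (v, w) r else 0)"
    unfolding alt by (subst sum_keys_single) auto
qed

lemma bar_uq2_add: "bar_uq2 (x + y) = bar_uq2 x + bar_uq2 y"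
  and bar_uq2_single: "bar_uq2 (Poly_Mapping.single (v, w) r) = Poly_Mapping.single (bar_word v, bar_word w) (barq r)"
proof -
  have alt: "bar_uq2 x = (\<Sum>p\<in>Poly_Mapping.keys x.
      (\<lambda>p r. Poly_Mapping.single (bar_word (fst p), bar_word (snd p)) (barq r)) p (lookup x p))" for x
    unfolding bar_uq2_def by (rule sum.cong) auto
  show "bar_uq2 (x + y) = bar_uq2 x + bar_uq2 y"
    unfolding alt by (rule sum_keys_additive) (auto simp: single_add barq_add)
  show "bar_uq2 (Poly_Mapping.single (v, w) r) = Poly_Mapping.single (bar_word v, bar_word w) (barq r)"
    unfolding alt by (subst sum_keys_single) auto
qed

lemma otimes_mon: "otimes (mon v) (mon w) = Poly_Mapping.single (Word v, Word w) 1"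
  by (simp add: otimes_def mon_def)

definition EE :: "int \<Rightarrow> falg2" where "EE a = otimes 1 (mon [gE a])"
definition EK :: "int \<Rightarrow> falg2" where "EK a = otimes (mon [gE a]) (mon [gK (a + 1), gKi a])"
definition EKi :: "int \<Rightarrow> falg2" where "EKi a = otimes (mon [gE a]) (mon [gKi (a + 1), gK a])"

lemma coprod_E: "coprod (mon [gE a]) = EE a + EK a"
  by (simp add: coprod_def mon_def EE_def EK_def)

lemma bar_coprod_E: "bar_uq2 (coprod (bar_uq (mon [gE a]))) = EE a + EKi a"
proof -
  have "bar_uq (mon [gE a]) = mon [gE a]"
    by (simp add: bar_uq_def mon_def bar_word_def)
  then show ?thesis
    by (simp add: coprod_E) (simp add: EE_def EK_def EKi_def one_mon otimes_mon bar_uq2_add bar_uq2_single bar_word_def)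
qed

lemma component_E:
  "component \<mu> \<nu> (EE a + EK a) = (EE a when \<mu> = 0 \<and> \<nu> = wt_gen (gE a)) + (EK a when \<mu> = wt_gen (gE a) \<and> \<nu> = 0)"
  "component \<mu> \<nu> (EE a + EKi a) = (EE a when \<mu> = 0 \<and> \<nu> = wt_gen (gE a)) + (EKi a when \<mu> = wt_gen (gE a) \<and> \<nu> = 0)"
  by (auto simp: EE_def EK_def EKi_def one_mon otimes_mon component_add component_single wt_Cons when_def
      simp del: wt_gen.simps(1))

context quasi_R begin

lemma Theta_E_ideal:
  assumes a: "- int k \<le> a" "a \<le> int k - 1"
  shows "(EE a * \<Theta> \<alpha> + EK a * \<Theta> (\<alpha> - wt_gen (gE a))) - (\<Theta> \<alpha> * EE a + \<Theta> (\<alpha> - wt_gen (gE a)) * EKi a) \<in> uq2_ideal"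
proof -
  let ?e = "wt_gen (gE a)"
  have "mon [gE a] \<in> subalg (gens_U k)"
    using a by (auto simp: subalg_def mon_def gens_U_def)
  \<comment> \<open>The comparison is made in bidegree \<open>(\<alpha>, ?e - \<alpha>)\<close>. One
    coproduct summand has bidegree \<open>(0, ?e)\<close>, the other \<open>(?e, 0)\<close>, so
    exactly the terms \<open>\<mu> = \<alpha>\<close> and \<open>\<mu> = \<alpha> - ?e\<close>
    survive.\<close>
  then have *: "Sum_any (\<lambda>\<mu>. component (\<alpha> - \<mu>) (?e - \<alpha> + \<mu>) (EE a + EK a) * \<Theta> \<mu>)
        - Sum_any (\<lambda>\<mu>. \<Theta> \<mu> * component (\<alpha> - \<mu>) (?e - \<alpha> + \<mu>) (EE a + EKi a)) \<in> uq2_ideal"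
    using quasi_R unfolding quasi_R_matrix_def coprod_E[symmetric] bar_coprod_E[symmetric] by blast
  have c: "(\<alpha> - \<mu> = 0 \<and> ?e - \<alpha> + \<mu> = ?e) = (\<mu> = \<alpha>)" "(\<alpha> - \<mu> = ?e \<and> ?e - \<alpha> + \<mu> = 0) = (\<mu> = \<alpha> - ?e)" for \<mu>
    by (auto simp: algebra_simps simp del: wt_gen.simps)
  have fin: "finite {\<mu>. (f \<mu> when \<mu> = \<beta>) \<noteq> (0::falg2)}" for f and \<beta> :: weight
    by (rule finite_subset[of _ "{\<beta>}"]) auto
  have S: "Sum_any (\<lambda>\<mu>. (f \<mu> when \<mu> = \<beta>) + (g \<mu> when \<mu> = \<gamma>)) = f \<beta> + (g \<gamma> :: falg2)" for f g and \<beta> \<gamma> :: weight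
    by (subst Sum_any.distrib) (simp_all only: fin Sum_any_when_equal)
  show ?thesis
    using * unfolding component_E c distrib_left distrib_right when_mult mult_when S .
qed

lemma Th_E:
  assumes a: "- int k \<le> a" "a \<le> int k - 1" and t: "hom_len (Suc (Suc n)) t"
  shows "A2 b (Suc n) (EE a + EK a) (Th b (Suc n) t) = Th b (Suc n) (A2 b (Suc n) (EE a + EKi a) t)"
proof -
  let ?A = "A2 b (Suc n)"
  let ?e = "wt_gen (gE a)"
  let ?S = "\<lambda>u. {\<mu>. ?A (\<Theta> \<mu>) u \<noteq> 0}"
  let ?t1 = "?A (EE a) t" and ?t2 = "?A (EKi a) t"
  have t12: "hom_len (Suc (Suc n)) ?t1" "hom_len (Suc (Suc n)) ?t2"
    using t by (simp_all add: hom_len_A2)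
  define S where "S = ?S t \<union> ?S ?t1 \<union> ?S ?t2"
  \<comment> \<open>\<open>T\<close> contains the relevant support together with its translate by
    \<open>?e\<close>, so both the sum over \<open>\<alpha>\<close> and the sum over
    \<open>\<alpha> - ?e\<close> exhaust the support.\<close>
  define T where "T = S \<union> (\<lambda>\<mu>. \<mu> + ?e) ` S"
  have S: "finite S"
    unfolding S_def using t t12 by (intro finite_UnI finite_A2_Theta)
  then have T: "finite T"
    by (simp add: T_def)
  have shift: "(\<Sum>\<alpha>\<in>T. ?A (\<Theta> (\<alpha> - ?e)) u) = Th b (Suc n) u" if "?S u \<subseteq> S" for u
  proof -
    have "(\<Sum>\<alpha>\<in>T. ?A (\<Theta> (\<alpha> - ?e)) u) = (\<Sum>\<mu>\<in>(\<lambda>\<alpha>. \<alpha> - ?e) ` T. ?A (\<Theta> \<mu>) u)"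
      by (subst sum.reindex) (auto simp: inj_on_def simp del: wt_gen.simps)
    also have "\<dots> = Th b (Suc n) u"
      using T that by (intro Th_sum[symmetric]) (force simp: T_def image_Un image_image)+
    finally show ?thesis .
  qed
  have noshift: "(\<Sum>\<alpha>\<in>T. ?A (\<Theta> \<alpha>) u) = Th b (Suc n) u" if "?S u \<subseteq> S" for u
    using T that by (intro Th_sum[symmetric]) (auto simp: T_def)
  have 1: "?A (EE a) (?A (\<Theta> \<alpha>) t) + ?A (EK a) (?A (\<Theta> (\<alpha> - ?e)) t)
      = ?A (\<Theta> \<alpha>) ?t1 + ?A (\<Theta> (\<alpha> - ?e)) ?t2" for \<alpha>
    using A2_uq2_ideal[OF Theta_E_ideal[OF a, of \<alpha>] t, of b]
    by (simp only: lmap_diff[OF lmap_A2_left] lmap_add[OF lmap_A2_left] A2_mult[OF t] right_minus_eq)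
  have sub: "?S t \<subseteq> S" "?S ?t1 \<subseteq> S" "?S ?t2 \<subseteq> S"
    by (auto simp: S_def)
  have "?A (EE a + EK a) (Th b (Suc n) t) = ?A (EE a) (\<Sum>\<alpha>\<in>T. ?A (\<Theta> \<alpha>) t) + ?A (EK a) (\<Sum>\<alpha>\<in>T. ?A (\<Theta> (\<alpha> - ?e)) t)"
    by (simp only: lmap_add[OF lmap_A2_left] shift[OF sub(1)] noshift[OF sub(1)])
  also have "\<dots> = (\<Sum>\<alpha>\<in>T. ?A (EE a) (?A (\<Theta> \<alpha>) t) + ?A (EK a) (?A (\<Theta> (\<alpha> - ?e)) t))"
    by (simp only: lmap_sum[OF lmap_A2] sum.distrib)
  also have "\<dots> = Th b (Suc n) ?t1 + Th b (Suc n) ?t2"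
    by (simp only: 1 sum.distrib shift[OF sub(3)] noshift[OF sub(2)])
  also have "\<dots> = Th b (Suc n) (A2 b (Suc n) (EE a + EKi a) t)"
    by (simp only: Th_add[OF t12] lmap_add[OF lmap_A2_left])
  finally show ?thesis .
qed

end

section \<open>Explicit form of the bar map\<close>

definition target :: "nat \<Rightarrow> int \<Rightarrow> nat \<Rightarrow> int" where
  "target e c j = (if e = 0 then c + int j else c - int j)"

text \<open>The index \<open>a\<close> for which F_a carries out the next move, from
  \<open>target e c j\<close> to \<open>target e c (Suc j)\<close>; for w it is the smaller of the
  two entries.\<close>

definition step_ix :: "nat \<Rightarrow> int \<Rightarrow> nat \<Rightarrow> int" where
  "step_ix e c j = (if e = 0 then c + int j else c - int j - 1)"

text \<open>The operator by which the quasi-R-matrix acts on the first tensor factor when the last one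
  moves from \<open>c\<close> to \<open>target e c j\<close>: an iterated q-commutator of the operators \<open>G a\<close> of \<open>E\<^sub>a\<close>.\<close>

primrec Aop :: "(int \<Rightarrow> formal \<Rightarrow> formal) \<Rightarrow> nat \<Rightarrow> int \<Rightarrow> nat \<Rightarrow> formal \<Rightarrow> formal" where
  "Aop G e c 0 x = x"
| "Aop G e c (Suc j) x = (\<lambda>h. (if j = 0 then qq else 1) * Aop G e c j (G (step_ix e c j) x) h
     - inverse qq * G (step_ix e c j) (Aop G e c j x) h)"

abbreviation Eop :: "nat list \<Rightarrow> nat \<Rightarrow> int \<Rightarrow> formal \<Rightarrow> formal" where
  "Eop b n a \<equiv> gop b n (gE a)"

text \<open>The matrix of the bar map for the condition \<open>S\<close> on the entries that are allowed to change;
  \<open>S\<close> is \<open>in_range k\<close> for \<open>\<psi>\<^bsup>(k)\<^esup>\<close> and trivial for the limit.\<close>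

primrec rm :: "(int \<Rightarrow> bool) \<Rightarrow> nat list \<Rightarrow> nat \<Rightarrow> int list \<Rightarrow> int list \<Rightarrow> qf" where
  "rm S b 0 g f = of_bool (g = [] \<and> f = [])"
| "rm S b (Suc n) g f = (if g = [] \<or> f = [] then 0
     else if last g = last f then rm S b n (butlast g) (butlast f)
     else if moves S (b ! n) (last f) (last g)
     then Aop (Eop b n) (b ! n) (last f) (nat \<bar>last g - last f\<bar>) (\<lambda>h. rm S b n h (butlast f)) (butlast g)
     else 0)"

lemma rm_snoc: "rm S b (Suc n) (h @ [d]) (f @ [c]) = (if d = c then rm S b n h f
     else if moves S (b ! n) c d then Aop (Eop b n) (b ! n) c (nat \<bar>d - c\<bar>) (\<lambda>h. rm S b n h f) h
     else 0)"
  by simp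

lemma moves_target: "moves S e c d \<Longrightarrow> target e c (nat \<bar>d - c\<bar>) = d"
  by (auto simp: moves_def target_def split: if_splits)

lemma Aop_cong_length:
  assumes "\<And>k. length k = length h \<Longrightarrow> x k = y k"
  shows "Aop (Eop b n) e c j x h = Aop (Eop b n) e c j y h"
  using assms
proof (induction j arbitrary: x y h)
  case (Suc j)
  have "Aop (Eop b n) e c j (Eop b n a x) h = Aop (Eop b n) e c j (Eop b n a y) h" for a
    using Suc.prems by (intro Suc.IH gop_cong_length) auto
  moreover have "Eop b n a (Aop (Eop b n) e c j x) h = Eop b n a (Aop (Eop b n) e c j y) h" for a
    using Suc.prems by (intro gop_cong_length Suc.IH) auto
  ultimately show ?case
    by simp
qed simp

lemma Aop_0: "Aop (Eop b n) e c j (\<lambda>_. 0) = (\<lambda>_. 0)"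
  by (induction j) (auto simp: urep.zero_fun[OF urep_gop])

lemma rm_0_length: "length g \<noteq> n \<or> length f \<noteq> n \<Longrightarrow> rm S b n g f = 0"
proof (induction n arbitrary: g f)
  case (Suc n)
  show ?case
  proof (cases "g = [] \<or> f = []")
    case False
    then obtain h d f' c where gf: "g = h @ [d]" "f = f' @ [c]"
      by (metis rev_exhaust)
    have "Aop (Eop b n) (b ! n) c j (\<lambda>h. rm S b n h f') h = 0" for j
    proof -
      have "Aop (Eop b n) (b ! n) c j (\<lambda>h. rm S b n h f') h = Aop (Eop b n) (b ! n) c j (\<lambda>_. 0) h"
        using Suc.prems gf by (intro Aop_cong_length Suc.IH) auto
      then show ?thesis
        by (simp add: Aop_0)
    qed
    moreover have "rm S b n h f' = 0"
      using Suc.prems gf by (intro Suc.IH) auto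
    ultimately show ?thesis
      unfolding gf rm_snoc by auto
  qed auto
qed auto

lemma hom_len_induct [consumes 1, case_names zero single add]:
  assumes "hom_len N x" "P 0" "\<And>f r. length f = N \<Longrightarrow> P (Poly_Mapping.single f r)"
    "\<And>x y. hom_len N x \<Longrightarrow> hom_len N y \<Longrightarrow> P x \<Longrightarrow> P y \<Longrightarrow> P (x + y)"
  shows "P x"
proof -
  have "P (\<Sum>f\<in>A. Poly_Mapping.single f (lookup x f))" if "finite A" "\<And>f. f \<in> A \<Longrightarrow> length f = N" for A
    using that
  proof (induction A rule: finite_induct)
    case (insert f A)
    have "hom_len N (\<Sum>f\<in>A. Poly_Mapping.single f (lookup x f))"
      using insert.prems by (intro hom_len_sum hom_len_single) auto
    then show ?case
      using insert assms(3,4) by (simp add: hom_len_single)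
  qed (simp add: assms)
  from this[of "Poly_Mapping.keys x"] show ?thesis
    using assms(1) by (simp add: hom_len_def flip: poly_mapping_expand)
qed

definition slice :: "int \<Rightarrow> tens \<Rightarrow> tens" where
  "slice d t = lin (\<lambda>f. if last f = d then Poly_Mapping.single (butlast f) 1 else 0) t"

lemma lookup_slice:
  assumes "hom_len (Suc n) t"
  shows "lookup (slice d t) h = lookup t (h @ [d])"
proof -
  have "lookup (slice d t) h = (\<Sum>f\<in>Poly_Mapping.keys t. if f = h @ [d] then lookup t (h @ [d]) else 0)"
    unfolding slice_def lookup_lin
  proof (intro sum.cong refl)
    fix f assume "f \<in> Poly_Mapping.keys t"
    then have "f \<noteq> []"
      using assms by (auto simp: hom_len_def)
    then show "lookup t f * lookup (if last f = d then Poly_Mapping.single (butlast f) 1 else 0) h = (if f = h @ [d] then lookup t (h @ [d]) else 0)"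
      by (cases f rule: rev_cases) (auto simp: lookup_single when_def)
  qed
  then show ?thesis
    by (auto simp: in_keys_iff)
qed

lemma hom_len_slice: "hom_len (Suc n) t \<Longrightarrow> hom_len n (slice d t)"
  unfolding slice_def by (intro hom_len_lin) (auto simp: hom_len_def)

lemma slice_expand:
  assumes "hom_len (Suc n) t" "finite D" "last ` Poly_Mapping.keys t \<subseteq> D"
  shows "t = (\<Sum>d\<in>D. tensor (slice d t) (bas d))"
proof (rule poly_mapping_eqI)
  fix f
  show "lookup t f = lookup (\<Sum>d\<in>D. tensor (slice d t) (bas d)) f"
  proof (cases f rule: rev_cases)
    case Nil
    then show ?thesis
      using hom_lenD[OF assms(1), of f] by (auto simp: lookup_sum lookup_tensor_bas_Nil)
  next
    case (snoc h c)
    have "lookup t f = 0" if "c \<notin> D"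
      using that assms(3) by (force simp: snoc in_keys_iff image_subset_iff)
    then show ?thesis
      using assms(1,2) by (auto simp: snoc lookup_sum lookup_tensor_bas lookup_slice)
  qed
qed

text \<open>\<open>E\<^sub>a\<close> maps \<open>x \<otimes> c\<close> to \<open>eshift e a c x + q\<^bsup>epow e a c\<^esup> E\<^sub>a x \<otimes> c\<close>.\<close>

definition eshift :: "nat \<Rightarrow> int \<Rightarrow> int \<Rightarrow> tens \<Rightarrow> tens" where
  "eshift e a c x = (if e = 0 then (if c = a + 1 then tensor x (bas a) else 0)
     else (if c = a then tensor x (bas (a + 1)) else 0))"

definition epow :: "nat \<Rightarrow> int \<Rightarrow> int \<Rightarrow> int" where
  "epow e a c = (if e = 0 then of_bool (c = a + 1) - of_bool (c = a) else of_bool (c = a) - of_bool (c = a + 1))"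

lemma hom_len_eshift: "hom_len n x \<Longrightarrow> hom_len (Suc n) (eshift e a c x)"
  by (simp add: eshift_def hom_len_tensor_bas)

lemma lin_word_act_Nil: "lin (word_act \<rho> []) x = x"
proof -
  have "word_act \<rho> [] = (\<lambda>f. Poly_Mapping.single f 1)"
    by auto
  then show ?thesis
    by simp
qed

lemma A2_single_bas: "hom_len n x \<Longrightarrow> A2 b n (Poly_Mapping.single (v, w) r) (tensor x (bas c))
    = scl r (tensor (lin (word_act (tensor_act b n) (letters v)) x) (word_act (factor_act (b ! n)) (letters w) [c]))"
  by (simp only: A2_single_tensor hom_len_bas) (simp add: bas_def)

lemma A2_EE: "hom_len n x \<Longrightarrow> A2 b n (EE a) (tensor x (bas c)) = eshift (b ! n) a c x"
  by (auto simp: EE_def one_mon otimes_mon A2_single_bas eshift_def factor_act_def lin_word_act_Nil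
    lmap_0[OF lmap_tensor_right])

lemma A2_EK: "hom_len n x \<Longrightarrow> A2 b n (EK a) (tensor x (bas c))
    = scl (qq powi epow (b ! n) a c) (tensor (lin (tensor_act b n (gE a)) x) (bas c))"
  and A2_EKi: "hom_len n x \<Longrightarrow> A2 b n (EKi a) (tensor x (bas c))
    = scl (qq powi - epow (b ! n) a c) (tensor (lin (tensor_act b n (gE a)) x) (bas c))"
proof -
  have s: "tensor y (Poly_Mapping.single [c] r) = scl r (tensor y (bas c))" for y r
    by (simp add: bas_def flip: lmap_scl[OF lmap_tensor_right])
  have w: "word_act (tensor_act b n) [gE a] = tensor_act b n (gE a)"
    by (auto simp: fun_eq_iff)
  show "hom_len n x \<Longrightarrow> A2 b n (EK a) (tensor x (bas c))
    = scl (qq powi epow (b ! n) a c) (tensor (lin (tensor_act b n (gE a)) x) (bas c))"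
    "hom_len n x \<Longrightarrow> A2 b n (EKi a) (tensor x (bas c))
    = scl (qq powi - epow (b ! n) a c) (tensor (lin (tensor_act b n (gE a)) x) (bas c))"
    by (auto simp: EK_def EKi_def otimes_mon A2_single_bas w factor_act_def epow_def
      power_int_minus s)
qed

lemma lin_tensor_act_E:
  "lin (tensor_act b (Suc (Suc n)) (gE a)) t = A2 b (Suc n) (EE a + EK a) t"
proof -
  have "coprod_gen (gE a) = EE a + EK a"
    by (simp add: EE_def EK_def)
  moreover have "tensor_act b (Suc (Suc n)) (gE a)
    = (\<lambda>f. act2 (tensor_act b (Suc n)) (factor_act (b ! Suc n)) (coprod_gen (gE a)) (take (Suc n) f) [f ! Suc n])"
    by (simp add: fun_eq_iff del: coprod_gen.simps)
  ultimately show ?thesis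
    by (simp only: A2_def)
qed

lemma hom_len_lin_tensor_act: "hom_len (Suc n) x \<Longrightarrow> hom_len (Suc n) (lin (tensor_act b (Suc n) g) x)"
  by (intro hom_len_lin hom_len_tensor_act) (simp add: hom_len_def)

lemma lookup_A2_E:
  assumes "hom_len (Suc (Suc n)) t"
  shows "lookup (A2 b (Suc n) (EE a + EK a) t) (h @ [d])
    = (if b ! Suc n = 0 then (if d = a then lookup t (h @ [a + 1]) else 0)
       else (if d = a + 1 then lookup t (h @ [a]) else 0))
      + qq powi epow (b ! Suc n) a d * Eop b (Suc n) a (\<lambda>h. lookup t (h @ [d])) h"
  by (simp only: lookup_lin_tensor_act[OF assms] flip: lin_tensor_act_E) (simp add: gop_snoc epow_def)

context quasi_R begin

text \<open>Commutation with E_a for \<open>a = step_ix e c j\<close> is read at the last entry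
  \<open>target e c j\<close>. There E_a brings the entry back from
  \<open>target e c (Suc j)\<close>, and its diagonal part has the twist \<open>inverse qq\<close>.
  On the input, E_a kills the last factor \<open>c\<close>, and the inverse twist is q if
  \<open>j = 0\<close> and 1 otherwise. Solving for the coefficient at
  \<open>target e c (Suc j)\<close> gives the recursion of \<open>Aop\<close>.\<close>

lemma lookup_Th_Aop:
  assumes "hom_len (Suc n) x" "in_range k c" "in_range k (target (b ! Suc n) c j)"
  shows "lookup (Th b (Suc n) (tensor x (bas c))) (h @ [target (b ! Suc n) c j])
    = Aop (Eop b (Suc n)) (b ! Suc n) c j (lookup x) h"
  using assms
proof (induction j arbitrary: x h)
  case 0
  then show ?case
    by (simp add: target_def lookup_Th_diag)
next
  case (Suc j)
  let ?e = "b ! Suc n"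
  define a where "a = step_ix ?e c j"
  have a: "- int k \<le> a" "a \<le> int k - 1" and rng: "in_range k (target ?e c j)"
    using Suc.prems by (auto simp: a_def step_ix_def target_def split: if_splits)
  let ?t = "tensor x (bas c)"
  let ?Ex = "lin (tensor_act b (Suc n) (gE a)) x"
  have t: "hom_len (Suc (Suc n)) ?t"
    using Suc.prems(1) by (rule hom_len_tensor_bas)
  have Ex: "hom_len (Suc n) ?Ex"
    using Suc.prems(1) by (rule hom_len_lin_tensor_act)
  have "eshift ?e a c x = 0"
    by (auto simp: eshift_def a_def step_ix_def)
  then have "A2 b (Suc n) (EE a + EKi a) ?t = scl (qq powi - epow ?e a c) (tensor ?Ex (bas c))"
    using Suc.prems(1) by (simp add: lmap_add[OF lmap_A2_left] A2_EE A2_EKi)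
  then have "A2 b (Suc n) (EE a + EK a) (Th b (Suc n) ?t) = scl (qq powi - epow ?e a c) (Th b (Suc n) (tensor ?Ex (bas c)))"
    using Th_E[OF a t] Th_scl[OF hom_len_tensor_bas[OF Ex]] by simp
  then have "lookup (A2 b (Suc n) (EE a + EK a) (Th b (Suc n) ?t)) (h @ [target ?e c j])
     = qq powi - epow ?e a c * lookup (Th b (Suc n) (tensor ?Ex (bas c))) (h @ [target ?e c j])"
    by simp
  also have "\<dots> = (if j = 0 then qq else 1) * Aop (Eop b (Suc n)) ?e c j (Eop b (Suc n) a (lookup x)) h"
    by (subst Suc.IH[OF Ex Suc.prems(2) rng])
      (auto simp: lookup_lin_tensor_act[OF Suc.prems(1)] epow_def a_def step_ix_def)
  also have "lookup (A2 b (Suc n) (EE a + EK a) (Th b (Suc n) ?t)) (h @ [target ?e c j])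
    = lookup (Th b (Suc n) ?t) (h @ [target ?e c (Suc j)])
      + inverse qq * Eop b (Suc n) a (Aop (Eop b (Suc n)) ?e c j (lookup x)) h"
    unfolding lookup_A2_E[OF hom_len_Th[OF t]] Suc.IH[OF Suc.prems(1,2) rng]
    by (auto simp: target_def a_def step_ix_def epow_def power_int_minus algebra_simps)
  finally show ?case
    by (simp add: a_def algebra_simps)
qed

lemma lookup_Th_eq:
  assumes "hom_len (Suc n) x"
  shows "lookup (Th b (Suc n) (tensor x (bas c))) (h @ [d])
    = (if d = c then lookup x h else if moves (in_range k) (b ! Suc n) c d
       then Aop (Eop b (Suc n)) (b ! Suc n) c (nat \<bar>d - c\<bar>) (lookup x) h else 0)"
proof (cases "moves (in_range k) (b ! Suc n) c d")
  case True
  then show ?thesis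
    using lookup_Th_Aop[OF assms, of c b "nat \<bar>d - c\<bar>" h] moves_target[OF True]
    by (auto simp: moves_def)
qed (auto simp: lookup_Th_diag[OF assms] lookup_Th_0[OF assms])

lemma psi_Suc_aux:
  assumes "hom_len (Suc n) (psi \<Theta> b (Suc n) f)"
  shows "psi \<Theta> b (Suc (Suc n)) f = Th b (Suc n) (tensor (psi \<Theta> b (Suc n) f) (bas (f ! Suc n)))"
proof -
  have "lin (\<lambda>g. act2 (tensor_act b (Suc n)) (factor_act (b ! Suc n)) z g [f ! Suc n]) x
      = A2 b (Suc n) z (tensor x (bas (f ! Suc n)))" if "hom_len (Suc n) x" for z x
  proof -
    have "A2 b (Suc n) z (tensor x (bas (f ! Suc n)))
      = lin (\<lambda>g. act2 (tensor_act b (Suc n)) (factor_act (b ! Suc n)) z (take (Suc n) (g @ [f ! Suc n])) [(g @ [f ! Suc n]) ! Suc n]) x"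
      by (simp add: A2_def tensor_bas lin_lin)
    also have "\<dots> = lin (\<lambda>g. act2 (tensor_act b (Suc n)) (factor_act (b ! Suc n)) z g [f ! Suc n]) x"
      using that by (intro lin_cong) (auto simp: hom_len_def nth_append)
    finally show ?thesis ..
  qed
  from this[OF assms] show ?thesis
    by (simp only: psi.simps Th_def)
qed

lemma hom_len_psi: "hom_len (Suc n) (psi \<Theta> b (Suc n) f)"
proof (induction n)
  case 0
  then show ?case
    using hom_len_bas by simp
next
  case (Suc n)
  show ?case
    unfolding psi_Suc_aux[OF Suc] by (intro hom_len_Th hom_len_tensor_bas Suc)
qed

lemmas psi_Suc = psi_Suc_aux[OF hom_len_psi]

lemma psi_append: "n < length f \<Longrightarrow> psi \<Theta> b (Suc n) (f @ g) = psi \<Theta> b (Suc n) f"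
proof (induction n)
  case (Suc n)
  then show ?case
    unfolding psi_Suc by (simp add: nth_append del: psi.simps)
qed (simp add: nth_append)

lemma lookup_psi:
  assumes "length f = Suc n"
  shows "lookup (psi \<Theta> b (Suc n) f) g = rm (in_range k) b (Suc n) g f"
proof (cases "length g = Suc n")
  case True
  then show ?thesis
    using assms
  proof (induction n arbitrary: f g)
    case 0
    then obtain c d where "f = [c]" "g = [d]"
      by (auto simp: length_Suc_conv)
    moreover have "Aop (Eop b 0) (b ! 0) c j (\<lambda>h. of_bool (h = [])) [] = 0" if "j > 0" for j
    proof -
      have "triv_act (gE a) x = (\<lambda>_. 0)" for a x
        by auto
      moreover have "Aop (\<lambda>a. triv_act (gE a)) e c j (\<lambda>_. 0) = (\<lambda>_. 0)" for e c j
        using Aop_0[of b 0] by simp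
      ultimately show ?thesis
        using that by (cases j) simp_all
    qed
    ultimately show ?case
      by (auto simp: bas_def lookup_single when_def rm_snoc[of _ _ _ "[]", simplified])
  next
    case (Suc n)
    then obtain h d f' c where gf: "g = h @ [d]" "f = f' @ [c]" "length h = Suc n" "length f' = Suc n"
      using snoc_length by metis
    have IH: "lookup (psi \<Theta> b (Suc n) f') h = rm (in_range k) b (Suc n) h f'" if "length h = Suc n" for h
      using Suc.IH gf that by auto
    then have "Aop (Eop b (Suc n)) e c j (lookup (psi \<Theta> b (Suc n) f')) h = Aop (Eop b (Suc n)) e c j (\<lambda>h. rm (in_range k) b (Suc n) h f') h" for e j
      using gf by (intro Aop_cong_length) auto
    moreover have "psi \<Theta> b (Suc (Suc n)) f = Th b (Suc n) (tensor (psi \<Theta> b (Suc n) f') (bas c))"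
      using gf by (simp only: psi_Suc psi_append) (simp add: nth_append del: psi.simps)
    ultimately show ?case
      using IH gf(3) by (simp only: gf rm_snoc lookup_Th_eq[OF hom_len_psi])
  qed
next
  case False
  then show ?thesis
    using hom_lenD[OF hom_len_psi] by (auto simp: rm_0_length simp del: psi.simps rm.simps)
qed

end

section \<open>Bar maps commute with the raising operators and are involutive\<close>

context quasi_R begin

definition Psi :: "nat list \<Rightarrow> nat \<Rightarrow> tens \<Rightarrow> tens" where
  "Psi b n x = (\<Sum>f\<in>Poly_Mapping.keys x. scl (barq (lookup x f)) (psi \<Theta> b n f))"

lemma Psi_add: "Psi b n (x + y) = Psi b n x + Psi b n y"
  unfolding Psi_def by (rule sum_keys_additive) (simp_all add: barq_add scl_add_left)

lemma Psi_single: "Psi b n (Poly_Mapping.single f r) = scl (barq r) (psi \<Theta> b n f)"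
  unfolding Psi_def by (rule sum_keys_single) simp

lemma Psi_0 [simp]: "Psi b n 0 = 0"
  by (simp add: Psi_def)

lemma Psi_scl: "Psi b n (scl r x) = scl (barq r) (Psi b n x)"
  by (induction x rule: poly_mapping_induct) (simp_all add: scl_add Psi_add Psi_single barq_mult)

lemma Psi_sum: "Psi b n (sum f A) = (\<Sum>a\<in>A. Psi b n (f a))"
  by (induction A rule: infinite_finite_induct) (simp_all add: Psi_add)

lemma hom_len_Psi: "hom_len (Suc n) (Psi b (Suc n) x)"
  unfolding Psi_def by (intro hom_len_sum hom_len_scl hom_len_psi)

lemma Psi_tensor:
  assumes "hom_len (Suc n) y"
  shows "Psi b (Suc (Suc n)) (tensor y (bas c)) = Th b (Suc n) (tensor (Psi b (Suc n) y) (bas c))"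
  using assms
proof (induction rule: hom_len_induct)
  case zero
  then show ?case by (simp add: lmap_0[OF lmap_tensor_left] Th_0)
next
  case (single f r)
  have "psi \<Theta> b (Suc (Suc n)) (f @ [c]) = Th b (Suc n) (tensor (psi \<Theta> b (Suc n) f) (bas c))"
    using single by (simp only: psi_Suc psi_append) (simp add: nth_append del: psi.simps)
  then show ?case
    using Th_scl[OF hom_len_tensor_bas[OF hom_len_psi]]
    by (simp add: bas_def tensor_single Psi_single lmap_scl[OF lmap_tensor_left] del: psi.simps)
next
  case (add x y)
  then show ?case
    by (simp add: lmap_add[OF lmap_tensor_left] Psi_add Th_add hom_len_tensor_bas hom_len_Psi)
qed

text \<open>Antilinearity inverts the power of q in the coproduct of E_a, which produces exactly the
  bar conjugate coproduct that \<open>Th_E\<close> moves past the quasi-R-matrix.\<close>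

lemma Psi_E:
  assumes a: "- int k \<le> a" "a \<le> int k - 1" and "hom_len (Suc n) x"
  shows "Psi b (Suc n) (lin (tensor_act b (Suc n) (gE a)) x) = lin (tensor_act b (Suc n) (gE a)) (Psi b (Suc n) x)"
  using assms(3)
proof (induction n arbitrary: x)
  case 0
  then show ?case
  proof (induction rule: hom_len_induct)
    case (single f r)
    then obtain c where "f = [c]"
      by (auto simp: length_Suc_conv)
    then show ?case
      by (auto simp: Psi_single factor_act_def bas_def)
  qed (simp_all add: lin_add Psi_add)
next
  case (Suc n)
  show ?case
    using Suc.prems
  proof (induction rule: hom_len_induct)
    case zero
    then show ?case by simp
  next
    case (add x y)
    then show ?case by (simp only: lin_add Psi_add)
  next
    case (single f r)
    then obtain g c where f: "f = g @ [c]" "length g = Suc n"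
      using snoc_length by blast
    let ?y = "Poly_Mapping.single g 1" and ?e = "b ! Suc n"
    have y: "hom_len (Suc n) ?y"
      by (simp add: f hom_len_single)
    let ?Ey = "lin (tensor_act b (Suc n) (gE a)) ?y"
    have Ey: "hom_len (Suc n) ?Ey"
      by (rule hom_len_lin_tensor_act[OF y])
    let ?P = "Psi b (Suc n) ?y"
    have sh: "Psi b (Suc (Suc n)) (eshift ?e a c ?y) = Th b (Suc n) (eshift ?e a c ?P)"
      by (auto simp: eshift_def Psi_tensor[OF y] Th_0)
    have "Psi b (Suc (Suc n)) (A2 b (Suc n) (EE a + EK a) (tensor ?y (bas c)))
      = Th b (Suc n) (eshift ?e a c ?P) + scl (qq powi - epow ?e a c) (Th b (Suc n) (tensor (lin (tensor_act b (Suc n) (gE a)) ?P) (bas c)))"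
      unfolding lmap_add[OF lmap_A2_left] A2_EE[OF y] A2_EK[OF y] Psi_add Psi_scl Psi_tensor[OF Ey] Suc.IH[OF y] sh
      by (simp add: barq_power_int power_int_inverse power_int_minus)
    also have "\<dots> = Th b (Suc n) (A2 b (Suc n) (EE a + EKi a) (tensor ?P (bas c)))"
      unfolding lmap_add[OF lmap_A2_left] A2_EE[OF hom_len_Psi] A2_EKi[OF hom_len_Psi]
      by (simp only: Th_add hom_len_eshift hom_len_Psi hom_len_scl hom_len_tensor_bas hom_len_lin_tensor_act Th_scl)
    also have "\<dots> = A2 b (Suc n) (EE a + EK a) (Th b (Suc n) (tensor ?P (bas c)))"
      by (rule Th_E[OF a, symmetric]) (intro hom_len_tensor_bas hom_len_Psi)
    also have "\<dots> = A2 b (Suc n) (EE a + EK a) (Psi b (Suc (Suc n)) (tensor ?y (bas c)))"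
      by (simp only: Psi_tensor[OF y])
    finally have "Psi b (Suc (Suc n)) (A2 b (Suc n) (EE a + EK a) (scl r (tensor ?y (bas c))))
       = A2 b (Suc n) (EE a + EK a) (Psi b (Suc (Suc n)) (scl r (tensor ?y (bas c))))"
      by (simp only: lmap_scl[OF lmap_A2] Psi_scl)
    moreover have "Poly_Mapping.single f r = scl r (tensor ?y (bas c))"
      by (simp add: f bas_def tensor_single)
    ultimately show ?case
      by (simp only: lin_tensor_act_E)
  qed
qed

lemmas Psi_E' = Psi_E[where n = "Suc n" for n, unfolded lin_tensor_act_E]

lemma moves_trans: "moves S e c d \<Longrightarrow> moves S e d d' \<Longrightarrow> moves S e c d'"
  and moves_irrefl: "\<not> moves S e c c"
  by (auto simp: moves_def split: if_splits)

text \<open>The square of \<open>Psi\<close> is linear and commutes with the E_a in range. Its part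
  that fixes the last entry is the identity by induction on the number of factors. Reading the
  commutation with E_a at successive distances from \<open>c\<close> then shows that all entries
  which move the last factor vanish.\<close>

lemma Psi_Psi: "hom_len (Suc n) x \<Longrightarrow> Psi b (Suc n) (Psi b (Suc n) x) = x"
proof (induction n arbitrary: x)
  case 0
  then show ?case
  proof (induction rule: hom_len_induct)
    case (single f r)
    then obtain c where "f = [c]"
      by (auto simp: length_Suc_conv)
    then show ?case
      by (auto simp: Psi_single bas_def)
  qed (simp_all add: Psi_add)
next
  case (Suc n)
  let ?P = "Psi b (Suc (Suc n))"
  let ?e = "b ! Suc n"
  let ?m = "moves (in_range k) ?e"
  define Y where "Y c x = ?P (?P (tensor x (bas c)))" for c x
  \<comment> \<open>\<open>Psi_tensor\<close> applies to vectors with a fixed last entry, so the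
    inner image is cut into slices. Keeping \<open>c\<close> in the index set allows the diagonal
    slice to be split off.\<close>
  have lookup_Y: "\<exists>D. finite D \<and> (\<forall>h d'. lookup (Y c x) (h @ [d']) =
      (\<Sum>d\<in>insert c D. lookup (Th b (Suc n) (tensor (Psi b (Suc n) (slice d (?P (tensor x (bas c))))) (bas d))) (h @ [d'])))" for c x
  proof -
    let ?u = "?P (tensor x (bas c))"
    define D where "D = insert c (last ` Poly_Mapping.keys ?u)"
    have u: "?u = (\<Sum>d\<in>D. tensor (slice d ?u) (bas d))"
      by (rule slice_expand[OF hom_len_Psi]) (auto simp: D_def)
    have "Y c x = (\<Sum>d\<in>D. Th b (Suc n) (tensor (Psi b (Suc n) (slice d ?u)) (bas d)))"
      unfolding Y_def by (subst u) (simp only: Psi_sum Psi_tensor[OF hom_len_slice[OF hom_len_Psi]])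
    moreover have "insert c D = D" "finite D"
      by (auto simp: D_def)
    ultimately show ?thesis
      by (intro exI[of _ D]) (simp add: lookup_sum)
  qed
  have slice_u: "slice d (?P (tensor x (bas c))) = (if d = c then Psi b (Suc n) x else if ?m c d
      then slice d (?P (tensor x (bas c))) else 0)" if "hom_len (Suc n) x" for c d x
    by (auto intro!: poly_mapping_eqI simp: Psi_tensor[OF that] lookup_slice[OF hom_len_Th[OF hom_len_tensor_bas[OF hom_len_Psi]]] lookup_Th_eq[OF hom_len_Psi])
  have A0: "Aop (Eop b (Suc n)) e c j (lookup 0) = (\<lambda>_. 0)" for e c j
    using Aop_0[of b "Suc n" e c j] by (simp add: zero_poly_mapping.rep_eq)
  have diag: "lookup (Y c x) (h @ [c]) = lookup x h" if x: "hom_len (Suc n) x" for c x h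
  proof -
    obtain D where D: "finite D" "lookup (Y c x) (h @ [c]) =
      (\<Sum>d\<in>insert c D. lookup (Th b (Suc n) (tensor (Psi b (Suc n) (slice d (?P (tensor x (bas c))))) (bas d))) (h @ [c]))"
      using lookup_Y by blast
    have "lookup (Th b (Suc n) (tensor (Psi b (Suc n) (slice d (?P (tensor x (bas c))))) (bas d))) (h @ [c]) = 0" if "d \<noteq> c" for d
      using that moves_trans[of "in_range k" ?e c d c] moves_irrefl
      by (subst slice_u[OF x]) (auto simp: lookup_Th_eq[OF hom_len_Psi] lmap_0[OF lmap_tensor_left] Th_0 A0)
    then have "lookup (Y c x) (h @ [c]) = (\<Sum>d\<in>{c}. lookup (Th b (Suc n) (tensor (Psi b (Suc n) (slice d (?P (tensor x (bas c))))) (bas d))) (h @ [c]))"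
      unfolding D(2) using D(1) by (intro sum.mono_neutral_right) auto
    then show ?thesis
      by (simp add: slice_u[OF x, of c c] lookup_Th_diag[OF x] Suc.IH[OF x])
  qed
  have off: "lookup (Y c x) (h @ [d']) = 0" if x: "hom_len (Suc n) x" and "d' \<noteq> c" "\<not> ?m c d'" for c x h d'
  proof -
    obtain D where D: "lookup (Y c x) (h @ [d']) =
      (\<Sum>d\<in>insert c D. lookup (Th b (Suc n) (tensor (Psi b (Suc n) (slice d (?P (tensor x (bas c))))) (bas d))) (h @ [d']))"
      using lookup_Y by blast
    have "lookup (Th b (Suc n) (tensor (Psi b (Suc n) (slice d (?P (tensor x (bas c))))) (bas d))) (h @ [d']) = 0" for d
      using that moves_trans[of "in_range k" ?e c d d']
      by (subst slice_u[OF x]) (auto simp: lookup_Th_eq[OF hom_len_Psi] lmap_0[OF lmap_tensor_left] Th_0 A0)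
    then show ?thesis
      unfolding D by (intro sum.neutral) blast
  qed
  have hY: "hom_len (Suc (Suc n)) (Y c x)" for c x
    unfolding Y_def by (rule hom_len_Psi)
  have step: "lookup (Y c x) (h @ [target ?e c (Suc j)]) = 0"
    if "hom_len (Suc n) x" "in_range k c" "in_range k (target ?e c (Suc j))" for c x j h
    using that
  proof (induction j arbitrary: x h)
    case (0 x h)
    note IH = diag
    define a where "a = step_ix ?e c 0"
    have a: "- int k \<le> a" "a \<le> int k - 1"
      using 0 by (auto simp: a_def step_ix_def target_def split: if_splits)
    let ?t = "tensor x (bas c)" and ?Ex = "lin (tensor_act b (Suc n) (gE a)) x"
    have t: "hom_len (Suc (Suc n)) ?t" and Ex: "hom_len (Suc n) ?Ex"
      using 0 by (auto intro: hom_len_tensor_bas hom_len_lin_tensor_act)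
    have "eshift ?e a c x = 0"
      by (auto simp: eshift_def a_def step_ix_def)
    then have "A2 b (Suc n) (EE a + EK a) ?t = scl (qq powi epow ?e a c) (tensor ?Ex (bas c))"
      using 0 by (simp add: lmap_add[OF lmap_A2_left] A2_EE A2_EK)
    then have "A2 b (Suc n) (EE a + EK a) (Y c x) = scl (qq powi epow ?e a c) (Y c ?Ex)"
      unfolding Y_def Psi_E'[OF a hom_len_Psi, symmetric] Psi_E'[OF a t, symmetric]
      by (simp only: Psi_scl barq_barq)
    then have "lookup (A2 b (Suc n) (EE a + EK a) (Y c x)) (h @ [c]) = lookup (scl (qq powi epow ?e a c) (Y c ?Ex)) (h @ [c])"
      by simp
    then show ?case
      unfolding lookup_A2_E[OF hY] lookup_scl diag[OF Ex] diag[OF 0(1)]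
      by (auto simp: epow_def a_def step_ix_def target_def lookup_lin_tensor_act[OF 0(1)])
  next
    case (Suc j x h)
    define a where "a = step_ix ?e c (Suc j)"
    have a: "- int k \<le> a" "a \<le> int k - 1" and rng: "in_range k (target ?e c (Suc j))"
      using Suc.prems by (auto simp: a_def step_ix_def target_def split: if_splits)
    let ?t = "tensor x (bas c)" and ?Ex = "lin (tensor_act b (Suc n) (gE a)) x"
    have t: "hom_len (Suc (Suc n)) ?t" and Ex: "hom_len (Suc n) ?Ex"
      using Suc.prems by (auto intro: hom_len_tensor_bas hom_len_lin_tensor_act)
    have "eshift ?e a c x = 0"
      by (auto simp: eshift_def a_def step_ix_def)
    then have "A2 b (Suc n) (EE a + EK a) ?t = scl (qq powi epow ?e a c) (tensor ?Ex (bas c))"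
      using Suc.prems by (simp add: lmap_add[OF lmap_A2_left] A2_EE A2_EK)
    then have "A2 b (Suc n) (EE a + EK a) (Y c x) = scl (qq powi epow ?e a c) (Y c ?Ex)"
      unfolding Y_def Psi_E'[OF a hom_len_Psi, symmetric] Psi_E'[OF a t, symmetric]
      by (simp only: Psi_scl barq_barq)
    then have "lookup (A2 b (Suc n) (EE a + EK a) (Y c x)) (h @ [target ?e c (Suc j)]) = lookup (scl (qq powi epow ?e a c) (Y c ?Ex)) (h @ [target ?e c (Suc j)])"
      by simp
    then show ?case
      unfolding lookup_A2_E[OF hY] lookup_scl Suc.IH[OF Ex Suc.prems(2) rng] Suc.IH[OF Suc.prems(1,2) rng] urep.zero[OF urep_gop]
      by (auto simp: a_def step_ix_def target_def algebra_simps split: if_splits)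
  qed
  have Y: "Y c x = tensor x (bas c)" if x: "hom_len (Suc n) x" for c x
  proof (rule poly_mapping_eqI)
    fix f
    show "lookup (Y c x) f = lookup (tensor x (bas c)) f"
    proof (cases f rule: rev_cases)
      case Nil
      then show ?thesis
        using hom_lenD[OF hY, of c x f] by (auto simp: lookup_tensor_bas_Nil)
    next
      case (snoc h d)
      have "lookup (Y c x) (h @ [d]) = 0" if "?m c d"
      proof -
        have "nat \<bar>d - c\<bar> = Suc (nat \<bar>d - c\<bar> - 1)"
          using that by (auto simp: moves_def split: if_splits)
        then show ?thesis
          using step[OF x, of c "nat \<bar>d - c\<bar> - 1" h] moves_target[OF that] that by (auto simp: moves_def)
      qed
      then show ?thesis
        using diag[OF x] off[OF x] by (cases "?m c d") (auto simp: snoc lookup_tensor_bas)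
    qed
  qed
  show ?case
    using Suc.prems
  proof (induction rule: hom_len_induct)
    case (single f r)
    then obtain g c where f: "f = g @ [c]" "length g = Suc n"
      using snoc_length by blast
    then have "Poly_Mapping.single f r = tensor (Poly_Mapping.single g r) (bas c)"
      by (simp add: bas_def tensor_single)
    then show ?case
      using Y[OF hom_len_single[OF f(2)]] by (simp only: Y_def)
  qed (simp_all only: Psi_add Psi_0)
qed

lemma lookup_Psi:
  assumes "hom_len (Suc n) x"
  shows "lookup (Psi b (Suc n) x) g = (\<Sum>f\<in>Poly_Mapping.keys x. barq (lookup x f) * rm (in_range k) b (Suc n) g f)"
  unfolding Psi_def lookup_sum lookup_scl
  using assms by (intro sum.cong refl) (simp add: lookup_psi hom_len_def del: psi.simps rm.simps)

lemma rm_involution: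
  assumes f: "length f = Suc n" and "finite H"
    "\<And>h. rm (in_range k) b (Suc n) g h \<noteq> 0 \<Longrightarrow> rm (in_range k) b (Suc n) h f \<noteq> 0 \<Longrightarrow> h \<in> H"
  shows "(\<Sum>h\<in>H. barq (rm (in_range k) b (Suc n) h f) * rm (in_range k) b (Suc n) g h) = of_bool (g = f)"
proof -
  let ?r = "rm (in_range k) b (Suc n)"
  have "lookup (Psi b (Suc n) (Psi b (Suc n) (Poly_Mapping.single f 1))) g = of_bool (g = f)"
    by (auto simp: Psi_Psi hom_len_single f lookup_single)
  then have "lookup (Psi b (Suc n) (psi \<Theta> b (Suc n) f)) g = of_bool (g = f)"
    by (simp add: Psi_single del: psi.simps)
  then have "(\<Sum>h\<in>Poly_Mapping.keys (psi \<Theta> b (Suc n) f). barq (?r h f) * ?r g h) = of_bool (g = f)"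
    by (simp only: lookup_Psi[OF hom_len_psi] lookup_psi[OF f])
  moreover have "h \<in> Poly_Mapping.keys (psi \<Theta> b (Suc n) f) \<longleftrightarrow> ?r h f \<noteq> 0" for h
    by (simp only: in_keys_iff lookup_psi[OF f])
  then have "(\<Sum>h\<in>Poly_Mapping.keys (psi \<Theta> b (Suc n) f). barq (?r h f) * ?r g h) = (\<Sum>h\<in>H. barq (?r h f) * ?r g h)"
    using assms(2,3) by (intro sum.mono_neutral_cong) (auto simp del: rm.simps psi.simps)
  ultimately show ?thesis
    by simp
qed

end

text \<open>The transpose of the matrix of \<open>E\<^sub>a\<close>, with barred coefficients.\<close>

primrec cop :: "nat list \<Rightarrow> nat \<Rightarrow> int \<Rightarrow> formal \<Rightarrow> formal" where
  "cop b 0 a y f = 0"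
| "cop b (Suc n) a y f = (if f = [] then 0 else
     (if b ! n = 0 then (if last f = a + 1 then y (butlast f @ [a]) else 0)
      else (if last f = a then y (butlast f @ [a + 1]) else 0))
     + qq powi - epow (b ! n) a (last f) * cop b n a (\<lambda>h. y (h @ [last f])) (butlast f))"

lemma cop_snoc: "cop b (Suc n) a y (h @ [c]) =
     (if b ! n = 0 then (if c = a + 1 then y (h @ [a]) else 0) else (if c = a then y (h @ [a + 1]) else 0))
     + qq powi - epow (b ! n) a c * cop b n a (\<lambda>h. y (h @ [c])) h"
  by simp

lemma cop_cong_length: "(\<And>k. length k = length f \<Longrightarrow> x k = y k) \<Longrightarrow> cop b n a x f = cop b n a y f"
proof (induction n arbitrary: x y f)
  case (Suc n)
  show ?case
  proof (cases f rule: rev_cases)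
    case (snoc h c)
    have "cop b n a (\<lambda>h. x (h @ [c])) h = cop b n a (\<lambda>h. y (h @ [c])) h"
      using Suc.prems snoc by (intro Suc.IH) auto
    then show ?thesis
      using Suc.prems by (auto simp: snoc)
  qed simp
qed simp

text \<open>Pulling the powers of q out of an antilinear functional inverts them; this is the origin
  of the negative exponents in \<open>cop\<close>.\<close>

lemma cop_antilinear:
  assumes add: "\<And>x y. \<phi> (x + y) = \<phi> x + \<phi> y" and scl: "\<And>r x. \<phi> (scl r x) = barq r * \<phi> x"
    and f: "length f = Suc n"
  shows "\<phi> (tensor_act b (Suc n) (gE a) f) = cop b (Suc n) a (\<lambda>h. \<phi> (Poly_Mapping.single h 1)) f"
  using assms
proof (induction n arbitrary: \<phi> f)
  case 0
  then obtain c where "f = [c]"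
    by (auto simp: length_Suc_conv)
  moreover have "\<phi> 0 = 0"
    using 0(2)[of 0 0] by simp
  ultimately show ?case
    by (auto simp: factor_act_def bas_def)
next
  case (Suc n)
  then obtain g c where f: "f = g @ [c]" "length g = Suc n"
    using snoc_length by blast
  have \<phi>0: "\<phi> 0 = 0"
    using Suc.prems(2)[of 0 0] by simp
  have IH: "\<phi> (tensor (tensor_act b (Suc n) (gE a) g) (bas c)) = cop b (Suc n) a (\<lambda>h. \<phi> (Poly_Mapping.single (h @ [c]) 1)) g"
    using f(2) Suc.IH[of "\<lambda>x. \<phi> (tensor x (bas c))" g] Suc.prems(1,2)
    by (simp add: lmap_add[OF lmap_tensor_left] lmap_scl[OF lmap_tensor_left] bas_def tensor_single del: tensor_act.simps cop.simps)
  have "tensor_act b (Suc (Suc n)) (gE a) f = A2 b (Suc n) (EE a + EK a) (tensor (Poly_Mapping.single g 1) (bas c))"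
    unfolding lin_tensor_act_E[symmetric] by (simp add: f bas_def tensor_single del: tensor_act.simps)
  also have "\<dots> = eshift (b ! Suc n) a c (Poly_Mapping.single g 1) + scl (qq powi epow (b ! Suc n) a c) (tensor (tensor_act b (Suc n) (gE a) g) (bas c))"
    by (simp add: lmap_add[OF lmap_A2_left] A2_EE A2_EK f hom_len_single del: tensor_act.simps)
  finally have "\<phi> (tensor_act b (Suc (Suc n)) (gE a) f) = \<phi> (eshift (b ! Suc n) a c (Poly_Mapping.single g 1))
      + qq powi - epow (b ! Suc n) a c * cop b (Suc n) a (\<lambda>h. \<phi> (Poly_Mapping.single (h @ [c]) 1)) g"
    by (simp add: Suc.prems(1,2) IH barq_power_int power_int_inverse power_int_minus del: tensor_act.simps cop.simps)
  then show ?case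
    by (auto simp: f cop_snoc eshift_def \<phi>0 bas_def tensor_single simp del: tensor_act.simps cop.simps)
qed

text \<open>A fixed coefficient of \<open>Psi\<close> is an antilinear functional, so
  \<open>cop_antilinear\<close> evaluates it on the image of a basis vector under E_a.\<close>

lemma (in quasi_R) rm_E:
  assumes a: "- int k \<le> a" "a \<le> int k - 1" and f: "length f = Suc n"
  shows "Eop b (Suc n) a (\<lambda>h. rm (in_range k) b (Suc n) h f) g = cop b (Suc n) a (rm (in_range k) b (Suc n) g) f"
proof -
  let ?f = "Poly_Mapping.single f 1"
  have "Psi b (Suc n) (lin (tensor_act b (Suc n) (gE a)) ?f) = lin (tensor_act b (Suc n) (gE a)) (Psi b (Suc n) ?f)"
    using f by (intro Psi_E[OF a] hom_len_single)
  then have "Psi b (Suc n) (tensor_act b (Suc n) (gE a) f) = lin (tensor_act b (Suc n) (gE a)) (psi \<Theta> b (Suc n) f)"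
    by (simp add: Psi_single del: tensor_act.simps psi.simps)
  then have "lookup (Psi b (Suc n) (tensor_act b (Suc n) (gE a) f)) g = Eop b (Suc n) a (lookup (psi \<Theta> b (Suc n) f)) g"
    by (simp only: lookup_lin_tensor_act[OF hom_len_psi])
  also have "lookup (psi \<Theta> b (Suc n) f) = (\<lambda>h. rm (in_range k) b (Suc n) h f)"
    by (simp add: fun_eq_iff lookup_psi[OF f] del: psi.simps rm.simps)
  also have "lookup (Psi b (Suc n) (tensor_act b (Suc n) (gE a) f)) g
      = cop b (Suc n) a (\<lambda>h. lookup (Psi b (Suc n) (Poly_Mapping.single h 1)) g) f"
    by (rule cop_antilinear[OF _ _ f]) (simp_all add: Psi_add Psi_scl lookup_add)
  also have "\<dots> = cop b (Suc n) a (rm (in_range k) b (Suc n) g) f"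
    using f by (intro cop_cong_length) (simp add: Psi_single lookup_psi del: psi.simps rm.simps)
  finally show ?thesis ..
qed

section \<open>Bruhat order and the limit of the bar maps\<close>

text \<open>The counting function of the Bruhat order for the first \<open>n\<close> factors only,
  which permits induction on the number of factors. For \<open>j \<ge> n\<close> the sum is empty,
  so \<open>j\<close> can range over all naturals.\<close>

definition shp :: "nat list \<Rightarrow> nat \<Rightarrow> int list \<Rightarrow> int \<Rightarrow> nat \<Rightarrow> int" where
  "shp b n f a j = (\<Sum>i=j..<n. of_bool (f ! i \<le> a) * (- 1) ^ (b ! i))"

definition bru :: "nat list \<Rightarrow> nat \<Rightarrow> int list \<Rightarrow> int list \<Rightarrow> bool" where
  "bru b n g f \<longleftrightarrow> length g = n \<and> length f = n \<and>
     (\<forall>a j. shp b n g a j \<le> shp b n f a j) \<and> (\<forall>a. shp b n g a 0 = shp b n f a 0)"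

lemma sharp_shp: "sharp b f a j = shp b (length b) f a j"
  unfolding sharp_def shp_def
  by (rule sum.mono_neutral_cong_left) auto

lemma bruhat_bru: "bruhat b g f \<longleftrightarrow> bru b (length b) g f"
proof -
  have "shp b n f a j = 0" if "n \<le> j" for n f a j
    using that by (simp add: shp_def)
  then show ?thesis
    unfolding bruhat_def bru_def sharp_shp by (metis linorder_not_le order_refl)
qed

lemma shp_snoc: "length g = n \<Longrightarrow> shp b (Suc n) (g @ [c]) a j
    = (if j \<le> n then shp b n g a j + of_bool (c \<le> a) * (- 1) ^ (b ! n) else 0)"
  by (auto simp: shp_def nth_append intro!: sum.cong)

lemma shp_diff: "j < n \<Longrightarrow> shp b n f a j = of_bool (f ! j \<le> a) * (- 1) ^ (b ! j) + shp b n f a (Suc j)"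
  unfolding shp_def by (rule sum.atLeast_Suc_lessThan)

lemma shp_eq_imp:
  assumes "\<And>j. shp b n h a j = shp b n f a j" "j < n"
  shows "h ! j \<le> a \<longleftrightarrow> f ! j \<le> a"
  using shp_diff[OF assms(2), of b h a] shp_diff[OF assms(2), of b f a] assms(1)[of j] assms(1)[of "Suc j"]
  by (auto simp: of_bool_def split: if_splits)

lemma bru_refl: "length f = n \<Longrightarrow> bru b n f f"
  and bru_trans: "bru b n h g \<Longrightarrow> bru b n g f \<Longrightarrow> bru b n h f"
  unfolding bru_def by (simp_all, meson order.trans)

lemma bit_cases: "n < length b \<Longrightarrow> set b \<subseteq> {0, 1} \<Longrightarrow> b ! n = 0 \<or> b ! n = (1::nat)"
  using nth_mem[of n b] by blast

lemma bru_antisym: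
  assumes "bru b n g f" "bru b n f g"
  shows "g = f"
proof (rule nth_equalityI)
  show "length g = length f"
    using assms by (simp add: bru_def)
  fix i assume "i < length g"
  then have "g ! i \<le> a \<longleftrightarrow> f ! i \<le> a" for a
    using assms by (intro shp_eq_imp[of b n]) (auto simp: bru_def intro: antisym)
  then show "g ! i = f ! i"
    by (metis order.antisym order.refl)
qed

text \<open>For a threshold outside the range of the entries of \<open>f\<close> and
  \<open>g\<close>, the two counts agree for every \<open>j\<close>; an intermediate
  \<open>h\<close> then has the same counts, and these determine which of its entries lie below the
  threshold.\<close>

lemma finite_bru_interval: "finite {h. bru b n g h \<and> bru b n h f}"
proof -
  define lo hi where "lo = Min (insert 0 (set f \<union> set g))" and "hi = Max (insert 0 (set f \<union> set g))"
  have "set h \<subseteq> {lo..hi} \<and> length h = n" if h: "bru b n g h" "bru b n h f" for h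
  proof -
    have len: "length h = n" "length g = n" "length f = n"
      using h by (auto simp: bru_def)
    have *: "h ! i \<le> a \<longleftrightarrow> f ! i \<le> a" if "i < n" "\<And>i. i < n \<Longrightarrow> g ! i \<le> a \<longleftrightarrow> f ! i \<le> a" for i a
    proof (rule shp_eq_imp[OF _ that(1)])
      fix j
      have "shp b n g a j = shp b n f a j"
        unfolding shp_def using that(2) by (intro sum.cong) auto
      then show "shp b n h a j = shp b n f a j"
        using h by (metis bru_def order.antisym)
    qed
    have lohi: "lo \<le> f ! i" "lo \<le> g ! i" "f ! i \<le> hi" "g ! i \<le> hi" if "i < n" for i
      using that len by (auto simp: lo_def hi_def intro!: Min_le Max_ge)
    have "lo \<le> h ! i \<and> h ! i \<le> hi" if "i < n" for i
    proof -
      \<comment> \<open>No entry of \<open>f\<close> or \<open>g\<close> is at most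
        \<open>lo - 1\<close>, and all are at most \<open>hi\<close>; the same then follows for
        \<open>h\<close>.\<close>
      have "g ! j \<le> lo - 1 \<longleftrightarrow> f ! j \<le> lo - 1" "g ! j \<le> hi \<longleftrightarrow> f ! j \<le> hi" if "j < n" for j
        using lohi[OF that] by auto
      then have "h ! i \<le> lo - 1 \<longleftrightarrow> f ! i \<le> lo - 1" "h ! i \<le> hi \<longleftrightarrow> f ! i \<le> hi"
        using *[OF that] by blast+
      then show ?thesis
        using lohi[OF that] by auto
    qed
    then show ?thesis
      using len by (auto simp: in_set_conv_nth)
  qed
  then have "{h. bru b n g h \<and> bru b n h f} \<subseteq> {h. set h \<subseteq> {lo..hi} \<and> length h = n}"
    by blast
  then show ?thesis
    by (rule finite_subset) (simp add: finite_lists_length_eq)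
qed

text \<open>E_a turns one entry v_{a+1} into v_a, or w_a into w_{a+1}. In both cases the signed
  count grows by one, only at threshold \<open>a\<close> and only for \<open>j\<close> up to the
  position of that entry.\<close>

lemma Eop_shp:
  assumes "Eop b n a x g \<noteq> 0" "length g = n" "n \<le> length b" "set b \<subseteq> {0, 1}"
  shows "\<exists>h. length h = n \<and> x h \<noteq> 0 \<and> (\<forall>a' j. shp b n h a' j \<le> shp b n g a' j
    \<and> shp b n g a' j \<le> shp b n h a' j + of_bool (a' = a)) \<and> (\<forall>a'. shp b n g a' 0 = shp b n h a' 0 + of_bool (a' = a))"
  using assms
proof (induction n arbitrary: x g)
  case 0
  then show ?case by simp
next
  case (Suc n)
  then obtain g' d where g: "g = g' @ [d]" "length g' = n"
    using snoc_length by blast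
  have e: "b ! n = 0 \<or> b ! n = 1"
    using Suc.prems by (intro bit_cases) auto
  let ?c = "if b ! n = 0 then a + 1 else a"
  have "(d = (if b ! n = 0 then a else a + 1) \<and> x (g' @ [?c]) \<noteq> 0) \<or> Eop b n a (\<lambda>h. x (h @ [d])) g' \<noteq> 0"
    using Suc.prems(1) unfolding g gop_snoc by (auto split: if_splits)
  then show ?case
  proof
    assume *: "d = (if b ! n = 0 then a else a + 1) \<and> x (g' @ [?c]) \<noteq> 0"
    then show ?thesis
      using e g(2) by (intro exI[of _ "g' @ [?c]"]) (auto simp: g shp_snoc)
  next
    assume "Eop b n a (\<lambda>h. x (h @ [d])) g' \<noteq> 0"
    from Suc.IH[OF this g(2)] Suc.prems obtain h where h: "length h = n" "x (h @ [d]) \<noteq> 0"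
      "\<And>a' j. shp b n h a' j \<le> shp b n g' a' j \<and> shp b n g' a' j \<le> shp b n h a' j + of_bool (a' = a)"
      "\<And>a'. shp b n g' a' 0 = shp b n h a' 0 + of_bool (a' = a)"
      by auto
    show ?thesis
      using h(1,2) h(3,4) by (intro exI[of _ "h @ [d]"]) (auto simp: g shp_snoc)
  qed
qed

text \<open>The thresholds crossed by the last entry during \<open>j\<close> moves, each exactly
  once.\<close>

definition between :: "nat \<Rightarrow> int \<Rightarrow> nat \<Rightarrow> int \<Rightarrow> bool" where
  "between e c j a \<longleftrightarrow> (if e = 0 then c \<le> a \<and> a < c + int j else c - int j \<le> a \<and> a < c)"

lemma between_Suc: "of_bool (between e c (Suc j) a) = (of_bool (between e c j a) + of_bool (a = step_ix e c j) :: int)"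
  by (auto simp: between_def step_ix_def of_bool_def)

lemma Aop_shp:
  assumes "Aop (Eop b n) e c k x g \<noteq> 0" "length g = n" "n \<le> length b" "set b \<subseteq> {0, 1}"
  shows "\<exists>h. length h = n \<and> x h \<noteq> 0 \<and> (\<forall>a' j. shp b n h a' j \<le> shp b n g a' j
    \<and> shp b n g a' j \<le> shp b n h a' j + of_bool (between e c k a')) \<and> (\<forall>a'. shp b n g a' 0 = shp b n h a' 0 + of_bool (between e c k a'))"
  using assms(1,2)
proof (induction k arbitrary: x g)
  case 0
  then show ?case by (auto simp: between_def)
next
  case (Suc k)
  let ?s = "step_ix e c k"
  consider "Aop (Eop b n) e c k (Eop b n ?s x) g \<noteq> 0" | "Eop b n ?s (Aop (Eop b n) e c k x) g \<noteq> 0"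
    using Suc.prems(1) by fastforce
  then show ?case
  proof cases
    case 1
    from Suc.IH[OF this Suc.prems(2)] obtain h where h: "length h = n" "Eop b n ?s x h \<noteq> 0"
      "\<And>a' j. shp b n h a' j \<le> shp b n g a' j \<and> shp b n g a' j \<le> shp b n h a' j + of_bool (between e c k a')"
      "\<And>a'. shp b n g a' 0 = shp b n h a' 0 + of_bool (between e c k a')"
      by auto
    from Eop_shp[OF h(2,1) assms(3,4)] obtain l where l: "length l = n" "x l \<noteq> 0"
      "\<And>a' j. shp b n l a' j \<le> shp b n h a' j \<and> shp b n h a' j \<le> shp b n l a' j + of_bool (a' = ?s)"
      "\<And>a'. shp b n h a' 0 = shp b n l a' 0 + of_bool (a' = ?s)"
      by auto
    show ?thesis
    proof (intro exI[of _ l] conjI allI l(1,2))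
      fix a' j
      show "shp b n l a' j \<le> shp b n g a' j"
        "shp b n g a' j \<le> shp b n l a' j + of_bool (between e c (Suc k) a')"
        "shp b n g a' 0 = shp b n l a' 0 + of_bool (between e c (Suc k) a')"
        unfolding between_Suc using h(3)[of a' j] l(3)[of a' j] h(4)[of a'] l(4)[of a'] by linarith+
    qed
  next
    case 2
    from Eop_shp[OF this Suc.prems(2) assms(3,4)] obtain h where h: "length h = n" "Aop (Eop b n) e c k x h \<noteq> 0"
      "\<And>a' j. shp b n h a' j \<le> shp b n g a' j \<and> shp b n g a' j \<le> shp b n h a' j + of_bool (a' = ?s)"
      "\<And>a'. shp b n g a' 0 = shp b n h a' 0 + of_bool (a' = ?s)"
      by auto
    from Suc.IH[OF h(2,1)] obtain l where l: "length l = n" "x l \<noteq> 0"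
      "\<And>a' j. shp b n l a' j \<le> shp b n h a' j \<and> shp b n h a' j \<le> shp b n l a' j + of_bool (between e c k a')"
      "\<And>a'. shp b n h a' 0 = shp b n l a' 0 + of_bool (between e c k a')"
      by auto
    show ?thesis
    proof (intro exI[of _ l] conjI allI l(1,2))
      fix a' j
      show "shp b n l a' j \<le> shp b n g a' j"
        "shp b n g a' j \<le> shp b n l a' j + of_bool (between e c (Suc k) a')"
        "shp b n g a' 0 = shp b n l a' 0 + of_bool (between e c (Suc k) a')"
        unfolding between_Suc using h(3)[of a' j] l(3)[of a' j] h(4)[of a'] l(4)[of a'] by linarith+
    qed
  qed
qed

text \<open>The q-commutator adds to the total count of the earlier factors one unit at each
  threshold crossed by the last entry, and at most that to the partial counts. The move of the last
  entry lowers its own contribution by the same amount, so totals are preserved and partial counts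
  do not grow.\<close>

lemma rm_triangular:
  assumes "rm S b n g f \<noteq> 0" "n \<le> length b" "set b \<subseteq> {0, 1}"
  shows "bru b n g f"
  using assms(1,2)
proof (induction n arbitrary: g f)
  case 0
  then show ?case by (auto simp: bru_def)
next
  case (Suc n)
  have "length g = Suc n" "length f = Suc n"
    using rm_0_length Suc.prems(1) by metis+
  then obtain h d f' c where gf: "g = h @ [d]" "f = f' @ [c]" "length h = n" "length f' = n"
    by (metis snoc_length)
  have e: "b ! n = 0 \<or> b ! n = 1"
    using Suc.prems assms(3) by (intro bit_cases) auto
  show ?case
  proof (cases "d = c")
    case True
    then have "bru b n h f'"
      using Suc.IH Suc.prems gf(1,2) True by (simp add: rm_snoc del: rm.simps)
    then show ?thesis
      using gf True by (auto simp: bru_def shp_snoc)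
  next
    case False
    then have mv: "moves S (b ! n) c d" and
      "Aop (Eop b n) (b ! n) c (nat \<bar>d - c\<bar>) (\<lambda>h. rm S b n h f') h \<noteq> 0"
      using Suc.prems(1) unfolding gf rm_snoc by (auto split: if_splits)
    from Aop_shp[OF this(2) gf(3) _ assms(3)] Suc.prems(2) obtain l where l: "length l = n" "rm S b n l f' \<noteq> 0"
      "\<And>a' j. shp b n h a' j \<le> shp b n l a' j + of_bool (between (b ! n) c (nat \<bar>d - c\<bar>) a')"
      "\<And>a'. shp b n h a' 0 = shp b n l a' 0 + of_bool (between (b ! n) c (nat \<bar>d - c\<bar>) a')"
      by auto
    have lf: "bru b n l f'"
      using Suc.IH[OF l(2)] Suc.prems(2) by simp
    have bt: "of_bool (between (b ! n) c (nat \<bar>d - c\<bar>) a) = of_bool (c \<le> a) * (- 1) ^ (b ! n) - (of_bool (d \<le> a) * (- 1) ^ (b ! n) :: int)" for a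
      using e mv by (auto simp: between_def moves_def split: if_splits)
    have "shp b n h a j \<le> shp b n f' a j + of_bool (between (b ! n) c (nat \<bar>d - c\<bar>) a)"
      "shp b n h a 0 = shp b n f' a 0 + of_bool (between (b ! n) c (nat \<bar>d - c\<bar>) a)" for a j
      using l(3)[of a j] l(4)[of a] lf by (auto simp: bru_def intro: order.trans)
    then show ?thesis
      using gf unfolding bt by (auto simp: bru_def shp_snoc algebra_simps)
  qed
qed

lemma rm_diag: "length f = n \<Longrightarrow> rm S b n f f = 1"
proof (induction n arbitrary: f)
  case (Suc n)
  then obtain h c where "f = h @ [c]" "length h = n"
    using snoc_length by blast
  then show ?case
    using Suc.IH by (simp add: rm_snoc del: rm.simps)
qed simp

section \<open>Integrality, locality and stabilization of the bar matrices\<close>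

lemma Eop_Laurent: "(\<And>h. x h \<in> Laurent) \<Longrightarrow> Eop b n a x g \<in> Laurent"
proof (induction n arbitrary: x g)
  case (Suc n)
  show ?case
  proof (cases g rule: rev_cases)
    case (snoc h c)
    then show ?thesis
      using Suc by (auto simp only: snoc gop_snoc ext_act.simps split: if_splits intro!: Laurent_add Laurent_mult)
  qed (simp add: gop_Nil)
qed simp

lemma Aop_Laurent: "(\<And>h. x h \<in> Laurent) \<Longrightarrow> Aop (Eop b n) e c j x g \<in> Laurent"
proof (induction j arbitrary: x g)
  case (Suc j)
  then show ?case
    unfolding Aop.simps by (intro Laurent_diff Laurent_mult Suc.IH Eop_Laurent) auto
qed simp

lemma rm_Laurent: "rm S b n g f \<in> Laurent"
proof (induction n arbitrary: g f)
  case (Suc n)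
  then show ?case
    by (auto intro: Aop_Laurent)
qed auto

text \<open>Finite dependence of one output coefficient on the input. It is what lets operators pass
  to eventual limits and through chains of columns with infinitely many members.\<close>

definition local_at :: "(formal \<Rightarrow> formal) \<Rightarrow> int list \<Rightarrow> int list set \<Rightarrow> bool" where
  "local_at T g H \<longleftrightarrow> finite H \<and> (\<forall>x y. (\<forall>h\<in>H. x h = y h) \<longrightarrow> T x g = T y g)"

lemma local_atD: "local_at T g H \<Longrightarrow> (\<And>h. h \<in> H \<Longrightarrow> x h = y h) \<Longrightarrow> T x g = T y g"
  and local_at_finite: "local_at T g H \<Longrightarrow> finite H"
  unfolding local_at_def by blast+

lemma local_atI: "finite H \<Longrightarrow> (\<And>x y. (\<And>h. h \<in> H \<Longrightarrow> x h = y h) \<Longrightarrow> T x g = T y g) \<Longrightarrow> local_at T g H"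
  unfolding local_at_def by blast

lemma Eop_local: "\<exists>H. local_at (Eop b n a) g H"
proof (induction n arbitrary: g)
  case 0
  show ?case
    by (rule exI[of _ "{}"]) (simp add: local_at_def)
next
  case (Suc n)
  show ?case
  proof (cases g rule: rev_cases)
    case Nil
    then show ?thesis
      by (intro exI[of _ "{}"]) (simp add: local_at_def gop_Nil)
  next
    case (snoc h c)
    obtain H where H: "local_at (Eop b n a) h H"
      using Suc by blast
    define H' where "H' = (\<lambda>h. h @ [c]) ` H \<union> {h @ [a], h @ [a + 1]}"
    have "local_at (Eop b (Suc n) a) g H'"
    proof (rule local_atI)
      show "finite H'"
        using local_at_finite[OF H] by (simp add: H'_def)
      fix x y :: formal assume xy: "\<And>h. h \<in> H' \<Longrightarrow> x h = y h"
      have "Eop b n a (\<lambda>h. x (h @ [c])) h = Eop b n a (\<lambda>h. y (h @ [c])) h"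
        by (rule local_atD[OF H]) (simp add: H'_def xy)
      moreover have "x (h @ [a]) = y (h @ [a])" "x (h @ [a + 1]) = y (h @ [a + 1])"
        by (simp_all add: H'_def xy)
      ultimately show "Eop b (Suc n) a x g = Eop b (Suc n) a y g"
        unfolding snoc gop_snoc by simp
    qed
    then show ?thesis ..
  qed
qed

lemma cop_local: "\<exists>H. local_at (cop b n a) g H"
proof (induction n arbitrary: g)
  case 0
  show ?case
    by (rule exI[of _ "{}"]) (simp add: local_at_def)
next
  case (Suc n)
  show ?case
  proof (cases g rule: rev_cases)
    case Nil
    then show ?thesis
      by (intro exI[of _ "{}"]) (simp add: local_at_def)
  next
    case (snoc h c)
    obtain H where H: "local_at (cop b n a) h H"
      using Suc by blast
    define H' where "H' = (\<lambda>h. h @ [c]) ` H \<union> {h @ [a], h @ [a + 1]}"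
    have "local_at (cop b (Suc n) a) g H'"
    proof (rule local_atI)
      show "finite H'"
        using local_at_finite[OF H] by (simp add: H'_def)
      fix x y :: formal assume xy: "\<And>h. h \<in> H' \<Longrightarrow> x h = y h"
      have "cop b n a (\<lambda>h. x (h @ [c])) h = cop b n a (\<lambda>h. y (h @ [c])) h"
        by (rule local_atD[OF H]) (simp add: H'_def xy)
      moreover have "x (h @ [a]) = y (h @ [a])" "x (h @ [a + 1]) = y (h @ [a + 1])"
        by (simp_all add: H'_def xy)
      ultimately show "cop b (Suc n) a x g = cop b (Suc n) a y g"
        unfolding snoc cop_snoc by simp
    qed
    then show ?thesis ..
  qed
qed

lemma local_comp:
  assumes T: "local_at T g H" and "\<And>h. \<exists>H. local_at T' h H"
  shows "\<exists>H. local_at (\<lambda>x. T (T' x)) g H"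
proof -
  obtain K where K: "\<And>h. local_at T' h (K h)"
    using assms(2) by metis
  have "local_at (\<lambda>x. T (T' x)) g (\<Union>(K ` H))"
  proof (rule local_atI)
    show "finite (\<Union>(K ` H))"
      using local_at_finite[OF T] local_at_finite[OF K] by simp
    fix x y :: formal assume xy: "\<And>h. h \<in> \<Union>(K ` H) \<Longrightarrow> x h = y h"
    have "T' x h = T' y h" if "h \<in> H" for h
      by (rule local_atD[OF K]) (use that xy in blast)
    then show "T (T' x) g = T (T' y) g"
      by (rule local_atD[OF T])
  qed
  then show ?thesis ..
qed

lemma Aop_local:
  assumes "\<And>a h. \<exists>H. local_at (G a) h H"
  shows "\<exists>H. local_at (Aop G e c j) g H"
proof (induction j arbitrary: g)
  case 0
  show ?case
    by (rule exI[of _ "{g}"]) (simp add: local_at_def)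
next
  case (Suc j)
  let ?G = "G (step_ix e c j)"
  obtain H0 where "local_at (Aop G e c j) g H0"
    using Suc by blast
  from local_comp[OF this assms] obtain H1 where H1: "local_at (\<lambda>x. Aop G e c j (?G x)) g H1" ..
  obtain H0 where "local_at ?G g H0"
    using assms by blast
  from local_comp[OF this Suc] obtain H2 where H2: "local_at (\<lambda>x. ?G (Aop G e c j x)) g H2" ..
  have "local_at (Aop G e c (Suc j)) g (H1 \<union> H2)"
  proof (rule local_atI)
    show "finite (H1 \<union> H2)"
      using local_at_finite[OF H1] local_at_finite[OF H2] by simp
    fix x y :: formal assume xy: "\<And>h. h \<in> H1 \<union> H2 \<Longrightarrow> x h = y h"
    have "Aop G e c j (?G x) g = Aop G e c j (?G y) g" "?G (Aop G e c j x) g = ?G (Aop G e c j y) g"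
      by (rule local_atD[OF H1], simp add: xy, rule local_atD[OF H2], simp add: xy)
    then show "Aop G e c (Suc j) x g = Aop G e c (Suc j) y g"
      by simp
  qed
  then show ?case ..
qed

abbreviation rlim :: "nat list \<Rightarrow> nat \<Rightarrow> int list \<Rightarrow> int list \<Rightarrow> qf" where
  "rlim \<equiv> rm (\<lambda>_. True)"

lemma eventually_local:
  assumes "local_at T g H" "\<And>h. \<forall>\<^sub>F l in F. x l h = y h"
  shows "\<forall>\<^sub>F l in F. T (x l) g = T y g"
proof -
  have "\<forall>\<^sub>F l in F. \<forall>h\<in>H. x l h = y h"
    using assms(2) local_at_finite[OF assms(1)] by (intro eventually_ball_finite) auto
  then show ?thesis
    by (rule eventually_mono) (rule local_atD[OF assms(1)], blast)
qed

lemma rm_tendsto: "\<forall>\<^sub>F l in sequentially. rm (in_range l) b n g f = rlim b n g f"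
proof (induction n arbitrary: g f)
  case (Suc n)
  show ?case
  proof (cases "g = [] \<or> f = []")
    case False
    then obtain h d f' c where gf: "g = h @ [d]" "f = f' @ [c]"
      by (metis rev_exhaust)
    have "\<exists>H. local_at (Aop (Eop b n) (b ! n) c (nat \<bar>d - c\<bar>)) h H"
      by (intro Aop_local Eop_local)
    then obtain H where "local_at (Aop (Eop b n) (b ! n) c (nat \<bar>d - c\<bar>)) h H" ..
    then have 1: "\<forall>\<^sub>F l in sequentially. Aop (Eop b n) (b ! n) c (nat \<bar>d - c\<bar>) (\<lambda>h. rm (in_range l) b n h f') h
        = Aop (Eop b n) (b ! n) c (nat \<bar>d - c\<bar>) (\<lambda>h. rlim b n h f') h"
      by (rule eventually_local) (rule Suc)
    \<comment> \<open>From this \<open>l\<close> on the range contains \<open>c\<close> and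
      \<open>d\<close>, so the restricted and the unrestricted condition \<open>moves\<close>
      agree.\<close>
    have 2: "\<forall>\<^sub>F l in sequentially. nat \<bar>c\<bar> + nat \<bar>d\<bar> \<le> l"
      by (rule eventually_ge_at_top)
    from 1 2 Suc[of h f'] show ?thesis
      by eventually_elim (auto simp: gf rm_snoc moves_def simp del: rm.simps)
  qed simp
qed simp

context
  fixes \<Theta> :: "nat \<Rightarrow> weight \<Rightarrow> falg2"
  assumes \<Theta>: "\<forall>k\<ge>1. quasi_R_matrix k (\<Theta> k)"
begin

lemma eventually_quasi_R: "\<forall>\<^sub>F l in sequentially. quasi_R l (\<Theta> l)"
proof (rule eventually_mono[OF eventually_ge_at_top[of 1]])
  fix l :: nat assume "1 \<le> l"
  then show "quasi_R l (\<Theta> l)"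
    using \<Theta> quasi_R.intro by blast
qed

lemma bar_coeff_rlim:
  assumes "length f = length b" "b \<noteq> []"
  shows "bar_coeff \<Theta> b g f = rlim b (length b) g f"
proof -
  obtain n where n: "length b = Suc n"
    using assms(2) by (cases b) auto
  have *: "\<forall>\<^sub>F l in sequentially. lookup (psi (\<Theta> l) b (length b) f) g = rlim b (length b) g f"
    using eventually_quasi_R rm_tendsto[of b "length b" g f]
  proof eventually_elim
    case (elim l)
    then show ?case
      using quasi_R.lookup_psi[OF elim(1), of f n b g] assms(1) by (simp only: n)
  qed
  have u: "r = rlim b (length b) g f" if "\<forall>\<^sub>F l in sequentially. lookup (psi (\<Theta> l) b (length b) f) g = r" for r
  proof -
    have "\<forall>\<^sub>F l in sequentially. r = rlim b (length b) g f"
      using that * by eventually_elim simp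
    then show ?thesis
      by simp
  qed
  show ?thesis
    unfolding bar_coeff_def using * u by (rule the_equality)
qed

lemma rlim_E:
  assumes "length f = Suc n"
  shows "Eop b (Suc n) a (\<lambda>h. rlim b (Suc n) h f) g = cop b (Suc n) a (rlim b (Suc n) g) f"
proof -
  obtain H where "local_at (Eop b (Suc n) a) g H"
    using Eop_local by blast
  then have 1: "\<forall>\<^sub>F l in sequentially. Eop b (Suc n) a (\<lambda>h. rm (in_range l) b (Suc n) h f) g
      = Eop b (Suc n) a (\<lambda>h. rlim b (Suc n) h f) g"
    by (rule eventually_local) (rule rm_tendsto)
  obtain H where "local_at (cop b (Suc n) a) f H"
    using cop_local by blast
  then have 2: "\<forall>\<^sub>F l in sequentially. cop b (Suc n) a (rm (in_range l) b (Suc n) g) f = cop b (Suc n) a (rlim b (Suc n) g) f"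
    by (rule eventually_local) (rule rm_tendsto)
  have 3: "\<forall>\<^sub>F l in sequentially. nat \<bar>a\<bar> + 1 \<le> l"
    by (rule eventually_ge_at_top)
  have "\<forall>\<^sub>F l::nat in sequentially. Eop b (Suc n) a (\<lambda>h. rlim b (Suc n) h f) g = cop b (Suc n) a (rlim b (Suc n) g) f"
    using eventually_quasi_R 1 2 3
  proof eventually_elim
    case (elim l)
    have "- int l \<le> a" "a \<le> int l - 1"
      using elim(4) by auto
    then show ?case
      using quasi_R.rm_E[OF elim(1) _ _ assms, of a b g] elim(2,3) by simp
  qed
  then show ?thesis
    by simp
qed

lemma rlim_involution:
  assumes f: "length f = Suc n" and H: "finite H" "\<And>h. bru b (Suc n) g h \<Longrightarrow> bru b (Suc n) h f \<Longrightarrow> h \<in> H"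
    and b: "Suc n \<le> length b" "set b \<subseteq> {0, 1}"
  shows "(\<Sum>h\<in>H. barq (rlim b (Suc n) h f) * rlim b (Suc n) g h) = of_bool (g = f)"
proof -
  have "\<forall>\<^sub>F l in sequentially. \<forall>h\<in>H. rm (in_range l) b (Suc n) h f = rlim b (Suc n) h f \<and> rm (in_range l) b (Suc n) g h = rlim b (Suc n) g h"
    using H(1) by (intro eventually_ball_finite ballI eventually_conj rm_tendsto)
  then have "\<forall>\<^sub>F l::nat in sequentially. (\<Sum>h\<in>H. barq (rlim b (Suc n) h f) * rlim b (Suc n) g h) = of_bool (g = f)"
    using eventually_quasi_R
  proof eventually_elim
    case (elim l)
    then have "(\<Sum>h\<in>H. barq (rlim b (Suc n) h f) * rlim b (Suc n) g h)
      = (\<Sum>h\<in>H. barq (rm (in_range l) b (Suc n) h f) * rm (in_range l) b (Suc n) g h)"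
      by (intro sum.cong refl) simp
    also have "\<dots> = of_bool (g = f)"
      by (rule quasi_R.rm_involution[OF elim(2) f H(1)]) (use rm_triangular[OF _ b] H(2) in blast)
    finally show ?case .
  qed
  then show ?thesis
    by simp
qed

end

section \<open>Bar-invariant bases of completions\<close>

text \<open>A description of the completion by finitely many upper bounds, stable under sums without
  normalizing a leading coefficient. \<open>le f f\<close> expresses that \<open>f\<close> belongs
  to the ordered set, here the lists of the right length.\<close>

definition bounded :: "(int list \<Rightarrow> int list \<Rightarrow> bool) \<Rightarrow> int list set \<Rightarrow> formal \<Rightarrow> bool" where
  "bounded le F x \<longleftrightarrow> finite F \<and> (\<forall>f\<in>F. le f f) \<and> (\<forall>g. x g \<noteq> 0 \<longrightarrow> (\<exists>f\<in>F. le g f))"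

lemma lower_form_basis_vec: "le f f \<Longrightarrow> lower_form le f (basis_vec f)"
  by (simp add: lower_form_def basis_vec_def)

lemma lower_form_bounded: "lower_form le f x \<Longrightarrow> bounded le {f} x"
  by (auto simp: lower_form_def bounded_def)

lemma bounded_span: "bounded le F x \<Longrightarrow> x \<in> completion le"
  unfolding completion_def
proof (induction F arbitrary: x rule: infinite_finite_induct)
  case (infinite F)
  then show ?case by (simp add: bounded_def)
next
  case empty
  then have "x = 0"
    by (auto simp: bounded_def fun_eq_iff)
  then show ?case
    by (simp only: fs.span_zero)
next
  case (insert f F)
  let ?S = "{x. \<exists>f. lower_form le f x}"
  define y where "y g = (if le g f then x g else 0)" for g
  \<comment> \<open>The part of \<open>x\<close> below \<open>f\<close> need not have coefficient 1
    at \<open>f\<close>, as \<open>lower_form\<close> demands; \<open>u\<close> has it, and a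
    multiple of \<open>basis_vec f\<close> restores the original value.\<close>
  define u where "u g = (if g = f then 1 else y g)" for g
  have le: "le f f"
    using insert.prems by (simp add: bounded_def)
  have "bounded le F (x - y)"
    using insert.prems by (auto simp: bounded_def y_def)
  then have "x - y \<in> fs.span ?S"
    by (rule insert.IH)
  moreover have "lower_form le f u"
    using le by (simp add: lower_form_def u_def y_def)
  then have "u + fscale (y f - 1) (basis_vec f) \<in> fs.span ?S"
    using lower_form_basis_vec[of le f, OF le] by (intro fs.span_add fs.span_scale fs.span_base) auto
  moreover have "u + fscale (y f - 1) (basis_vec f) = y"
    by (auto simp: u_def fscale_def basis_vec_def when_def fun_eq_iff)
  ultimately have "(x - y) + y \<in> fs.span ?S"
    by (simp only: fs.span_add)
  then show ?case
    by simp
qed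

lemma span_bounded:
  assumes refl: "\<And>g f. le g f \<Longrightarrow> le f f" and "x \<in> completion le"
  shows "\<exists>F. bounded le F x"
proof -
  have "fs.subspace {x. \<exists>F. bounded le F x}"
  proof (rule fs.subspaceI)
    show "0 \<in> {x. \<exists>F. bounded le F x}"
      by (auto simp: bounded_def intro!: exI[of _ "{}"])
    fix x y :: formal and c
    assume "x \<in> {x. \<exists>F. bounded le F x}"
    then obtain F where F: "bounded le F x" by blast
    then show "fscale c x \<in> {x. \<exists>F. bounded le F x}"
      by (auto simp: bounded_def fscale_def)
    assume "y \<in> {x. \<exists>F. bounded le F x}"
    then obtain G where G: "bounded le G y" by blast
    have "bounded le (F \<union> G) (x + y)"
      unfolding bounded_def
    proof (intro conjI allI impI)
      fix g assume "(x + y) g \<noteq> 0"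
      then have "x g \<noteq> 0 \<or> y g \<noteq> 0"
        by auto
      then show "\<exists>f\<in>F \<union> G. le g f"
        using F G by (auto simp: bounded_def)
    qed (use F G in \<open>auto simp: bounded_def\<close>)
    then show "x + y \<in> {x. \<exists>F. bounded le F x}"
      by blast
  qed
  moreover have "{x. \<exists>f. lower_form le f x} \<subseteq> {x. \<exists>F. bounded le F x}"
    using lower_form_bounded by blast
  ultimately show ?thesis
    using assms(2) fs.span_minimal[of "{x. \<exists>f. lower_form le f x}" "{x. \<exists>F. bounded le F x}"]
    unfolding completion_def by blast
qed

definition bar_of :: "(int list \<Rightarrow> int list \<Rightarrow> qf) \<Rightarrow> formal \<Rightarrow> formal" where
  "bar_of \<rho> x g = Sum_any (\<lambda>h. barq (x h) * \<rho> g h)"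

text \<open>Reflexivity is required only at lists that occur in some relation, because the Bruhat
  orders compare only lists of the length of the sequence.\<close>

locale fin_order =
  fixes le :: "int list \<Rightarrow> int list \<Rightarrow> bool"
  assumes le_trans: "le h g \<Longrightarrow> le g f \<Longrightarrow> le h f"
    and le_antisym: "le g f \<Longrightarrow> le f g \<Longrightarrow> g = f"
    and le_refl_left: "le g f \<Longrightarrow> le g g"
    and le_refl_right: "le g f \<Longrightarrow> le f f"
    and finite_interval: "finite {h. le g h \<and> le h f}"

lemma (in fin_order) interval_card:
  assumes "le g h" "g \<noteq> h" "le h f"
  shows "card {k. le h k \<and> le k f} < card {k. le g k \<and> le k f}"
proof (rule psubset_card_mono[OF finite_interval])
  have "g \<in> {k. le g k \<and> le k f}" "g \<notin> {k. le h k \<and> le k f}"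
    using assms le_refl_left le_trans le_antisym by blast+
  moreover have "{k. le h k \<and> le k f} \<subseteq> {k. le g k \<and> le k f}"
    using assms le_trans by blast
  ultimately show "{k. le h k \<and> le k f} \<subset> {k. le g k \<and> le k f}"
    by blast
qed

text \<open>The setting of Lusztig's lemma: \<open>\<rho> g f\<close> is the coefficient of the
  basis vector \<open>g\<close> in the bar image of the basis vector \<open>f\<close>.\<close>

locale bar_system = fin_order +
  fixes \<rho> :: "int list \<Rightarrow> int list \<Rightarrow> qf"
  assumes tri: "\<rho> g f \<noteq> 0 \<Longrightarrow> le g f"
    and diag: "le f f \<Longrightarrow> \<rho> f f = 1"
    and Laurent: "\<rho> g f \<in> Laurent"
    and involution: "le f f \<Longrightarrow> (\<Sum>h | le g h \<and> le h f. barq (\<rho> h f) * \<rho> g h) = of_bool (g = f)"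
begin

lemma bounded_completion: "x \<in> completion le \<longleftrightarrow> (\<exists>F. bounded le F x)"
  using bounded_span span_bounded[of le] le_refl_right by blast

lemma finite_above: "finite F \<Longrightarrow> finite {h. le g h \<and> (\<exists>f\<in>F. le h f)}"
proof -
  assume "finite F"
  then have "finite (\<Union>f\<in>F. {h. le g h \<and> le h f})"
    using finite_interval by blast
  then show ?thesis
    by (rule rev_finite_subset) blast
qed

lemma bar_of_sum:
  assumes "bounded le F x" "finite U" "{h. le g h \<and> (\<exists>f\<in>F. le h f)} \<subseteq> U"
  shows "bar_of \<rho> x g = (\<Sum>h\<in>U. barq (x h) * \<rho> g h)"
  unfolding bar_of_def
proof (rule Sum_any.expand_superset[OF assms(2)])
  show "{h. barq (x h) * \<rho> g h \<noteq> 0} \<subseteq> U"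
  proof
    fix h assume "h \<in> {h. barq (x h) * \<rho> g h \<noteq> 0}"
    then have "x h \<noteq> 0" "\<rho> g h \<noteq> 0"
      by auto
    then have "\<exists>f\<in>F. le h f" "le g h"
      using assms(1) tri unfolding bounded_def by blast+
    then show "h \<in> U"
      using assms(3) by blast
  qed
qed

lemma bounded_bar_of:
  assumes "bounded le F x"
  shows "bounded le F (bar_of \<rho> x)"
proof -
  have "\<exists>f\<in>F. le g f" if "bar_of \<rho> x g \<noteq> 0" for g
  proof -
    have "finite F"
      using assms by (simp add: bounded_def)
    then have "bar_of \<rho> x g = (\<Sum>h | le g h \<and> (\<exists>f\<in>F. le h f). barq (x h) * \<rho> g h)"
      by (intro bar_of_sum[OF assms finite_above order.refl])
    with that have "(\<Sum>h | le g h \<and> (\<exists>f\<in>F. le h f). barq (x h) * \<rho> g h) \<noteq> 0"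
      by simp
    then obtain h where "h \<in> {h. le g h \<and> (\<exists>f\<in>F. le h f)}"
      by (rule sum.not_neutral_contains_not_neutral)
    then have "le g h" "\<exists>f\<in>F. le h f"
      by auto
    then show ?thesis
      using le_trans by blast
  qed
  then show ?thesis
    using assms unfolding bounded_def by blast
qed

lemma involution':
  assumes "le k k" "finite U" "{h. le g h \<and> le h k} \<subseteq> U"
  shows "(\<Sum>h\<in>U. barq (\<rho> h k) * \<rho> g h) = of_bool (g = k)"
proof -
  have "(\<Sum>h | le g h \<and> le h k. barq (\<rho> h k) * \<rho> g h) = (\<Sum>h\<in>U. barq (\<rho> h k) * \<rho> g h)"
    using assms(2,3)
  proof (rule sum.mono_neutral_left)
    show "\<forall>h\<in>U - {h. le g h \<and> le h k}. barq (\<rho> h k) * \<rho> g h = 0"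
      using tri by fastforce
  qed
  then show ?thesis
    using involution[OF assms(1)] by simp
qed

lemma bar_of_bar_of:
  assumes "bounded le F x"
  shows "bar_of \<rho> (bar_of \<rho> x) = x"
proof
  fix g
  let ?U = "{h. le g h \<and> (\<exists>f\<in>F. le h f)}"
  have F: "finite F" and x: "\<And>g. x g \<noteq> 0 \<Longrightarrow> \<exists>f\<in>F. le g f"
    using assms by (auto simp: bounded_def)
  have U: "finite ?U"
    by (rule finite_above[OF F])
  have "bar_of \<rho> (bar_of \<rho> x) g = (\<Sum>h\<in>?U. barq (bar_of \<rho> x h) * \<rho> g h)"
    by (rule bar_of_sum[OF bounded_bar_of[OF assms] U order.refl])
  also have "\<dots> = (\<Sum>h\<in>?U. barq (\<Sum>k\<in>?U. barq (x k) * \<rho> h k) * \<rho> g h)"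
  proof (intro sum.cong refl)
    fix h assume "h \<in> ?U"
    then have "bar_of \<rho> x h = (\<Sum>k\<in>?U. barq (x k) * \<rho> h k)"
      using le_trans by (intro bar_of_sum[OF assms U]) blast
    then show "barq (bar_of \<rho> x h) * \<rho> g h = barq (\<Sum>k\<in>?U. barq (x k) * \<rho> h k) * \<rho> g h"
      by simp
  qed
  also have "\<dots> = (\<Sum>h\<in>?U. \<Sum>k\<in>?U. x k * (barq (\<rho> h k) * \<rho> g h))"
    by (simp add: barq_sum barq_mult sum_distrib_right mult.assoc)
  also have "\<dots> = (\<Sum>k\<in>?U. x k * (\<Sum>h\<in>?U. barq (\<rho> h k) * \<rho> g h))"
    by (subst sum.swap) (simp add: sum_distrib_left)
  also have "\<dots> = (\<Sum>k\<in>?U. x k * of_bool (g = k))"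
  proof (intro sum.cong refl)
    fix k assume k: "k \<in> ?U"
    have "(\<Sum>h\<in>?U. barq (\<rho> h k) * \<rho> g h) = of_bool (g = k)"
      using k le_refl_left le_trans by (intro involution'[OF _ U]) blast+
    then show "x k * (\<Sum>h\<in>?U. barq (\<rho> h k) * \<rho> g h) = x k * of_bool (g = k)"
      by simp
  qed
  also have "\<dots> = (if g \<in> ?U then x g else 0)"
    using U by (simp add: of_bool_def if_distrib cong: if_cong)
  also have "\<dots> = x g"
  proof -
    have "x g = 0 \<or> g \<in> ?U"
      using x[of g] le_refl_left by blast
    then show ?thesis
      by auto
  qed
  finally show "bar_of \<rho> (bar_of \<rho> x) g = x g" .
qed

definition canonical :: "int list \<Rightarrow> formal \<Rightarrow> bool" where
  "canonical f x \<longleftrightarrow> lower_form le f x \<and> (\<forall>g. g \<noteq> f \<longrightarrow> x g \<in> qinv_Z_qinv) \<and> bar_of \<rho> x = x"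

text \<open>Going down from \<open>f\<close>, suppose both elements agree strictly between
  \<open>g\<close> and \<open>f\<close> and at \<open>f\<close>. Bar invariance then makes their
  difference at \<open>g\<close> invariant under \<open>barq\<close>, while it has only negative
  exponents; hence it is 0.\<close>

lemma canonical_unique:
  assumes "canonical f x" "canonical f y"
  shows "x = y"
proof -
  have lf: "lower_form le f x" "lower_form le f y"
    and q: "\<And>g. g \<noteq> f \<Longrightarrow> x g \<in> qinv_Z_qinv" "\<And>g. g \<noteq> f \<Longrightarrow> y g \<in> qinv_Z_qinv"
    and bx: "bar_of \<rho> x = x" "bar_of \<rho> y = y"
    using assms by (simp_all add: canonical_def)
  then have le: "le f f"
    by (simp add: lower_form_def)
  have below: "x g = y g" if "le g f" for g
    using that
  proof (induction "card {h. le g h \<and> le h f}" arbitrary: g rule: less_induct)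
    case less
    show ?case
    proof (cases "g = f")
      case True
      then show ?thesis
        using lf by (simp add: lower_form_def)
    next
      case False
      let ?U = "{h. le g h \<and> le h f}"
      have gU: "g \<in> ?U"
        using less.prems le_refl_left by blast
      have sum: "z g = barq (z g) + (\<Sum>h\<in>?U - {g}. barq (z h) * \<rho> g h)" if "lower_form le f z" "bar_of \<rho> z = z" for z
      proof -
        have "z g = (\<Sum>h\<in>?U. barq (z h) * \<rho> g h)"
          using bar_of_sum[OF lower_form_bounded[OF that(1)] finite_interval[of g f]] that(2) by simp
        also have "\<dots> = barq (z g) * \<rho> g g + (\<Sum>h\<in>?U - {g}. barq (z h) * \<rho> g h)"
          using gU by (rule sum.remove[OF finite_interval])
        finally show ?thesis
          using gU by (simp add: diag)
      qed
      have "x h = y h" if "h \<in> ?U - {g}" for h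
      proof -
        have h: "le g h" "g \<noteq> h" "le h f"
          using that by auto
        show ?thesis
          by (rule less.hyps[OF interval_card[OF h] h(3)])
      qed
      then have eq: "(\<Sum>h\<in>?U - {g}. barq (x h) * \<rho> g h) = (\<Sum>h\<in>?U - {g}. barq (y h) * \<rho> g h)"
        by (intro sum.cong) auto
      have diff: "a = c + b \<Longrightarrow> a - c = (b :: qf)" for a b c
        by simp
      have "x g - barq (x g) = y g - barq (y g)"
        unfolding diff[OF sum[OF lf(1) bx(1)]] diff[OF sum[OF lf(2) bx(2)]] by (rule eq)
      then have "x g - y g = barq (x g) - barq (y g)"
        by (simp add: algebra_simps)
      then have "barq (x g - y g) = x g - y g"
        by (simp add: barq_diff)
      moreover have "x g - y g \<in> qinv_Z_qinv"
        using q[OF False] by blast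
      ultimately have "x g - y g = 0"
        using qinv_bar_invariant by blast
      then show ?thesis
        by simp
    qed
  qed
  show ?thesis
  proof
    fix g
    show "x g = y g"
    proof (cases "le g f")
      case False
      then have "x g = 0" "y g = 0"
        using lf unfolding lower_form_def by blast+
      then show ?thesis
        by simp
    qed (rule below)
  qed
qed

text \<open>A solution of \<open>z = y - barq y\<close> with only negative exponents. Bar invariance
  at \<open>g\<close> is this equation for the coefficient \<open>y\<close> at \<open>g\<close>,
  with \<open>z\<close> the contribution of the indices above \<open>g\<close>.\<close>

definition neg_part :: "qf \<Rightarrow> qf" where
  "neg_part z = (SOME y. y \<in> qinv_Z_qinv \<and> z = y - barq y)"

function canon :: "int list \<Rightarrow> int list \<Rightarrow> qf" where
  "canon f g = (if g = f then 1 else if le g f then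
     neg_part (\<Sum>h\<in>{h. le g h \<and> le h f} - {g}. barq (canon f h) * \<rho> g h) else 0)"
  by auto
termination
proof (relation "measure (\<lambda>(f, g). card {h. le g h \<and> le h f})")
  fix f g h
  assume "g \<noteq> f" "le g f" "h \<in> {h. le g h \<and> le h f} - {g}"
  then show "((f, h), (f, g)) \<in> measure (\<lambda>(f, g). card {h. le g h \<and> le h f})"
    using interval_card[of g h f] by auto
qed simp

declare canon.simps [simp del]

text \<open>The equation for the coefficient at \<open>g\<close> is solvable because its right-hand
  side \<open>Z\<close> satisfies \<open>barq Z = - Z\<close>; this follows from the invariance
  already reached above \<open>g\<close> and the involutivity of \<open>\<rho>\<close>.\<close>

lemma canon_properties:
  assumes le: "le f f" and "le g f"
  shows "(g \<noteq> f \<longrightarrow> canon f g \<in> qinv_Z_qinv) \<and>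
    canon f g = (\<Sum>h | le g h \<and> le h f. barq (canon f h) * \<rho> g h)"
  using assms(2)
proof (induction "card {h. le g h \<and> le h f}" arbitrary: g rule: less_induct)
  case less
  let ?x = "canon f"
  let ?U = "{h. le g h \<and> le h f}"
  have gU: "g \<in> ?U"
    using less.prems le_refl_left by blast
  have sum: "(\<Sum>h\<in>?U. barq (?x h) * \<rho> g h) = barq (?x g) + (\<Sum>h\<in>?U - {g}. barq (?x h) * \<rho> g h)"
    using gU sum.remove[OF finite_interval gU, of "\<lambda>h. barq (?x h) * \<rho> g h"] by (simp add: diag)
  show ?case
  proof (cases "g = f")
    case True
    have U: "?U - {g} = {}"
      using True le_antisym by blast
    show ?thesis
      unfolding sum U using True by (simp add: canon.simps[of f f])
  next
    case False
    define I where "I = ?U - {g}"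
    have I: "finite I"
      by (simp add: I_def finite_interval)
    have gI: "g \<notin> I"
      by (simp add: I_def)
    define Z where "Z = (\<Sum>h\<in>I. barq (?x h) * \<rho> g h)"
    have IH: "h \<noteq> f \<longrightarrow> ?x h \<in> qinv_Z_qinv" "?x h = (\<Sum>k\<in>I. barq (?x k) * \<rho> h k)" if "h \<in> I" for h
    proof -
      have h: "le g h" "h \<noteq> g" "le h f"
        using that by (auto simp: I_def)
      note IH = less.hyps[OF interval_card[OF h(1) h(2)[symmetric] h(3)] h(3)]
      show "h \<noteq> f \<longrightarrow> ?x h \<in> qinv_Z_qinv"
        using IH by blast
      have "(\<Sum>k | le h k \<and> le k f. barq (?x k) * \<rho> h k) = (\<Sum>k\<in>I. barq (?x k) * \<rho> h k)"
      proof (rule sum.mono_neutral_left[OF I])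
        show "{k. le h k \<and> le k f} \<subseteq> I"
        proof
          fix k assume "k \<in> {k. le h k \<and> le k f}"
          then show "k \<in> I"
            using le_trans[OF h(1), of k] le_antisym[OF h(1)] h(2) by (auto simp: I_def)
        qed
        show "\<forall>k\<in>I - {k. le h k \<and> le k f}. barq (?x k) * \<rho> h k = 0"
          using tri[of h] by (fastforce simp: I_def)
      qed
      then show "?x h = (\<Sum>k\<in>I. barq (?x k) * \<rho> h k)"
        using IH by simp
    qed
    have xL: "?x h \<in> Laurent" if "h \<in> I" for h
      using IH(1)[OF that] qinv_Laurent by (cases "h = f") (auto simp: canon.simps[of f f])
    have "Z \<in> Laurent"
      unfolding Z_def using xL Laurent by (intro Laurent_sum Laurent_mult Laurent_barq)
    moreover have "barq Z = - Z"
    proof -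
      \<comment> \<open>Involutivity at \<open>(g, k)\<close> with the summand \<open>h = g\<close>
        isolated, after applying \<open>barq\<close>.\<close>
      have inner: "(\<Sum>h\<in>I. \<rho> h k * barq (\<rho> g h)) = - \<rho> g k" if k: "k \<in> I" for k
      proof -
        have k': "le g k" "k \<noteq> g" "le k f"
          using k by (auto simp: I_def)
        have "(\<Sum>h\<in>insert g I. barq (\<rho> h k) * \<rho> g h) = of_bool (g = k)"
        proof (rule involution'[OF le_refl_right[OF k'(1)]])
          show "{h. le g h \<and> le h k} \<subseteq> insert g I"
            using le_trans[OF _ k'(3)] by (auto simp: I_def)
        qed (simp add: I)
        then have "barq (\<rho> g k) * \<rho> g g + (\<Sum>h\<in>I. barq (\<rho> h k) * \<rho> g h) = 0"
          using I k'(2) gI by simp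
        then have "barq (barq (\<rho> g k) * \<rho> g g + (\<Sum>h\<in>I. barq (\<rho> h k) * \<rho> g h)) = 0"
          by simp
        then show ?thesis
          using gU by (simp add: diag barq_add barq_mult barq_sum eq_neg_iff_add_eq_0 add.commute)
      qed
      have "barq Z = (\<Sum>h\<in>I. ?x h * barq (\<rho> g h))"
        by (simp add: Z_def barq_sum barq_mult)
      also have "\<dots> = (\<Sum>h\<in>I. (\<Sum>k\<in>I. barq (?x k) * \<rho> h k) * barq (\<rho> g h))"
        using IH(2) by (intro sum.cong refl) simp
      also have "\<dots> = (\<Sum>h\<in>I. \<Sum>k\<in>I. barq (?x k) * (\<rho> h k * barq (\<rho> g h)))"
        by (simp add: sum_distrib_right mult.assoc)
      also have "\<dots> = (\<Sum>k\<in>I. barq (?x k) * (\<Sum>h\<in>I. \<rho> h k * barq (\<rho> g h)))"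
        by (subst sum.swap) (simp add: sum_distrib_left)
      also have "\<dots> = (\<Sum>k\<in>I. - (barq (?x k) * \<rho> g k))"
        by (intro sum.cong refl) (simp add: inner)
      also have "\<dots> = - Z"
        by (simp add: Z_def sum_negf)
      finally show ?thesis .
    qed
    ultimately have "\<exists>y. y \<in> qinv_Z_qinv \<and> Z = y - barq y"
      using qinv_split by blast
    then have "neg_part Z \<in> qinv_Z_qinv \<and> Z = neg_part Z - barq (neg_part Z)"
      unfolding neg_part_def by (rule someI_ex)
    moreover have "?x g = neg_part Z"
      using False less.prems by (simp add: canon.simps[of f g] Z_def I_def)
    ultimately show ?thesis
      unfolding sum using False by (simp flip: I_def Z_def)
  qed
qed

lemma canonical_exists:
  assumes "le f f"
  shows "canonical f (canon f)"
proof -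
  have lf: "lower_form le f (canon f)"
    using assms by (auto simp: lower_form_def canon.simps[of f] split: if_splits)
  have "bar_of \<rho> (canon f) g = canon f g" for g
  proof (cases "le g f")
    case True
    then show ?thesis
      using bar_of_sum[OF lower_form_bounded[OF lf] finite_interval[of g f]] canon_properties[OF assms True] by simp
  next
    case False
    then have "{h. le g h \<and> (\<exists>f'\<in>{f}. le h f')} \<subseteq> {}"
      using le_trans by blast
    then show ?thesis
      using bar_of_sum[OF lower_form_bounded[OF lf] finite.emptyI] False assms by (auto simp: canon.simps[of f g])
  qed
  moreover have "canon f g \<in> qinv_Z_qinv" if "g \<noteq> f" for g
    using canon_properties[OF assms, of g] that by (cases "le g f") (auto simp: canon.simps[of f g])
  ultimately show ?thesis
    using lf by (auto simp: canonical_def)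
qed

end

section \<open>Eventually vanishing geometric sums\<close>

definition ev0 :: "(nat \<Rightarrow> qf) \<Rightarrow> bool" where
  "ev0 u \<longleftrightarrow> (\<forall>\<^sub>F k in sequentially. u k = 0)"

text \<open>Sums along chains of equal pairs. The ratio \<open>- inverse qq\<close> expands the N_f
  in the M_h, and \<open>- qq\<close> is its barred counterpart. The definition is used where only
  finitely many terms are nonzero.\<close>

definition geo :: "qf \<Rightarrow> (nat \<Rightarrow> qf) \<Rightarrow> qf" where
  "geo c u = Sum_any (\<lambda>k. c ^ k * u k)"

lemma ev0_iff: "ev0 u \<longleftrightarrow> (\<exists>K. \<forall>k\<ge>K. u k = 0)"
  by (simp add: ev0_def eventually_sequentially)

lemma geo_sum: "\<forall>k\<ge>K. u k = 0 \<Longrightarrow> geo c u = (\<Sum>k<K. c ^ k * u k)"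
  unfolding geo_def by (rule Sum_any.expand_superset) (auto intro: ccontr simp: not_less)

lemma geo_Suc:
  assumes "ev0 u"
  shows "geo c u = u 0 + c * geo c (\<lambda>k. u (Suc k))"
proof -
  obtain K where K: "\<forall>k\<ge>K. u k = 0"
    using assms unfolding ev0_iff by blast
  have "geo c u = (\<Sum>k<Suc K. c ^ k * u k)"
    using K by (intro geo_sum) simp
  also have "\<dots> = u 0 + (\<Sum>k<K. c ^ Suc k * u (Suc k))"
    unfolding sum.lessThan_Suc_shift by simp
  also have "(\<Sum>k<K. c ^ Suc k * u (Suc k)) = c * (\<Sum>k<K. c ^ k * u (Suc k))"
    unfolding sum_distrib_left by (intro sum.cong refl) simp
  also have "(\<Sum>k<K. c ^ k * u (Suc k)) = geo c (\<lambda>k. u (Suc k))"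
    using K by (intro geo_sum[symmetric]) simp
  finally show ?thesis .
qed

lemma ev0_add: "ev0 u \<Longrightarrow> ev0 v \<Longrightarrow> ev0 (\<lambda>k. u k + v k)"
  unfolding ev0_def by (erule (1) eventually_elim2) simp

lemma ev0_scale: "ev0 u \<Longrightarrow> ev0 (\<lambda>k. r * u k)"
  unfolding ev0_def by (erule eventually_mono) simp

lemma ev0_0: "ev0 (\<lambda>k. 0)"
  by (simp add: ev0_def)

lemma ev0_Suc: "ev0 u \<Longrightarrow> ev0 (\<lambda>k. u (Suc k))"
  unfolding ev0_iff using le_SucI by blast

lemma geo_add: "ev0 u \<Longrightarrow> ev0 v \<Longrightarrow> geo c (\<lambda>k. u k + v k) = geo c u + geo c v"
proof -
  assume "ev0 u" "ev0 v"
  then obtain K L where K: "\<forall>k\<ge>K. u k = 0" "\<forall>k\<ge>L. v k = 0"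
    unfolding ev0_iff by blast
  then show ?thesis
    by (simp add: geo_sum[of "max K L"] sum.distrib distrib_left)
qed

lemma geo_scale: "ev0 u \<Longrightarrow> geo c (\<lambda>k. r * u k) = r * geo c u"
proof -
  assume "ev0 u"
  then obtain K where K: "\<forall>k\<ge>K. u k = 0"
    unfolding ev0_iff by blast
  then show ?thesis
    by (simp add: geo_sum[of K] sum_distrib_left mult_ac)
qed

lemma geo_0 [simp]: "geo c (\<lambda>k. 0) = 0"
  by (simp add: geo_def)

lemma geo_nonzero: "geo c u \<noteq> 0 \<Longrightarrow> \<exists>k. u k \<noteq> 0"
proof (rule ccontr)
  assume *: "geo c u \<noteq> 0" "\<nexists>k. u k \<noteq> 0"
  then have "u = (\<lambda>k. 0)"
    by auto
  with * show False
    by simp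
qed

text \<open>Only finitely many inputs matter at \<open>g\<close>, and along each of them the chain
  vanishes eventually; so the sum can be cut off at a common \<open>K\<close> and \<open>T\<close>
  is applied to a finite sum.\<close>

lemma geo_local:
  assumes T: "local_at T g H" and sum: "\<And>A v w. T (\<lambda>h. \<Sum>k\<in>(A::nat set). v k * w k h) g = (\<Sum>k\<in>A. v k * T (w k) g)"
    and u: "\<And>h. ev0 (\<lambda>k. u k h)"
  shows "T (\<lambda>h. geo c (\<lambda>k. u k h)) g = geo c (\<lambda>k. T (u k) g)" "ev0 (\<lambda>k. T (u k) g)"
proof -
  have "\<forall>\<^sub>F k in sequentially. \<forall>h\<in>H. u k h = 0"
    using u local_at_finite[OF T] by (intro eventually_ball_finite) (auto simp: ev0_def)
  then obtain K where K: "\<And>k h. K \<le> k \<Longrightarrow> h \<in> H \<Longrightarrow> u k h = 0"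
    by (auto simp: eventually_sequentially)
  have T0: "T (\<lambda>_. 0) g = 0"
    using sum[where A = "{}"] by simp
  have Tu: "T (u k) g = 0" if "K \<le> k" for k
    using local_atD[OF T, of "u k" "\<lambda>_. 0"] K[OF that] T0 by simp
  then show "ev0 (\<lambda>k. T (u k) g)"
    unfolding ev0_iff by blast
  have "T (\<lambda>h. geo c (\<lambda>k. u k h)) g = T (\<lambda>h. \<Sum>k<K. c ^ k * u k h) g"
    by (rule local_atD[OF T], rule geo_sum) (use K in auto)
  also have "\<dots> = (\<Sum>k<K. c ^ k * T (u k) g)"
    by (rule sum)
  also have "\<dots> = geo c (\<lambda>k. T (u k) g)"
    by (rule geo_sum[symmetric]) (use Tu in auto)
  finally show "T (\<lambda>h. geo c (\<lambda>k. u k h)) g = geo c (\<lambda>k. T (u k) g)" .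
qed

text \<open>Iteration gives \<open>u 0 = r ^ k * u k\<close> for every \<open>k\<close>. This is the
  telescoping that carries an identity from the M_f to the N_f.\<close>

lemma ev0_recursion:
  assumes "\<And>k. u k = r * u (Suc k)" "ev0 u"
  shows "u 0 = 0"
proof -
  have "u 0 = r ^ k * u k" for k
  proof (induction k)
    case (Suc k)
    then show ?case
      using assms(1)[of k] by simp
  qed simp
  note 1 = this
  obtain k where "u k = 0"
    using assms(2) unfolding ev0_iff by blast
  then show ?thesis
    using 1[of k] by simp
qed

section \<open>Commutant of the raising operators on the adjacent pair\<close>

text \<open>\<open>Nrow\<close> and \<open>Ncol\<close> are the matrix of \<open>E\<^sub>a\<close> on \<open>X \<otimes> \<bbbL>\<close> and its transpose with barred
  coefficients. The formulas come from \<open>E\<^sub>a N\<^bsub>cc\<^esub> = \<delta>\<^bsub>ac\<^esub> N\<^bsub>a,a+1\<^esub>\<close> and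
  \<open>E\<^sub>a N\<^bsub>a+1,a\<^esub> = N\<^bsub>a+1,a+1\<^esub> + (q + q\<inverse>) N\<^bsub>aa\<^esub> + N\<^bsub>a-1,a-1\<^esub>\<close>.\<close>

type_synonym pairf = "int list \<Rightarrow> int \<Rightarrow> int \<Rightarrow> qf"

definition row0 :: "int \<Rightarrow> (int \<Rightarrow> int \<Rightarrow> qf) \<Rightarrow> int \<Rightarrow> int \<Rightarrow> qf" where
  "row0 a y c d = (if c = d then (if c = a + 1 \<or> c = a - 1 then y (a + 1) a
       else if c = a then (qq + inverse qq) * y (a + 1) a else 0)
     else (if d = a + 1 then y c a else 0) + (if c = a \<and> d \<noteq> a + 1 then y (a + 1) d else 0))"

definition col0 :: "int \<Rightarrow> (int \<Rightarrow> int \<Rightarrow> qf) \<Rightarrow> int \<Rightarrow> int \<Rightarrow> qf" where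
  "col0 a y c d = (if c = d then (if c = a then y a (a + 1) else 0)
     else if c = a + 1 \<and> d = a then y (a + 1) (a + 1) + (qq + inverse qq) * y a a + y (a - 1) (a - 1)
     else (if d = a then y c (a + 1) else 0) + (if c = a + 1 then y a d else 0))"

text \<open>The exponent by which K_{a+1} times the inverse of K_a scales the weight space of v_c
  and w_d. It is 0 for \<open>c = d\<close>, consistently with the equal pairs in one N_cc having a
  common weight.\<close>

definition kap :: "int \<Rightarrow> int \<Rightarrow> int \<Rightarrow> int" where
  "kap a c d = of_bool (c = a + 1) - of_bool (c = a) + of_bool (d = a) - of_bool (d = a + 1)"

definition Nrow :: "int \<Rightarrow> (formal \<Rightarrow> formal) \<Rightarrow> pairf \<Rightarrow> pairf" where
  "Nrow a E y g c d = row0 a (y g) c d + qq powi kap a c d * E (\<lambda>h. y h c d) g"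

definition Ncol :: "int \<Rightarrow> (formal \<Rightarrow> formal) \<Rightarrow> pairf \<Rightarrow> pairf" where
  "Ncol a E y f c d = col0 a (y f) c d + qq powi - kap a c d * E (\<lambda>h. y h c d) f"

lemma qq_plus_inverse_nonzero: "qq + inverse qq \<noteq> 0"
proof
  assume "qq + inverse qq = 0"
  then have "lau (Poly_Mapping.single 1 1 + Poly_Mapping.single (-1) 1) = 0"
    by (simp add: lau_add lau_single power_int_minus)
  then have "lookup (Poly_Mapping.single (1::int) 1 + Poly_Mapping.single (-1) 1) 1 = (0::int)"
    by (simp only: lau_eq_0_iff lookup_zero)
  then show False
    by (simp add: lookup_add lookup_single)
qed

text \<open>A map that commutes with all \<open>E\<^sub>a\<close> and lowers the height \<open>d - c\<close> of weights by \<open>h \<ge> 1\<close>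
  vanishes, because \<open>\<bbbL>\<close> contains no vector that is killed by all \<open>E\<^sub>a\<close>.\<close>

lemma commutant:
  fixes \<Delta> :: "int \<Rightarrow> int \<Rightarrow> int \<Rightarrow> int \<Rightarrow> qf"
  assumes "h \<ge> 1"
    and eq: "\<And>a x y c d. (d - c) - (y - x) = h - 1 \<Longrightarrow>
      row0 a (\<lambda>x y. \<Delta> x y c d) x y = col0 a (\<lambda>c d. \<Delta> x y c d) c d"
    and height: "(d - c) - (y - x) = h"
  shows "\<Delta> x y c d = 0"
proof -
  \<comment> \<open>If \<open>a\<close> is neither \<open>c - 1\<close> nor \<open>d\<close>, then
    E_a kills N_cd and hence its image. On vectors N_xy with \<open>x \<noteq> y\<close> that
    satisfy \<open>x = a + 1\<close> or \<open>y = a\<close>, the operator E_a detects the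
    coefficient, which must therefore vanish.\<close>
  have off: "\<Delta> x y c d = 0"
    if "x \<noteq> y" "a = x - 1 \<or> a = y" "a \<noteq> c - 1" "a \<noteq> d" "(d - c) - (y - x) = h" for a x y c d
  proof -
    have col: "col0 a z c d = 0" for z
      using that by (auto simp: col0_def)
    have "x = a + 1 \<or> y = a"
      using that(2) by auto
    then consider "x = a + 1" "y = a" | "x = a + 1" "y \<noteq> a" | "y = a" "x \<noteq> a + 1"
      by blast
    then show ?thesis
    proof cases
      case 1
      then show ?thesis
        using eq[of d c a a a] that col qq_plus_inverse_nonzero by (simp add: row0_def)
    next
      case 2
      then show ?thesis
        using eq[of d c y a a] that col by (simp add: row0_def)
    next
      case 3
      then show ?thesis
        using eq[of d c "a + 1" x a] that col by (simp add: row0_def)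
    qed
  qed
  \<comment> \<open>The coefficient of N_ee in the image is visible after applying E_e, as the
    coefficient of N_{e,e+1}.\<close>
  have zero: "\<Delta> e e c d = col0 e (\<lambda>c d. \<Delta> e (e + 1) c d) c d" if "d - c = h" for e c d
    using eq[of d c "e + 1" e e] that by (simp add: row0_def)
  have zero': "\<Delta> e e c d = 0" if "d - c = h" "e \<noteq> c - 1" "e \<noteq> d" for e c d
    using zero[OF that(1)] that \<open>h \<ge> 1\<close> by (auto simp: col0_def)
  show ?thesis
  proof (cases "x = y")
    case True
    then have h: "d - c = h" "c < d"
      using height \<open>h \<ge> 1\<close> by auto
    consider "x = c - 1" | "x = d" | "x \<noteq> c - 1" "x \<noteq> d"
      by blast
    then show ?thesis
    proof cases
      case 1
      have "\<Delta> (c - 1) c (c - 1) d = 0"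
        using h by (intro off[where a = c]) auto
      then show ?thesis
        using zero[OF h(1), of x] h True 1 by (auto simp: col0_def)
    next
      case 2
      have "\<Delta> d (d + 1) c (d + 1) = 0"
        using h by (intro off[where a = "d - 1"]) auto
      then show ?thesis
        using zero[OF h(1), of x] h True 2 by (auto simp: col0_def)
    next
      case 3
      then show ?thesis
        using zero'[OF h(1)] True by simp
    qed
  next
    case False
    show ?thesis
    proof (cases "(x - 1 = c - 1 \<or> x - 1 = d) \<and> (y = c - 1 \<or> y = d)")
      case False
      then show ?thesis
        using off[of x y "x - 1"] off[of x y y] \<open>x \<noteq> y\<close> height by blast
    next
      case True
      \<comment> \<open>In these remaining positions both candidates for \<open>a\<close> meet N_cd.
        With the value chosen below, E_a N_cd is zero or a single N, whose coefficient is already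
        known to vanish.\<close>
      then consider "x = c" "y = c - 1" | "x = d + 1" "y = d" | "x = d + 1" "y = c - 1"
        using height \<open>h \<ge> 1\<close> by force
      then show ?thesis
      proof cases
        case 1
        then have cd: "c \<le> d"
          using height \<open>h \<ge> 1\<close> by auto
        have "c \<noteq> d \<Longrightarrow> \<Delta> c c (c - 1) d = 0"
          using 1 height cd by (intro zero') auto
        then show ?thesis
          using eq[of d c c c "c - 1"] 1 height cd by (auto simp: row0_def col0_def split: if_splits)
      next
        case 2
        then have cd: "c \<le> d"
          using height \<open>h \<ge> 1\<close> by auto
        have "\<Delta> d d c (d + 1) = 0"
          using 2 height cd by (intro zero') auto
        then show ?thesis
          using eq[of d c d d d] 2 height cd qq_plus_inverse_nonzero by (auto simp: row0_def col0_def split: if_splits)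
      next
        case 3
        then have cd: "c \<le> d"
          using height \<open>h \<ge> 1\<close> by auto
        have "c \<noteq> d \<Longrightarrow> \<Delta> (d + 1) c (c - 1) d = 0"
          using 3 height cd by (intro off[where a = c]) auto
        then show ?thesis
          using eq[of d c c "d + 1" "c - 1"] 3 height cd by (auto simp: row0_def col0_def split: if_splits)
      qed
    qed
  qed
qed

lemma row0_add: "row0 a (\<lambda>x y. u x y - v x y) c d = row0 a u c d - row0 a v c d"
  and col0_add: "col0 a (\<lambda>x y. u x y - v x y) c d = col0 a u c d - col0 a v c d"
  by (auto simp: row0_def col0_def algebra_simps)

text \<open>\<open>R g x y f c d\<close> stands for the coefficient of \<open>g\<close> tensor N_xy
  in the bar image of \<open>f\<close> tensor N_cd. \<open>level\<close> exempts the entries between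
  two equal pairs: these have height 0 and are recovered from the commutation.\<close>

locale pair_system =
  fixes E Ec :: "int \<Rightarrow> formal \<Rightarrow> formal" and r :: "int list \<Rightarrow> int list \<Rightarrow> qf"
    and R :: "int list \<Rightarrow> int \<Rightarrow> int \<Rightarrow> int list \<Rightarrow> int \<Rightarrow> int \<Rightarrow> qf"
  assumes E0: "E a (\<lambda>_. 0) g = 0" and Ec0: "Ec a (\<lambda>_. 0) g = 0"
    and low: "(d - c) - (y - x) < 0 \<Longrightarrow> R g x y f c d = 0"
    and level: "(d - c) - (y - x) = 0 \<Longrightarrow> \<not> (x = c \<and> y = d) \<Longrightarrow> \<not> (x = y \<and> c = d) \<Longrightarrow> R g x y f c d = 0"
    and diag: "c \<noteq> d \<Longrightarrow> R g c d f c d = r g f"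
    and commute: "Nrow a (E a) (\<lambda>g x y. R g x y f c d) g x y = Ncol a (Ec a) (\<lambda>f c d. R g x y f c d) f c d"
begin

text \<open>Commutation with E_x, read at N_{x,x+1}. On the left E_x sends N_xx there; on the right
  E_x N_cc is zero unless \<open>c = x\<close>, when a diagonal entry appears. All terms from the
  first factors have negative height difference.\<close>

lemma zero_level: "R g x x f c c = (if x = c then r g f else 0)"
  using commute[of x f c c g x "x + 1"] low E0 Ec0 diag
  by (auto simp: Nrow_def Ncol_def row0_def col0_def)

end

text \<open>The difference \<open>D\<close> of two solutions vanishes for height differences at most
  0. When it vanishes at height difference \<open>h - 1\<close>, the contribution of the first
  factors to the commutation drops out there, and what remains is the hypothesis of
  \<open>commutant\<close> for \<open>h\<close>.\<close>

lemma pair_system_unique: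
  assumes R1: "pair_system E Ec r R1" and R2: "pair_system E Ec r R2"
    and E: "\<And>a x y g. E a (\<lambda>f. x f - y f) g = E a x g - E a y g"
    and Ec: "\<And>a x y g. Ec a (\<lambda>f. x f - y f) g = Ec a x g - Ec a y g"
  shows "R1 g x y f c d = R2 g x y f c d"
proof -
  interpret R1: pair_system E Ec r R1 by fact
  interpret R2: pair_system E Ec r R2 by fact
  define D where "D g x y f c d = R1 g x y f c d - R2 g x y f c d" for g x y f c d
  have commute: "Nrow a (E a) (\<lambda>g x y. D g x y f c d) g x y = Ncol a (Ec a) (\<lambda>f c d. D g x y f c d) f c d" for a g x y f c d
    using R1.commute[of a f c d g x y] R2.commute[of a f c d g x y]
    unfolding Nrow_def Ncol_def D_def row0_add col0_add E Ec
    by (simp add: algebra_simps)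
  have base: "D g x y f c d = 0" if "(d - c) - (y - x) \<le> 0" for g x y f c d
  proof (cases "(d - c) - (y - x) = 0")
    case True
    consider "x = c" "y = d" "c \<noteq> d" | "x = y" "c = d" | "\<not> (x = c \<and> y = d)" "\<not> (x = y \<and> c = d)"
      by auto
    then show ?thesis
      by cases (simp_all add: D_def R1.diag R2.diag R1.zero_level R2.zero_level R1.level[OF True] R2.level[OF True])
  next
    case False
    then show ?thesis
      using that by (simp add: D_def R1.low R2.low)
  qed
  have "D g x y f c d = 0" if "(d - c) - (y - x) = int h" for h g x y f c d
    using that
  proof (induction h arbitrary: g x y f c d rule: less_induct)
    case (less h)
    show ?case
    proof (cases "h = 0")
      case True
      then show ?thesis
        using less.prems by (intro base) auto
    next
      case False
      have IH: "D g x y f c d = 0" if "(d - c) - (y - x) = int h - 1" for g x y f c d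
        using less.IH[of "h - 1"] that False by auto
      have "row0 a (\<lambda>x y. D g x y f c d) x y = col0 a (\<lambda>c d. D g x y f c d) c d"
        if "(d - c) - (y - x) = int h - 1" for a x y c d
        using commute[of a f c d g x y] IH[OF that] by (simp add: Nrow_def Ncol_def R1.E0 R1.Ec0)
      then show ?thesis
        using False less.prems by (intro commutant[of "int h" "\<lambda>x y c d. D g x y f c d"]) auto
    qed
  qed
  from this[where h = "nat ((d - c) - (y - x))"] have "D g x y f c d = 0"
    using base by (cases "(d - c) - (y - x) \<le> 0") auto
  then show ?thesis
    by (simp add: D_def)
qed

section \<open>Comparison of the bar maps for adjacent sequences\<close>

lemma gop_cong_b: "(\<And>i. i < n \<Longrightarrow> b ! i = b' ! i) \<Longrightarrow> gop b n = gop b' n"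
proof (induction n)
  case (Suc n)
  then have "gop b n = gop b' n" "b ! n = b' ! n"
    by auto
  then show ?case
    by (simp only: gop.simps(2))
qed simp

lemma cop_cong_b: "(\<And>i. i < n \<Longrightarrow> b ! i = b' ! i) \<Longrightarrow> cop b n = cop b' n"
proof (induction n)
  case (Suc n)
  then have "cop b n = cop b' n" "b ! n = b' ! n"
    by auto
  then show ?case
    by (simp add: fun_eq_iff)
qed (simp add: fun_eq_iff)

lemma rm_cong_b: "(\<And>i. i < n \<Longrightarrow> b ! i = b' ! i) \<Longrightarrow> rm S b n = rm S b' n"
proof (induction n)
  case (Suc n)
  then have "rm S b n = rm S b' n" "b ! n = b' ! n" "gop b n = gop b' n"
    by (auto intro!: gop_cong_b)
  then show ?case
    by (intro ext) (simp only: rm.simps(2))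
qed (simp add: fun_eq_iff)

section \<open>Chains of equal pairs\<close>

definition shift :: "nat \<Rightarrow> int \<Rightarrow> int list \<Rightarrow> int list" where
  "shift \<kappa> k f = f[\<kappa> := f ! \<kappa> + k, Suc \<kappa> := f ! Suc \<kappa> + k]"

abbreviation eqk :: "nat \<Rightarrow> int list \<Rightarrow> bool" where
  "eqk \<kappa> f \<equiv> f ! \<kappa> = f ! Suc \<kappa>"

lemma up_shift: "up \<kappa> = shift \<kappa> 1" and down_shift: "down \<kappa> = shift \<kappa> (- 1)"
  by (auto simp: fun_eq_iff up_def down_def shift_def)

lemma split_pair: "Suc \<kappa> < length f \<Longrightarrow> \<exists>g c d r. f = g @ c # d # r \<and> length g = \<kappa>"
  by (intro exI[of _ "take \<kappa> f"] exI[of _ "f ! \<kappa>"] exI[of _ "f ! Suc \<kappa>"] exI[of _ "drop (Suc (Suc \<kappa>)) f"])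
    (simp add: Cons_nth_drop_Suc id_take_nth_drop[symmetric] Suc_lessD flip: id_take_nth_drop)

context
  fixes g :: "int list" and \<kappa> :: nat
  assumes g: "length g = \<kappa>"
begin

lemma shift_pair: "shift \<kappa> k (g @ c # d # r) = g @ (c + k) # (d + k) # r"
  and eqk_pair: "eqk \<kappa> (g @ c # d # r) \<longleftrightarrow> c = d"
  and fL_pair: "fL \<kappa> (g @ c # d # r) = (if c = d then g @ (c + 1) # (d + 1) # r else g @ d # c # r)"
  and fU_pair: "fU \<kappa> (g @ c # d # r) = (if c = d then g @ (c - 1) # (d - 1) # r else g @ d # c # r)"
  using g by (auto simp: shift_def fL_def fU_def up_def down_def swap_def list_update_append nth_append)

end

lemma nth_append_length_Suc: "(g @ c # d # r) ! Suc (length g) = d"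
  by (simp add: nth_append)

lemma shift_shift: "Suc \<kappa> < length f \<Longrightarrow> shift \<kappa> k (shift \<kappa> l f) = shift \<kappa> (l + k) f"
  by (drule split_pair) (auto simp: shift_pair add.assoc)

lemma eqk_shift: "Suc \<kappa> < length f \<Longrightarrow> eqk \<kappa> (shift \<kappa> k f) \<longleftrightarrow> eqk \<kappa> f"
  by (drule split_pair) (auto simp: shift_pair nth_append_length_Suc)

lemma shift_0: "shift \<kappa> 0 f = f"
  by (simp add: shift_def)

lemma length_shift [simp]: "length (shift \<kappa> k f) = length f"
  by (simp add: shift_def)

lemma shift_inject: "Suc \<kappa> < length f \<Longrightarrow> shift \<kappa> k f = shift \<kappa> l f \<longleftrightarrow> k = l"
  by (drule split_pair) (auto simp: shift_pair)

lemma shift_snoc: "Suc \<kappa> < length f \<Longrightarrow> shift \<kappa> k (f @ [c]) = shift \<kappa> k f @ [c]"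
  and eqk_snoc: "Suc \<kappa> < length f \<Longrightarrow> eqk \<kappa> (f @ [c]) \<longleftrightarrow> eqk \<kappa> f"
  and fL_snoc: "Suc \<kappa> < length f \<Longrightarrow> fL \<kappa> (f @ [c]) = fL \<kappa> f @ [c]"
  by (drule split_pair, auto simp: shift_pair fL_pair nth_append_length_Suc)+

lemma length_fL [simp]: "length (fL \<kappa> f) = length f"
  and length_fU [simp]: "length (fU \<kappa> f) = length f"
  by (simp_all add: fL_def fU_def up_def down_def swap_def)

lemma fL_fU: "Suc \<kappa> < length f \<Longrightarrow> fL \<kappa> (fU \<kappa> f) = f"
  and fU_fL: "Suc \<kappa> < length f \<Longrightarrow> fU \<kappa> (fL \<kappa> f) = f"
  by (drule split_pair, auto simp: fL_pair fU_pair)+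

text \<open>The two entries count with opposite signs, so the counts can change only for
  \<open>j = Suc \<kappa>\<close>, where the sign hypotheses make them decrease. The case
  \<open>s = - 1\<close> belongs to \<open>b\<close>, the case \<open>s = 1\<close> to
  \<open>b'\<close>.\<close>

lemma shift_bru:
  assumes \<kappa>: "Suc \<kappa> < n" and f: "length f = n" "eqk \<kappa> f"
    and s: "s = 1 \<or> s = - 1" "(- 1) ^ (b ! \<kappa>) = - s" "(- 1) ^ (b ! Suc \<kappa>) = s"
  shows "bru b n (shift \<kappa> s f) f"
proof -
  let ?f = "shift \<kappa> s f"
  have nth: "?f ! i = f ! i" if "i \<noteq> \<kappa>" "i \<noteq> Suc \<kappa>" for i
    using that by (simp add: shift_def)
  have nth': "?f ! \<kappa> = f ! \<kappa> + s" "?f ! Suc \<kappa> = f ! \<kappa> + s"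
    using \<kappa> f by (simp_all add: shift_def)
  have hi: "shp b n ?f a j = shp b n f a j" if "Suc \<kappa> < j" for a j
    unfolding shp_def using that by (intro sum.cong) (auto simp: nth)
  have mid: "shp b n ?f a (Suc \<kappa>) \<le> shp b n f a (Suc \<kappa>)"
    and lo': "shp b n ?f a \<kappa> = shp b n f a \<kappa>" for a
    using \<kappa> s f by (auto simp: shp_diff[of \<kappa>] shp_diff[of "Suc \<kappa>"] hi nth')
  have lo: "shp b n ?f a j = shp b n f a j" if "j \<le> \<kappa>" for a j
    using that
  proof (induction j rule: inc_induct)
    case (step j)
    then show ?case
      using \<kappa> by (simp add: shp_diff[of j] nth)
  qed (rule lo')
  have "shp b n ?f a j \<le> shp b n f a j" for a j
    using hi[of j a] mid[of a] lo[of j a] by (cases "j = Suc \<kappa>"; cases "j \<le> \<kappa>") auto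
  then show ?thesis
    using f lo by (auto simp: bru_def)
qed

lemma shift_bru_iterate:
  assumes \<kappa>: "Suc \<kappa> < n" and f: "length f = n" "eqk \<kappa> f"
    and s: "s = 1 \<or> s = - 1" "(- 1) ^ (b ! \<kappa>) = - s" "(- 1) ^ (b ! Suc \<kappa>) = s"
  shows "bru b n (shift \<kappa> (s * int k) f) f"
proof (induction k)
  case 0
  then show ?case
    using f by (simp add: shift_0 bru_refl)
next
  case (Suc k)
  have "bru b n (shift \<kappa> s (shift \<kappa> (s * int k) f)) (shift \<kappa> (s * int k) f)"
    using assms by (intro shift_bru) (simp_all add: eqk_shift)
  also have "shift \<kappa> s (shift \<kappa> (s * int k) f) = shift \<kappa> (s * int (Suc k)) f"
    using assms by (simp add: shift_shift algebra_simps)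
  finally show ?case
    using Suc bru_trans by blast
qed

lemma finite_ev0: "finite {k. u k \<noteq> 0} \<Longrightarrow> ev0 u"
  unfolding ev0_iff finite_nat_set_iff_bounded by (metis (mono_tags, lifting) mem_Collect_eq not_le)

text \<open>The members of the chain with nonzero value lie in one Bruhat interval, which is finite,
  and the chain has no repetitions.\<close>

lemma ev0_chain:
  assumes \<kappa>: "Suc \<kappa> < n" and f: "length f = n" "eqk \<kappa> f"
    and s: "s = 1 \<or> s = - 1" "(- 1) ^ (b ! \<kappa>) = - s" "(- 1) ^ (b ! Suc \<kappa>) = s"
    and tri: "\<And>h. u h \<noteq> 0 \<Longrightarrow> bru b n g h"
  shows "ev0 (\<lambda>k. u (shift \<kappa> (s * int k) f))"
proof (rule finite_ev0, rule finite_imageD)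
  let ?K = "{k. u (shift \<kappa> (s * int k) f) \<noteq> 0}"
  have "(\<lambda>k. shift \<kappa> (s * int k) f) ` ?K \<subseteq> {h. bru b n g h \<and> bru b n h f}"
    using tri shift_bru_iterate[OF \<kappa> f s] by auto
  then show "finite ((\<lambda>k. shift \<kappa> (s * int k) f) ` ?K)"
    using finite_bru_interval by (rule finite_subset)
  show "inj_on (\<lambda>k. shift \<kappa> (s * int k) f) ?K"
    using \<kappa> f s(1) by (auto simp: inj_on_def shift_inject)
qed

lemma ev0_geo: "ev0 u \<Longrightarrow> ev0 (\<lambda>k. geo c (\<lambda>j. u (k + j)))"
proof -
  assume "ev0 u"
  then obtain K where K: "\<forall>k\<ge>K. u k = 0"
    unfolding ev0_iff by blast
  then have "(\<lambda>j. u (k + j)) = (\<lambda>j. 0)" if "k \<ge> K" for k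
    using that by auto
  then show ?thesis
    unfolding ev0_iff by (intro exI[of _ K]) simp
qed

lemma ev0_local:
  assumes T: "local_at T g H" and T0: "T (\<lambda>_. 0) g = 0" and u: "\<And>h. ev0 (\<lambda>k. u k h)"
  shows "ev0 (\<lambda>k. T (u k) g)"
  unfolding ev0_def
proof -
  have "\<forall>\<^sub>F k in sequentially. T (u k) g = T (\<lambda>_. 0) g"
    by (rule eventually_local[OF T]) (use u in \<open>simp add: ev0_def\<close>)
  then show "\<forall>\<^sub>F k in sequentially. T (u k) g = 0"
    by (simp only: T0)
qed

subsection \<open>Coordinates of pairs\<close>

text \<open>Row coordinates with respect to \<open>N\<^sub>f\<close> and, relabelled by \<open>f\<^sup>L\<close>, with respect to \<open>N'\<^sub>f\<close>: here
  \<open>M\<^sub>f = N\<^sub>f + q\<inverse> N\<^bsub>f\<down>\<^esub>\<close> and \<open>M'\<^sub>f = N'\<^sub>f + q\<inverse> N'\<^bsub>f\<up>\<^esub>\<close>. The transforms \<open>Cb\<close> and \<open>Cb'\<close> are the barred transposes.\<close>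

definition Tb :: "formal \<Rightarrow> pairf" where
  "Tb x g c d = x (g @ [c, d]) + (if c = d then inverse qq * x (g @ [c + 1, d + 1]) else 0)"

definition Tb' :: "formal \<Rightarrow> pairf" where
  "Tb' x g c d = (if c = d then x (g @ [c + 1, d + 1]) + inverse qq * x (g @ [c, d]) else x (g @ [d, c]))"

definition Cb :: "pairf \<Rightarrow> pairf" where
  "Cb y f c d = y f c d + (if c = d then qq * y f (c - 1) (d - 1) else 0)"

definition Cb' :: "pairf \<Rightarrow> pairf" where
  "Cb' y f c d = (if c = d then y f (c - 1) (d - 1) + qq * y f c d else y f d c)"

lemma gop_snoc_pair: "gop b (Suc (Suc n)) g x (h @ [c, d]) = ext_act (b ! Suc n) (gop b (Suc n)) g x (h @ [c]) d"
  using gop_snoc[of b "Suc n" g x "h @ [c]" d] by simp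

lemma cop_snoc_pair: "cop b (Suc (Suc n)) a y (h @ [c, d]) =
     (if b ! Suc n = 0 then (if d = a + 1 then y (h @ [c, a]) else 0) else (if d = a then y (h @ [c, a + 1]) else 0))
     + qq powi - epow (b ! Suc n) a d * cop b (Suc n) a (\<lambda>h. y (h @ [d])) (h @ [c])"
  using cop_snoc[of b "Suc n" a y "h @ [c]" d] by simp

lemma cop_add: "cop b n a (\<lambda>f. x f + y f) f = cop b n a x f + cop b n a y f"
  and cop_scale: "cop b n a (\<lambda>f. r * x f) f = r * cop b n a x f"
  by (induction n arbitrary: x y f) (auto simp: algebra_simps)

lemma cop_zero: "cop b n a (\<lambda>_. 0) f = 0"
  using cop_scale[of b n a 0 "\<lambda>_. 0" f] by simp

lemma Eop_add: "Eop b n a (\<lambda>f. x f + y f) f = Eop b n a x f + Eop b n a y f"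
  and Eop_scale: "Eop b n a (\<lambda>f. r * x f) f = r * Eop b n a x f"
  and Eop_zero: "Eop b n a (\<lambda>_. 0) f = 0"
  by (rule urep.add[OF urep_gop], rule urep.scale[OF urep_gop], rule urep.zero[OF urep_gop])

text \<open>Here and in the next lemma the same operator \<open>Nrow\<close> arises from the two
  orders of the factors: this is the isomorphism of the modules on the pair, written in
  coordinates.\<close>

lemma Tb_E:
  assumes "b ! \<kappa> = 0" "b ! Suc \<kappa> = 1"
  shows "Tb (Eop b (Suc (Suc \<kappa>)) a x) g c d = Nrow a (Eop b \<kappa> a) (Tb x) g c d"
  using assms
  by (auto simp: Tb_def Nrow_def row0_def kap_def gop_snoc_pair gop_snoc Eop_add Eop_scale Eop_zero power_int_minus;
      simp add: field_simps power2_eq_square)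

lemma Tb'_E:
  assumes "b ! \<kappa> = 1" "b ! Suc \<kappa> = 0"
  shows "Tb' (Eop b (Suc (Suc \<kappa>)) a x) g c d = Nrow a (Eop b \<kappa> a) (Tb' x) g c d"
  using assms
  by (auto simp: Tb'_def Nrow_def row0_def kap_def gop_snoc_pair gop_snoc Eop_add Eop_scale Eop_zero power_int_minus;
      simp add: field_simps power2_eq_square)

text \<open>\<open>cop\<close> for the last two factors, with the two entries as separate arguments
  so that it can be combined with \<open>Cb\<close> and \<open>Cb'\<close>.\<close>

definition Mcol :: "nat \<Rightarrow> nat \<Rightarrow> int \<Rightarrow> (formal \<Rightarrow> formal) \<Rightarrow> pairf \<Rightarrow> pairf" where
  "Mcol e e' a Ec y f c d = (if e' = 0 then (if d = a + 1 then y f c a else 0) else (if d = a then y f c (a + 1) else 0))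
     + qq powi - epow e' a d * ((if e = 0 then (if c = a + 1 then y f a d else 0) else (if c = a then y f (a + 1) d else 0))
     + qq powi - epow e a c * Ec (\<lambda>h. y h c d) f)"

lemma cop_Mcol: "cop b (Suc (Suc n)) a z (f @ [c, d])
    = Mcol (b ! n) (b ! Suc n) a (cop b n a) (\<lambda>f c d. z (f @ [c, d])) f c d"
  by (simp add: Mcol_def cop_snoc_pair cop_snoc del: cop.simps)

lemma Cb_E: "Mcol 0 1 a (cop b n a) (Cb y) f c d = Cb (Ncol a (cop b n a) y) f c d"
  by (auto simp: Cb_def Ncol_def Mcol_def col0_def kap_def epow_def cop_add cop_scale cop_zero power_int_minus;
      simp add: field_simps power2_eq_square)

lemma Cb'_E: "Mcol 1 0 a (cop b n a) (Cb' y) f c d = Cb' (Ncol a (cop b n a) y) f c d"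
  by (auto simp: Cb'_def Ncol_def Mcol_def col0_def kap_def epow_def cop_add cop_scale cop_zero power_int_minus;
      simp add: field_simps power2_eq_square)

lemma rlim_E_all:
  assumes \<Theta>: "\<forall>k\<ge>1. quasi_R_matrix k (\<Theta> k)"
  shows "Eop b (Suc n) a (\<lambda>h. rlim b (Suc n) h f) g = cop b (Suc n) a (rlim b (Suc n) g) f"
proof (cases "length f = Suc n")
  case False
  then have "cop b (Suc n) a (rlim b (Suc n) g) f = cop b (Suc n) a (\<lambda>_. 0) f"
    by (intro cop_cong_length rm_0_length) auto
  moreover have "(\<lambda>h. rlim b (Suc n) h f) = (\<lambda>_. 0)"
    using False by (intro ext rm_0_length) auto
  ultimately show ?thesis
    by (simp only: Eop_zero cop_zero)
qed (rule rlim_E[OF \<Theta>])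

lemma Nrow_add: "Nrow a (Eop b n a) (\<lambda>g x y. u g x y + v g x y) g x y = Nrow a (Eop b n a) u g x y + Nrow a (Eop b n a) v g x y"
  and Nrow_scale: "Nrow a (Eop b n a) (\<lambda>g x y. r * u g x y) g x y = r * Nrow a (Eop b n a) u g x y"
  by (auto simp: Nrow_def row0_def Eop_add Eop_scale algebra_simps)

lemma Nrow_zero: "Nrow a (Eop b n a) (\<lambda>g x y. 0) g x y = 0"
  by (simp add: Nrow_def row0_def Eop_zero)

lemma Mcol_zero: "Mcol e e' a (cop b n a) (\<lambda>g x y. 0) g x y = 0"
  by (simp add: Mcol_def cop_zero)

lemma Mcol_add: "Mcol e e' a (cop b n a) (\<lambda>g x y. u g x y + v g x y) g x y = Mcol e e' a (cop b n a) u g x y + Mcol e e' a (cop b n a) v g x y"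
  and Mcol_scale: "Mcol e e' a (cop b n a) (\<lambda>g x y. r * u g x y) g x y = r * Mcol e e' a (cop b n a) u g x y"
  by (auto simp: Mcol_def cop_add cop_scale algebra_simps)

text \<open>Row transforms and column operators act on different indices and therefore
  commute.\<close>

lemma Tb_Mcol: "Tb (\<lambda>h. Mcol e e' a (cop b n a) (R h) f c d) g x y = Mcol e e' a (cop b n a) (\<lambda>f c d. Tb (\<lambda>h. R h f c d) g x y) f c d"
  and Tb'_Mcol: "Tb' (\<lambda>h. Mcol e e' a (cop b n a) (R h) f c d) g x y = Mcol e e' a (cop b n a) (\<lambda>f c d. Tb' (\<lambda>h. R h f c d) g x y) f c d"
  by (auto simp: Tb_def Tb'_def Mcol_add Mcol_scale Mcol_zero)

lemma Cb_Nrow: "Cb (\<lambda>f c d. Nrow a (Eop b n a) (\<lambda>g x y. R g x y f c d) g x y) f c d = Nrow a (Eop b n a) (\<lambda>g x y. Cb (R g x y) f c d) g x y"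
  and Cb'_Nrow: "Cb' (\<lambda>f c d. Nrow a (Eop b n a) (\<lambda>g x y. R g x y f c d) g x y) f c d = Nrow a (Eop b n a) (\<lambda>g x y. Cb' (R g x y) f c d) g x y"
  by (auto simp: Cb_def Cb'_def Nrow_add Nrow_scale Nrow_zero)

lemma Tb_add: "Tb (\<lambda>h. u h + r * v h) g x y = Tb u g x y + r * Tb v g x y"
  and Tb'_add: "Tb' (\<lambda>h. u h + r * v h) g x y = Tb' u g x y + r * Tb' v g x y"
  by (auto simp: Tb_def Tb'_def algebra_simps)

text \<open>The columns for equal entries are infinite sums of columns of the matrix of the bar map, so that
  commutation with \<open>E\<^sub>a\<close> is checked on \<open>M\<^sub>f\<close> and transferred by a telescoping argument.\<close>

lemma pair_commute:
  fixes R :: "int list \<Rightarrow> int \<Rightarrow> int \<Rightarrow> int list \<Rightarrow> int \<Rightarrow> int \<Rightarrow> qf"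
    and b :: "nat list" and n :: nat
  defines "\<Delta> \<equiv> \<lambda>a g x y f c d. Nrow a (Eop b n a) (\<lambda>g x y. R g x y f c d) g x y - Ncol a (cop b n a) (R g x y) f c d"
  assumes ev: "\<And>g x y f c. ev0 (\<lambda>k. R g x y f (c + s * int k) (c + s * int k))"
    and s: "s = 1 \<or> s = - 1"
    and ne: "\<And>a g x y f c d. c \<noteq> d \<Longrightarrow> \<Delta> a g x y f c d = 0"
    and eq: "\<And>a g x y f c. \<Delta> a g x y f c c = - qq * \<Delta> a g x y f (c + s) (c + s)"
  shows "Nrow a (Eop b n a) (\<lambda>g x y. R g x y f c d) g x y = Ncol a (cop b n a) (R g x y) f c d"
proof -
  have "\<Delta> a g x y f c c = 0" for c
  proof -
    define u where "u k = \<Delta> a g x y f (c + s * int k) (c + s * int k)" for k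
    have "u 0 = 0"
    proof (rule ev0_recursion)
      show "u k = - qq * u (Suc k)" for k
        using eq[of a g x y f "c + s * int k"] by (simp add: u_def algebra_simps)
      have row: "ev0 (\<lambda>k. Nrow a (Eop b n a) (\<lambda>g x y. R g x y f (c + s * int k) (c + s * int k)) g x y)"
      proof -
        obtain H where H: "local_at (Eop b n a) g H"
          using Eop_local by blast
        have "ev0 (\<lambda>k. Eop b n a (\<lambda>h. R h x y f (c + s * int k) (c + s * int k)) g)"
          by (rule ev0_local[OF H Eop_zero ev])
        moreover have "ev0 (\<lambda>k. row0 a (\<lambda>x y. R g x y f (c + s * int k) (c + s * int k)) x y)"
          unfolding row0_def
          by (cases "x = y"; cases "x = a"; cases "y = a + 1"; cases "x = a + 1"; cases "x = a - 1")
            (simp_all add: ev0_add ev0_scale ev0_0 ev)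
        ultimately show ?thesis
          unfolding Nrow_def by (intro ev0_add ev0_scale)
      qed
      have col: "ev0 (\<lambda>k. Ncol a (cop b n a) (R g x y) f (c + s * int k) (c + s * int k))"
      proof -
        obtain H where H: "local_at (cop b n a) f H"
          using cop_local by blast
        have "ev0 (\<lambda>k. cop b n a (\<lambda>h. R g x y h (c + s * int k) (c + s * int k)) f)"
          by (rule ev0_local[OF H cop_zero ev])
        moreover have "ev0 (\<lambda>k. col0 a (R g x y f) (c + s * int k) (c + s * int k))"
        proof (rule finite_ev0, rule finite_subset)
          \<comment> \<open>On an equal pair \<open>col0\<close> is nonzero only if the entries are
            \<open>a\<close>, and the chain meets \<open>a\<close> at most once.\<close>
          show "{k. col0 a (R g x y f) (c + s * int k) (c + s * int k) \<noteq> 0} \<subseteq> {nat \<bar>a - c\<bar>}"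
            using s by (auto simp: col0_def split: if_splits)
        qed simp
        moreover have "kap a d d = 0" for d
          by (simp add: kap_def)
        ultimately show ?thesis
          unfolding Ncol_def by (auto intro!: ev0_add)
      qed
      show "ev0 u"
        unfolding u_def \<Delta>_def using ev0_add[OF row ev0_scale[OF col, of "- 1"]] by simp
    qed
    then show ?thesis
      by (simp add: u_def)
  qed
  then have "\<Delta> a g x y f c d = 0"
    using ne by (cases "c = d") auto
  then show ?thesis
    by (simp add: \<Delta>_def)
qed

definition pair_sharp :: "int \<Rightarrow> int \<Rightarrow> int \<Rightarrow> int" where
  "pair_sharp x y a = of_bool (x \<le> a) - of_bool (y \<le> a)"

lemma pair_sharp_same: "pair_sharp x x a = 0"
  by (simp add: pair_sharp_def)

text \<open>Summing \<open>pair_sharp x y a\<close> over all \<open>a\<close> gives the height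
  \<open>y - x\<close>. Hence the pointwise order refines the height, and equal heights force equal
  functions: the same pair, or two pairs of equal entries. It suffices to evaluate at the entries
  and their predecessors.\<close>

lemma pair_sharp_height:
  assumes "\<And>a. pair_sharp x y a \<le> pair_sharp c d a"
  shows "0 \<le> (d - c) - (y - x)" "(d - c) - (y - x) = 0 \<Longrightarrow> (x = c \<and> y = d) \<or> (x = y \<and> c = d)"
proof -
  note a = assms[unfolded pair_sharp_def]
  have "0 \<le> (d - c) - (y - x) \<and> ((d - c) - (y - x) = 0 \<longrightarrow> (x = c \<and> y = d) \<or> (x = y \<and> c = d))"
    using a[of x] a[of "x - 1"] a[of y] a[of "y - 1"] a[of c] a[of "c - 1"] a[of d] a[of "d - 1"]
    by (auto simp: of_bool_def split: if_splits)
  then show "0 \<le> (d - c) - (y - x)" "(d - c) - (y - x) = 0 \<Longrightarrow> (x = c \<and> y = d) \<or> (x = y \<and> c = d)"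
    by blast+
qed

section \<open>The exchanged factors in last position\<close>

locale adjacent =
  fixes \<Theta> :: "nat \<Rightarrow> weight \<Rightarrow> falg2" and b b' :: "nat list" and \<kappa> :: nat
  assumes \<Theta>: "\<forall>k\<ge>1. quasi_R_matrix k (\<Theta> k)"
    and \<kappa>: "Suc \<kappa> < length b" and length_b': "length b' = length b"
    and b\<kappa>: "b ! \<kappa> = 0" "b ! Suc \<kappa> = 1" and b'\<kappa>: "b' ! \<kappa> = 1" "b' ! Suc \<kappa> = 0"
    and b_eq: "\<And>i. i \<noteq> \<kappa> \<Longrightarrow> i \<noteq> Suc \<kappa> \<Longrightarrow> b' ! i = b ! i"
    and bits: "set b \<subseteq> {0, 1}" "set b' \<subseteq> {0, 1}"
begin

abbreviation "N2 \<equiv> Suc (Suc \<kappa>)"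

lemma prefix: "gop b' \<kappa> = gop b \<kappa>" "cop b' \<kappa> = cop b \<kappa>" "rlim b' \<kappa> = rlim b \<kappa>"
  by (auto intro!: gop_cong_b cop_cong_b rm_cong_b simp: b_eq)

lemma ev0_b: "ev0 (\<lambda>k. rlim b N2 h (f @ [c - int k, c - int k]))"
proof (cases "length f = \<kappa>")
  case True
  have "ev0 (\<lambda>k. rlim b N2 h (shift \<kappa> (- 1 * int k) (f @ [c, c])))"
  proof (rule ev0_chain[where n = N2 and b = b and g = h])
    show "eqk \<kappa> (f @ [c, c])"
      using eqk_pair[OF True, of c c "[]"] by simp
    show "bru b N2 h l" if "rlim b N2 h l \<noteq> 0" for l
      using rm_triangular[OF that] \<kappa> bits by simp
  qed (use True b\<kappa> in auto)
  then show ?thesis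
    using shift_pair[OF True, of _ c c "[]"] by simp
next
  case False
  then have "rlim b N2 h (f @ [c - int k, c - int k]) = 0" for k
    by (intro rm_0_length) simp
  then show ?thesis
    by (simp add: ev0_0)
qed

lemma ev0_b': "ev0 (\<lambda>k. rlim b' N2 h (f @ [c + int k, c + int k]))"
proof (cases "length f = \<kappa>")
  case True
  have "ev0 (\<lambda>k. rlim b' N2 h (shift \<kappa> (1 * int k) (f @ [c, c])))"
  proof (rule ev0_chain[where n = N2 and b = b' and g = h])
    show "eqk \<kappa> (f @ [c, c])"
      using eqk_pair[OF True, of c c "[]"] by simp
    show "bru b' N2 h l" if "rlim b' N2 h l \<noteq> 0" for l
      using rm_triangular[OF that] \<kappa> bits length_b' by simp
  qed (use True b'\<kappa> in auto)
  then show ?thesis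
    using shift_pair[OF True, of _ c c "[]"] by simp
next
  case False
  then have "rlim b' N2 h (f @ [c + int k, c + int k]) = 0" for k
    by (intro rm_0_length) simp
  then show ?thesis
    by (simp add: ev0_0)
qed

text \<open>The bar image of \<open>f\<close> tensor N_cd in coordinates with respect to the M. The
  ratio is \<open>- qq\<close> because the bar map inverts the coefficients of N_cd.\<close>

definition B1 :: "int list \<Rightarrow> int \<Rightarrow> int \<Rightarrow> formal" where
  "B1 f c d h = (if c = d then geo (- qq) (\<lambda>k. rlim b N2 h (f @ [c - int k, d - int k])) else rlim b N2 h (f @ [c, d]))"

text \<open>The analogue of \<open>B1\<close> for N' whose index is relabelled by \<open>fL\<close>:
  unequal entries are exchanged, and an equal pair starts at \<open>c + 1\<close> and moves
  upwards.\<close>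

definition B2 :: "int list \<Rightarrow> int \<Rightarrow> int \<Rightarrow> formal" where
  "B2 f c d h = (if c = d then geo (- qq) (\<lambda>k. rlim b' N2 h (f @ [c + 1 + int k, d + 1 + int k])) else rlim b' N2 h (f @ [d, c]))"

lemma B1_eq: "rlim b N2 h (f @ [c, c]) = B1 f c c h + qq * B1 f (c - 1) (c - 1) h"
  using geo_Suc[OF ev0_b, of "- qq" h f c] by (simp add: B1_def algebra_simps)

lemma B2_eq: "rlim b' N2 h (f @ [c, c]) = B2 f (c - 1) (c - 1) h + qq * B2 f c c h"
  using geo_Suc[OF ev0_b', of "- qq" h f c] by (simp add: B2_def algebra_simps)

lemma ev0_B1: "ev0 (\<lambda>k. B1 f (c + - 1 * int k) (c + - 1 * int k) h)"
  using ev0_geo[OF ev0_b, of "- qq" h f c] by (simp add: B1_def algebra_simps)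

lemma ev0_B2: "ev0 (\<lambda>k. B2 f (c + 1 * int k) (c + 1 * int k) h)"
  using ev0_geo[OF ev0_b', of "- qq" h f "c + 1"] by (simp add: B2_def algebra_simps)

definition R1 :: "int list \<Rightarrow> int \<Rightarrow> int \<Rightarrow> int list \<Rightarrow> int \<Rightarrow> int \<Rightarrow> qf" where
  "R1 g x y f c d = Tb (B1 f c d) g x y"

definition R2 :: "int list \<Rightarrow> int \<Rightarrow> int \<Rightarrow> int list \<Rightarrow> int \<Rightarrow> int \<Rightarrow> qf" where
  "R2 g x y f c d = Tb' (B2 f c d) g x y"

lemma Cb_R1: "Cb (R1 g x y) f c d = Tb (\<lambda>h. rlim b N2 h (f @ [c, d])) g x y"
proof (cases "c = d")
  case True
  then show ?thesis
    unfolding True B1_eq Tb_add by (simp add: Cb_def R1_def)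
next
  case False
  then have "B1 f c d h = rlim b N2 h (f @ [c, d])" for h
    by (auto simp only: B1_def if_False)
  then have "B1 f c d = (\<lambda>h. rlim b N2 h (f @ [c, d]))"
    by blast
  with False show ?thesis
    by (simp add: Cb_def R1_def del: rm.simps)
qed

lemma Cb'_R2: "Cb' (R2 g x y) f c d = Tb' (\<lambda>h. rlim b' N2 h (f @ [c, d])) g x y"
proof (cases "c = d")
  case True
  then show ?thesis
    unfolding True B2_eq Tb'_add by (simp add: Cb'_def R2_def)
next
  case False
  then have "B2 f d c h = rlim b' N2 h (f @ [c, d])" for h
    by (simp add: B2_def eq_commute[of d c] del: rm.simps)
  then have "B2 f d c = (\<lambda>h. rlim b' N2 h (f @ [c, d]))"
    by blast
  with False show ?thesis
    by (simp add: Cb'_def R2_def del: rm.simps)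
qed

text \<open>\<open>Cb\<close> recovers the column of M_f from the columns of the N. For the M the
  commutation is known, so \<open>Cb\<close> annihilates the defect \<open>\<Delta>\<close>; as the
  defect vanishes eventually along chains, \<open>pair_commute\<close> makes it zero.\<close>

lemma R1_commute:
  "Nrow a (Eop b \<kappa> a) (\<lambda>g x y. R1 g x y f c d) g x y = Ncol a (cop b \<kappa> a) (R1 g x y) f c d"
proof -
  define \<Delta> where "\<Delta> a g x y f c d = Nrow a (Eop b \<kappa> a) (\<lambda>g x y. R1 g x y f c d) g x y - Ncol a (cop b \<kappa> a) (R1 g x y) f c d" for a g x y f c d
  have "Cb (\<lambda>f c d. Nrow a (Eop b \<kappa> a) (\<lambda>g x y. R1 g x y f c d) g x y) f c d
      = Cb (\<lambda>f c d. Ncol a (cop b \<kappa> a) (R1 g x y) f c d) f c d" for a g x y f c d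
  proof -
    have "Cb (\<lambda>f c d. Nrow a (Eop b \<kappa> a) (\<lambda>g x y. R1 g x y f c d) g x y) f c d
       = Nrow a (Eop b \<kappa> a) (Tb (\<lambda>h. rlim b N2 h (f @ [c, d]))) g x y"
      unfolding Cb_Nrow Cb_R1 ..
    also have "\<dots> = Tb (\<lambda>h. cop b N2 a (rlim b N2 h) (f @ [c, d])) g x y"
      unfolding Tb_E[OF b\<kappa>, symmetric] rlim_E_all[OF \<Theta>, symmetric] ..
    also have "\<dots> = Mcol 0 1 a (cop b \<kappa> a) (\<lambda>f c d. Tb (\<lambda>h. rlim b N2 h (f @ [c, d])) g x y) f c d"
      unfolding cop_Mcol Tb_Mcol b\<kappa> ..
    also have "\<dots> = Cb (Ncol a (cop b \<kappa> a) (R1 g x y)) f c d"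
      unfolding Cb_R1[symmetric] Cb_E ..
    finally show ?thesis .
  qed
  moreover have "Cb (\<Delta> a g x y) f c d = Cb (\<lambda>f c d. Nrow a (Eop b \<kappa> a) (\<lambda>g x y. R1 g x y f c d) g x y) f c d
      - Cb (Ncol a (cop b \<kappa> a) (R1 g x y)) f c d" for a g x y f c d
    by (simp add: Cb_def \<Delta>_def algebra_simps)
  ultimately have \<Delta>: "Cb (\<Delta> a g x y) f c d = 0" for a g x y f c d
    by simp
  show ?thesis
  proof (rule pair_commute[where s = "- 1"])
    show "ev0 (\<lambda>k. R1 g x y f (c + - 1 * int k) (c + - 1 * int k))" for g x y f c
      unfolding R1_def Tb_def by (cases "x = y") (simp_all only: if_True if_False simp_thms ev0_add ev0_scale ev0_B1 ev0_0)
    show "Nrow a (Eop b \<kappa> a) (\<lambda>g x y. R1 g x y f c d) g x y - Ncol a (cop b \<kappa> a) (R1 g x y) f c d = 0"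
      if "c \<noteq> d" for a g x y f c d
      using \<Delta>[of a g x y f c d] that by (simp add: Cb_def \<Delta>_def)
    show "Nrow a (Eop b \<kappa> a) (\<lambda>g x y. R1 g x y f c c) g x y - Ncol a (cop b \<kappa> a) (R1 g x y) f c c
        = - qq * (Nrow a (Eop b \<kappa> a) (\<lambda>g x y. R1 g x y f (c + - 1) (c + - 1)) g x y - Ncol a (cop b \<kappa> a) (R1 g x y) f (c + - 1) (c + - 1))" for a g x y f c
      using \<Delta>[of a g x y f c c] by (simp add: Cb_def \<Delta>_def eq_neg_iff_add_eq_0)
  qed simp
qed

lemma R2_commute:
  "Nrow a (Eop b \<kappa> a) (\<lambda>g x y. R2 g x y f c d) g x y = Ncol a (cop b \<kappa> a) (R2 g x y) f c d"
proof -
  define \<Delta> where "\<Delta> a g x y f c d = Nrow a (Eop b \<kappa> a) (\<lambda>g x y. R2 g x y f c d) g x y - Ncol a (cop b \<kappa> a) (R2 g x y) f c d" for a g x y f c d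
  have "Cb' (\<lambda>f c d. Nrow a (Eop b \<kappa> a) (\<lambda>g x y. R2 g x y f c d) g x y) f c d
      = Cb' (\<lambda>f c d. Ncol a (cop b \<kappa> a) (R2 g x y) f c d) f c d" for a g x y f c d
  proof -
    have "Cb' (\<lambda>f c d. Nrow a (Eop b \<kappa> a) (\<lambda>g x y. R2 g x y f c d) g x y) f c d
       = Nrow a (Eop b \<kappa> a) (Tb' (\<lambda>h. rlim b' N2 h (f @ [c, d]))) g x y"
      unfolding Cb'_Nrow Cb'_R2 ..
    also have "\<dots> = Tb' (\<lambda>h. cop b' N2 a (rlim b' N2 h) (f @ [c, d])) g x y"
      unfolding prefix(1)[symmetric] Tb'_E[OF b'\<kappa>, symmetric] rlim_E_all[OF \<Theta>, symmetric] ..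
    also have "\<dots> = Mcol 1 0 a (cop b \<kappa> a) (\<lambda>f c d. Tb' (\<lambda>h. rlim b' N2 h (f @ [c, d])) g x y) f c d"
      unfolding cop_Mcol Tb'_Mcol b'\<kappa> prefix ..
    also have "\<dots> = Cb' (Ncol a (cop b \<kappa> a) (R2 g x y)) f c d"
      unfolding Cb'_R2[symmetric] Cb'_E ..
    finally show ?thesis .
  qed
  moreover have "Cb' (\<Delta> a g x y) f c d = Cb' (\<lambda>f c d. Nrow a (Eop b \<kappa> a) (\<lambda>g x y. R2 g x y f c d) g x y) f c d
      - Cb' (Ncol a (cop b \<kappa> a) (R2 g x y)) f c d" for a g x y f c d
    by (simp add: Cb'_def \<Delta>_def algebra_simps)
  ultimately have \<Delta>: "Cb' (\<Delta> a g x y) f c d = 0" for a g x y f c d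
    by simp
  show ?thesis
  proof (rule pair_commute[where s = 1])
    show "ev0 (\<lambda>k. R2 g x y f (c + 1 * int k) (c + 1 * int k))" for g x y f c
      unfolding R2_def Tb'_def by (cases "x = y") (simp_all only: if_True if_False simp_thms ev0_add ev0_scale ev0_B2)
    show "Nrow a (Eop b \<kappa> a) (\<lambda>g x y. R2 g x y f c d) g x y - Ncol a (cop b \<kappa> a) (R2 g x y) f c d = 0"
      if "c \<noteq> d" for a g x y f c d
      using \<Delta>[of a g x y f d c] that by (simp add: Cb'_def \<Delta>_def)
    show "Nrow a (Eop b \<kappa> a) (\<lambda>g x y. R2 g x y f c c) g x y - Ncol a (cop b \<kappa> a) (R2 g x y) f c c
        = - qq * (Nrow a (Eop b \<kappa> a) (\<lambda>g x y. R2 g x y f (c + 1) (c + 1)) g x y - Ncol a (cop b \<kappa> a) (R2 g x y) f (c + 1) (c + 1))" for a g x y f c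
      using \<Delta>[of a g x y f "c + 1" "c + 1"] by (simp add: Cb'_def \<Delta>_def eq_neg_iff_add_eq_0)
  qed simp
qed

lemma rlim_pair_sharp:
  assumes "rlim b N2 (g @ [x, y]) (f @ [c, d]) \<noteq> 0"
  shows "pair_sharp x y a \<le> pair_sharp c d a"
proof -
  have "bru b N2 (g @ [x, y]) (f @ [c, d])"
    using rm_triangular[OF assms] \<kappa> bits by simp
  moreover then have "length g = \<kappa>" "length f = \<kappa>"
    by (simp_all add: bru_def)
  moreover have "shp b N2 (h @ [u, v]) a \<kappa> = pair_sharp u v a" if "length h = \<kappa>" for h u v
    using that b\<kappa> by (simp add: shp_diff nth_append pair_sharp_def) (simp add: shp_def)
  ultimately show ?thesis
    by (metis bru_def)
qed

lemma rlim_pair_sharp':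
  assumes "rlim b' N2 (g @ [x, y]) (f @ [c, d]) \<noteq> 0"
  shows "pair_sharp y x a \<le> pair_sharp d c a"
proof -
  have "bru b' N2 (g @ [x, y]) (f @ [c, d])"
    using rm_triangular[OF assms] \<kappa> bits length_b' by simp
  moreover then have "length g = \<kappa>" "length f = \<kappa>"
    by (simp_all add: bru_def)
  moreover have "shp b' N2 (h @ [u, v]) a \<kappa> = pair_sharp v u a" if "length h = \<kappa>" for h u v
    using that b'\<kappa> by (simp add: shp_diff nth_append pair_sharp_def) (simp add: shp_def)
  ultimately show ?thesis
    by (metis bru_def)
qed

lemma R1_pair_sharp: "R1 g x y f c d \<noteq> 0 \<Longrightarrow> pair_sharp x y a \<le> pair_sharp c d a"
proof -
  have B: "pair_sharp x y a \<le> pair_sharp c d a" if "B1 f c d (g @ [x, y]) \<noteq> 0" for x y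
  proof (cases "c = d")
    case True
    then have "geo (- qq) (\<lambda>k. rlim b N2 (g @ [x, y]) (f @ [c - int k, d - int k])) \<noteq> 0"
      using that by (simp add: B1_def del: rm.simps)
    from geo_nonzero[OF this] obtain k where "rlim b N2 (g @ [x, y]) (f @ [c - int k, d - int k]) \<noteq> 0" ..
    from rlim_pair_sharp[OF this, of a] show ?thesis
      using True by (simp add: pair_sharp_def)
  next
    case False
    then show ?thesis
      using that rlim_pair_sharp by (simp add: B1_def)
  qed
  assume "R1 g x y f c d \<noteq> 0"
  then have "B1 f c d (g @ [x, y]) \<noteq> 0 \<or> x = y \<and> B1 f c d (g @ [x + 1, y + 1]) \<noteq> 0"
    by (auto simp: R1_def Tb_def split: if_splits)
  then show ?thesis
    using B[of x y] B[of "x + 1" "y + 1"] by (auto simp: pair_sharp_same)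
qed

lemma R2_pair_sharp: "R2 g x y f c d \<noteq> 0 \<Longrightarrow> pair_sharp x y a \<le> pair_sharp c d a"
proof -
  have B: "pair_sharp y x a \<le> pair_sharp c d a" if "B2 f c d (g @ [x, y]) \<noteq> 0" for x y
  proof (cases "c = d")
    case True
    then have "geo (- qq) (\<lambda>k. rlim b' N2 (g @ [x, y]) (f @ [c + 1 + int k, d + 1 + int k])) \<noteq> 0"
      using that by (simp add: B2_def del: rm.simps)
    from geo_nonzero[OF this] obtain k where "rlim b' N2 (g @ [x, y]) (f @ [c + 1 + int k, d + 1 + int k]) \<noteq> 0" ..
    from rlim_pair_sharp'[OF this, of a] show ?thesis
      using True by (simp add: pair_sharp_def)
  next
    case False
    then show ?thesis
      using that rlim_pair_sharp' by (simp add: B2_def)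
  qed
  assume "R2 g x y f c d \<noteq> 0"
  then have "x \<noteq> y \<and> B2 f c d (g @ [y, x]) \<noteq> 0 \<or> x = y \<and> (B2 f c d (g @ [x, y]) \<noteq> 0 \<or> B2 f c d (g @ [x + 1, y + 1]) \<noteq> 0)"
    by (auto simp: R2_def Tb'_def split: if_splits)
  then show ?thesis
    using B[of x y] B[of y x] B[of "x + 1" "y + 1"] by (auto simp: pair_sharp_same)
qed

lemma rm_snoc_pair: "rm S b (Suc (Suc n)) (g @ [c, d]) (f @ [c, d]) = rm S b n g f"
  using rm_snoc[of S b "Suc n" "g @ [c]" d "f @ [c]" d] by (simp add: rm_snoc del: rm.simps)

lemma R1_R2: "R1 g x y f c d = R2 g x y f c d"
proof (rule pair_system_unique[of "Eop b \<kappa>" "cop b \<kappa>" "rlim b \<kappa>"])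
  show "pair_system (Eop b \<kappa>) (cop b \<kappa>) (rlim b \<kappa>) R1"
  proof
    fix g x y f c d and a :: int
    show "R1 g x y f c d = 0" if "d - c - (y - x) < 0"
      using pair_sharp_height(1)[of x y c d] R1_pair_sharp[of g x y f c d] that by fastforce
    show "R1 g x y f c d = 0" if "d - c - (y - x) = 0" "\<not> (x = c \<and> y = d)" "\<not> (x = y \<and> c = d)"
      using pair_sharp_height(2)[of x y c d] R1_pair_sharp[of g x y f c d] that by fastforce
    show "R1 g c d f c d = rlim b \<kappa> g f" if "c \<noteq> d"
      using that by (simp add: R1_def Tb_def B1_def rm_snoc_pair del: rm.simps)
  qed (simp_all only: Eop_zero cop_zero R1_commute)
  show "pair_system (Eop b \<kappa>) (cop b \<kappa>) (rlim b \<kappa>) R2"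
  proof
    fix g x y f c d and a :: int
    show "R2 g x y f c d = 0" if "d - c - (y - x) < 0"
      using pair_sharp_height(1)[of x y c d] R2_pair_sharp[of g x y f c d] that by fastforce
    show "R2 g x y f c d = 0" if "d - c - (y - x) = 0" "\<not> (x = c \<and> y = d)" "\<not> (x = y \<and> c = d)"
      using pair_sharp_height(2)[of x y c d] R2_pair_sharp[of g x y f c d] that by fastforce
    have "rm S b' N2 (g @ [d, c]) (f @ [d, c]) = rm S b' \<kappa> g f" for S
      using rm_snoc[of S b' "Suc \<kappa>" "g @ [d]" c "f @ [d]" c] by (simp add: rm_snoc del: rm.simps)
    then show "R2 g c d f c d = rlim b \<kappa> g f" if "c \<noteq> d"
      using that by (simp add: R2_def Tb'_def B2_def prefix del: rm.simps)
  qed (simp_all only: Eop_zero cop_zero R2_commute)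
  show "Eop b \<kappa> a (\<lambda>f. x f - y f) g = Eop b \<kappa> a x g - Eop b \<kappa> a y g" for a x y g
    using Eop_add[of b \<kappa> a x "\<lambda>f. - 1 * y f" g] by (simp only: Eop_scale) simp
  show "cop b \<kappa> a (\<lambda>f. x f - y f) g = cop b \<kappa> a x g - cop b \<kappa> a y g" for a x y g
    using cop_add[of b \<kappa> a x "\<lambda>f. - 1 * y f" g] by (simp only: cop_scale) simp
qed

end

section \<open>Factors behind the exchanged pair\<close>

definition Cop :: "nat \<Rightarrow> int \<Rightarrow> formal \<Rightarrow> formal" where
  "Cop \<kappa> s x g = x g + (if eqk \<kappa> g then inverse qq * x (shift \<kappa> (- s) g) else 0)"

definition Bvec :: "nat \<Rightarrow> int \<Rightarrow> (int list \<Rightarrow> int list \<Rightarrow> qf) \<Rightarrow> int list \<Rightarrow> formal" where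
  "Bvec \<kappa> s r f h = (if eqk \<kappa> f then geo (- qq) (\<lambda>k. r h (shift \<kappa> (s * int k) f)) else r h f)"

text \<open>Since \<open>M\<^sub>f = N\<^sub>f + q\<inverse> N\<^bsub>f\<down>\<^esub>\<close>, \<open>Cop\<close> passes from coordinates with respect to the \<open>M\<^sub>f\<close> to coordinates with
  respect to the \<open>N\<^sub>f\<close>. For \<open>s = -1\<close> (resp. \<open>s = 1\<close>) \<open>Nmat \<kappa> s r\<close> is the matrix of the bar involution with respect to the \<open>N\<^sub>f\<close>
  (resp. \<open>N'\<^sub>f\<close>), where \<open>r\<close> is the one with respect to the \<open>M\<^sub>f\<close>; \<open>Bvec \<kappa> s r f\<close> is the bar image of \<open>N\<^sub>f\<close>
  in coordinates with respect to the \<open>M\<^sub>f\<close>.\<close>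

definition Nmat :: "nat \<Rightarrow> int \<Rightarrow> (int list \<Rightarrow> int list \<Rightarrow> qf) \<Rightarrow> int list \<Rightarrow> int list \<Rightarrow> qf" where
  "Nmat \<kappa> s r g f = Cop \<kappa> s (Bvec \<kappa> s r f) g"

lemma Cop_add: "Cop \<kappa> s (\<lambda>h. x h + y h) g = Cop \<kappa> s x g + Cop \<kappa> s y g"
  and Cop_diff: "Cop \<kappa> s (\<lambda>h. x h - y h) g = Cop \<kappa> s x g - Cop \<kappa> s y g"
  and Cop_scale: "Cop \<kappa> s (\<lambda>h. r * x h) g = r * Cop \<kappa> s x g"
  and Cop_zero: "Cop \<kappa> s (\<lambda>h. 0) g = 0"
  by (auto simp: Cop_def algebra_simps)

lemma Cop_snoc: "Suc \<kappa> < length g \<Longrightarrow> Cop \<kappa> s x (g @ [c]) = Cop \<kappa> s (\<lambda>h. x (h @ [c])) g"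
  by (simp add: Cop_def shift_snoc eqk_snoc)

lemma Aop_add: "Aop (Eop b n) e c j (\<lambda>h. x h + y h) = (\<lambda>h. Aop (Eop b n) e c j x h + Aop (Eop b n) e c j y h)"
proof (induction j arbitrary: x y)
  case (Suc j)
  have "Eop b n a (\<lambda>h. x h + y h) = (\<lambda>h. Eop b n a x h + Eop b n a y h)" for a x y
    by (rule ext) (rule Eop_add)
  then show ?case
    by (simp add: Suc algebra_simps)
qed simp

lemma Aop_scale: "Aop (Eop b n) e c j (\<lambda>h. r * x h) = (\<lambda>h. r * Aop (Eop b n) e c j x h)"
proof (induction j arbitrary: x)
  case (Suc j)
  have "Eop b n a (\<lambda>h. r * x h) = (\<lambda>h. r * Eop b n a x h)" for a x
    by (rule ext) (rule Eop_scale)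
  then show ?case
    by (simp add: Suc algebra_simps)
qed simp

lemma Aop_sum: "Aop (Eop b n) e c j (\<lambda>h. \<Sum>k\<in>A. v k * w k h) g = (\<Sum>k\<in>A. v k * Aop (Eop b n) e c j (w k) g)"
  by (induction A rule: infinite_finite_induct) (simp_all add: Aop_0 Aop_add Aop_scale)

context adjacent begin

text \<open>The N-coordinates of \<open>x\<close> match the N'-coordinates of \<open>x'\<close>
  after relabelling. This is the invariant carried through the operations that attach a further
  factor.\<close>

definition rel :: "nat \<Rightarrow> formal \<Rightarrow> formal \<Rightarrow> bool" where
  "rel n x x' \<longleftrightarrow> (\<forall>g. length g = n \<longrightarrow> Cop \<kappa> (- 1) x g = Cop \<kappa> 1 x' (fL \<kappa> g))"

lemma Cop_Tb: "length g = \<kappa> \<Longrightarrow> Cop \<kappa> (- 1) x (g @ [c, d]) = Tb x g c d"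
  and Cop_Tb': "length g = \<kappa> \<Longrightarrow> Cop \<kappa> 1 x (fL \<kappa> (g @ [c, d])) = Tb' x g c d"
  by (auto simp: Cop_def Tb_def Tb'_def fL_pair shift_pair nth_append_length_Suc nth_append)

lemma pair_length: "length g = N2 \<Longrightarrow> \<exists>h c d. g = h @ [c, d] \<and> length h = \<kappa>"
  using split_pair[of \<kappa> g] by auto

text \<open>With the pair in last position both sides are the operator \<open>Nrow\<close>. A factor
  behind the pair is untouched by \<open>Cop\<close> and \<open>fL\<close>, and its type is the same
  in both sequences, so the formula for E_a applies to both sides alike.\<close>

lemma rel_E:
  assumes "N2 \<le> n" "rel n x x'"
  shows "rel n (Eop b n a x) (Eop b' n a x')"
  using assms
proof (induction n arbitrary: x x' rule: dec_induct)
  case base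
  show ?case
    unfolding rel_def
  proof (intro allI impI)
    fix g :: "int list" assume "length g = N2"
    then obtain h c d where g: "g = h @ [c, d]" "length h = \<kappa>"
      using pair_length by blast
    have "Tb x l c d = Tb' x' l c d" if "length l = \<kappa>" for l c d
    proof -
      have "Cop \<kappa> (- 1) x (l @ [c, d]) = Cop \<kappa> 1 x' (fL \<kappa> (l @ [c, d]))"
        using base that by (simp add: rel_def)
      then show ?thesis
        by (simp only: Cop_Tb[OF that] Cop_Tb'[OF that])
    qed
    then have "Nrow a (Eop b \<kappa> a) (Tb x) h c d = Nrow a (Eop b \<kappa> a) (Tb' x') h c d"
      using g(2) gop_cong_length[of h "\<lambda>h. Tb x h c d" "\<lambda>h. Tb' x' h c d" b \<kappa> "gE a"]
      by (simp add: Nrow_def row0_def)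
    then show "Cop \<kappa> (- 1) (Eop b N2 a x) g = Cop \<kappa> 1 (Eop b' N2 a x') (fL \<kappa> g)"
      unfolding g(1) Cop_Tb[OF g(2)] Cop_Tb'[OF g(2)] Tb_E[OF b\<kappa>] Tb'_E[OF b'\<kappa>] prefix .
  qed
next
  case (step n)
  have bn: "b' ! n = b ! n"
    using step.hyps by (intro b_eq) auto
  show ?case
    unfolding rel_def
  proof (intro allI impI)
    fix g :: "int list" assume "length g = Suc n"
    then obtain h c where g: "g = h @ [c]" "length h = n"
      using snoc_length by blast
    have \<kappa>n: "Suc \<kappa> < length h" "Suc \<kappa> < length (fL \<kappa> h)"
      using g step.hyps by auto
    have r: "rel n (\<lambda>h. x (h @ [d])) (\<lambda>h. x' (h @ [d]))" for d
      unfolding rel_def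
    proof (intro allI impI)
      fix l :: "int list" assume l: "length l = n"
      then have "Suc \<kappa> < length l" "Suc \<kappa> < length (fL \<kappa> l)"
        using step.hyps by auto
      then show "Cop \<kappa> (- 1) (\<lambda>h. x (h @ [d])) l = Cop \<kappa> 1 (\<lambda>h. x' (h @ [d])) (fL \<kappa> l)"
        using step.prems l by (simp add: rel_def fL_snoc flip: Cop_snoc)
    qed
    have 1: "Cop \<kappa> (- 1) (\<lambda>h. x (h @ [d])) h = Cop \<kappa> 1 (\<lambda>h. x' (h @ [d])) (fL \<kappa> h)" for d
      using r g(2) by (simp add: rel_def)
    have 2: "Cop \<kappa> (- 1) (Eop b n a (\<lambda>h. x (h @ [d]))) h = Cop \<kappa> 1 (Eop b' n a (\<lambda>h. x' (h @ [d]))) (fL \<kappa> h)" for d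
      using step.IH[OF r] g(2) by (simp add: rel_def)
    show "Cop \<kappa> (- 1) (Eop b (Suc n) a x) g = Cop \<kappa> 1 (Eop b' (Suc n) a x') (fL \<kappa> g)"
      unfolding g(1) fL_snoc[OF \<kappa>n(1)] Cop_snoc[OF \<kappa>n(1)] Cop_snoc[OF \<kappa>n(2)] gop_snoc ext_act.simps bn
      by (cases "b ! n = 0"; cases "c = a"; cases "c = a + 1") (simp_all add: Cop_add Cop_scale 1 2)
  qed
qed

lemma rel_Aop:
  assumes "N2 \<le> n" "rel n x x'"
  shows "rel n (Aop (Eop b n) e c j x) (Aop (Eop b' n) e c j x')"
  using assms(2)
proof (induction j arbitrary: x x')
  case (Suc j)
  let ?s = "step_ix e c j"
  have "rel n (Aop (Eop b n) e c j (Eop b n ?s x)) (Aop (Eop b' n) e c j (Eop b' n ?s x'))"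
    by (intro Suc.IH rel_E assms(1) Suc.prems)
  moreover have "rel n (Eop b n ?s (Aop (Eop b n) e c j x)) (Eop b' n ?s (Aop (Eop b' n) e c j x'))"
    by (intro Suc.IH rel_E assms(1) Suc.prems)
  ultimately show ?case
    by (simp add: rel_def Cop_diff Cop_scale)
qed simp

lemma rlim_chain:
  assumes "Suc \<kappa> < n" "n \<le> length b" "length f = n" "eqk \<kappa> f"
  shows "ev0 (\<lambda>k. rlim b n h (shift \<kappa> (- 1 * int k) f))" "ev0 (\<lambda>k. rlim b' n h (shift \<kappa> (1 * int k) f))"
proof -
  show "ev0 (\<lambda>k. rlim b n h (shift \<kappa> (- 1 * int k) f))"
    by (rule ev0_chain[where b = b and g = h, OF assms(1,3,4)])
      (use rm_triangular assms(2) bits b\<kappa> in auto)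
  show "ev0 (\<lambda>k. rlim b' n h (shift \<kappa> (1 * int k) f))"
    by (rule ev0_chain[where b = b' and g = h, OF assms(1,3,4)])
      (use rm_triangular assms(2) bits b'\<kappa> length_b' in auto)
qed

text \<open>By locality the q-commutators pass through the sum along the chain, so the columns of
  the N satisfy the same recursion in the number of factors as those of the M.\<close>

lemma Bvec_snoc:
  assumes f: "Suc \<kappa> < length f" and ev: "\<And>h. eqk \<kappa> f \<Longrightarrow> ev0 (\<lambda>k. rlim \<beta> n h (shift \<kappa> (s * int k) f))"
  shows "Bvec \<kappa> s (rlim \<beta> (Suc n)) (f @ [c]) (h @ [d]) = (if d = c then Bvec \<kappa> s (rlim \<beta> n) f h
     else if moves (\<lambda>_. True) (\<beta> ! n) c d then Aop (Eop \<beta> n) (\<beta> ! n) c (nat \<bar>d - c\<bar>) (Bvec \<kappa> s (rlim \<beta> n) f) h else 0)"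
proof (cases "eqk \<kappa> f")
  case False
  then have "Bvec \<kappa> s (rlim \<beta> n) f = (\<lambda>h. rlim \<beta> n h f)"
    by (auto simp: Bvec_def simp del: rm.simps)
  with False show ?thesis
    using f by (simp add: Bvec_def eqk_snoc rm_snoc del: rm.simps)
next
  case True
  then have B: "Bvec \<kappa> s (rlim \<beta> n) f = (\<lambda>h. geo (- qq) (\<lambda>k. rlim \<beta> n h (shift \<kappa> (s * int k) f)))"
    by (auto simp: Bvec_def simp del: rm.simps)
  have "\<exists>H. local_at (Aop (Eop \<beta> n) (\<beta> ! n) c (nat \<bar>d - c\<bar>)) h H"
    by (intro Aop_local Eop_local)
  then obtain H where H: "local_at (Aop (Eop \<beta> n) (\<beta> ! n) c (nat \<bar>d - c\<bar>)) h H" ..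
  show ?thesis
    unfolding B geo_local(1)[OF H Aop_sum ev[OF True]]
    using f True by (simp add: Bvec_def eqk_snoc shift_snoc rm_snoc del: rm.simps)
qed

lemma Bvec_B1: "length f = \<kappa> \<Longrightarrow> Bvec \<kappa> (- 1) (rlim b N2) (f @ [c, d]) = B1 f c d"
  and Bvec_B2: "length f = \<kappa> \<Longrightarrow> Bvec \<kappa> 1 (rlim b' N2) (fL \<kappa> (f @ [c, d])) = B2 f c d"
  by (auto simp: fun_eq_iff Bvec_def B1_def B2_def fL_pair shift_pair nth_append_length_Suc nth_append simp del: rm.simps)

lemma rel_Bvec:
  assumes "N2 \<le> n" "n \<le> length b" "length f = n"
  shows "rel n (Bvec \<kappa> (- 1) (rlim b n) f) (Bvec \<kappa> 1 (rlim b' n) (fL \<kappa> f))"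
  using assms
proof (induction n arbitrary: f rule: dec_induct)
  case base
  then obtain f0 c d where f: "f = f0 @ [c, d]" "length f0 = \<kappa>"
    using pair_length by blast
  show ?case
    unfolding rel_def
  proof (intro allI impI)
    fix g :: "int list" assume "length g = N2"
    then obtain h x y where g: "g = h @ [x, y]" "length h = \<kappa>"
      using pair_length by blast
    show "Cop \<kappa> (- 1) (Bvec \<kappa> (- 1) (rlim b N2) f) g = Cop \<kappa> 1 (Bvec \<kappa> 1 (rlim b' N2) (fL \<kappa> f)) (fL \<kappa> g)"
      using R1_R2 unfolding f(1) Bvec_B1[OF f(2)] Bvec_B2[OF f(2)] g(1) Cop_Tb[OF g(2)] Cop_Tb'[OF g(2)] R1_def R2_def .
  qed
next
  case (step n)
  have bn: "b' ! n = b ! n"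
    using step.hyps by (intro b_eq) auto
  obtain f0 c where f: "f = f0 @ [c]" "length f0 = n"
    using step.prems snoc_length by blast
  have \<kappa>n: "Suc \<kappa> < n" "Suc \<kappa> < length f0" "Suc \<kappa> < length (fL \<kappa> f0)"
    using f step.hyps by auto
  have eqL: "eqk \<kappa> (fL \<kappa> f0) = eqk \<kappa> f0"
    using split_pair[OF \<kappa>n(2)] by (auto simp: fL_pair nth_append_length_Suc nth_append split: if_splits)
  let ?B = "Bvec \<kappa> (- 1) (rlim b n) f0" and ?B' = "Bvec \<kappa> 1 (rlim b' n) (fL \<kappa> f0)"
  have IH: "rel n ?B ?B'"
    using step.IH[OF _ f(2)] step.prems by simp
  show ?case
    unfolding rel_def
  proof (intro allI impI)
    fix g :: "int list" assume "length g = Suc n"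
    then obtain h d where g: "g = h @ [d]" "length h = n"
      using snoc_length by blast
    have h: "Suc \<kappa> < length h" "Suc \<kappa> < length (fL \<kappa> h)"
      using g \<kappa>n by auto
    have 1: "Bvec \<kappa> (- 1) (rlim b (Suc n)) (f0 @ [c]) (l @ [d]) = (if d = c then ?B l
       else if moves (\<lambda>_. True) (b ! n) c d then Aop (Eop b n) (b ! n) c (nat \<bar>d - c\<bar>) ?B l else 0)" for l
      using rlim_chain(1)[OF \<kappa>n(1) _ f(2)] step.prems by (intro Bvec_snoc \<kappa>n) auto
    have 2: "Bvec \<kappa> 1 (rlim b' (Suc n)) (fL \<kappa> f0 @ [c]) (l @ [d]) = (if d = c then ?B' l
       else if moves (\<lambda>_. True) (b' ! n) c d then Aop (Eop b' n) (b' ! n) c (nat \<bar>d - c\<bar>) ?B' l else 0)" for l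
      using rlim_chain(2)[OF \<kappa>n(1), of "fL \<kappa> f0"] f(2) step.prems by (intro Bvec_snoc \<kappa>n) auto
    have "rel n (Aop (Eop b n) (b ! n) c (nat \<bar>d - c\<bar>) ?B) (Aop (Eop b' n) (b ! n) c (nat \<bar>d - c\<bar>) ?B')"
      using step.hyps IH by (intro rel_Aop)
    then show "Cop \<kappa> (- 1) (Bvec \<kappa> (- 1) (rlim b (Suc n)) f) g = Cop \<kappa> 1 (Bvec \<kappa> 1 (rlim b' (Suc n)) (fL \<kappa> f)) (fL \<kappa> g)"
      unfolding f(1) g(1) fL_snoc[OF h(1)] fL_snoc[OF \<kappa>n(2)] Cop_snoc[OF h(1)] Cop_snoc[OF h(2)] 1 2 bn
      using IH g(2) by (cases "d = c"; cases "moves (\<lambda>_. True) (b ! n) c d") (simp_all add: rel_def Cop_zero)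
  qed
qed

lemma Nmat_adjacent:
  assumes "length f = length b" "length g = length b"
  shows "Nmat \<kappa> (- 1) (rlim b (length b)) g f = Nmat \<kappa> 1 (rlim b' (length b)) (fL \<kappa> g) (fL \<kappa> f)"
  using rel_Bvec[of "length b" f] \<kappa> assms by (simp add: rel_def Nmat_def)

end

section \<open>The bar involution in the coordinates of the N-basis\<close>

text \<open>The inverse of \<open>Cop\<close> on the B-completion.\<close>

definition Exp :: "nat \<Rightarrow> int \<Rightarrow> formal \<Rightarrow> formal" where
  "Exp \<kappa> s x h = (if eqk \<kappa> h then geo (- inverse qq) (\<lambda>k. x (shift \<kappa> (- (s * int k)) h)) else x h)"

lemma Cop_sum: "Cop \<kappa> s (\<lambda>g. \<Sum>h\<in>A. v h * w h g) g = (\<Sum>h\<in>A. v h * Cop \<kappa> s (w h) g)"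
  by (induction A rule: infinite_finite_induct) (simp_all add: Cop_zero Cop_add Cop_scale)

lemma geo_Laurent: "c \<in> Laurent \<Longrightarrow> (\<And>k. u k \<in> Laurent) \<Longrightarrow> geo c u \<in> Laurent"
  unfolding geo_def Sum_any.expand_set by (intro Laurent_sum Laurent_mult Laurent_power)

lemma qinv_power_mult: "x \<in> qinv_Z_qinv \<Longrightarrow> (- inverse qq) ^ k * x \<in> qinv_Z_qinv"
proof (induction k)
  case (Suc k)
  then show ?case
    using qinv_mult_minus_qinv[of "(- inverse qq) ^ k * x"] by (simp add: mult.assoc)
qed simp

text \<open>A common setting for both sequences: \<open>s\<close> is the direction in which chains
  of equal pairs descend, down for \<open>b\<close> and up for \<open>b'\<close>.\<close>

locale N_system = bar_system le r for le r +
  fixes \<kappa> n :: nat and s :: int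
  assumes \<kappa>n: "Suc \<kappa> < n" and s: "s = 1 \<or> s = - 1"
    and le_length: "le g f \<Longrightarrow> length g = n \<and> length f = n"
    and le_refl: "length f = n \<Longrightarrow> le f f"
    and le_shift: "length f = n \<Longrightarrow> eqk \<kappa> f \<Longrightarrow> le (shift \<kappa> s f) f"
begin

lemma le_chain: "length f = n \<Longrightarrow> eqk \<kappa> f \<Longrightarrow> le (shift \<kappa> (s * int k) f) f"
proof (induction k)
  case (Suc k)
  have "le (shift \<kappa> s (shift \<kappa> (s * int k) f)) (shift \<kappa> (s * int k) f)"
    using Suc \<kappa>n by (intro le_shift) (simp_all add: eqk_shift)
  also have "shift \<kappa> s (shift \<kappa> (s * int k) f) = shift \<kappa> (s * int (Suc k)) f"
    using Suc \<kappa>n by (simp add: shift_shift algebra_simps)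
  finally show ?case
    using Suc le_trans by blast
qed (simp add: shift_0 le_refl)

lemma le_chain_up: "length f = n \<Longrightarrow> eqk \<kappa> f \<Longrightarrow> le f (shift \<kappa> (- (s * int k)) f)"
  using le_chain[of "shift \<kappa> (- (s * int k)) f" k] \<kappa>n by (simp add: eqk_shift shift_shift shift_0)

lemma chain_inject: "length f = n \<Longrightarrow> shift \<kappa> (s * int k) f = shift \<kappa> (s * int l) f \<longleftrightarrow> k = l"
  "length f = n \<Longrightarrow> shift \<kappa> (- (s * int k)) f = shift \<kappa> (- (s * int l)) f \<longleftrightarrow> k = l"
  using \<kappa>n s by (auto simp: shift_inject)

lemma chain_fix: "length f = n \<Longrightarrow> shift \<kappa> (s * int k) f = f \<longleftrightarrow> k = 0"
  "length f = n \<Longrightarrow> shift \<kappa> (- (s * int k)) f = f \<longleftrightarrow> k = 0"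
  using chain_inject[of f k 0] by (simp_all add: shift_0)

lemma ev0_down:
  assumes "length f = n" "eqk \<kappa> f" "\<And>h. u h \<noteq> 0 \<Longrightarrow> le g h"
  shows "ev0 (\<lambda>k. u (shift \<kappa> (s * int k) f))"
proof (rule finite_ev0, rule finite_imageD)
  let ?K = "{k. u (shift \<kappa> (s * int k) f) \<noteq> 0}"
  have "(\<lambda>k. shift \<kappa> (s * int k) f) ` ?K \<subseteq> {h. le g h \<and> le h f}"
    using assms le_chain by auto
  then show "finite ((\<lambda>k. shift \<kappa> (s * int k) f) ` ?K)"
    using finite_interval by (rule finite_subset)
  show "inj_on (\<lambda>k. shift \<kappa> (s * int k) f) ?K"
    using assms(1) by (auto simp: inj_on_def chain_inject)
qed

text \<open>Upwards a chain leaves every bounded set: its members in the support of \<open>x\<close>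
  lie above \<open>h\<close> and below an element of \<open>F\<close>, which leaves finitely
  many.\<close>

lemma ev0_up:
  assumes "length h = n" "eqk \<kappa> h" "bounded le F x"
  shows "ev0 (\<lambda>k. x (shift \<kappa> (- (s * int k)) h))"
proof (rule finite_ev0, rule finite_imageD)
  let ?K = "{k. x (shift \<kappa> (- (s * int k)) h) \<noteq> 0}"
  have "(\<lambda>k. shift \<kappa> (- (s * int k)) h) ` ?K \<subseteq> {l. le h l \<and> (\<exists>f\<in>F. le l f)}"
    using assms le_chain_up by (auto simp: bounded_def)
  then show "finite ((\<lambda>k. shift \<kappa> (- (s * int k)) h) ` ?K)"
    by (rule finite_subset) (use assms in \<open>auto intro: finite_above simp: bounded_def\<close>)
  show "inj_on (\<lambda>k. shift \<kappa> (- (s * int k)) h) ?K"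
    using assms(1) by (auto simp: inj_on_def chain_inject)
qed

lemma bounded_length: "bounded le F x \<Longrightarrow> length g \<noteq> n \<Longrightarrow> x g = 0"
  using le_length unfolding bounded_def by blast

lemma Bvec_tri: "Bvec \<kappa> s r f h \<noteq> 0 \<Longrightarrow> le h f"
proof -
  assume *: "Bvec \<kappa> s r f h \<noteq> 0"
  show ?thesis
  proof (cases "eqk \<kappa> f")
    case True
    then have "geo (- qq) (\<lambda>k. r h (shift \<kappa> (s * int k) f)) \<noteq> 0"
      using * by (simp add: Bvec_def)
    from geo_nonzero[OF this] obtain k where "r h (shift \<kappa> (s * int k) f) \<noteq> 0" ..
    then have "le h (shift \<kappa> (s * int k) f)"
      by (rule tri)
    moreover from le_length[OF this] have "le (shift \<kappa> (s * int k) f) f"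
      using True by (intro le_chain) simp_all
    ultimately show ?thesis
      by (rule le_trans)
  qed (use * tri in \<open>auto simp: Bvec_def\<close>)
qed

text \<open>The bar image of the relation that writes M_f as N_f plus q inverse times the next N on
  the chain.\<close>

lemma Bvec_step:
  assumes "length f = n" "eqk \<kappa> f"
  shows "Bvec \<kappa> s r f h + qq * Bvec \<kappa> s r (shift \<kappa> s f) h = r h f"
proof -
  have "eqk \<kappa> (shift \<kappa> s f)" "\<And>k. shift \<kappa> (s * int k) (shift \<kappa> s f) = shift \<kappa> (s * int (Suc k)) f"
    using assms \<kappa>n by (simp_all add: eqk_shift shift_shift algebra_simps)
  moreover have "ev0 (\<lambda>k. r h (shift \<kappa> (s * int k) f))"
    by (rule ev0_down[OF assms]) (rule tri)
  ultimately show ?thesis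
    using assms(2) geo_Suc[of "\<lambda>k. r h (shift \<kappa> (s * int k) f)" "- qq"] by (simp add: Bvec_def shift_0)
qed

lemma Nmat_tri:
  assumes "Nmat \<kappa> s r g f \<noteq> 0"
  shows "le g f"
proof (cases "Bvec \<kappa> s r f g = 0")
  case True
  then have *: "eqk \<kappa> g" "Bvec \<kappa> s r f (shift \<kappa> (- s) g) \<noteq> 0"
    using assms by (auto simp: Nmat_def Cop_def split: if_splits)
  from Bvec_tri[OF *(2)] have le: "le (shift \<kappa> (- s) g) f" .
  with *(1) have "le g (shift \<kappa> (- s) g)"
    using le_length[OF le] le_chain_up[of g 1] by simp
  then show ?thesis
    using le le_trans by blast
qed (rule Bvec_tri)

lemma Nmat_diag:
  assumes "le f f"
  shows "Nmat \<kappa> s r f f = 1"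
proof (cases "eqk \<kappa> f")
  case True
  have f: "length f = n"
    using assms le_length by blast
  have "r f (shift \<kappa> (s * int k) f) = 0" if "1 \<le> k" for k
    using tri[of f "shift \<kappa> (s * int k) f"] le_antisym[OF _ le_chain[OF f True, of k]] chain_fix(1)[OF f, of k] that by fastforce
  then have "Bvec \<kappa> s r f f = 1"
    using True assms by (simp add: Bvec_def geo_sum[of 1] shift_0 diag)
  moreover have "Bvec \<kappa> s r f (shift \<kappa> (- s) f) = 0"
    using Bvec_tri[of f "shift \<kappa> (- s) f"] le_antisym[OF le_chain_up[OF f True, of 1]] chain_fix(2)[OF f, of 1] by fastforce
  ultimately show ?thesis
    by (simp add: Nmat_def Cop_def)
qed (use assms in \<open>simp add: Nmat_def Cop_def Bvec_def diag\<close>)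

lemma Nmat_Laurent: "Nmat \<kappa> s r g f \<in> Laurent"
proof -
  have "Bvec \<kappa> s r f h \<in> Laurent" for h
    unfolding Bvec_def using Laurent geo_Laurent[of "- qq", OF Laurent_uminus[OF Laurent_qq(1)]] by simp
  then show ?thesis
    unfolding Nmat_def Cop_def by auto
qed

lemma bounded_Exp:
  assumes "bounded le F x"
  shows "bounded le F (Exp \<kappa> s x)"
proof -
  have "\<exists>f\<in>F. le h f" if "Exp \<kappa> s x h \<noteq> 0" for h
  proof (cases "eqk \<kappa> h")
    case True
    then have "geo (- inverse qq) (\<lambda>k. x (shift \<kappa> (- (s * int k)) h)) \<noteq> 0"
      using that by (simp add: Exp_def)
    from geo_nonzero[OF this] obtain k where "x (shift \<kappa> (- (s * int k)) h) \<noteq> 0" ..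
    then obtain f where f: "f \<in> F" "le (shift \<kappa> (- (s * int k)) h) f"
      using assms unfolding bounded_def by blast
    then have "le h (shift \<kappa> (- (s * int k)) h)"
      using True le_length[OF f(2)] by (intro le_chain_up) auto
    then show ?thesis
      using f le_trans by blast
  qed (use that assms in \<open>auto simp: Exp_def bounded_def\<close>)
  then show ?thesis
    using assms by (simp add: bounded_def)
qed

lemma Exp_length: "bounded le F x \<Longrightarrow> length h \<noteq> n \<Longrightarrow> Exp \<kappa> s x h = 0"
  by (rule bounded_length[OF bounded_Exp])

lemma bounded_Cop:
  assumes "bounded le F x"
  shows "bounded le F (Cop \<kappa> s x)"
proof -
  have "\<exists>f\<in>F. le g f" if "Cop \<kappa> s x g \<noteq> 0" for g
  proof (cases "x g = 0")
    case True
    then have *: "eqk \<kappa> g" "x (shift \<kappa> (- s) g) \<noteq> 0"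
      using that by (auto simp: Cop_def split: if_splits)
    then obtain f where f: "f \<in> F" "le (shift \<kappa> (- s) g) f"
      using assms unfolding bounded_def by blast
    then have "le g (shift \<kappa> (- s) g)"
      using *(1) le_length[OF f(2)] le_chain_up[of g 1] by simp
    then show ?thesis
      using f le_trans by blast
  qed (use assms in \<open>auto simp: bounded_def\<close>)
  then show ?thesis
    using assms by (simp add: bounded_def)
qed

lemma shift_up_Suc: "length g = n \<Longrightarrow> shift \<kappa> (- (s * int k)) (shift \<kappa> (- s) g) = shift \<kappa> (- (s * int (Suc k))) g"
  using \<kappa>n by (simp add: shift_shift algebra_simps)

lemma shift_up_Suc': "length g = n \<Longrightarrow> shift \<kappa> (- s) (shift \<kappa> (- (s * int k)) g) = shift \<kappa> (- (s * int (Suc k))) g"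
  using \<kappa>n by (simp add: shift_shift algebra_simps)

lemma Cop_Exp:
  assumes "bounded le F x"
  shows "Cop \<kappa> s (Exp \<kappa> s x) = x"
proof
  fix g
  show "Cop \<kappa> s (Exp \<kappa> s x) g = x g"
  proof (cases "length g = n \<and> eqk \<kappa> g")
    case True
    then have "eqk \<kappa> (shift \<kappa> (- s) g)"
      using \<kappa>n by (simp add: eqk_shift)
    then show ?thesis
      using True geo_Suc[OF ev0_up[OF _ _ assms], of g "- inverse qq"]
      by (simp add: Cop_def Exp_def shift_up_Suc shift_0)
  next
    case False
    then show ?thesis
      using bounded_length[OF assms, of g] Exp_length[OF assms, of g] Exp_length[OF assms, of "shift \<kappa> (- s) g"]
      by (auto simp: Cop_def Exp_def)
  qed
qed

lemma Exp_Cop: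
  assumes "bounded le F x"
  shows "Exp \<kappa> s (Cop \<kappa> s x) = x"
proof
  fix h
  show "Exp \<kappa> s (Cop \<kappa> s x) h = x h"
  proof (cases "length h = n")
    case True
    show ?thesis
    proof (cases "eqk \<kappa> h")
      case eq: True
      define u where "u k = x (shift \<kappa> (- (s * int k)) h)" for k
      have u: "ev0 u"
        unfolding u_def by (rule ev0_up[OF True eq assms])
      have eqs: "eqk \<kappa> (shift \<kappa> (- (s * int k)) h)" for k
        using True eq \<kappa>n by (simp add: eqk_shift)
      have "Exp \<kappa> s (Cop \<kappa> s x) h = geo (- inverse qq) (\<lambda>k. u k + inverse qq * u (Suc k))"
        using True by (simp add: Exp_def eq Cop_def eqs shift_up_Suc' u_def)
      also have "\<dots> = u 0"
        using u ev0_Suc[OF u] by (simp add: geo_add ev0_scale geo_scale geo_Suc[OF u])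
      finally show ?thesis
        by (simp add: u_def shift_0)
    qed (simp add: Exp_def Cop_def)
  next
    case False
    then show ?thesis
      using Exp_length[OF bounded_Cop[OF assms]] bounded_length[OF assms] by simp
  qed
qed

text \<open>Antilinearity of the bar map on combinations of the N, which are infinite sums of the M.
  Instead of interchanging the sums, the coordinates \<open>x\<close> are rewritten through the
  expansion \<open>y\<close>, one chain step at a time, and \<open>Bvec_step\<close> collapses the
  result.\<close>

lemma bar_of_Exp:
  assumes x: "bounded le F x" and U: "finite U" "{h. le g h \<and> (\<exists>f\<in>F. le h f)} \<subseteq> U"
  shows "bar_of r (Exp \<kappa> s x) g = (\<Sum>h\<in>U. barq (x h) * Bvec \<kappa> s r h g)"
proof -
  define y where "y = Exp \<kappa> s x"
  have y: "bounded le F y"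
    unfolding y_def by (rule bounded_Exp[OF x])
  let ?V = "{h. le g h \<and> (\<exists>f\<in>F. le h f)}" and ?B = "\<lambda>h. Bvec \<kappa> s r h g"
  let ?Z = "{h \<in> ?V. (if eqk \<kappa> h then qq * barq (y (shift \<kappa> (- s) h)) * ?B h else 0) = 0}"
  let ?Z' = "{h \<in> ?V. (if eqk \<kappa> h then qq * barq (y h) * ?B (shift \<kappa> s h) else 0) = 0}"
  have fV: "finite ?V"
    using U by (rule finite_subset[rotated])
  have xy: "x h = y h + (if eqk \<kappa> h then inverse qq * y (shift \<kappa> (- s) h) else 0)" for h
    using Cop_Exp[OF x] by (metis Cop_def y_def)
  have "(\<Sum>h\<in>U. barq (x h) * ?B h) = (\<Sum>h\<in>?V. barq (x h) * ?B h)"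
    using U Bvec_tri x by (intro sum.mono_neutral_right) (fastforce simp: bounded_def)+
  also have "\<dots> = (\<Sum>h\<in>?V. barq (y h) * ?B h) + (\<Sum>h\<in>?V. if eqk \<kappa> h then qq * barq (y (shift \<kappa> (- s) h)) * ?B h else 0)"
    unfolding sum.distrib[symmetric]
  proof (intro sum.cong refl)
    fix h
    show "barq (x h) * ?B h = barq (y h) * ?B h + (if eqk \<kappa> h then qq * barq (y (shift \<kappa> (- s) h)) * ?B h else 0)"
      unfolding xy[of h] by (simp add: barq_add barq_mult barq_inverse distrib_right)
  qed
  \<comment> \<open>Reindexing by one step along the chains brings both sums to the common factor
    \<open>barq (y h)\<close>. Only nonzero summands are matched, since the ends of the chains may
    leave \<open>?V\<close>.\<close>
  also have "(\<Sum>h\<in>?V. if eqk \<kappa> h then qq * barq (y (shift \<kappa> (- s) h)) * ?B h else 0)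
      = (\<Sum>h\<in>?V. if eqk \<kappa> h then qq * barq (y h) * ?B (shift \<kappa> s h) else 0)"
  proof (rule sum.reindex_bij_witness_not_neutral
      [where i = "shift \<kappa> s" and j = "shift \<kappa> (- s)" and S' = "?Z"
       and T' = "?Z'"])
    have *: "eqk \<kappa> h \<and> length h = n" "y (shift \<kappa> (- s) h) \<noteq> 0" "?B h \<noteq> 0" "shift \<kappa> (- s) h \<in> ?V"
      if "h \<in> ?V - ?Z" for h
    proof -
      show h: "eqk \<kappa> h \<and> length h = n" "y (shift \<kappa> (- s) h) \<noteq> 0" "?B h \<noteq> 0"
        using that le_length by (auto split: if_splits)
      then have "le g h" "le h (shift \<kappa> (- s) h)"
        using that le_chain_up[of h 1] by auto
      then show "shift \<kappa> (- s) h \<in> ?V"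
        using h(2) y le_trans unfolding bounded_def by blast
    qed
    have **: "eqk \<kappa> h \<and> length h = n" "y h \<noteq> 0" "?B (shift \<kappa> s h) \<noteq> 0" "shift \<kappa> s h \<in> ?V"
      if "h \<in> ?V - ?Z'" for h
    proof -
      show h: "eqk \<kappa> h \<and> length h = n" "y h \<noteq> 0" "?B (shift \<kappa> s h) \<noteq> 0"
        using that le_length by (auto split: if_splits)
      have "le (shift \<kappa> s h) h" "le g (shift \<kappa> s h)"
        using h le_shift Bvec_tri by auto
      then show "shift \<kappa> s h \<in> ?V"
        using that le_trans by blast
    qed
    show "shift \<kappa> s (shift \<kappa> (- s) h) = h" "shift \<kappa> (- s) h \<in> ?V - ?Z'"
      if "h \<in> ?V - ?Z" for h
      using *[OF that] \<kappa>n by (simp_all add: shift_shift shift_0 eqk_shift)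
    show "shift \<kappa> (- s) (shift \<kappa> s h) = h" "shift \<kappa> s h \<in> ?V - ?Z"
      if "h \<in> ?V - ?Z'" for h
      using **[OF that] \<kappa>n by (simp_all add: shift_shift shift_0 eqk_shift)
    show "(if eqk \<kappa> (shift \<kappa> (- s) h) then qq * barq (y (shift \<kappa> (- s) h)) * ?B (shift \<kappa> s (shift \<kappa> (- s) h)) else 0)
      = (if eqk \<kappa> h then qq * barq (y (shift \<kappa> (- s) h)) * ?B h else 0)" if "h \<in> ?V" for h
      using that le_length[of g h] \<kappa>n by (auto simp: shift_shift shift_0 eqk_shift)
  qed (rule finite_subset[OF _ fV], blast, rule finite_subset[OF _ fV], blast, auto)
  also have "(\<Sum>h\<in>?V. barq (y h) * ?B h) + \<dots> = (\<Sum>h\<in>?V. barq (y h) * r g h)"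
    unfolding sum.distrib[symmetric]
  proof (intro sum.cong refl)
    fix h assume "h \<in> ?V"
    then have "length h = n"
      using le_length by blast
    show "barq (y h) * ?B h + (if eqk \<kappa> h then qq * barq (y h) * ?B (shift \<kappa> s h) else 0) = barq (y h) * r g h"
    proof (cases "eqk \<kappa> h")
      case True
      then show ?thesis
        using Bvec_step[OF \<open>length h = n\<close> True, of g, symmetric] by (simp add: algebra_simps)
    qed (simp add: Bvec_def)
  qed
  also have "\<dots> = bar_of r y g"
    using bar_of_sum[OF y fV order.refl] by simp
  finally show ?thesis
    by (simp add: y_def)
qed

lemma bar_of_Nmat:
  assumes "bounded le F x"
  shows "bar_of (Nmat \<kappa> s r) x = Cop \<kappa> s (bar_of r (Exp \<kappa> s x))"
proof
  fix g
  let ?U = "\<lambda>g. {h. le g h \<and> (\<exists>f\<in>F. le h f)}"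
  have U: "finite (?U g)" for g
    using assms by (intro finite_above) (simp add: bounded_def)
  have 1: "bar_of r (Exp \<kappa> s x) g = (\<Sum>h\<in>?U g. barq (x h) * Bvec \<kappa> s r h g)"
    by (rule bar_of_Exp[OF assms U order.refl])
  have 2: "bar_of r (Exp \<kappa> s x) (shift \<kappa> (- s) g) = (\<Sum>h\<in>?U g. barq (x h) * Bvec \<kappa> s r h (shift \<kappa> (- s) g))" if "eqk \<kappa> g"
  proof (rule bar_of_Exp[OF assms U])
    show "?U (shift \<kappa> (- s) g) \<subseteq> ?U g"
    proof
      fix h assume h: "h \<in> ?U (shift \<kappa> (- s) g)"
      then have "le g (shift \<kappa> (- s) g)"
        using that le_length[of "shift \<kappa> (- s) g" h] le_chain_up[of g 1] by simp
      then show "h \<in> ?U g"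
        using h le_trans by blast
    qed
  qed
  have "bar_of (Nmat \<kappa> s r) x g = (\<Sum>h\<in>?U g. barq (x h) * Nmat \<kappa> s r g h)"
    unfolding bar_of_def using Nmat_tri assms by (intro Sum_any.expand_superset U) (fastforce simp: bounded_def)
  also have "\<dots> = Cop \<kappa> s (\<lambda>g'. \<Sum>h\<in>?U g. barq (x h) * Bvec \<kappa> s r h g') g"
    unfolding Nmat_def Cop_sum ..
  also have "\<dots> = Cop \<kappa> s (bar_of r (Exp \<kappa> s x)) g"
    using 1 2 by (simp add: Cop_def)
  finally show "bar_of (Nmat \<kappa> s r) x g = Cop \<kappa> s (bar_of r (Exp \<kappa> s x)) g" .
qed

lemma Exp_bar_of:
  assumes "bounded le F x"
  shows "Exp \<kappa> s (bar_of (Nmat \<kappa> s r) x) = bar_of r (Exp \<kappa> s x)"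
  unfolding bar_of_Nmat[OF assms] by (rule Exp_Cop[OF bounded_bar_of[OF bounded_Exp[OF assms]]])

text \<open>Involutivity is transported from \<open>r\<close> by the mutually inverse maps
  \<open>Exp\<close> and \<open>Cop\<close> and evaluated at a basis vector.\<close>

lemma N_bar_system: "bar_system le (Nmat \<kappa> s r)"
proof
  fix g f assume f: "le f f"
  have b: "bounded le {f} (basis_vec f)"
    by (rule lower_form_bounded[OF lower_form_basis_vec[of le f, OF f]])
  have "bar_of (Nmat \<kappa> s r) (basis_vec f) h = Nmat \<kappa> s r h f" for h
  proof -
    have "bar_of (Nmat \<kappa> s r) (basis_vec f) h = (\<Sum>k\<in>{f}. barq (basis_vec f k) * Nmat \<kappa> s r h k)"
      unfolding bar_of_def by (rule Sum_any.expand_superset) (auto simp: basis_vec_def when_def)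
    then show ?thesis
      by (simp add: basis_vec_def)
  qed
  then have N: "bar_of (Nmat \<kappa> s r) (basis_vec f) = (\<lambda>h. Nmat \<kappa> s r h f)" ..
  have "bounded le {f} (\<lambda>h. Nmat \<kappa> s r h f)"
    using f Nmat_tri by (auto simp: bounded_def)
  then have "bar_of (Nmat \<kappa> s r) (\<lambda>h. Nmat \<kappa> s r h f) = Cop \<kappa> s (bar_of r (Exp \<kappa> s (\<lambda>h. Nmat \<kappa> s r h f)))"
    by (rule bar_of_Nmat)
  also have "\<dots> = basis_vec f"
    unfolding N[symmetric] Exp_bar_of[OF b] bar_of_bar_of[OF bounded_Exp[OF b]] by (rule Cop_Exp[OF b])
  finally have "bar_of (Nmat \<kappa> s r) (\<lambda>h. Nmat \<kappa> s r h f) g = of_bool (g = f)"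
    by (simp add: basis_vec_def when_def)
  moreover have "bar_of (Nmat \<kappa> s r) (\<lambda>h. Nmat \<kappa> s r h f) g = (\<Sum>h | le g h \<and> le h f. barq (Nmat \<kappa> s r h f) * Nmat \<kappa> s r g h)"
    unfolding bar_of_def by (rule Sum_any.expand_superset[OF finite_interval]) (auto intro: Nmat_tri)
  ultimately show "(\<Sum>h | le g h \<and> le h f. barq (Nmat \<kappa> s r h f) * Nmat \<kappa> s r g h) = of_bool (g = f)"
    by simp
qed (simp_all add: Nmat_tri Nmat_diag Nmat_Laurent)

lemma iterate_shift: "length f = n \<Longrightarrow> (shift \<kappa> s ^^ k) f = shift \<kappa> (s * int k) f"
  using \<kappa>n by (induction k) (simp_all add: shift_0 shift_shift algebra_simps)

lemma Nvec_chain: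
  assumes h: "length h = n" "eqk \<kappa> h"
  shows "Nvec \<kappa> (shift \<kappa> s) (shift \<kappa> (- (s * int k)) h) h = (- inverse qq) ^ k"
proof -
  let ?f = "shift \<kappa> (- (s * int k)) h"
  have f: "length ?f = n" "eqk \<kappa> ?f"
    using h \<kappa>n by (simp_all add: eqk_shift)
  have "h = (shift \<kappa> s ^^ j) ?f \<longleftrightarrow> j = k" for j
  proof -
    have "shift \<kappa> (s * int k) ?f = h"
      using h \<kappa>n by (simp add: shift_shift shift_0)
    then show ?thesis
      using chain_inject(1)[OF f(1), of j k] by (auto simp: iterate_shift[OF f(1)])
  qed
  then have "Sum_any (\<lambda>j. (- qq) powi (- int j) when j \<ge> 1 \<and> h = (shift \<kappa> s ^^ j) ?f)
      = Sum_any (\<lambda>j. ((- qq) powi (- int k) when k \<ge> 1) when j = k)"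
    by (intro Sum_any.cong) (auto simp: when_def)
  also have "\<dots> = ((- qq) powi (- int k) when k \<ge> 1)"
    by simp
  finally show ?thesis
    using f(2) chain_fix(2)[OF h(1), of k]
    by (cases "k = 0") (auto simp: Nvec_def shift_0 power_int_minus simp flip: power_inverse)
qed

lemma Nvec_nonzero:
  assumes "Nvec \<kappa> (shift \<kappa> s) f h \<noteq> 0" "length f = n"
  shows "f = h \<or> eqk \<kappa> h \<and> length h = n \<and> (\<exists>k. f = shift \<kappa> (- (s * int k)) h)"
proof (cases "f = h")
  case False
  then have eq: "eqk \<kappa> f" and "Sum_any (\<lambda>k. (- qq) powi (- int k) when k \<ge> 1 \<and> h = (shift \<kappa> s ^^ k) f) \<noteq> 0"
    using assms by (auto simp: Nvec_def split: if_splits)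
  then obtain k where "h = (shift \<kappa> s ^^ k) f"
    by (metis (mono_tags, lifting) Sum_any.not_neutral_obtains_not_neutral when_neq_zero)
  then have "h = shift \<kappa> (s * int k) f"
    using iterate_shift[OF assms(2)] by simp
  then show ?thesis
    using eq assms(2) \<kappa>n by (auto simp: eqk_shift shift_shift shift_0 intro!: exI[of _ k])
qed simp

text \<open>M_h occurs only in N_h and, for an equal pair, in the N_f with \<open>f\<close> above
  \<open>h\<close> on the same chain; along that chain the coefficients are powers of
  \<open>- inverse qq\<close>.\<close>

lemma expand_Exp:
  assumes "bounded le F x"
  shows "expand \<kappa> (shift \<kappa> s) x = Exp \<kappa> s x"
proof
  fix h
  have x: "length f = n" if "x f \<noteq> 0" for f
    using bounded_length[OF assms] that by blast
  show "expand \<kappa> (shift \<kappa> s) x h = Exp \<kappa> s x h"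
  proof (cases "length h = n \<and> eqk \<kappa> h")
    case True
    then obtain K where K: "\<forall>k\<ge>K. x (shift \<kappa> (- (s * int k)) h) = 0"
      using ev0_up[OF _ _ assms] unfolding ev0_iff by blast
    let ?i = "\<lambda>k. shift \<kappa> (- (s * int k)) h"
    have "expand \<kappa> (shift \<kappa> s) x h = (\<Sum>f\<in>?i ` {..<K}. x f * Nvec \<kappa> (shift \<kappa> s) f h)"
      unfolding expand_def
    proof (rule Sum_any.expand_superset)
      show "{f. x f * Nvec \<kappa> (shift \<kappa> s) f h \<noteq> 0} \<subseteq> ?i ` {..<K}"
      proof
        fix f assume "f \<in> {f. x f * Nvec \<kappa> (shift \<kappa> s) f h \<noteq> 0}"
        then have f: "x f \<noteq> 0" "Nvec \<kappa> (shift \<kappa> s) f h \<noteq> 0"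
          by auto
        then obtain k where k: "f = ?i k"
          using Nvec_nonzero[OF f(2) x[OF f(1)]] shift_0[of \<kappa> h] by (metis minus_zero mult_zero_right of_nat_0)
        then have "k < K"
          using K f(1) not_less by blast
        then show "f \<in> ?i ` {..<K}"
          using k by blast
      qed
    qed simp
    also have "\<dots> = (\<Sum>k<K. x (?i k) * Nvec \<kappa> (shift \<kappa> s) (?i k) h)"
      using True by (subst sum.reindex) (auto simp: inj_on_def chain_inject)
    also have "\<dots> = (\<Sum>k<K. (- inverse qq) ^ k * x (?i k))"
      using True by (intro sum.cong refl) (simp only: Nvec_chain mult.commute)
    also have "\<dots> = Exp \<kappa> s x h"
      using True K by (simp add: Exp_def geo_sum)
    finally show ?thesis .
  next
    case False
    have "expand \<kappa> (shift \<kappa> s) x h = (\<Sum>f\<in>{h}. x f * Nvec \<kappa> (shift \<kappa> s) f h)"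
      unfolding expand_def
      by (rule Sum_any.expand_superset) (use False Nvec_nonzero x in fastforce)+
    also have "\<dots> = Exp \<kappa> s x h"
    proof (cases "length h = n")
      case True
      with False show ?thesis
        by (simp add: Exp_def Nvec_def)
    qed (simp add: Exp_length[OF assms] bounded_length[OF assms])
    finally show ?thesis .
  qed
qed

sublocale N: bar_system le "Nmat \<kappa> s r"
  by (rule N_bar_system)

lemma canonical_Exp:
  assumes "N.canonical f x"
  shows "canonical f (Exp \<kappa> s x)"
proof -
  have lf: "lower_form le f x" and q: "\<And>g. g \<noteq> f \<Longrightarrow> x g \<in> qinv_Z_qinv" and bx: "bar_of (Nmat \<kappa> s r) x = x"
    using assms by (simp_all add: N.canonical_def)
  have b: "bounded le {f} x"
    by (rule lower_form_bounded[OF lf])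
  have f: "x f = 1" "length f = n"
    using lf le_length[of f f] by (auto simp: lower_form_def)
  have "Exp \<kappa> s x f = 1"
  proof (cases "eqk \<kappa> f")
    case True
    have "x (shift \<kappa> (- (s * int k)) f) = 0" if "1 \<le> k" for k
    proof (rule ccontr)
      assume "x (shift \<kappa> (- (s * int k)) f) \<noteq> 0"
      then have "le (shift \<kappa> (- (s * int k)) f) f"
        using lf by (simp add: lower_form_def)
      then have "shift \<kappa> (- (s * int k)) f = f"
        using le_chain_up[OF f(2) True] by (rule le_antisym)
      then show False
        using that by (simp add: chain_fix[OF f(2)])
    qed
    then show ?thesis
      using True f(1) by (simp add: Exp_def geo_sum[of 1] shift_0)
  qed (simp add: Exp_def f)
  moreover have "Exp \<kappa> s x g \<in> qinv_Z_qinv" if g: "g \<noteq> f" for g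
  proof (cases "eqk \<kappa> g")
    case True
    have "(- inverse qq) ^ k * x (shift \<kappa> (- (s * int k)) g) \<in> qinv_Z_qinv" for k
    proof (cases "shift \<kappa> (- (s * int k)) g = f")
      \<comment> \<open>The leading coefficient 1 of \<open>x\<close> is not in the lattice, but it
        reaches \<open>g \<noteq> f\<close> only after at least one chain step, that is, with at
        least one factor \<open>- inverse qq\<close>.\<close>
      case eq: True
      then have "k \<noteq> 0"
        using g by (auto simp: shift_0 intro!: gr0I)
      then obtain j where "k = Suc j"
        by (cases k) auto
      then show ?thesis
        unfolding eq f(1) using qinv_power_mult[OF qinv_minus_qinv, of j] by (simp only: power_Suc2 mult_1_right)
    qed (intro qinv_power_mult q)
    then show ?thesis
      using True by (auto simp: Exp_def geo_def Sum_any.expand_set)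
  qed (simp add: Exp_def q g)
  moreover have "bar_of r (Exp \<kappa> s x) = Exp \<kappa> s x"
    using Exp_bar_of[OF b] bx by simp
  ultimately show ?thesis
    using bounded_Exp[OF b] by (auto simp: canonical_def lower_form_def bounded_def)
qed

end

section \<open>Refined orders and the map R\<close>

lemma bounded_mono: "bounded le F x \<Longrightarrow> (\<And>g f. le g f \<Longrightarrow> le' g f) \<Longrightarrow> bounded le' F x"
  unfolding bounded_def by blast

lemma lower_form_mono: "lower_form le f x \<Longrightarrow> (\<And>g f. le g f \<Longrightarrow> le' g f) \<Longrightarrow> lower_form le' f x"
  unfolding lower_form_def by blast

text \<open>A finer order shrinks the intervals, and the summands of the involution identity lost in
  this way vanish by \<open>tri'\<close>.\<close>

lemma (in bar_system) bar_system_refine: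
  assumes le': "\<And>g f. le' g f \<Longrightarrow> le g f"
    and trans: "\<And>h g f. le' h g \<Longrightarrow> le' g f \<Longrightarrow> le' h f"
    and refl: "\<And>g f. le' g f \<Longrightarrow> le' g g \<and> le' f f"
    and tri': "\<And>g f. \<rho> g f \<noteq> 0 \<Longrightarrow> le' g f"
  shows "bar_system le' \<rho>"
proof
  fix g f assume f: "le' f f"
  have "(\<Sum>h | le' g h \<and> le' h f. barq (\<rho> h f) * \<rho> g h) = (\<Sum>h | le g h \<and> le h f. barq (\<rho> h f) * \<rho> g h)"
    using le' tri' by (intro sum.mono_neutral_left finite_interval) (auto 0 4)
  then show "(\<Sum>h | le' g h \<and> le' h f. barq (\<rho> h f) * \<rho> g h) = of_bool (g = f)"
    using involution[OF le'[OF f]] by simp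
next
  fix g f
  show "finite {h. le' g h \<and> le' h f}"
    by (rule finite_subset[OF _ finite_interval[of g f]]) (use le' in blast)
qed (use assms le_antisym diag Laurent in blast)+

locale adjacent_factors =
  fixes \<Theta> :: "nat \<Rightarrow> weight \<Rightarrow> falg2" and b :: "nat list" and \<kappa> :: nat and s :: int
  assumes \<Theta>: "\<forall>k\<ge>1. quasi_R_matrix k (\<Theta> k)"
    and \<kappa>b: "Suc \<kappa> < length b" and bits: "set b \<subseteq> {0, 1}"
    and sign: "(- 1) ^ (b ! \<kappa>) = - s" "(- 1) ^ (b ! Suc \<kappa>) = s"
begin

lemma length_b: "length b = Suc (length b - 1)"
  using \<kappa>b by simp

lemma s_cases: "s = 1 \<or> s = - 1"
  unfolding sign(2)[symmetric] by (cases "even (b ! Suc \<kappa>)") simp_all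

sublocale N_system "bruhat b" "rlim b (length b)" \<kappa> "length b" s
proof
  fix h g f :: "int list"
  show "bruhat b h g \<Longrightarrow> bruhat b g f \<Longrightarrow> bruhat b h f"
    unfolding bruhat_bru by (rule bru_trans)
  show "bruhat b g f \<Longrightarrow> bruhat b f g \<Longrightarrow> g = f"
    unfolding bruhat_bru by (rule bru_antisym)
  show len: "bruhat b g f \<Longrightarrow> length g = length b \<and> length f = length b"
    by (simp add: bruhat_def)
  show refl: "length f = length b \<Longrightarrow> bruhat b f f" for f
    unfolding bruhat_bru by (rule bru_refl)
  show "bruhat b g f \<Longrightarrow> bruhat b g g" "bruhat b g f \<Longrightarrow> bruhat b f f"
    by (simp_all add: bruhat_def)
  show int: "finite {h. bruhat b g h \<and> bruhat b h f}"
    unfolding bruhat_bru by (rule finite_bru_interval)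
  show "rlim b (length b) g f \<noteq> 0 \<Longrightarrow> bruhat b g f"
    unfolding bruhat_bru by (rule rm_triangular[OF _ order.refl bits])
  show "bruhat b f f \<Longrightarrow> rlim b (length b) f f = 1"
    by (rule rm_diag) (simp add: bruhat_def)
  show "rlim b (length b) g f \<in> Laurent"
    by (rule rm_Laurent)
  show "length f = length b \<Longrightarrow> eqk \<kappa> f \<Longrightarrow> bruhat b (shift \<kappa> s f) f"
    unfolding bruhat_bru by (rule shift_bru[OF \<kappa>b _ _ s_cases sign])
  assume f: "bruhat b f f"
  show "(\<Sum>h | bruhat b g h \<and> bruhat b h f. barq (rlim b (length b) h f) * rlim b (length b) g h) = of_bool (g = f)"
    using rlim_involution[OF \<Theta>, of f "length b - 1" "{h. bruhat b g h \<and> bruhat b h f}" b g] int f bits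
    unfolding length_b[symmetric] by (simp add: bruhat_bru bru_def del: rm.simps)
qed (rule \<kappa>b s_cases)+

text \<open>\<open>bar_coeff\<close> is known to be the limit entry only for columns of the right
  length; at all other lists a bounded \<open>x\<close> vanishes.\<close>

lemma bar_bar_of:
  assumes "bounded (bruhat b) F x"
  shows "bar \<Theta> b x = bar_of (rlim b (length b)) x"
proof -
  have "barq (x f) * bar_coeff \<Theta> b g f = barq (x f) * rlim b (length b) g f" for g f
  proof (cases "length f = length b")
    case True
    then show ?thesis
      using bar_coeff_rlim[OF \<Theta> True] \<kappa>b by fastforce
  qed (simp add: bounded_length[OF assms])
  then show ?thesis
    unfolding bar_def bar_of_def by presburger
qed

lemma T_hat_bounded: "x \<in> T_hat b \<longleftrightarrow> (\<exists>F. bounded (bruhat b) F x)"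
  unfolding T_hat_def by (rule bounded_completion)

lemma bar_expand:
  assumes "bounded (bruhat b) F x"
  shows "bar \<Theta> b (expand \<kappa> (shift \<kappa> s) x) = expand \<kappa> (shift \<kappa> s) (bar_of (Nmat \<kappa> s (rlim b (length b))) x)"
  unfolding expand_Exp[OF assms] bar_bar_of[OF bounded_Exp[OF assms]]
    expand_Exp[OF N.bounded_bar_of[OF assms]] Exp_bar_of[OF assms] ..

lemma expand_inject:
  assumes "bounded (bruhat b) F x" "bounded (bruhat b) G y" "expand \<kappa> (shift \<kappa> s) x = expand \<kappa> (shift \<kappa> s) y"
  shows "x = y"
proof -
  have "Cop \<kappa> s (expand \<kappa> (shift \<kappa> s) x) = Cop \<kappa> s (expand \<kappa> (shift \<kappa> s) y)"
    by (simp only: assms(3))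
  then show ?thesis
    unfolding expand_Exp[OF assms(1)] expand_Exp[OF assms(2)] Cop_Exp[OF assms(1)] Cop_Exp[OF assms(2)] .
qed

text \<open>\<open>expand\<close> is injective on bounded elements and intertwines the two bar maps,
  so the defining description turns into \<open>N.canonical\<close>, where uniqueness is
  available.\<close>

lemma dual_canonical_L_eq:
  assumes "N.canonical f x"
  shows "dual_canonical_L \<Theta> b \<kappa> (shift \<kappa> s) f = x"
proof -
  have "y \<in> T_hat b \<and> lower_form (bruhat b) f y \<and> (\<forall>g. g \<noteq> f \<longrightarrow> y g \<in> qinv_Z_qinv) \<and>
      bar \<Theta> b (expand \<kappa> (shift \<kappa> s) y) = expand \<kappa> (shift \<kappa> s) y \<longleftrightarrow> N.canonical f y" for y
  proof (cases "lower_form (bruhat b) f y")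
    case True
    have y: "bounded (bruhat b) {f} y"
      by (rule lower_form_bounded[OF True])
    then have "y \<in> T_hat b"
      unfolding T_hat_bounded by blast
    moreover have "bar \<Theta> b (expand \<kappa> (shift \<kappa> s) y) = expand \<kappa> (shift \<kappa> s) y
      \<longleftrightarrow> bar_of (Nmat \<kappa> s (rlim b (length b))) y = y"
      unfolding bar_expand[OF y] using expand_inject[OF N.bounded_bar_of[OF y] y] by auto
    ultimately show ?thesis
      unfolding N.canonical_def by blast
  qed (simp add: N.canonical_def)
  then have "dual_canonical_L \<Theta> b \<kappa> (shift \<kappa> s) f = (THE y. N.canonical f y)"
    unfolding dual_canonical_L_def by presburger
  also have "\<dots> = x"
    using assms N.canonical_unique by blast
  finally show ?thesis .
qed

lemma dual_canonical_eq:
  assumes "N.canonical f x"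
  shows "dual_canonical \<Theta> b f = expand \<kappa> (shift \<kappa> s) x"
proof -
  have "y \<in> T_hat b \<and> lower_form (bruhat b) f y \<and> (\<forall>g. g \<noteq> f \<longrightarrow> y g \<in> qinv_Z_qinv) \<and> bar \<Theta> b y = y
     \<longleftrightarrow> canonical f y" for y
  proof (cases "lower_form (bruhat b) f y")
    case True
    have y: "bounded (bruhat b) {f} y"
      by (rule lower_form_bounded[OF True])
    then have "y \<in> T_hat b"
      unfolding T_hat_bounded by blast
    then show ?thesis
      unfolding canonical_def bar_bar_of[OF y] by blast
  qed (simp add: canonical_def)
  then have "dual_canonical \<Theta> b f = (THE y. canonical f y)"
    unfolding dual_canonical_def by presburger
  also have "\<dots> = Exp \<kappa> s x"
    using canonical_Exp[OF assms] canonical_unique by blast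
  also have "\<dots> = expand \<kappa> (shift \<kappa> s) x"
    using assms by (intro expand_Exp[OF lower_form_bounded, symmetric]) (auto simp: N.canonical_def)
  finally show ?thesis .
qed

end

text \<open>\<open>fL\<close> permutes the lists of length \<open>r\<close> with inverse
  \<open>fU\<close>, so the sum has at most one term.\<close>

lemma Rmap_eq:
  assumes "Suc \<kappa> < r"
  shows "Rmap r \<kappa> x h = (if length h = r then x (fU \<kappa> h) else 0)"
proof -
  have "length f = r \<and> fL \<kappa> f = h \<longleftrightarrow> length h = r \<and> f = fU \<kappa> h" for f
    using assms fL_fU[of \<kappa> h] fU_fL[of \<kappa> f] length_fL[of \<kappa> f] length_fU[of \<kappa> h] by metis
  then have "{f. length f = r \<and> fL \<kappa> f = h} = (if length h = r then {fU \<kappa> h} else {})"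
    by simp
  then show ?thesis
    by (simp add: Rmap_def)
qed

section \<open>The C-completions and the relabelling map\<close>

context adjacent begin

interpretation B: adjacent_factors \<Theta> b \<kappa> "- 1"
  by standard (use \<Theta> \<kappa> bits b\<kappa> in auto)

interpretation B': adjacent_factors \<Theta> b' \<kappa> 1
  by standard (use \<Theta> \<kappa> bits b'\<kappa> length_b' in auto)

abbreviation "NB \<equiv> Nmat \<kappa> (- 1) (rlim b (length b))"
abbreviation "NB' \<equiv> Nmat \<kappa> 1 (rlim b' (length b'))"

lemma fL_fU_length: "length f = length b \<Longrightarrow> fL \<kappa> (fU \<kappa> f) = f"
  and fU_fL_length: "length f = length b \<Longrightarrow> fU \<kappa> (fL \<kappa> f) = f"
  using \<kappa> by (simp_all add: fL_fU fU_fL)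

lemma NB_tri: "NB g f \<noteq> 0 \<Longrightarrow> refined b b' \<kappa> g f"
proof -
  assume *: "NB g f \<noteq> 0"
  have "bruhat b g f"
    by (rule B.Nmat_tri[OF *])
  then have "NB g f = NB' (fL \<kappa> g) (fL \<kappa> f)"
    using B.le_length unfolding length_b' by (intro Nmat_adjacent) blast+
  then show ?thesis
    using * \<open>bruhat b g f\<close> B'.Nmat_tri by (simp add: refined_def)
qed

text \<open>As \<open>fU\<close> inverts \<open>fL\<close>, relabelling merely exchanges the two
  Bruhat conditions.\<close>

lemma refined_star_iff:
  assumes "length g = length b" "length f = length b"
  shows "refined_star b b' \<kappa> g f \<longleftrightarrow> refined b b' \<kappa> (fU \<kappa> g) (fU \<kappa> f)"
  unfolding refined_star_def refined_def fL_fU_length[OF assms(1)] fL_fU_length[OF assms(2)] by blast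

lemma NB'_eq: "length g = length b \<Longrightarrow> length f = length b \<Longrightarrow> NB' g f = NB (fU \<kappa> g) (fU \<kappa> f)"
  using Nmat_adjacent[of "fU \<kappa> f" "fU \<kappa> g"] by (simp add: fL_fU_length length_b')

lemma NB'_tri: "NB' g f \<noteq> 0 \<Longrightarrow> refined_star b b' \<kappa> g f"
proof -
  assume *: "NB' g f \<noteq> 0"
  then have len: "length g = length b" "length f = length b"
    using B'.le_length[OF B'.Nmat_tri[OF *]] unfolding length_b' by blast+
  show ?thesis
    using * NB_tri unfolding refined_star_iff[OF len] NB'_eq[OF len] by blast
qed

lemma refined_refl: "length f = length b \<Longrightarrow> refined b b' \<kappa> f f"
  and refined_star_refl: "length f = length b \<Longrightarrow> refined_star b b' \<kappa> f f"
  using length_b' by (simp_all add: refined_def refined_star_def bruhat_def)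

lemma refined_length: "refined b b' \<kappa> g f \<Longrightarrow> length g = length b \<and> length f = length b"
  and refined_star_length: "refined_star b b' \<kappa> g f \<Longrightarrow> length g = length b \<and> length f = length b"
  unfolding refined_def refined_star_def bruhat_def length_b' by simp_all

interpretation R: bar_system "refined b b' \<kappa>" NB
proof (rule B.N.bar_system_refine)
  show "refined b b' \<kappa> h f" if "refined b b' \<kappa> h g" "refined b b' \<kappa> g f" for h g f
    using that B.le_trans B'.le_trans unfolding refined_def by blast
  show "refined b b' \<kappa> g g \<and> refined b b' \<kappa> f f" if "refined b b' \<kappa> g f" for g f
    using refined_length[OF that] refined_refl by blast
qed (simp add: refined_def, rule NB_tri)

interpretation R': bar_system "refined_star b b' \<kappa>" NB'
proof (rule B'.N.bar_system_refine)
  show "refined_star b b' \<kappa> h f" if "refined_star b b' \<kappa> h g" "refined_star b b' \<kappa> g f" for h g f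
    using that B.le_trans B'.le_trans unfolding refined_star_def by blast
  show "refined_star b b' \<kappa> g g \<and> refined_star b b' \<kappa> f f" if "refined_star b b' \<kappa> g f" for g f
    using refined_star_length[OF that] refined_star_refl by blast
qed (simp add: refined_star_def, rule NB'_tri)

lemma T_ddot_bounded: "x \<in> T_ddot b b' \<kappa> \<longleftrightarrow> (\<exists>F. bounded (refined b b' \<kappa>) F x)"
  and T_ddot'_bounded: "x \<in> T_ddot' b b' \<kappa> \<longleftrightarrow> (\<exists>F. bounded (refined_star b b' \<kappa>) F x)"
  unfolding T_ddot_def T_ddot'_def by (rule R.bounded_completion R'.bounded_completion)+

lemma refined_bounded: "bounded (refined b b' \<kappa>) F x \<Longrightarrow> bounded (bruhat b) F x"
  and refined_star_bounded: "bounded (refined_star b b' \<kappa>) F x \<Longrightarrow> bounded (bruhat b') F x"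
  by (erule bounded_mono, simp add: refined_def refined_star_def)+

lemma T_ddot_T_hat: "T_ddot b b' \<kappa> \<subseteq> T_hat b"
  using T_ddot_bounded B.T_hat_bounded refined_bounded by blast

lemma T_ddot'_T_hat: "T_ddot' b b' \<kappa> \<subseteq> T_hat b'"
  using T_ddot'_bounded B'.T_hat_bounded refined_star_bounded by blast

lemma bar_T_ddot:
  assumes "x \<in> T_ddot b b' \<kappa>"
  shows "bar \<Theta> b (expand \<kappa> (down \<kappa>) x) \<in> expand \<kappa> (down \<kappa>) ` T_ddot b b' \<kappa>"
proof -
  obtain F where F: "bounded (refined b b' \<kappa>) F x"
    using assms unfolding T_ddot_bounded by blast
  have "bar_of NB x \<in> T_ddot b b' \<kappa>"
    unfolding T_ddot_bounded using R.bounded_bar_of[OF F] by blast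
  then show ?thesis
    unfolding down_shift B.bar_expand[OF refined_bounded[OF F]] by (rule imageI)
qed

lemma bar_T_ddot':
  assumes "x \<in> T_ddot' b b' \<kappa>"
  shows "bar \<Theta> b' (expand \<kappa> (up \<kappa>) x) \<in> expand \<kappa> (up \<kappa>) ` T_ddot' b b' \<kappa>"
proof -
  obtain F where F: "bounded (refined_star b b' \<kappa>) F x"
    using assms unfolding T_ddot'_bounded by blast
  have "bar_of NB' x \<in> T_ddot' b b' \<kappa>"
    unfolding T_ddot'_bounded using R'.bounded_bar_of[OF F] by blast
  then show ?thesis
    unfolding up_shift B'.bar_expand[OF refined_star_bounded[OF F]] by (rule imageI)
qed

text \<open>An element canonical for the refined order is canonical for the Bruhat order. Uniqueness
  for the latter thus identifies the dual canonical basis with elements constructed inside the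
  C-completion.\<close>

lemma R_canonical: "R.canonical f x \<Longrightarrow> B.N.canonical f x"
  and R'_canonical: "R'.canonical f x \<Longrightarrow> B'.N.canonical f x"
  unfolding R.canonical_def R'.canonical_def B.N.canonical_def B'.N.canonical_def
  by (auto elim!: lower_form_mono simp: refined_def refined_star_def)

lemma dual_canonical_L_T_ddot:
  assumes "length f = length b"
  shows "dual_canonical_L \<Theta> b \<kappa> (down \<kappa>) f \<in> T_ddot b b' \<kappa>"
    and "dual_canonical_L \<Theta> b' \<kappa> (up \<kappa>) f \<in> T_ddot' b b' \<kappa>"
proof -
  note 1 = R.canonical_exists[OF refined_refl[OF assms]]
  show "dual_canonical_L \<Theta> b \<kappa> (down \<kappa>) f \<in> T_ddot b b' \<kappa>"
    unfolding down_shift B.dual_canonical_L_eq[OF R_canonical[OF 1]] T_ddot_bounded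
    using 1 lower_form_bounded unfolding R.canonical_def by blast
  note 2 = R'.canonical_exists[OF refined_star_refl[OF assms]]
  show "dual_canonical_L \<Theta> b' \<kappa> (up \<kappa>) f \<in> T_ddot' b b' \<kappa>"
    unfolding up_shift B'.dual_canonical_L_eq[OF R'_canonical[OF 2]] T_ddot'_bounded
    using 2 lower_form_bounded unfolding R'.canonical_def by blast
qed

abbreviation "RR \<equiv> Rmap (length b) \<kappa>"

lemma RR: "RR x h = (if length h = length b then x (fU \<kappa> h) else 0)"
  by (rule Rmap_eq[OF \<kappa>])

lemma bounded_RR:
  assumes "bounded (refined b b' \<kappa>) F x"
  shows "bounded (refined_star b b' \<kappa>) (fL \<kappa> ` F) (RR x)"
  unfolding bounded_def
proof (intro conjI ballI allI impI)
  have F: "length f = length b" if "f \<in> F" for f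
    using assms that refined_length by (auto simp: bounded_def)
  show "finite (fL \<kappa> ` F)"
    using assms by (simp add: bounded_def)
  show "refined_star b b' \<kappa> f f" if "f \<in> fL \<kappa> ` F" for f
    using that F by (auto intro: refined_star_refl)
  fix h assume "RR x h \<noteq> 0"
  then have h: "length h = length b" "x (fU \<kappa> h) \<noteq> 0"
    by (auto simp: RR split: if_splits)
  then obtain f where f: "f \<in> F" "refined b b' \<kappa> (fU \<kappa> h) f"
    using assms unfolding bounded_def by blast
  then have "refined_star b b' \<kappa> h (fL \<kappa> f)"
    using h F by (simp add: refined_star_iff fU_fL_length)
  with f(1) show "\<exists>f\<in>fL \<kappa> ` F. refined_star b b' \<kappa> h f"
    by blast
qed

definition RI :: "formal \<Rightarrow> formal" where
  "RI y g = (if length g = length b then y (fL \<kappa> g) else 0)"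

lemma bounded_RI:
  assumes "bounded (refined_star b b' \<kappa>) F y"
  shows "bounded (refined b b' \<kappa>) (fU \<kappa> ` F) (RI y)"
  unfolding bounded_def
proof (intro conjI ballI allI impI)
  have F: "length f = length b" if "f \<in> F" for f
    using assms that refined_star_length by (auto simp: bounded_def)
  show "finite (fU \<kappa> ` F)"
    using assms by (simp add: bounded_def)
  show "refined b b' \<kappa> f f" if "f \<in> fU \<kappa> ` F" for f
    using that F by (auto intro: refined_refl)
  fix g assume "RI y g \<noteq> 0"
  then have g: "length g = length b" "y (fL \<kappa> g) \<noteq> 0"
    by (auto simp: RI_def split: if_splits)
  then obtain f where f: "f \<in> F" "refined_star b b' \<kappa> (fL \<kappa> g) f"
    using assms unfolding bounded_def by blast
  then have "refined b b' \<kappa> g (fU \<kappa> f)"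
    using g F by (simp add: refined_star_iff fU_fL_length)
  with f(1) show "\<exists>f\<in>fU \<kappa> ` F. refined b b' \<kappa> g f"
    by blast
qed

lemma RR_bij: "bij_betw RR (T_ddot b b' \<kappa>) (T_ddot' b b' \<kappa>)"
proof (rule bij_betw_byWitness[where f' = RI])
  show "RR ` T_ddot b b' \<kappa> \<subseteq> T_ddot' b b' \<kappa>"
    unfolding image_subset_iff Ball_def T_ddot_bounded T_ddot'_bounded using bounded_RR by blast
  show "RI ` T_ddot' b b' \<kappa> \<subseteq> T_ddot b b' \<kappa>"
    unfolding image_subset_iff Ball_def T_ddot_bounded T_ddot'_bounded using bounded_RI by blast
  show "\<forall>x\<in>T_ddot b b' \<kappa>. RI (RR x) = x"
  proof (intro ballI ext)
    fix x g assume "x \<in> T_ddot b b' \<kappa>"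
    then obtain F where "bounded (refined b b' \<kappa>) F x"
      unfolding T_ddot_bounded by blast
    then show "RI (RR x) g = x g"
      using B.bounded_length[OF refined_bounded, of F x g] by (simp add: RI_def RR fU_fL_length)
  qed
  show "\<forall>y\<in>T_ddot' b b' \<kappa>. RR (RI y) = y"
  proof (intro ballI ext)
    fix y g assume "y \<in> T_ddot' b b' \<kappa>"
    then obtain F where "bounded (refined_star b b' \<kappa>) F y"
      unfolding T_ddot'_bounded by blast
    then show "RR (RI y) g = y g"
      using B'.bounded_length[OF refined_star_bounded, of F y g] by (simp add: RI_def RR fL_fU_length length_b')
  qed
qed

lemma bar_of_RR:
  assumes "bounded (refined b b' \<kappa>) F x"
  shows "bar_of NB' (RR x) = RR (bar_of NB x)"
proof
  fix g
  note RRx = bounded_RR[OF assms]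
  show "bar_of NB' (RR x) g = RR (bar_of NB x) g"
  proof (cases "length g = length b")
    case True
    let ?U = "{h. refined b b' \<kappa> (fU \<kappa> g) h \<and> (\<exists>f\<in>F. refined b b' \<kappa> h f)}"
    have U: "finite ?U" "h \<in> ?U \<Longrightarrow> length h = length b" for h
      using assms refined_length by (auto intro: R.finite_above simp: bounded_def)
    have "bar_of NB' (RR x) g = (\<Sum>h\<in>fL \<kappa> ` ?U. barq (RR x h) * NB' g h)"
      unfolding bar_of_def
    proof (rule Sum_any.expand_superset)
      show "finite (fL \<kappa> ` ?U)"
        using U by simp
      show "{h. barq (RR x h) * NB' g h \<noteq> 0} \<subseteq> fL \<kappa> ` ?U"
      proof
        fix h assume "h \<in> {h. barq (RR x h) * NB' g h \<noteq> 0}"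
        then have h: "length h = length b" "x (fU \<kappa> h) \<noteq> 0" "NB' g h \<noteq> 0"
          by (auto simp: RR split: if_splits)
        then have "refined b b' \<kappa> (fU \<kappa> g) (fU \<kappa> h)"
          using NB_tri by (simp add: NB'_eq True)
        with h(2) assms have "fU \<kappa> h \<in> ?U"
          unfolding bounded_def by blast
        then show "h \<in> fL \<kappa> ` ?U"
          using fL_fU_length[OF h(1)] by (metis imageI)
      qed
    qed
    also have "\<dots> = (\<Sum>h\<in>?U. barq (RR x (fL \<kappa> h)) * NB' g (fL \<kappa> h))"
      by (rule sum.reindex_cong[OF _ refl refl]) (metis (no_types, lifting) U(2) fU_fL_length inj_onI)
    also have "\<dots> = (\<Sum>h\<in>?U. barq (x h) * NB (fU \<kappa> g) h)"
      using U(2) True by (intro sum.cong refl) (simp add: RR NB'_eq fU_fL_length)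
    also have "\<dots> = bar_of NB x (fU \<kappa> g)"
      by (rule R.bar_of_sum[OF assms U(1) order.refl, symmetric])
    finally show ?thesis
      by (simp add: RR True)
  next
    case False
    then show ?thesis
      using B'.bounded_length[OF refined_star_bounded[OF R'.bounded_bar_of[OF RRx]], of g] by (simp add: RR length_b')
  qed
qed

lemma RR_canonical:
  assumes "R.canonical f x" "length f = length b"
  shows "R'.canonical (fL \<kappa> f) (RR x)"
proof -
  have x: "lower_form (refined b b' \<kappa>) f x" "\<And>g. g \<noteq> f \<Longrightarrow> x g \<in> qinv_Z_qinv" "bar_of NB x = x"
    using assms(1) by (auto simp: R.canonical_def)
  have "refined_star b b' \<kappa> g (fL \<kappa> f)" if "RR x g \<noteq> 0" for g
    using bounded_RR[OF lower_form_bounded[OF x(1)]] that by (simp add: bounded_def)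
  then have "lower_form (refined_star b b' \<kappa>) (fL \<kappa> f) (RR x)"
    using x(1) by (simp add: lower_form_def RR fU_fL_length assms(2))
  moreover have "RR x g \<in> qinv_Z_qinv" if "g \<noteq> fL \<kappa> f" for g
    using x(2)[of "fU \<kappa> g"] that fL_fU_length[of g] by (cases "fU \<kappa> g = f") (auto simp: RR)
  moreover have "bar_of NB' (RR x) = RR x"
    using bar_of_RR[OF lower_form_bounded[OF x(1)]] x(3) by simp
  ultimately show ?thesis
    by (simp add: R'.canonical_def)
qed

lemma RR_dual_canonical:
  assumes f: "length f = length b"
  shows "RR (basis_vec f) = basis_vec (fL \<kappa> f)"
    and "RR (dual_canonical_L \<Theta> b \<kappa> (down \<kappa>) f) = dual_canonical_L \<Theta> b' \<kappa> (up \<kappa>) (fL \<kappa> f)"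
    and "\<exists>x\<in>T_hat b. expand \<kappa> (down \<kappa>) x = dual_canonical \<Theta> b f"
    and "\<And>x. x \<in> T_hat b \<Longrightarrow> expand \<kappa> (down \<kappa>) x = dual_canonical \<Theta> b f \<Longrightarrow>
      RR x \<in> T_hat b' \<and> expand \<kappa> (up \<kappa>) (RR x) = dual_canonical \<Theta> b' (fL \<kappa> f)"
proof -
  let ?L = "R.canon f"
  show "RR (basis_vec f) = basis_vec (fL \<kappa> f)"
    using f fL_fU_length fU_fL_length by (auto simp: fun_eq_iff RR basis_vec_def when_def)
  have L: "R.canonical f ?L"
    by (rule R.canonical_exists[OF refined_refl[OF f]])
  have L': "R'.canonical (fL \<kappa> f) (RR ?L)"
    by (rule RR_canonical[OF L f])
  show "RR (dual_canonical_L \<Theta> b \<kappa> (down \<kappa>) f) = dual_canonical_L \<Theta> b' \<kappa> (up \<kappa>) (fL \<kappa> f)"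
    unfolding down_shift up_shift B.dual_canonical_L_eq[OF R_canonical[OF L]] B'.dual_canonical_L_eq[OF R'_canonical[OF L']] ..
  have b: "bounded (bruhat b) {f} ?L"
    using L by (intro refined_bounded lower_form_bounded) (simp add: R.canonical_def)
  have b': "RR ?L \<in> T_hat b'"
    unfolding B'.T_hat_bounded using L' refined_star_bounded[OF lower_form_bounded] unfolding R'.canonical_def by blast
  have dc: "dual_canonical \<Theta> b f = expand \<kappa> (down \<kappa>) ?L"
    unfolding down_shift by (rule B.dual_canonical_eq[OF R_canonical[OF L]])
  then show "\<exists>x\<in>T_hat b. expand \<kappa> (down \<kappa>) x = dual_canonical \<Theta> b f"
    unfolding B.T_hat_bounded Bex_def using b by metis
  fix x assume x: "x \<in> T_hat b" "expand \<kappa> (down \<kappa>) x = dual_canonical \<Theta> b f"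
  then obtain F where F: "bounded (bruhat b) F x"
    unfolding B.T_hat_bounded by blast
  \<comment> \<open>\<open>expand\<close> is injective on the B-completion, so L_f has only one
    vector of N-coordinates, namely that of the dual canonical basis element constructed
    above.\<close>
  have "x = ?L"
    by (rule B.expand_inject[OF F b]) (use x(2) in \<open>simp only: dc down_shift\<close>)
  then show "RR x \<in> T_hat b' \<and> expand \<kappa> (up \<kappa>) (RR x) = dual_canonical \<Theta> b' (fL \<kappa> f)"
    using b' B'.dual_canonical_eq[OF R'_canonical[OF L']] by (simp add: up_shift)
qed

end

lemma Rmap_add: "Rmap r \<kappa> (x + y) = Rmap r \<kappa> x + Rmap r \<kappa> y"
  and Rmap_scale: "Rmap r \<kappa> (fscale c x) = fscale c (Rmap r \<kappa> x)"
  by (simp_all add: fun_eq_iff Rmap_def sum.distrib fscale_def sum_distrib_left)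

lemma length_zero_one_seq: "zero_one_seq m n b \<Longrightarrow> length b = m + n"
  unfolding zero_one_seq_def using sum_count_set[of b "{0, 1}"] by simp

theorem theorem5p13:
  fixes m n \<kappa> :: nat and b1 b2 b b' :: "nat list"
    and \<Theta> :: "nat \<Rightarrow> weight \<Rightarrow> falg2"
  assumes b: "zero_one_seq m n b" "b = b1 @ [0, 1] @ b2"
    and b': "zero_one_seq m n b'" "b' = b1 @ [1, 0] @ b2"
    and \<kappa>: "\<kappa> = length b1"
    and \<Theta>: "\<forall>k\<ge>1. quasi_R_matrix k (\<Theta> k)"
  shows
    "((\<forall>x\<in>T_ddot b b' \<kappa>. \<forall>y\<in>T_ddot b b' \<kappa>.
         Rmap (m + n) \<kappa> (x + y) = Rmap (m + n) \<kappa> x + Rmap (m + n) \<kappa> y) \<and>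
      (\<forall>c. \<forall>x\<in>T_ddot b b' \<kappa>. Rmap (m + n) \<kappa> (fscale c x) = fscale c (Rmap (m + n) \<kappa> x)) \<and>
      bij_betw (Rmap (m + n) \<kappa>) (T_ddot b b' \<kappa>) (T_ddot' b b' \<kappa>))
     \<and>
     (fs.subspace (T_ddot b b' \<kappa>) \<and> T_ddot b b' \<kappa> \<subseteq> T_hat b \<and>
      (\<forall>x\<in>T_ddot b b' \<kappa>.
         bar \<Theta> b (expand \<kappa> (down \<kappa>) x) \<in> expand \<kappa> (down \<kappa>) ` T_ddot b b' \<kappa>) \<and>
      fs.subspace (T_ddot' b b' \<kappa>) \<and> T_ddot' b b' \<kappa> \<subseteq> T_hat b' \<and>
      (\<forall>x\<in>T_ddot' b b' \<kappa>.
         bar \<Theta> b' (expand \<kappa> (up \<kappa>) x) \<in> expand \<kappa> (up \<kappa>) ` T_ddot' b b' \<kappa>) \<and>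
      (\<forall>f. length f = m + n \<longrightarrow>
         dual_canonical_L \<Theta> b \<kappa> (down \<kappa>) f \<in> T_ddot b b' \<kappa> \<and>
         dual_canonical_L \<Theta> b' \<kappa> (up \<kappa>) f \<in> T_ddot' b b' \<kappa>))
     \<and>
     (\<forall>f. length f = m + n \<longrightarrow>
        Rmap (m + n) \<kappa> (basis_vec f) = basis_vec (fL \<kappa> f) \<and>
        Rmap (m + n) \<kappa> (dual_canonical_L \<Theta> b \<kappa> (down \<kappa>) f)
          = dual_canonical_L \<Theta> b' \<kappa> (up \<kappa>) (fL \<kappa> f) \<and>
        (\<exists>x\<in>T_hat b. expand \<kappa> (down \<kappa>) x = dual_canonical \<Theta> b f) \<and>
        (\<forall>x\<in>T_hat b. expand \<kappa> (down \<kappa>) x = dual_canonical \<Theta> b f \<longrightarrow>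
           Rmap (m + n) \<kappa> x \<in> T_hat b' \<and>
           expand \<kappa> (up \<kappa>) (Rmap (m + n) \<kappa> x) = dual_canonical \<Theta> b' (fL \<kappa> f)))"
proof -
  interpret adjacent \<Theta> b b' \<kappa>
  proof
    show "set b \<subseteq> {0, 1}" "set b' \<subseteq> {0, 1}"
      using b(1) b'(1) by (simp_all add: zero_one_seq_def)
  qed (auto simp: \<Theta> b(2) b'(2) \<kappa> nth_append nth_Cons split: nat.split)
  have "m + n = length b"
    using length_zero_one_seq[OF b(1)] by simp
  then show ?thesis
    using Rmap_add Rmap_scale RR_bij T_ddot_T_hat bar_T_ddot T_ddot'_T_hat bar_T_ddot'
      dual_canonical_L_T_ddot RR_dual_canonical
    by (auto simp: T_ddot_def T_ddot'_def completion_def fs.subspace_span)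
qed

end
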